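(* Let $Q$ be an acyclic affine quiver with indivisible imaginary root $\delta$, let $\mathbf{F}_q$ be a finite field and let $r\geq 1$. Let $$\chi_{r\delta}=\sum_{\substack{[M]\text{ regular}\\ \dim M=r\delta}}[M]\in \mathbf{H}_{Q,\mathbf{F}_q},$$ the sum being over isomorphism classes of regular representations of $Q$ over $\mathbf{F}_q$ of dimension vector $r\delta$. Then the kernel of the linear form $$L:\mathbf{H}_{Q,\mathbf{F}_q,\mathcal{R}}^{\mathrm{cusp}}[r\delta]\to\mathbf{C},\qquad f\mapsto (f,\chi_{r\delta})$$ on the space of regular cuspidal functions of dimension $r\delta$ is exactly the space $\mathbf{H}_{Q,\mathbf{F}_q}^{\mathrm{cusp}}[r\delta]$ of cuspidal functions of dimension $r\delta$.
   Context: Hall algebra. Let $Q=(I,\Omega)$ be a finite quiver and $\nu=\sqrt q$. On $\mathbf{Z}^I$ the Euler form is $\langle \mathbf d,\mathbf d'\rangle=\sum_{i\in I} d_id'_i-\sum_{\alpha:i\to j}d_id'_j$ and its symmetrization is $(\mathbf d,\mathbf d')=\langle\mathbf d,\mathbf d'\rangle+\langle\mathbf d',\mathbf d\rangle$. Representations are finite dimensional over $\mathbf{F}_q$; write $a_M=|\mathrm{Aut}(M)|$ and let $F^R_{M,N}$ be the number of subrepresentations $X\subset R$ with $X\simeq N$, $R/X\simeq M$. The Hall algebra $\mathbf{H}_{Q,\mathbf{F}_q}=\bigoplus_{[M]}\mathbf{C}[M]$ ($[M]$ running over isomorphism classes) is graded by dimension vectors in $\mathbf{N}^I$ (component of degree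 $\mathbf d$ denoted $[\mathbf d]$) and is identified with finitely supported functions on isomorphism classes. It has multiplication $[M]\star[N]=\nu^{\langle \dim M,\dim N\rangle}\sum_{[R]}F^R_{M,N}[R]$, unit $1=[0]$, comultiplication $\Delta([R])=\sum_{[U],[V]}\nu^{\langle \dim U,\dim V\rangle}F^R_{U,V}\frac{a_Ua_V}{a_R}[U]\otimes[V]$, and Green's scalar product, the Hermitian form (linear in the first variable) with $([M],[N])=\delta_{[M],[N]}/a_M$. A function $f$ is cuspidal if $\Delta(f)=f\otimes 1+1\otimes f$; $\mathbf{H}^{\mathrm{cusp}}_{Q,\mathbf{F}_q}[\mathbf d]$ is the space of cuspidal functions of dimension $\mathbf d$. Affine quivers. An affine quiver is a quiver whose underlying graph is an extended Dynkin diagram $A_n^{(1)},D_n^{(1)},E_{6,7,8}^{(1)}$; it is acyclic if it has no oriented cycles. $\delta\in\mathbf{N}^I$ is the indivisible positive generator of the kernel of $(-,-)$. For $Q$ acyclic affine, an indecomposable representation $M$ is preprojective, regular or preinjective according to whether $\langle\delta,\dim M\rangle$ is $<0$, $=0$ or $>0$; a general representation is called preprojective (resp. regular, preinjective) if all its indecomposable direct summands are. Regular Hall algebra. $\mathbf{H}_{Q,\mathbf{F}_q,\mathcal R}\subset\mathbf{H}_{Q,\mathbf{F}_q}$ is the span of the $[M]$ with $M$ regular. $\Delta_{\mathcal R}$ is the composition of $\Delta$ restricted to $\mathbf{H}_{Q,\mathbf{F}_q,\mathcal R}$ with the orthogonal projection to $\mathbf{H}_{Q,\mathbf{F}_q,\mathcal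 R}\otimes\mathbf{H}_{Q,\mathbf{F}_q,\mathcal R}$ (i.e. one keeps only terms $[U]\otimes[V]$ with $U,V$ regular). A function $f\in\mathbf{H}_{Q,\mathbf{F}_q,\mathcal R}$ is regular cuspidal if $\Delta_{\mathcal R}(f)=f\otimes1+1\otimes f$; $\mathbf{H}^{\mathrm{cusp}}_{Q,\mathbf{F}_q,\mathcal R}[r\delta]$ is the space of regular cuspidal functions of dimension $r\delta$. *)

theory Defs
  imports
    Complex_Main
    "HOL-Library.Multiset"
    "HOL-Library.Indicator_Function"
    "Graph_Theory.Digraph"
    "HOL-Algebra.AbelCoset"
    "Jordan_Normal_Form.Missing_VectorSpace"
begin

subsection \<open>Affine quivers and the Euler form\<close>

text \<open>A quiver \<open>(I, \<Omega>)\<close> is a directed multigraph of type \<open>('v, 'a) pre_digraph\<close> with vertex set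
  \<open>I = verts Q\<close> and set of arrows \<open>\<Omega> = arcs Q\<close>; it is finite if \<open>fin_digraph Q\<close> holds.\<close>

text \<open>The underlying graph of \<open>Q\<close> is the multigraph with vertices \<open>0, \<dots>, n\<close> and edge list \<open>es\<close>,
  up to isomorphism.\<close>

definition has_underlying_graph :: "('v, 'a) pre_digraph \<Rightarrow> nat \<Rightarrow> (nat \<times> nat) list \<Rightarrow> bool" where
  "has_underlying_graph Q n es \<longleftrightarrow>
     (\<exists>\<phi>. bij_betw \<phi> (verts Q) {0..n} \<and>
        image_mset (\<lambda>a. {\<phi> (tail Q a), \<phi> (head Q a)}) (mset_set (arcs Q)) =
        image_mset (\<lambda>(i, j). {i, j}) (mset es))"

text \<open>Edges of the extended Dynkin diagrams, each on the vertices \<open>0, \<dots>, n\<close>.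
  For \<open>n = 1\<close> the diagram of type \<open>A\<close> is a double edge.\<close>

definition edges_A :: "nat \<Rightarrow> (nat \<times> nat) list" where
  "edges_A n = map (\<lambda>i. (i, i + 1)) [0..<n] @ [(n, 0)]"

definition edges_D :: "nat \<Rightarrow> (nat \<times> nat) list" where
  "edges_D n = [(0, 2), (1, 2)] @ map (\<lambda>i. (i, i + 1)) [2..<n - 2] @ [(n - 2, n - 1), (n - 2, n)]"

definition edges_E6 :: "(nat \<times> nat) list" where
  "edges_E6 = [(0, 1), (1, 2), (2, 3), (3, 4), (2, 5), (5, 6)]"

definition edges_E7 :: "(nat \<times> nat) list" where
  "edges_E7 = [(0, 1), (1, 2), (2, 3), (3, 4), (4, 5), (5, 6), (3, 7)]"

definition edges_E8 :: "(nat \<times> nat) list" where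
  "edges_E8 = [(0, 1), (1, 2), (2, 3), (3, 4), (4, 5), (5, 6), (6, 7), (2, 8)]"

definition affine_quiver :: "('v, 'a) pre_digraph \<Rightarrow> bool" where
  "affine_quiver Q \<longleftrightarrow> fin_digraph Q \<and>
     ((\<exists>n\<ge>1. has_underlying_graph Q n (edges_A n)) \<or>
      (\<exists>n\<ge>4. has_underlying_graph Q n (edges_D n)) \<or>
      has_underlying_graph Q 6 edges_E6 \<or>
      has_underlying_graph Q 7 edges_E7 \<or>
      has_underlying_graph Q 8 edges_E8)"

definition acyclic_quiver :: "('v, 'a) pre_digraph \<Rightarrow> bool" where
  "acyclic_quiver Q \<longleftrightarrow> acyclic (arcs_ends Q)"

text \<open>Elements of \<open>\<int>\<^sup>I\<close> and \<open>\<nat>\<^sup>I\<close> are functions on the vertex type that vanish off \<open>verts Q\<close>.\<close>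

definition int_vectors :: "('v, 'a) pre_digraph \<Rightarrow> ('v \<Rightarrow> int) set" where
  "int_vectors Q = {x. \<forall>v. v \<notin> verts Q \<longrightarrow> x v = 0}"

definition dim_vectors :: "('v, 'a) pre_digraph \<Rightarrow> ('v \<Rightarrow> nat) set" where
  "dim_vectors Q = {d. \<forall>v. v \<notin> verts Q \<longrightarrow> d v = 0}"

definition euler_form :: "('v, 'a) pre_digraph \<Rightarrow> ('v \<Rightarrow> int) \<Rightarrow> ('v \<Rightarrow> int) \<Rightarrow> int" where
  "euler_form Q x y =
     (\<Sum>v\<in>verts Q. x v * y v) - (\<Sum>a\<in>arcs Q. x (tail Q a) * y (head Q a))"

definition sym_euler_form :: "('v, 'a) pre_digraph \<Rightarrow> ('v \<Rightarrow> int) \<Rightarrow> ('v \<Rightarrow> int) \<Rightarrow> int" where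
  "sym_euler_form Q x y = euler_form Q x y + euler_form Q y x"

abbreviation euler_dim :: "('v, 'a) pre_digraph \<Rightarrow> ('v \<Rightarrow> nat) \<Rightarrow> ('v \<Rightarrow> nat) \<Rightarrow> int" where
  "euler_dim Q d e \<equiv> euler_form Q (\<lambda>v. int (d v)) (\<lambda>v. int (e v))"

text \<open>\<open>\<delta>\<close> is the indivisible positive generator of the kernel of the symmetrized Euler form;
  \<open>Gcd = 1\<close> also says that \<open>\<delta> \<noteq> 0\<close>.\<close>

definition indivisible_imaginary_root :: "('v, 'a) pre_digraph \<Rightarrow> ('v \<Rightarrow> nat) \<Rightarrow> bool" where
  "indivisible_imaginary_root Q \<delta> \<longleftrightarrow>
     \<delta> \<in> dim_vectors Q \<and> Gcd (\<delta> ` verts Q) = 1 \<and>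
     {x \<in> int_vectors Q. \<forall>y\<in>int_vectors Q. sym_euler_form Q x y = 0} =
       {\<lambda>v. n * int (\<delta> v) | n. True}"

subsection \<open>Representations\<close>

record ('v, 'a, 'k, 'm) quiver_rep =
  space :: "'v \<Rightarrow> ('k, 'm) module"
  arrow_map :: "'a \<Rightarrow> 'm \<Rightarrow> 'm"

definition representation ::
  "('v, 'a) pre_digraph \<Rightarrow> ('k, 'e) ring_scheme \<Rightarrow> ('v, 'a, 'k, 'm) quiver_rep \<Rightarrow> bool" where
  "representation Q K M \<longleftrightarrow>
     (\<forall>v\<in>verts Q. vectorspace K (space M v) \<and> vectorspace.fin_dim K (space M v)) \<and>
     (\<forall>a\<in>arcs Q. linear_map K (space M (tail Q a)) (space M (head Q a)) (arrow_map M a))"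

definition dim_vector ::
  "('v, 'a) pre_digraph \<Rightarrow> ('k, 'e) ring_scheme \<Rightarrow> ('v, 'a, 'k, 'm) quiver_rep \<Rightarrow> 'v \<Rightarrow> nat" where
  "dim_vector Q K M = (\<lambda>v. if v \<in> verts Q then vectorspace.dim K (space M v) else 0)"

definition zero_rep :: "('v, 'a) pre_digraph \<Rightarrow> ('v, 'a, 'k, 'm) quiver_rep \<Rightarrow> bool" where
  "zero_rep Q M \<longleftrightarrow> (\<forall>v\<in>verts Q. carrier (space M v) = {\<zero>\<^bsub>space M v\<^esub>})"

definition rep_hom ::
  "('v, 'a) pre_digraph \<Rightarrow> ('k, 'e) ring_scheme \<Rightarrow>
   ('v, 'a, 'k, 'm) quiver_rep \<Rightarrow> ('v, 'a, 'k, 'n) quiver_rep \<Rightarrow> ('v \<Rightarrow> 'm \<Rightarrow> 'n) set" where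
  "rep_hom Q K M N =
     {\<phi>. (\<forall>v\<in>verts Q. \<phi> v \<in> module_hom K (space M v) (space N v)) \<and>
         (\<forall>a\<in>arcs Q. \<forall>x\<in>carrier (space M (tail Q a)).
            \<phi> (head Q a) (arrow_map M a x) = arrow_map N a (\<phi> (tail Q a) x))}"

definition rep_iso ::
  "('v, 'a) pre_digraph \<Rightarrow> ('k, 'e) ring_scheme \<Rightarrow>
   ('v, 'a, 'k, 'm) quiver_rep \<Rightarrow> ('v, 'a, 'k, 'n) quiver_rep \<Rightarrow> ('v \<Rightarrow> 'm \<Rightarrow> 'n) set" where
  "rep_iso Q K M N =
     {\<phi> \<in> rep_hom Q K M N.
        \<forall>v\<in>verts Q. bij_betw (\<phi> v) (carrier (space M v)) (carrier (space N v))}"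

definition isomorphic ::
  "('v, 'a) pre_digraph \<Rightarrow> ('k, 'e) ring_scheme \<Rightarrow>
   ('v, 'a, 'k, 'm) quiver_rep \<Rightarrow> ('v, 'a, 'k, 'n) quiver_rep \<Rightarrow> bool" where
  "isomorphic Q K M N \<longleftrightarrow> rep_iso Q K M N \<noteq> {}"

text \<open>Automorphisms are taken extensional in order to be counted correctly.\<close>

definition automorphisms ::
  "('v, 'a) pre_digraph \<Rightarrow> ('k, 'e) ring_scheme \<Rightarrow>
   ('v, 'a, 'k, 'm) quiver_rep \<Rightarrow> ('v \<Rightarrow> 'm \<Rightarrow> 'm) set" where
  "automorphisms Q K M =
     rep_iso Q K M M \<inter> (\<Pi>\<^sub>E v\<in>verts Q. carrier (space M v) \<rightarrow>\<^sub>E carrier (space M v))"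

text \<open>A subrepresentation is given by its family of subspaces.\<close>

definition subreps ::
  "('v, 'a) pre_digraph \<Rightarrow> ('k, 'e) ring_scheme \<Rightarrow>
   ('v, 'a, 'k, 'm) quiver_rep \<Rightarrow> ('v \<Rightarrow> 'm set) set" where
  "subreps Q K R =
     {X \<in> extensional (verts Q).
        (\<forall>v\<in>verts Q. subspace K (X v) (space R v)) \<and>
        (\<forall>a\<in>arcs Q. arrow_map R a ` X (tail Q a) \<subseteq> X (head Q a))}"

definition sub_rep ::
  "('v, 'a, 'k, 'm) quiver_rep \<Rightarrow> ('v \<Rightarrow> 'm set) \<Rightarrow> ('v, 'a, 'k, 'm) quiver_rep" where
  "sub_rep R X = \<lparr>space = (\<lambda>v. (space R v)\<lparr>carrier := X v\<rparr>), arrow_map = arrow_map R\<rparr>"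

text \<open>The multiplicative fields of a \<open>module\<close> record play no role for vector spaces. The operations
  induced on cosets are written as unions in the manner of \<open>rcoset_mult\<close>.\<close>

definition quotient_space :: "('k, 'm) module \<Rightarrow> 'm set \<Rightarrow> ('k, 'm set) module" where
  "quotient_space V W =
     \<lparr>carrier = a_rcosets\<^bsub>V\<^esub> W, mult = undefined, one = undefined,
      zero = W, add = set_add V, smult = (\<lambda>c C. \<Union>x\<in>C. W +>\<^bsub>V\<^esub> (c \<odot>\<^bsub>V\<^esub> x))\<rparr>"

definition quotient_rep ::
  "('v, 'a) pre_digraph \<Rightarrow> ('v, 'a, 'k, 'm) quiver_rep \<Rightarrow> ('v \<Rightarrow> 'm set) \<Rightarrow>
   ('v, 'a, 'k, 'm set) quiver_rep" where
  "quotient_rep Q R X =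
     \<lparr>space = (\<lambda>v. quotient_space (space R v) (X v)),
      arrow_map = (\<lambda>a C. \<Union>x\<in>C. X (head Q a) +>\<^bsub>space R (head Q a)\<^esub> arrow_map R a x)\<rparr>"

subsection \<open>Regular representations\<close>

definition complementary_subreps ::
  "('v, 'a) pre_digraph \<Rightarrow> ('k, 'e) ring_scheme \<Rightarrow> ('v, 'a, 'k, 'm) quiver_rep \<Rightarrow>
   ('v \<Rightarrow> 'm set) \<Rightarrow> ('v \<Rightarrow> 'm set) \<Rightarrow> bool" where
  "complementary_subreps Q K M X Y \<longleftrightarrow>
     X \<in> subreps Q K M \<and> Y \<in> subreps Q K M \<and>
     (\<forall>v\<in>verts Q. X v \<inter> Y v = {\<zero>\<^bsub>space M v\<^esub>} \<and>
                  X v <+>\<^bsub>space M v\<^esub> Y v = carrier (space M v))"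

definition indecomposable ::
  "('v, 'a) pre_digraph \<Rightarrow> ('k, 'e) ring_scheme \<Rightarrow> ('v, 'a, 'k, 'm) quiver_rep \<Rightarrow> bool" where
  "indecomposable Q K M \<longleftrightarrow>
     \<not> zero_rep Q M \<and>
     (\<forall>X Y. complementary_subreps Q K M X Y \<longrightarrow>
        zero_rep Q (sub_rep M X) \<or> zero_rep Q (sub_rep M Y))"

definition direct_summand ::
  "('v, 'a) pre_digraph \<Rightarrow> ('k, 'e) ring_scheme \<Rightarrow> ('v, 'a, 'k, 'm) quiver_rep \<Rightarrow>
   ('v \<Rightarrow> 'm set) \<Rightarrow> bool" where
  "direct_summand Q K M X \<longleftrightarrow> (\<exists>Y. complementary_subreps Q K M X Y)"

definition regular_rep ::
  "('v, 'a) pre_digraph \<Rightarrow> ('k, 'e) ring_scheme \<Rightarrow> ('v \<Rightarrow> nat) \<Rightarrow>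
   ('v, 'a, 'k, 'm) quiver_rep \<Rightarrow> bool" where
  "regular_rep Q K \<delta> M \<longleftrightarrow>
     (\<forall>X. direct_summand Q K M X \<and> indecomposable Q K (sub_rep M X) \<longrightarrow>
        euler_dim Q \<delta> (dim_vector Q K (sub_rep M X)) = 0)"

subsection \<open>Isomorphism classes\<close>

text \<open>Over a finite field the spaces of a finite-dimensional representation are finite sets, so every
  representation is isomorphic to one whose spaces have carriers in \<open>nat\<close>. Isomorphism classes are
  therefore taken among these.\<close>

type_synonym ('v, 'a, 'k) iso_class = "('v, 'a, 'k, nat) quiver_rep set"

definition iso_classes ::
  "('v, 'a) pre_digraph \<Rightarrow> ('k, 'e) ring_scheme \<Rightarrow> ('v, 'a, 'k) iso_class set" where
  "iso_classes Q K =
     {M. representation Q K M} //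
     {(M, N). representation Q K M \<and> representation Q K N \<and> isomorphic Q K M N}"

definition representative :: "('v, 'a, 'k) iso_class \<Rightarrow> ('v, 'a, 'k, nat) quiver_rep" where
  "representative c = (SOME M. M \<in> c)"

definition class_dim ::
  "('v, 'a) pre_digraph \<Rightarrow> ('k, 'e) ring_scheme \<Rightarrow> ('v, 'a, 'k) iso_class \<Rightarrow> 'v \<Rightarrow> nat" where
  "class_dim Q K c = dim_vector Q K (representative c)"

definition zero_class ::
  "('v, 'a) pre_digraph \<Rightarrow> ('k, 'e) ring_scheme \<Rightarrow> ('v, 'a, 'k) iso_class" where
  "zero_class Q K = {M. representation Q K M \<and> zero_rep Q M}"

definition regular_classes ::
  "('v, 'a) pre_digraph \<Rightarrow> ('k, 'e) ring_scheme \<Rightarrow> ('v \<Rightarrow> nat) \<Rightarrow> ('v, 'a, 'k) iso_class set" where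
  "regular_classes Q K \<delta> = {c \<in> iso_classes Q K. regular_rep Q K \<delta> (representative c)}"

text \<open>\<open>aut_number\<close> is \<open>a\<^sub>M\<close> and \<open>hall_number Q K R M N\<close> is the number of subrepresentations
  \<open>X\<close> of \<open>R\<close> with \<open>X \<cong> N\<close> and \<open>R/X \<cong> M\<close>.\<close>

definition aut_number ::
  "('v, 'a) pre_digraph \<Rightarrow> ('k, 'e) ring_scheme \<Rightarrow> ('v, 'a, 'k) iso_class \<Rightarrow> nat" where
  "aut_number Q K c = card (automorphisms Q K (representative c))"

definition hall_number ::
  "('v, 'a) pre_digraph \<Rightarrow> ('k, 'e) ring_scheme \<Rightarrow>
   ('v, 'a, 'k) iso_class \<Rightarrow> ('v, 'a, 'k) iso_class \<Rightarrow> ('v, 'a, 'k) iso_class \<Rightarrow> nat" where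
  "hall_number Q K r m n =
     card {X \<in> subreps Q K (representative r).
             isomorphic Q K (sub_rep (representative r) X) (representative n) \<and>
             isomorphic Q K (quotient_rep Q (representative r) X) (representative m)}"

subsection \<open>The Hall algebra\<close>

text \<open>Elements of the Hall algebra are finitely supported functions on isomorphism classes, with
  \<open>[M]\<close> the indicator function of the class of \<open>M\<close>; elements of its tensor square are functions on
  pairs of classes.\<close>

type_synonym ('v, 'a, 'k) class_fun = "('v, 'a, 'k) iso_class \<Rightarrow> complex"
type_synonym ('v, 'a, 'k) class_fun2 = "('v, 'a, 'k) iso_class \<times> ('v, 'a, 'k) iso_class \<Rightarrow> complex"

definition hall_algebra ::
  "('v, 'a) pre_digraph \<Rightarrow> ('k, 'e) ring_scheme \<Rightarrow> ('v, 'a, 'k) class_fun set" where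
  "hall_algebra Q K = {f. finite {c. f c \<noteq> 0} \<and> {c. f c \<noteq> 0} \<subseteq> iso_classes Q K}"

definition hall_degree ::
  "('v, 'a) pre_digraph \<Rightarrow> ('k, 'e) ring_scheme \<Rightarrow> ('v \<Rightarrow> nat) \<Rightarrow> ('v, 'a, 'k) class_fun set" where
  "hall_degree Q K d = {f \<in> hall_algebra Q K. \<forall>c. f c \<noteq> 0 \<longrightarrow> class_dim Q K c = d}"

definition hall_regular ::
  "('v, 'a) pre_digraph \<Rightarrow> ('k, 'e) ring_scheme \<Rightarrow> ('v \<Rightarrow> nat) \<Rightarrow> ('v, 'a, 'k) class_fun set" where
  "hall_regular Q K \<delta> = {f \<in> hall_algebra Q K. {c. f c \<noteq> 0} \<subseteq> regular_classes Q K \<delta>}"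

definition hall_unit ::
  "('v, 'a) pre_digraph \<Rightarrow> ('k, 'e) ring_scheme \<Rightarrow> ('v, 'a, 'k) class_fun" where
  "hall_unit Q K = indicator {zero_class Q K}"

definition tensor ::
  "('v, 'a, 'k) class_fun \<Rightarrow> ('v, 'a, 'k) class_fun \<Rightarrow> ('v, 'a, 'k) class_fun2" where
  "tensor f g = (\<lambda>(u, v). f u * g v)"

text \<open>The coefficient of \<open>[U] \<otimes> [V]\<close> in \<open>\<Delta>([R])\<close>.\<close>

definition comult_coeff ::
  "('v, 'a) pre_digraph \<Rightarrow> ('k, 'e) ring_scheme \<Rightarrow>
   ('v, 'a, 'k) iso_class \<Rightarrow> ('v, 'a, 'k) iso_class \<Rightarrow> ('v, 'a, 'k) iso_class \<Rightarrow> complex" where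
  "comult_coeff Q K r u v =
     complex_of_real (sqrt (real (card (carrier K)))) powi
       euler_dim Q (class_dim Q K u) (class_dim Q K v) *
     of_nat (hall_number Q K r u v) *
     (of_nat (aut_number Q K u) * of_nat (aut_number Q K v) / of_nat (aut_number Q K r))"

definition comult ::
  "('v, 'a) pre_digraph \<Rightarrow> ('k, 'e) ring_scheme \<Rightarrow>
   ('v, 'a, 'k) class_fun \<Rightarrow> ('v, 'a, 'k) class_fun2" where
  "comult Q K f =
     (\<lambda>(u, v). if u \<in> iso_classes Q K \<and> v \<in> iso_classes Q K
        then \<Sum>r | f r \<noteq> 0. f r * comult_coeff Q K r u v else 0)"

definition regular_comult ::
  "('v, 'a) pre_digraph \<Rightarrow> ('k, 'e) ring_scheme \<Rightarrow> ('v \<Rightarrow> nat) \<Rightarrow>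
   ('v, 'a, 'k) class_fun \<Rightarrow> ('v, 'a, 'k) class_fun2" where
  "regular_comult Q K \<delta> f =
     (\<lambda>(u, v). if u \<in> regular_classes Q K \<delta> \<and> v \<in> regular_classes Q K \<delta>
        then comult Q K f (u, v) else 0)"

definition hall_inner ::
  "('v, 'a) pre_digraph \<Rightarrow> ('k, 'e) ring_scheme \<Rightarrow>
   ('v, 'a, 'k) class_fun \<Rightarrow> ('v, 'a, 'k) class_fun \<Rightarrow> complex" where
  "hall_inner Q K f g = (\<Sum>c | f c \<noteq> 0. f c * cnj (g c) / of_nat (aut_number Q K c))"

definition cuspidal ::
  "('v, 'a) pre_digraph \<Rightarrow> ('k, 'e) ring_scheme \<Rightarrow> ('v \<Rightarrow> nat) \<Rightarrow> ('v, 'a, 'k) class_fun set" where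
  "cuspidal Q K d =
     {f \<in> hall_degree Q K d.
        comult Q K f = (\<lambda>p. tensor f (hall_unit Q K) p + tensor (hall_unit Q K) f p)}"

definition regular_cuspidal ::
  "('v, 'a) pre_digraph \<Rightarrow> ('k, 'e) ring_scheme \<Rightarrow> ('v \<Rightarrow> nat) \<Rightarrow> ('v \<Rightarrow> nat) \<Rightarrow>
   ('v, 'a, 'k) class_fun set" where
  "regular_cuspidal Q K \<delta> d =
     {f \<in> hall_regular Q K \<delta> \<inter> hall_degree Q K d.
        regular_comult Q K \<delta> f = (\<lambda>p. tensor f (hall_unit Q K) p + tensor (hall_unit Q K) f p)}"

text \<open>The sum of all \<open>[M]\<close> with \<open>M\<close> regular of dimension \<open>d\<close>.\<close>

definition regular_char ::
  "('v, 'a) pre_digraph \<Rightarrow> ('k, 'e) ring_scheme \<Rightarrow> ('v \<Rightarrow> nat) \<Rightarrow> ('v \<Rightarrow> nat) \<Rightarrow>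
   ('v, 'a, 'k) class_fun" where
  "regular_char Q K \<delta> d = indicator {c \<in> regular_classes Q K \<delta>. class_dim Q K c = d}"

end

theory Submission
  imports Defs
begin

text \<open>Put \<open>\<theta> = \<langle>\<delta>, -\<rangle>\<close>. Every \<open>M\<close> has a unique subrepresentation \<open>X\<close> such that \<open>\<theta> \<ge> 0\<close> on all quotients of \<open>X\<close> and
  \<open>\<theta> < 0\<close> on all nonzero subrepresentations of \<open>M/X\<close>, and \<open>Ext(M/X, X) = 0\<close>, so \<open>M = X \<oplus> M/X\<close>. In particular \<open>M\<close> is regular iff
  \<open>\<theta>(M) = 0\<close> and \<open>\<theta> \<le> 0\<close> on its subrepresentations; no classification of indecomposables is needed.

  Put \<open>\<mu>(M) = f(M)/a\<^sub>M\<close>. Up to nonzero factors the coefficient of \<open>\<Delta>(f)\<close> at \<open>[U] \<otimes> [V]\<close> is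
  \<open>\<gamma>(U, V) = \<Sum>\<^sub>M \<mu>(M) F\<^sup>M(U, V)\<close>, and the linear form sends \<open>f\<close> to \<open>\<Sum>\<^sub>M \<mu>(M)\<close>. If \<open>\<gamma>(U, V) = 0\<close> for all nonzero \<open>U, V\<close>, then
  \<open>f(M) = 0\<close> for nonregular \<open>M\<close>, since \<open>M\<close> is the only class contributing to \<open>\<gamma>(M/X, X)\<close>; and \<open>\<Sum> \<mu> = 0\<close>, since every \<open>M\<close> has
  exactly one subrepresentation of dimension \<open>r\<delta>\<^sub>i\<close> concentrated at a given sink \<open>i\<close>.

  Conversely let \<open>f\<close> be regular cuspidal with \<open>\<Sum> \<mu> = 0\<close>. Then \<open>\<Sum>\<^sub>M \<mu>(M) #{X \<subseteq> M. X \<cong> V} = 0\<close> whenever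
  \<open>dim V \<noteq> r\<delta>\<close>, and \<open>\<gamma>(U, V) = 0\<close> follows by induction on \<open>dim U\<close> and \<open>|End U|\<close>. A decomposable \<open>U\<close> is handled by
  counting flags in two ways. An indecomposable \<open>U\<close> with \<open>\<theta>(U) > 0\<close> is a rigid brick, hence the only semistable representation
  of its dimension for the weight \<open>\<langle>dim U, -\<rangle> - \<langle>-, dim U\<rangle>\<close>, and the Harder-Narasimhan recursion for this weight
  expresses \<open>\<gamma>(U, V)\<close> through the sums above.\<close>

section \<open>Linear algebra over a finite field\<close>

text \<open>The obstacle is that the regular coproduct controls only pairs of regular
  representations, whereas a regular M may have subrepresentations with preprojective and quotients
  with preinjective summands. The vanishing of the linear form enters through one principle: it
  kills every function of M that is constant on the support of f. For preprojective V this applies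
  to |Hom(V, M)|, since Ext(V, M) = 0 makes it a function of the dimension vector; the rest is
  triangular elimination among counts of subrepresentations. Ext(M/X, X) = 0 comes from counting,
  not from Auslander-Reiten theory. Ext is right exact in both arguments, so it suffices to embed
  M/X into some representation without extensions by X, and a random one of large suitable dimension
  works. Suitable are multiples of m \<delta> + z, where z makes the weak inequalities for \<theta>
  strict. An indecomposable U with \<theta>(U) \<noteq> 0 has positive Euler form, because on an
  affine quiver that form is a sum of squares vanishing only along \<delta>; hence a brick is rigid.
  |End U| serves in the induction because it drops from a direct sum to every nonsplit extension of
  the same two summands.\<close>

locale finite_field =
  fixes K :: "('k, 'e) ring_scheme"
  assumes field_K: "field K" and finite_K: "finite (carrier K)"
begin

definition q :: nat where "q = card (carrier K)"

lemma q_ge_2: "q \<ge> 2"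
proof -
  interpret field K by (rule field_K)
  have "card {\<zero>\<^bsub>K\<^esub>, \<one>\<^bsub>K\<^esub>} \<le> card (carrier K)"
    by (rule card_mono[OF finite_K]) auto
  then show ?thesis by (simp add: q_def)
qed

abbreviation VS :: "('k, 'm) module \<Rightarrow> bool" where
  "VS V \<equiv> vectorspace K V \<and> vectorspace.fin_dim K V"

abbreviation vdim :: "('k, 'm) module \<Rightarrow> nat" where
  "vdim V \<equiv> vectorspace.dim K V"

text \<open>Cutting down to extensional functions makes every linear map occur exactly once, so that
  the set is finite and its cardinality is meaningful.\<close>

definition LH :: "('k, 'm) module \<Rightarrow> ('k, 'n) module \<Rightarrow> ('m \<Rightarrow> 'n) set" where
  "LH V W = module_hom K V W \<inter> extensional (carrier V)"

lemma module_homI: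
  assumes "\<And>x. x \<in> carrier V \<Longrightarrow> f x \<in> carrier W"
    and "\<And>x y. x \<in> carrier V \<Longrightarrow> y \<in> carrier V \<Longrightarrow> f (x \<oplus>\<^bsub>V\<^esub> y) = f x \<oplus>\<^bsub>W\<^esub> f y"
    and "\<And>c x. c \<in> carrier K \<Longrightarrow> x \<in> carrier V \<Longrightarrow> f (c \<odot>\<^bsub>V\<^esub> x) = c \<odot>\<^bsub>W\<^esub> f x"
  shows "f \<in> module_hom K V W"
  using assms by (auto simp: module_hom_def)

lemma module_homD:
  assumes "f \<in> module_hom K V W"
  shows "\<And>x. x \<in> carrier V \<Longrightarrow> f x \<in> carrier W"
    and "\<And>x y. x \<in> carrier V \<Longrightarrow> y \<in> carrier V \<Longrightarrow> f (x \<oplus>\<^bsub>V\<^esub> y) = f x \<oplus>\<^bsub>W\<^esub> f y"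
    and "\<And>c x. c \<in> carrier K \<Longrightarrow> x \<in> carrier V \<Longrightarrow> f (c \<odot>\<^bsub>V\<^esub> x) = c \<odot>\<^bsub>W\<^esub> f x"
  using assms by (auto simp: module_hom_def)

lemma mod_hom_of:
  assumes "vectorspace K V" "vectorspace K W" "f \<in> module_hom K V W"
  shows "linear_map K V W f"
  using assms unfolding linear_map_def mod_hom_def mod_hom_axioms_def
  by (auto intro: vectorspace.axioms)

lemma module_hom_zero:
  assumes "vectorspace K V" "vectorspace K W" "f \<in> module_hom K V W"
  shows "f \<zero>\<^bsub>V\<^esub> = \<zero>\<^bsub>W\<^esub>"
proof -
  interpret linear_map K V W f by (rule mod_hom_of[OF assms])
  show ?thesis by simp
qed

lemma module_hom_minus:
  assumes "vectorspace K V" "vectorspace K W" "f \<in> module_hom K V W" "x \<in> carrier V" "y \<in> carrier V"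
  shows "f (x \<ominus>\<^bsub>V\<^esub> y) = f x \<ominus>\<^bsub>W\<^esub> f y" "f (\<ominus>\<^bsub>V\<^esub> y) = \<ominus>\<^bsub>W\<^esub> f y"
proof -
  interpret linear_map K V W f by (rule mod_hom_of[OF assms(1-3)])
  show "f (x \<ominus>\<^bsub>V\<^esub> y) = f x \<ominus>\<^bsub>W\<^esub> f y" "f (\<ominus>\<^bsub>V\<^esub> y) = \<ominus>\<^bsub>W\<^esub> f y"
    using assms by (auto simp: T_minus)
qed

lemma module_hom_comp:
  assumes "f \<in> module_hom K U V" "g \<in> module_hom K V W"
  shows "(\<lambda>x. g (f x)) \<in> module_hom K U W"
  by (intro module_homI) (simp_all add: module_homD[OF assms(1)] module_homD[OF assms(2)])

lemma module_hom_cong: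
  assumes "f \<in> module_hom K V W" "\<And>x. x \<in> carrier V \<Longrightarrow> g x = f x" "vectorspace K V"
  shows "g \<in> module_hom K V W"
proof -
  interpret vectorspace K V by fact
  show ?thesis using assms(2)
    by (intro module_homI) (simp_all add: module_homD[OF assms(1)])
qed

lemma module_hom_add:
  assumes "vectorspace K V" "vectorspace K W" "f \<in> module_hom K V W" "g \<in> module_hom K V W"
  shows "(\<lambda>x. f x \<oplus>\<^bsub>W\<^esub> g x) \<in> module_hom K V W"
proof -
  interpret V: vectorspace K V by fact
  interpret W: vectorspace K W by fact
  show ?thesis
    by (intro module_homI)
      (simp_all add: module_homD[OF assms(3)] module_homD[OF assms(4)] W.a_ac W.smult_r_distr)
qed

lemma module_hom_uminus:
  assumes "vectorspace K V" "vectorspace K W" "f \<in> module_hom K V W"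
  shows "(\<lambda>x. \<ominus>\<^bsub>W\<^esub> f x) \<in> module_hom K V W"
proof -
  interpret V: vectorspace K V by fact
  interpret W: vectorspace K W by fact
  show ?thesis
    by (intro module_homI) (simp_all add: module_homD[OF assms(3)] W.minus_add W.a_comm W.smult_r_minus)
qed

lemma module_hom_diff:
  assumes "vectorspace K V" "vectorspace K W" "f \<in> module_hom K V W" "g \<in> module_hom K V W"
  shows "(\<lambda>x. f x \<ominus>\<^bsub>W\<^esub> g x) \<in> module_hom K V W"
  unfolding a_minus_def
  by (rule module_hom_add[OF assms(1,2,3) module_hom_uminus[OF assms(1,2,4)]])

lemma restrict_LH: "f \<in> module_hom K V W \<Longrightarrow> vectorspace K V \<Longrightarrow> restrict f (carrier V) \<in> LH V W"
  unfolding LH_def by (auto intro: module_hom_cong)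

lemma LH_hom: "f \<in> LH V W \<Longrightarrow> f \<in> module_hom K V W" by (simp add: LH_def)

section \<open>Subspaces, bases and the number of linear maps\<close>

lemma subspace_iff:
  "subspace K S V \<longleftrightarrow> vectorspace K V \<and> S \<subseteq> carrier V \<and> \<zero>\<^bsub>V\<^esub> \<in> S \<and>
     (\<forall>x\<in>S. \<forall>y\<in>S. x \<oplus>\<^bsub>V\<^esub> y \<in> S) \<and> (\<forall>c\<in>carrier K. \<forall>x\<in>S. c \<odot>\<^bsub>V\<^esub> x \<in> S)"
proof -
  have "vectorspace K V \<Longrightarrow> module K V" by (rule vectorspace.axioms)
  then show ?thesis unfolding subspace_def submodule_def by blast
qed

lemma subspace_minus:
  assumes "subspace K S V" "x \<in> S" "y \<in> S"
  shows "x \<ominus>\<^bsub>V\<^esub> y \<in> S" "\<ominus>\<^bsub>V\<^esub> y \<in> S"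
proof -
  interpret vectorspace K V using assms by (simp add: subspace_iff)
  have "y \<in> carrier V" using assms by (auto simp: subspace_iff)
  then have "\<ominus>\<^bsub>V\<^esub> y = (\<ominus>\<^bsub>K\<^esub> \<one>\<^bsub>K\<^esub>) \<odot>\<^bsub>V\<^esub> y"
    using smult_minus_1 by simp
  also have "\<dots> \<in> S" using assms by (auto simp: subspace_iff)
  finally show "\<ominus>\<^bsub>V\<^esub> y \<in> S" .
  then show "x \<ominus>\<^bsub>V\<^esub> y \<in> S" unfolding a_minus_def using assms by (auto simp: subspace_iff)
qed

lemma basis_ex:
  assumes "VS V"
  obtains B where "finite B" "vectorspace.basis K V B" "card B = vdim V"
    "B \<subseteq> carrier V"
  using vectorspace.finite_basis_exists vectorspace.dim_basis vectorspace.basis_def assms by metis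

text \<open>Coordinates identify a space with the functions from a basis to the field. Both the
  cardinality of a space and the construction of maps from values on a basis rest on this
  bijection.\<close>

lemma basis_lincomb:
  assumes V: "vectorspace K V" and B: "finite B" "vectorspace.basis K V B"
  shows "bij_betw (\<lambda>a. module.lincomb V a B) (B \<rightarrow>\<^sub>E carrier K) (carrier V)"
proof -
  interpret V: vectorspace K V by fact
  have BV: "B \<subseteq> carrier V" using B by (simp add: V.basis_def)
  have "\<forall>v. v \<in> carrier V \<longrightarrow> (\<exists>! a. a \<in> B \<rightarrow>\<^sub>E carrier K \<and> V.lincomb a B = v)"
    using V.basis_criterion[OF B(1) BV] B by simp
  then show ?thesis
    unfolding bij_betw_def inj_on_def image_def
    using V.lincomb_closed[OF BV] by (auto simp: PiE_def)
qed

lemma card_VS: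
  assumes "VS V"
  shows "finite (carrier V)" "card (carrier V) = q ^ vdim V"
proof -
  obtain B where B: "finite B" "vectorspace.basis K V B" "card B = vdim V" using basis_ex[OF assms] by metis
  have bij: "bij_betw (\<lambda>a. module.lincomb V a B) (B \<rightarrow>\<^sub>E carrier K) (carrier V)"
    using basis_lincomb B assms by blast
  show "finite (carrier V)" using bij_betw_finite[OF bij] finite_PiE[OF B(1), of "\<lambda>_. carrier K"] finite_K by auto
  show "card (carrier V) = q ^ vdim V"
    using bij_betw_same_card[OF bij] B by (simp add: card_PiE q_def)
qed

lemma fin_dimI:
  assumes "vectorspace K V" "finite (carrier V)"
  shows "vectorspace.fin_dim K V"
proof -
  interpret V: vectorspace K V by fact
  show ?thesis unfolding V.fin_dim_def
    using V.in_own_span[of "carrier V"] V.span_is_subset2[of "carrier V"] assms(2) by blast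
qed

lemma subspace_VS:
  assumes "VS V" "subspace K S V"
  shows "VS (V\<lparr>carrier := S\<rparr>)"
proof -
  have 1: "vectorspace K (V\<lparr>carrier := S\<rparr>)" using assms vectorspace.subspace_is_vs by blast
  have "finite S" using assms card_VS(1)[OF assms(1)] by (auto simp: subspace_iff intro: finite_subset)
  then show ?thesis using 1 fin_dimI[OF 1] by simp
qed

lemma finsum_hom:
  assumes "vectorspace K V" "vectorspace K W" "f \<in> module_hom K V W" "finite B" "g \<in> B \<rightarrow> carrier V"
  shows "f (finsum V g B) = finsum W (\<lambda>b. f (g b)) B"
proof -
  interpret V: vectorspace K V by fact
  interpret W: vectorspace K W by fact
  from assms(4,5) show ?thesis
  proof (induction B)
    case empty then show ?case using module_hom_zero assms by simp
  next
    case (insert b B)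
    have "f (finsum V g (insert b B)) = f (g b \<oplus>\<^bsub>V\<^esub> finsum V g B)"
      using insert by (simp add: V.finsum_insert)
    also have "\<dots> = f (g b) \<oplus>\<^bsub>W\<^esub> f (finsum V g B)" using insert assms(3)
      by (simp add: module_homD V.finsum_closed)
    also have "\<dots> = finsum W (\<lambda>b. f (g b)) (insert b B)" using insert assms(3)
      by (subst W.finsum_insert) (auto dest: module_homD(1))
    finally show ?case .
  qed
qed

lemma hom_eq_on_basis:
  assumes "vectorspace K V" "vectorspace K W" "f \<in> module_hom K V W" "g \<in> module_hom K V W"
    "finite B" "vectorspace.basis K V B" "\<And>b. b \<in> B \<Longrightarrow> f b = g b" "x \<in> carrier V"
  shows "f x = g x"
proof -
  interpret V: vectorspace K V by fact
  interpret W: vectorspace K W by fact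
  have BV: "B \<subseteq> carrier V" using assms by (simp add: V.basis_def)
  obtain a where a: "a \<in> B \<rightarrow>\<^sub>E carrier K" "x = V.lincomb a B"
    using basis_lincomb[OF assms(1,5,6)] assms(8) unfolding bij_betw_def by auto
  have c: "(\<lambda>v. a v \<odot>\<^bsub>V\<^esub> v) \<in> B \<rightarrow> carrier V" using a BV by auto
  have "f x = finsum W (\<lambda>b. f (a b \<odot>\<^bsub>V\<^esub> b)) B"
    unfolding a V.lincomb_def using finsum_hom[OF assms(1,2,3,5) c] .
  also have "\<dots> = finsum W (\<lambda>b. g (a b \<odot>\<^bsub>V\<^esub> b)) B"
  proof (rule W.finsum_cong')
    fix b assume b: "b \<in> B"
    then have "a b \<in> carrier K" "b \<in> carrier V" using a BV by auto
    then show "f (a b \<odot>\<^bsub>V\<^esub> b) = g (a b \<odot>\<^bsub>V\<^esub> b)"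
      using module_homD(3)[OF assms(3)] module_homD(3)[OF assms(4)] assms(7) b by simp
  next
    show "(\<lambda>b. g (a b \<odot>\<^bsub>V\<^esub> b)) \<in> B \<rightarrow> carrier W" using c module_homD(1)[OF assms(4)] by (auto simp: Pi_iff)
  qed simp
  also have "\<dots> = g x"
    unfolding a V.lincomb_def using finsum_hom[OF assms(1,2,4,5) c] by simp
  finally show ?thesis .
qed

lemma restrict_eqD: "restrict f A = g \<Longrightarrow> x \<in> A \<Longrightarrow> g x = f x"
  by auto

lemma finsum_delta:
  assumes U: "vectorspace K U" and h: "\<And>b'. b' \<in> B \<Longrightarrow> h b' \<in> carrier U" and b: "b \<in> B" "finite B"
  shows "finsum U (\<lambda>b'. (if b' = b then \<one>\<^bsub>K\<^esub> else \<zero>\<^bsub>K\<^esub>) \<odot>\<^bsub>U\<^esub> h b') B = h b"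
proof -
  interpret U: vectorspace K U by fact
  have "finsum U (\<lambda>b'. (if b' = b then \<one>\<^bsub>K\<^esub> else \<zero>\<^bsub>K\<^esub>) \<odot>\<^bsub>U\<^esub> h b') B
      = finsum U (\<lambda>b'. if b = b' then h b' else \<zero>\<^bsub>U\<^esub>) B"
    using h by (intro U.finsum_cong') auto
  also have "\<dots> = h b" using h b by (intro U.finsum_singleton) auto
  finally show ?thesis .
qed

lemma hom_extend_basis:
  assumes "vectorspace K V" "vectorspace K W" "finite B" "vectorspace.basis K V B" "g \<in> B \<rightarrow> carrier W"
  obtains f where "f \<in> module_hom K V W" "\<And>b. b \<in> B \<Longrightarrow> f b = g b"
proof -
  interpret V: vectorspace K V by fact
  interpret W: vectorspace K W by fact
  have BV: "B \<subseteq> carrier V" using assms by (simp add: V.basis_def)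
  note bij = basis_lincomb[OF assms(1,3,4)]
  define co where "co = inv_into (B \<rightarrow>\<^sub>E carrier K) (\<lambda>a. V.lincomb a B)"
  have co: "co x \<in> B \<rightarrow>\<^sub>E carrier K" "V.lincomb (co x) B = x" if "x \<in> carrier V" for x
    using inv_into_into[of x "\<lambda>a. V.lincomb a B"] bij_betw_inv_into_right[OF bij that] bij_betw_imp_surj_on[OF bij] that
    unfolding co_def by simp_all
  \<comment> \<open>Coordinates are unique, so additivity and homogeneity of \<open>f\<close> follow
    once a coefficient family for the sum or the multiple is exhibited.\<close>
  have cou: "restrict a B = co x" if "x \<in> carrier V" "a \<in> B \<rightarrow> carrier K" "V.lincomb a B = x" for x a
  proof -
    have "V.lincomb (restrict a B) B = x"
      using that BV V.lincomb_cong[OF refl BV, of "restrict a B" a] by simp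
    then show ?thesis using co[OF that(1)] bij that(2) unfolding bij_betw_def inj_on_def by auto
  qed
  define f where "f x = finsum W (\<lambda>b. co x b \<odot>\<^bsub>W\<^esub> g b) B" for x
  have gW: "\<And>b. b \<in> B \<Longrightarrow> g b \<in> carrier W" using assms(5) by auto
  have cK: "co x b \<in> carrier K" if "x \<in> carrier V" "b \<in> B" for x b using co(1)[OF that(1)] that(2) by auto
  have "f \<in> module_hom K V W"
  proof (rule module_homI)
    fix x assume "x \<in> carrier V"
    then show "f x \<in> carrier W" unfolding f_def using gW cK by (auto intro!: W.finsum_closed)
  next
    fix x y assume x: "x \<in> carrier V" and y: "y \<in> carrier V"
    have "V.lincomb (\<lambda>b. co x b \<oplus>\<^bsub>K\<^esub> co y b) B = x \<oplus>\<^bsub>V\<^esub> y"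
    proof -
      have "V.lincomb (\<lambda>b. co x b \<oplus>\<^bsub>K\<^esub> co y b) B = finsum V (\<lambda>b. co x b \<odot>\<^bsub>V\<^esub> b \<oplus>\<^bsub>V\<^esub> co y b \<odot>\<^bsub>V\<^esub> b) B"
        unfolding V.lincomb_def using BV x y cK by (intro V.finsum_cong') (auto simp: V.smult_l_distr subset_iff)
      also have "\<dots> = V.lincomb (co x) B \<oplus>\<^bsub>V\<^esub> V.lincomb (co y) B"
        unfolding V.lincomb_def using BV x y cK by (intro V.finsum_addf) (auto simp: subset_iff)
      finally show ?thesis using co x y by simp
    qed
    then have "restrict (\<lambda>b. co x b \<oplus>\<^bsub>K\<^esub> co y b) B = co (x \<oplus>\<^bsub>V\<^esub> y)"
      using cou x y cK by (auto intro!: cou)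
    note e = restrict_eqD[OF this]
    have "f (x \<oplus>\<^bsub>V\<^esub> y) = finsum W (\<lambda>b. co x b \<odot>\<^bsub>W\<^esub> g b \<oplus>\<^bsub>W\<^esub> co y b \<odot>\<^bsub>W\<^esub> g b) B"
      unfolding f_def using e gW cK x y by (intro W.finsum_cong') (auto simp: W.smult_l_distr)
    also have "\<dots> = f x \<oplus>\<^bsub>W\<^esub> f y"
      unfolding f_def using gW cK x y by (intro W.finsum_addf) auto
    finally show "f (x \<oplus>\<^bsub>V\<^esub> y) = f x \<oplus>\<^bsub>W\<^esub> f y" .
  next
    fix c x assume c: "c \<in> carrier K" and x: "x \<in> carrier V"
    have "V.lincomb (\<lambda>b. c \<otimes>\<^bsub>K\<^esub> co x b) B = c \<odot>\<^bsub>V\<^esub> x"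
      using V.lincomb_smult[OF BV _ c, of "co x"] co x by auto
    then have "restrict (\<lambda>b. c \<otimes>\<^bsub>K\<^esub> co x b) B = co (c \<odot>\<^bsub>V\<^esub> x)"
      using c x cK by (auto intro!: cou)
    note e = restrict_eqD[OF this]
    have "f (c \<odot>\<^bsub>V\<^esub> x) = finsum W (\<lambda>b. c \<odot>\<^bsub>W\<^esub> (co x b \<odot>\<^bsub>W\<^esub> g b)) B"
      unfolding f_def using e gW cK x c by (intro W.finsum_cong') (auto simp: W.smult_assoc1)
    also have "\<dots> = c \<odot>\<^bsub>W\<^esub> f x"
      unfolding f_def using gW cK x c assms(3) by (intro W.finsum_smult[symmetric]) auto
    finally show "f (c \<odot>\<^bsub>V\<^esub> x) = c \<odot>\<^bsub>W\<^esub> f x" .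
  qed
  moreover have "f b = g b" if b: "b \<in> B" for b
  proof -
    let ?a = "\<lambda>b'. if b' = b then \<one>\<^bsub>K\<^esub> else \<zero>\<^bsub>K\<^esub>"
    have "V.lincomb ?a B = b" unfolding V.lincomb_def using finsum_delta[OF assms(1) _ b assms(3), of "\<lambda>b. b"] BV by auto
    then have "restrict ?a B = co b" using b BV by (intro cou) auto
    note e = restrict_eqD[OF this]
    have "f b = finsum W (\<lambda>b'. ?a b' \<odot>\<^bsub>W\<^esub> g b') B"
      unfolding f_def using e gW by (intro W.finsum_cong') auto
    also have "\<dots> = g b" by (rule finsum_delta[OF assms(2) gW b assms(3)])
    finally show ?thesis .
  qed
  ultimately show ?thesis using that by blast
qed

lemma card_LH:
  assumes V: "VS V" and W: "VS W"
  shows "finite (LH V W)" "card (LH V W) = card (carrier W) ^ vdim V"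
proof -
  obtain B where B: "finite B" "vectorspace.basis K V B" "card B = vdim V" "B \<subseteq> carrier V"
    using basis_ex[OF V] by metis
  have bij: "bij_betw (\<lambda>f. restrict f B) (LH V W) (B \<rightarrow>\<^sub>E carrier W)"
    unfolding bij_betw_def
  proof
    show "inj_on (\<lambda>f. restrict f B) (LH V W)"
    proof (rule inj_onI)
      fix f g assume f: "f \<in> LH V W" and g: "g \<in> LH V W" and e: "restrict f B = restrict g B"
      have "f b = g b" if "b \<in> B" for b using fun_cong[OF e, of b] that by simp
      then have "f x = g x" if "x \<in> carrier V" for x
        using hom_eq_on_basis[of V W f g B x] V W B LH_hom[OF f] LH_hom[OF g] that by simp
      then show "f = g" using f g unfolding LH_def by (auto intro: extensionalityI)
    qed
    show "(\<lambda>f. restrict f B) ` LH V W = (B \<rightarrow>\<^sub>E carrier W)"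
    proof
      show "(\<lambda>f. restrict f B) ` LH V W \<subseteq> (B \<rightarrow>\<^sub>E carrier W)" using B(4) by (auto simp: LH_def module_hom_def)
      show "(B \<rightarrow>\<^sub>E carrier W) \<subseteq> (\<lambda>f. restrict f B) ` LH V W"
      proof
        fix g assume g: "g \<in> B \<rightarrow>\<^sub>E carrier W"
        then have g0: "g \<in> B \<rightarrow> carrier W" by auto
        obtain f where f: "f \<in> module_hom K V W" "\<And>b. b \<in> B \<Longrightarrow> f b = g b"
          using hom_extend_basis[OF V[THEN conjunct1] W[THEN conjunct1] B(1,2) g0] by blast
        have "restrict (restrict f (carrier V)) B = g" using f g B(4) by (intro ext) (auto simp: PiE_def extensional_def)
        then show "g \<in> (\<lambda>f. restrict f B) ` LH V W" using restrict_LH[OF f(1)] V by (metis imageI)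
      qed
    qed
  qed
  show "finite (LH V W)" using bij_betw_finite[OF bij] finite_PiE[OF B(1), of "\<lambda>_. carrier W"] card_VS(1)[OF W] by auto
  show "card (LH V W) = card (carrier W) ^ vdim V"
    using bij_betw_same_card[OF bij] B by (simp add: card_PiE)
qed

text \<open>Steinitz extension: independent sets have at most dim V elements, so a maximal one
  containing a basis of \<open>S\<close> exists. The nested pair of bases produces the exponent dim
  V - dim S in later counts.\<close>

lemma basis_extend:
  assumes V: "VS V" and S: "subspace K S V"
  obtains B C where "finite C" "vectorspace.basis K V C" "card C = vdim V" "C \<subseteq> carrier V"
    "B \<subseteq> C" "vectorspace.basis K (V\<lparr>carrier := S\<rparr>) B" "card B = vdim (V\<lparr>carrier := S\<rparr>)"
proof -
  interpret V: vectorspace K V using V by simp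
  have VSS: "VS (V\<lparr>carrier := S\<rparr>)" by (rule subspace_VS[OF V S])
  interpret S: vectorspace K "V\<lparr>carrier := S\<rparr>" using VSS by simp
  obtain B where B: "finite B" "S.basis B" "card B = vdim (V\<lparr>carrier := S\<rparr>)" "B \<subseteq> S"
    using basis_ex[OF VSS] by auto
  have SV: "S \<subseteq> carrier V" using S by (simp add: subspace_iff)
  have "\<not> V.lin_dep B"
    using B(2) V.span_li_not_depend(2)[of B S] S B(4) SV unfolding S.basis_def by auto
  then have "\<exists>C. finite C \<and> maximal C (\<lambda>C. V.lin_indpt C \<and> C \<subseteq> carrier V \<and> B \<subseteq> C)"
    using V.li_le_dim V B(4) SV by (intro maximal_exists[of _ "V.dim" B]) auto
  then obtain C where C: "finite C" "maximal C (\<lambda>C. V.lin_indpt C \<and> C \<subseteq> carrier V \<and> B \<subseteq> C)" by blast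
  then have "maximal C (\<lambda>S. S \<subseteq> carrier V \<and> V.lin_indpt S)" unfolding maximal_def by blast
  then have "V.basis C" by (rule V.max_li_is_basis)
  then show ?thesis using that[of C B] C B V.dim_basis[of C] unfolding maximal_def by auto
qed

lemma hom_extend_subspace:
  assumes V: "VS V" and W: "vectorspace K W" and S: "subspace K S V"
    and f: "f \<in> module_hom K (V\<lparr>carrier := S\<rparr>) W"
  obtains g where "g \<in> module_hom K V W" "\<And>x. x \<in> S \<Longrightarrow> g x = f x"
proof -
  interpret V: vectorspace K V using V by simp
  interpret W: vectorspace K W by fact
  obtain B C where C: "finite C" "vectorspace.basis K V C" "C \<subseteq> carrier V"
    "B \<subseteq> C" "vectorspace.basis K (V\<lparr>carrier := S\<rparr>) B" using basis_extend[OF V S] by metis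
  have VSS: "VS (V\<lparr>carrier := S\<rparr>)" by (rule subspace_VS[OF V S])
  have BS: "B \<subseteq> S" using C(5) vectorspace.basis_def[of K "V\<lparr>carrier := S\<rparr>" B] VSS by auto
  have SV: "S \<subseteq> carrier V" using S by (simp add: subspace_iff)
  have g0: "(\<lambda>b. if b \<in> B then f b else \<zero>\<^bsub>W\<^esub>) \<in> C \<rightarrow> carrier W"
    using module_homD(1)[OF f] BS by auto
  obtain g where g: "g \<in> module_hom K V W" "\<And>b. b \<in> C \<Longrightarrow> g b = (if b \<in> B then f b else \<zero>\<^bsub>W\<^esub>)"
    using hom_extend_basis[OF V[THEN conjunct1] W C(1,2) g0] by blast
  have gS: "g \<in> module_hom K (V\<lparr>carrier := S\<rparr>) W"
    using SV by (intro module_homI) (simp_all add: module_homD[OF g(1)] subset_iff)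
  have gB: "g b = f b" if "b \<in> B" for b using g(2)[of b] C(4) that by auto
  have "g x = f x" if "x \<in> S" for x
    by (rule hom_eq_on_basis[OF VSS[THEN conjunct1] W gS f finite_subset[OF C(4,1)] C(5) gB]) (use that in auto)
  then show ?thesis using that g(1) by blast
qed

text \<open>The values on the dim V - dim S basis vectors outside \<open>S\<close> determine the
  map. Only an upper bound is claimed: \<open>h\<close> is arbitrary, and if it is not linear on
  \<open>S\<close> there is no such map.\<close>

lemma card_hom_agree_le:
  assumes V: "VS V" and W: "VS W" and S: "subspace K S V"
  shows "card {g \<in> LH V W. \<forall>x\<in>S. g x = h x} \<le> card (carrier W) ^ (vdim V - vdim (V\<lparr>carrier := S\<rparr>))"
proof -
  obtain B C where C: "finite C" "vectorspace.basis K V C" "card C = vdim V" "C \<subseteq> carrier V"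
    "B \<subseteq> C" "vectorspace.basis K (V\<lparr>carrier := S\<rparr>) B" "card B = vdim (V\<lparr>carrier := S\<rparr>)"
    using basis_extend[OF V S] by metis
  have BS: "B \<subseteq> S" using C(6) vectorspace.basis_def[of K "V\<lparr>carrier := S\<rparr>" B] subspace_VS[OF V S] by auto
  let ?G = "{g \<in> LH V W. \<forall>x\<in>S. g x = h x}"
  have inj: "inj_on (\<lambda>f. restrict f (C - B)) ?G"
  proof (rule inj_onI)
    fix f g assume f: "f \<in> ?G" and g: "g \<in> ?G" and e: "restrict f (C - B) = restrict g (C - B)"
    have fg: "f b = g b" if "b \<in> C" for b
      proof (cases "b \<in> B")
      case True then show ?thesis using f g BS by auto
    next
      case False then show ?thesis using fun_cong[OF e, of b] that by simp
    qed
    have "f x = g x" if "x \<in> carrier V" for x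
      using hom_eq_on_basis[of V W f g C x] V W f g C fg that by (auto simp: LH_def)
    then show "f = g" using f g unfolding LH_def by (auto intro: extensionalityI)
  qed
  have "(\<lambda>f. restrict f (C - B)) ` ?G \<subseteq> (C - B) \<rightarrow>\<^sub>E carrier W"
    using C(4) by (auto simp: LH_def module_hom_def split: if_splits)
  then have "card ?G \<le> card ((C - B) \<rightarrow>\<^sub>E carrier W)"
    using card_inj_on_le[OF inj] finite_PiE[of "C - B" "\<lambda>_. carrier W"] C(1) card_VS(1)[OF W] by auto
  also have "\<dots> = card (carrier W) ^ (vdim V - vdim (V\<lparr>carrier := S\<rparr>))"
    using C by (simp add: card_PiE card_Diff_subset finite_subset[OF C(5,1)])
  finally show ?thesis .
qed

text \<open>The lifts of \<open>h\<close> along \<open>p\<close>, if there are any, form a torsor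
  under the maps into ker p; subtracting one lift \<open>g0\<close> and evaluating on a basis gives
  the bound.\<close>

lemma card_hom_lift_le:
  assumes V: "VS V" and W: "VS W" and U: "VS U" and p: "p \<in> module_hom K W U"
  shows "card {g \<in> LH V W. \<forall>x\<in>carrier V. p (g x) = h x} \<le>
    card {w \<in> carrier W. p w = \<zero>\<^bsub>U\<^esub>} ^ vdim V"
proof -
  interpret W: vectorspace K W using W by simp
  interpret U: vectorspace K U using U by simp
  obtain C where C: "finite C" "vectorspace.basis K V C" "card C = vdim V" "C \<subseteq> carrier V"
    using basis_ex[OF V] by metis
  let ?G = "{g \<in> LH V W. \<forall>x\<in>carrier V. p (g x) = h x}"
  let ?N = "{w \<in> carrier W. p w = \<zero>\<^bsub>U\<^esub>}"
  have finW: "finite (carrier W)" using card_VS(1)[OF W] .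
  show ?thesis
  proof (cases "?G = {}")
    case False
    then obtain g0 where g0: "g0 \<in> ?G" by auto
    have g0h: "g0 \<in> module_hom K V W" using g0 by (auto simp: LH_def)
    have inj: "inj_on (\<lambda>f. \<lambda>b\<in>C. f b \<ominus>\<^bsub>W\<^esub> g0 b) ?G"
    proof (rule inj_onI)
      fix f g assume f: "f \<in> ?G" and g: "g \<in> ?G" and e: "(\<lambda>b\<in>C. f b \<ominus>\<^bsub>W\<^esub> g0 b) = (\<lambda>b\<in>C. g b \<ominus>\<^bsub>W\<^esub> g0 b)"
      have fh: "f \<in> module_hom K V W" "g \<in> module_hom K V W" using f g by (auto simp: LH_def)
      have fg: "f b = g b" if b: "b \<in> C" for b
      proof -
        have "f b \<ominus>\<^bsub>W\<^esub> g0 b = g b \<ominus>\<^bsub>W\<^esub> g0 b" using fun_cong[OF e, of b] b by simp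
        moreover have "f b \<in> carrier W" "g b \<in> carrier W" "g0 b \<in> carrier W"
          using fh g0h b C(4) by (auto dest: module_homD(1))
        ultimately show ?thesis unfolding a_minus_def by (simp add: W.a_inv_closed)
      qed
      have "f x = g x" if "x \<in> carrier V" for x
        using hom_eq_on_basis[of V W f g C x] V W fh C fg that by auto
      then show "f = g" using f g unfolding LH_def by (auto intro: extensionalityI)
    qed
    have "(\<lambda>f. \<lambda>b\<in>C. f b \<ominus>\<^bsub>W\<^esub> g0 b) ` ?G \<subseteq> C \<rightarrow>\<^sub>E ?N"
    proof (clarsimp)
      fix f b assume f: "f \<in> LH V W" "\<forall>x\<in>carrier V. p (f x) = h x" and b: "b \<in> C"
      have bV: "b \<in> carrier V" using b C(4) by auto
      have cc: "f b \<in> carrier W" "g0 b \<in> carrier W" using f g0h bV by (auto simp: LH_def dest: module_homD(1))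
      have "p (f b \<ominus>\<^bsub>W\<^esub> g0 b) = p (f b) \<ominus>\<^bsub>U\<^esub> p (g0 b)"
        using module_hom_minus(1)[of W U p "f b" "g0 b"] W U p cc by auto
      also have "\<dots> = \<zero>\<^bsub>U\<^esub>"
        using f g0 bV module_homD(1)[OF p cc(2)] by (simp add: a_minus_def U.r_neg)
      finally show "f b \<ominus>\<^bsub>W\<^esub> g0 b \<in> carrier W \<and> p (f b \<ominus>\<^bsub>W\<^esub> g0 b) = \<zero>\<^bsub>U\<^esub>" using cc by simp
    qed
    then have "card ?G \<le> card (C \<rightarrow>\<^sub>E ?N)"
      using card_inj_on_le[OF inj] finite_PiE[of "C" "\<lambda>_. ?N"] C(1) finW by auto
    then show ?thesis using C by (simp add: card_PiE)
  next
    case True then show ?thesis by (metis card.empty zero_le)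
  qed
qed

section \<open>Cosets and quotient spaces\<close>

lemma subspace_additive:
  assumes "subspace K W V"
  shows "abelian_subgroup W V"
proof -
  interpret V: vectorspace K V using assms by (simp add: subspace_iff)
  have "subgroup W (add_monoid V)"
    using assms subspace_minus(2)[OF assms]
    by (intro subgroup.intro) (auto simp: subspace_iff a_inv_def[symmetric])
  then show ?thesis
    by (intro abelian_subgroupI3 additive_subgroupI V.abelian_group_axioms)
qed

lemma mem_coset:
  assumes "subspace K W V" "x \<in> carrier V"
  shows "z \<in> W +>\<^bsub>V\<^esub> x \<longleftrightarrow> z \<in> carrier V \<and> z \<ominus>\<^bsub>V\<^esub> x \<in> W"
proof -
  interpret V: vectorspace K V using assms by (simp add: subspace_iff)
  have WV: "W \<subseteq> carrier V" using assms by (simp add: subspace_iff)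
  show ?thesis
  proof
    assume "z \<in> W +>\<^bsub>V\<^esub> x"
    then obtain w where w: "w \<in> W" "z = w \<oplus>\<^bsub>V\<^esub> x" unfolding a_r_coset_def' by auto
    then have "z \<ominus>\<^bsub>V\<^esub> x = w" using assms WV by (simp add: a_minus_def V.a_assoc V.r_neg subset_iff)
    then show "z \<in> carrier V \<and> z \<ominus>\<^bsub>V\<^esub> x \<in> W" using w WV assms by auto
  next
    assume z: "z \<in> carrier V \<and> z \<ominus>\<^bsub>V\<^esub> x \<in> W"
    then have "z = (z \<ominus>\<^bsub>V\<^esub> x) \<oplus>\<^bsub>V\<^esub> x" using assms by (simp add: a_minus_def V.a_assoc V.l_neg)
    then show "z \<in> W +>\<^bsub>V\<^esub> x" unfolding a_r_coset_def' using z by auto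
  qed
qed

lemma coset_eq_iff:
  assumes "subspace K W V" "x \<in> carrier V" "y \<in> carrier V"
  shows "W +>\<^bsub>V\<^esub> x = W +>\<^bsub>V\<^esub> y \<longleftrightarrow> x \<ominus>\<^bsub>V\<^esub> y \<in> W"
proof -
  interpret V: vectorspace K V using assms by (simp add: subspace_iff)
  note sW = subspace_additive[OF assms(1)]
  show ?thesis
  proof
    assume "W +>\<^bsub>V\<^esub> x = W +>\<^bsub>V\<^esub> y"
    then show "x \<ominus>\<^bsub>V\<^esub> y \<in> W" using abelian_subgroup.a_rcos_self[OF sW assms(2)] mem_coset[OF assms(1,3)] by auto
  next
    assume "x \<ominus>\<^bsub>V\<^esub> y \<in> W"
    then have "x \<in> W +>\<^bsub>V\<^esub> y" using mem_coset[OF assms(1,3)] assms by auto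
    then show "W +>\<^bsub>V\<^esub> x = W +>\<^bsub>V\<^esub> y"
      using abelian_subgroup.a_repr_independence'[OF sW, of x y] assms by auto
  qed
qed

text \<open>The axioms of a vector space descend along any surjection that respects the operations.
  One proof serves both the quotient by a subspace and the copy of a space on natural
  numbers.\<close>

lemma vectorspace_image:
  assumes V: "VS V" and c: "carrier W = p ` carrier V" and z: "\<zero>\<^bsub>W\<^esub> = p \<zero>\<^bsub>V\<^esub>"
    and add: "\<And>x y. x \<in> carrier V \<Longrightarrow> y \<in> carrier V \<Longrightarrow> p x \<oplus>\<^bsub>W\<^esub> p y = p (x \<oplus>\<^bsub>V\<^esub> y)"
    and sm: "\<And>c x. c \<in> carrier K \<Longrightarrow> x \<in> carrier V \<Longrightarrow> c \<odot>\<^bsub>W\<^esub> p x = p (c \<odot>\<^bsub>V\<^esub> x)"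
  shows "VS W" "p \<in> module_hom K V W"
proof -
  interpret V: vectorspace K V using V by simp
  have cl: "p x \<in> carrier W" if "x \<in> carrier V" for x using that c by blast
  have ex: "\<exists>x\<in>carrier V. y = p x" if "y \<in> carrier W" for y using that c by blast
  have "vectorspace K W"
  proof (rule vs_criteria[OF field_K])
    show "\<forall>v\<in>carrier W. \<exists>neg_v\<in>carrier W. v \<oplus>\<^bsub>W\<^esub> neg_v = \<zero>\<^bsub>W\<^esub>"
    proof (clarsimp simp: c)
      fix x assume x: "x \<in> carrier V"
      then have "p x \<oplus>\<^bsub>W\<^esub> p (\<ominus>\<^bsub>V\<^esub> x) = \<zero>\<^bsub>W\<^esub>" by (simp add: add z V.r_neg)
      then show "\<exists>y\<in>carrier V. p x \<oplus>\<^bsub>W\<^esub> p y = \<zero>\<^bsub>W\<^esub>" using x by auto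
    qed
    show "\<zero>\<^bsub>W\<^esub> \<in> carrier W" unfolding z by (rule cl) simp
    show "\<forall>v w. v \<in> carrier W \<and> w \<in> carrier W \<longrightarrow> v \<oplus>\<^bsub>W\<^esub> w \<in> carrier W"
      using ex by (metis add cl V.add.m_closed)
    show "\<forall>c v. c \<in> carrier K \<and> v \<in> carrier W \<longrightarrow> c \<odot>\<^bsub>W\<^esub> v \<in> carrier W"
      using ex by (metis sm cl V.smult_closed)
    show "\<forall>v w. v \<in> carrier W \<and> w \<in> carrier W \<longrightarrow> v \<oplus>\<^bsub>W\<^esub> w = w \<oplus>\<^bsub>W\<^esub> v"
      using ex by (metis add V.a_comm)
    show "\<forall>v w x. v \<in> carrier W \<and> w \<in> carrier W \<and> x \<in> carrier W \<longrightarrow>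
        v \<oplus>\<^bsub>W\<^esub> w \<oplus>\<^bsub>W\<^esub> x = v \<oplus>\<^bsub>W\<^esub> (w \<oplus>\<^bsub>W\<^esub> x)"
      using ex by (metis add V.a_assoc V.add.m_closed)
    show "\<forall>v\<in>carrier W. v \<oplus>\<^bsub>W\<^esub> \<zero>\<^bsub>W\<^esub> = v"
      using ex by (metis add z V.r_zero V.zero_closed)
    show "\<forall>a b v. a \<in> carrier K \<and> b \<in> carrier K \<and> v \<in> carrier W \<longrightarrow>
        (a \<otimes>\<^bsub>K\<^esub> b) \<odot>\<^bsub>W\<^esub> v = a \<odot>\<^bsub>W\<^esub> (b \<odot>\<^bsub>W\<^esub> v)"
    proof (intro allI impI)
      fix a b v assume "a \<in> carrier K \<and> b \<in> carrier K \<and> v \<in> carrier W"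
      then show "(a \<otimes>\<^bsub>K\<^esub> b) \<odot>\<^bsub>W\<^esub> v = a \<odot>\<^bsub>W\<^esub> (b \<odot>\<^bsub>W\<^esub> v)"
        using ex[of v] V.smult_assoc1[of a b] sm by (metis V.smult_closed V.m_closed)
    qed
    show "\<forall>v\<in>carrier W. \<one>\<^bsub>K\<^esub> \<odot>\<^bsub>W\<^esub> v = v"
      using ex by (metis sm V.smult_one V.one_closed)
    show "\<forall>a b v. a \<in> carrier K \<and> b \<in> carrier K \<and> v \<in> carrier W \<longrightarrow>
        (a \<oplus>\<^bsub>K\<^esub> b) \<odot>\<^bsub>W\<^esub> v = a \<odot>\<^bsub>W\<^esub> v \<oplus>\<^bsub>W\<^esub> b \<odot>\<^bsub>W\<^esub> v"
    proof (intro allI impI)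
      fix a b v assume ab: "a \<in> carrier K \<and> b \<in> carrier K \<and> v \<in> carrier W"
      then obtain x where x: "x \<in> carrier V" "v = p x" using ex by blast
      show "(a \<oplus>\<^bsub>K\<^esub> b) \<odot>\<^bsub>W\<^esub> v = a \<odot>\<^bsub>W\<^esub> v \<oplus>\<^bsub>W\<^esub> b \<odot>\<^bsub>W\<^esub> v"
        using ab x by (simp add: sm add V.smult_l_distr)
    qed
    show "\<forall>a v w. a \<in> carrier K \<and> v \<in> carrier W \<and> w \<in> carrier W \<longrightarrow>
        a \<odot>\<^bsub>W\<^esub> (v \<oplus>\<^bsub>W\<^esub> w) = a \<odot>\<^bsub>W\<^esub> v \<oplus>\<^bsub>W\<^esub> a \<odot>\<^bsub>W\<^esub> w"
    proof (intro allI impI)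
      fix a v w assume ab: "a \<in> carrier K \<and> v \<in> carrier W \<and> w \<in> carrier W"
      then obtain x y where x: "x \<in> carrier V" "v = p x" "y \<in> carrier V" "w = p y" using ex by metis
      show "a \<odot>\<^bsub>W\<^esub> (v \<oplus>\<^bsub>W\<^esub> w) = a \<odot>\<^bsub>W\<^esub> v \<oplus>\<^bsub>W\<^esub> a \<odot>\<^bsub>W\<^esub> w"
        using ab x by (simp add: sm add V.smult_r_distr)
    qed
  qed
  then show "VS W" using fin_dimI[of W] c card_VS(1)[OF V] by auto
  show "p \<in> module_hom K V W" by (rule module_homI) (simp_all add: cl add sm)
qed

lemma quotient_space:
  assumes V: "VS V" and W: "subspace K W V"
  shows "VS (quotient_space V W)" "(\<lambda>x. W +>\<^bsub>V\<^esub> x) \<in> module_hom K V (quotient_space V W)"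
    "carrier (quotient_space V W) = (\<lambda>x. W +>\<^bsub>V\<^esub> x) ` carrier V"
proof -
  interpret V: vectorspace K V using V by simp
  note sW = subspace_additive[OF W]
  show 1: "carrier (quotient_space V W) = (\<lambda>x. W +>\<^bsub>V\<^esub> x) ` carrier V"
    by (auto simp: quotient_space_def A_RCOSETS_def')
  \<comment> \<open>Scalar multiplication of cosets is written as a union over the coset; all its
    members are the same coset, so the union collapses.\<close>
  have 2: "c \<odot>\<^bsub>quotient_space V W\<^esub> (W +>\<^bsub>V\<^esub> x) = W +>\<^bsub>V\<^esub> (c \<odot>\<^bsub>V\<^esub> x)"
    if c: "c \<in> carrier K" and x: "x \<in> carrier V" for c x
  proof -
    have "W +>\<^bsub>V\<^esub> (c \<odot>\<^bsub>V\<^esub> y) = W +>\<^bsub>V\<^esub> (c \<odot>\<^bsub>V\<^esub> x)" if "y \<in> W +>\<^bsub>V\<^esub> x" for y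
    proof -
      have y: "y \<in> carrier V" "y \<ominus>\<^bsub>V\<^esub> x \<in> W" using that mem_coset[OF W x] by auto
      have "c \<odot>\<^bsub>V\<^esub> (y \<ominus>\<^bsub>V\<^esub> x) \<in> W" using W y c by (simp add: subspace_iff)
      moreover have "c \<odot>\<^bsub>V\<^esub> (y \<ominus>\<^bsub>V\<^esub> x) = c \<odot>\<^bsub>V\<^esub> y \<ominus>\<^bsub>V\<^esub> c \<odot>\<^bsub>V\<^esub> x"
        using c x y by (simp add: a_minus_def V.smult_r_distr V.smult_r_minus)
      ultimately show ?thesis using coset_eq_iff[OF W, of "c \<odot>\<^bsub>V\<^esub> y" "c \<odot>\<^bsub>V\<^esub> x"] c x y by simp
    qed
    moreover have "x \<in> W +>\<^bsub>V\<^esub> x" using abelian_subgroup.a_rcos_self[OF sW x] .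
    ultimately have "(\<Union>y\<in>W +>\<^bsub>V\<^esub> x. W +>\<^bsub>V\<^esub> (c \<odot>\<^bsub>V\<^esub> y)) = W +>\<^bsub>V\<^esub> (c \<odot>\<^bsub>V\<^esub> x)" by blast
    then show ?thesis by (simp add: quotient_space_def)
  qed
  have 3: "(W +>\<^bsub>V\<^esub> x) \<oplus>\<^bsub>quotient_space V W\<^esub> (W +>\<^bsub>V\<^esub> y) = W +>\<^bsub>V\<^esub> (x \<oplus>\<^bsub>V\<^esub> y)"
    if "x \<in> carrier V" "y \<in> carrier V" for x y
    using abelian_subgroup.a_rcos_sum[OF sW that] by (simp add: quotient_space_def)
  have 4: "\<zero>\<^bsub>quotient_space V W\<^esub> = W +>\<^bsub>V\<^esub> \<zero>\<^bsub>V\<^esub>"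
  proof -
    have "x \<in> W +>\<^bsub>V\<^esub> \<zero>\<^bsub>V\<^esub> \<longleftrightarrow> x \<in> W" for x
    proof -
      have "x \<in> carrier V \<Longrightarrow> x \<ominus>\<^bsub>V\<^esub> \<zero>\<^bsub>V\<^esub> = x" by (simp add: a_minus_def)
      moreover have "W \<subseteq> carrier V" using W by (simp add: subspace_iff)
      ultimately show ?thesis using mem_coset[OF W V.zero_closed, of x] by (metis subsetD)
    qed
    then have "W +>\<^bsub>V\<^esub> \<zero>\<^bsub>V\<^esub> = W" by blast
    then show ?thesis by (simp add: quotient_space_def)
  qed
  note vi = vectorspace_image[where p = "\<lambda>x. W +>\<^bsub>V\<^esub> x" and V = V and W = "quotient_space V W", OF V 1 4]
  show "VS (quotient_space V W)"
  proof (rule vi(1))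
    fix x y assume "x \<in> carrier V" "y \<in> carrier V"
    then show "(W +>\<^bsub>V\<^esub> x) \<oplus>\<^bsub>quotient_space V W\<^esub> (W +>\<^bsub>V\<^esub> y) = W +>\<^bsub>V\<^esub> (x \<oplus>\<^bsub>V\<^esub> y)"
      by (fact 3)
  next
    fix c x assume "c \<in> carrier K" "x \<in> carrier V"
    then show "c \<odot>\<^bsub>quotient_space V W\<^esub> (W +>\<^bsub>V\<^esub> x) = W +>\<^bsub>V\<^esub> (c \<odot>\<^bsub>V\<^esub> x)" by (fact 2)
  qed
  show "(\<lambda>x. W +>\<^bsub>V\<^esub> x) \<in> module_hom K V (quotient_space V W)"
  proof (rule vi(2))
    fix x y assume "x \<in> carrier V" "y \<in> carrier V"
    then show "(W +>\<^bsub>V\<^esub> x) \<oplus>\<^bsub>quotient_space V W\<^esub> (W +>\<^bsub>V\<^esub> y) = W +>\<^bsub>V\<^esub> (x \<oplus>\<^bsub>V\<^esub> y)"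
      by (fact 3)
  next
    fix c x assume "c \<in> carrier K" "x \<in> carrier V"
    then show "c \<odot>\<^bsub>quotient_space V W\<^esub> (W +>\<^bsub>V\<^esub> x) = W +>\<^bsub>V\<^esub> (c \<odot>\<^bsub>V\<^esub> x)" by (fact 2)
  qed
qed

section \<open>Sums, images and preimages of subspaces; rank and nullity\<close>

lemma subspace_inter:
  "subspace K S V \<Longrightarrow> subspace K T V \<Longrightarrow> subspace K (S \<inter> T) V"
  by (auto simp: subspace_iff)

lemma subspace_set_add:
  assumes "subspace K S V" "subspace K T V"
  shows "subspace K (S <+>\<^bsub>V\<^esub> T) V"
proof -
  interpret V: vectorspace K V using assms by (simp add: subspace_iff)
  have "S <+>\<^bsub>V\<^esub> T = V.subspace_sum S T"
    by (auto simp: set_add_def' V.submodule_sum_def)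
  then show ?thesis using V.sum_is_subspace[OF assms] by simp
qed

lemma subspace_hom_image:
  assumes "vectorspace K V" "vectorspace K W" "f \<in> module_hom K V W" "subspace K S V"
  shows "subspace K (f ` S) W"
proof -
  have SV: "S \<subseteq> carrier V" using assms by (simp add: subspace_iff)
  show ?thesis unfolding subspace_iff
  proof (intro conjI ballI)
    show "f ` S \<subseteq> carrier W" using SV module_homD(1)[OF assms(3)] by auto
    have "\<zero>\<^bsub>V\<^esub> \<in> S" using assms by (simp add: subspace_iff)
    then show "\<zero>\<^bsub>W\<^esub> \<in> f ` S" using module_hom_zero[OF assms(1-3)] by (metis imageI)
  next
    fix x y assume "x \<in> f ` S" "y \<in> f ` S"
    then obtain a b where ab: "a \<in> S" "x = f a" "b \<in> S" "y = f b" by auto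
    then have "x \<oplus>\<^bsub>W\<^esub> y = f (a \<oplus>\<^bsub>V\<^esub> b)" using SV module_homD(2)[OF assms(3), of a b] by (simp add: subset_iff)
    then show "x \<oplus>\<^bsub>W\<^esub> y \<in> f ` S" using ab assms(4) by (auto simp: subspace_iff)
  next
    fix c x assume c: "c \<in> carrier K" "x \<in> f ` S"
    then obtain a where a: "a \<in> S" "x = f a" by auto
    then have "c \<odot>\<^bsub>W\<^esub> x = f (c \<odot>\<^bsub>V\<^esub> a)" using SV c module_homD(3)[OF assms(3), of c a] by (simp add: subset_iff)
    then show "c \<odot>\<^bsub>W\<^esub> x \<in> f ` S" using a c assms(4) by (auto simp: subspace_iff)
  qed fact
qed

lemma subspace_hom_vimage:
  assumes "vectorspace K V" "vectorspace K W" "f \<in> module_hom K V W" "subspace K T W"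
  shows "subspace K {x \<in> carrier V. f x \<in> T} V"
proof -
  interpret V: vectorspace K V by fact
  show ?thesis using assms(1,4) module_hom_zero[OF assms(1-3)]
    by (auto simp: subspace_iff module_homD[OF assms(3)])
qed

lemma subspace_zero: "vectorspace K V \<Longrightarrow> subspace K {\<zero>\<^bsub>V\<^esub>} V"
proof -
  assume V: "vectorspace K V"
  interpret V: vectorspace K V by fact
  show ?thesis using V by (auto simp: subspace_iff)
qed

lemma subspace_full: "vectorspace K V \<Longrightarrow> subspace K (carrier V) V"
proof -
  assume V: "vectorspace K V"
  interpret V: vectorspace K V by fact
  show ?thesis using V by (auto simp: subspace_iff)
qed

lemma hom_inj_iff:
  assumes "vectorspace K V" "vectorspace K W" "f \<in> module_hom K V W"
  shows "inj_on f (carrier V) \<longleftrightarrow> (\<forall>x\<in>carrier V. f x = \<zero>\<^bsub>W\<^esub> \<longrightarrow> x = \<zero>\<^bsub>V\<^esub>)"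
proof -
  interpret V: vectorspace K V by fact
  interpret W: vectorspace K W by fact
  note z = module_hom_zero[OF assms]
  show ?thesis
  proof
    assume "inj_on f (carrier V)"
    then show "\<forall>x\<in>carrier V. f x = \<zero>\<^bsub>W\<^esub> \<longrightarrow> x = \<zero>\<^bsub>V\<^esub>" using z V.zero_closed unfolding inj_on_def by metis
  next
    assume *: "\<forall>x\<in>carrier V. f x = \<zero>\<^bsub>W\<^esub> \<longrightarrow> x = \<zero>\<^bsub>V\<^esub>"
    show "inj_on f (carrier V)"
    proof (rule inj_onI)
      fix x y assume xy: "x \<in> carrier V" "y \<in> carrier V" "f x = f y"
      have "f (x \<ominus>\<^bsub>V\<^esub> y) = f y \<ominus>\<^bsub>W\<^esub> f y" using module_hom_minus(1)[OF assms xy(1,2)] xy(3) by simp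
      also have "\<dots> = \<zero>\<^bsub>W\<^esub>" using module_homD(1)[OF assms(3) xy(2)] by (simp add: a_minus_def W.r_neg)
      finally have "x \<ominus>\<^bsub>V\<^esub> y = \<zero>\<^bsub>V\<^esub>" using * xy by auto
      then have "(x \<ominus>\<^bsub>V\<^esub> y) \<oplus>\<^bsub>V\<^esub> y = y" using xy by simp
      then show "x = y" using xy by (simp add: a_minus_def V.a_assoc V.l_neg)
    qed
  qed
qed

lemma dim_ker_im:
  assumes "VS V" "VS W" "f \<in> module_hom K V W"
  shows "vdim V = vdim (V\<lparr>carrier := {x \<in> carrier V. f x = \<zero>\<^bsub>W\<^esub>}\<rparr>) + vdim (W\<lparr>carrier := f ` carrier V\<rparr>)"
proof -
  interpret linear_map K V W f using mod_hom_of assms by blast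
  show ?thesis using rank_nullity assms(1) unfolding im_def ker_def by simp
qed

lemma VS_dim_eqI:
  assumes "VS V" "VS W" "card (carrier V) = card (carrier W)"
  shows "vdim V = vdim W"
  using card_VS(2)[OF assms(1)] card_VS(2)[OF assms(2)] assms(3) q_ge_2 power_inject_exp[of q] by simp

lemma subspace_sub:
  assumes "subspace K S V"
  shows "subspace K T (V\<lparr>carrier := S\<rparr>) \<longleftrightarrow> subspace K T V \<and> T \<subseteq> S"
proof -
  have "vectorspace K (V\<lparr>carrier := S\<rparr>)"
    using vectorspace.subspace_is_vs[of K V S] assms by (auto simp: subspace_iff)
  then show ?thesis using assms by (auto simp: subspace_iff)
qed

lemma set_add_mem: "x \<in> S <+>\<^bsub>V\<^esub> T \<longleftrightarrow> (\<exists>s\<in>S. \<exists>t\<in>T. x = s \<oplus>\<^bsub>V\<^esub> t)"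
  by (auto simp: set_add_def')

end

section \<open>Representations and subrepresentations\<close>

locale quiver_reps = finite_field K for K :: "('k, 'e) ring_scheme" +
  fixes Q :: "('v, 'a) pre_digraph"
  assumes fin_Q: "fin_digraph Q"
begin

abbreviation I :: "'v set" where "I \<equiv> verts Q"
abbreviation rep :: "('v, 'a, 'k, 'm) quiver_rep \<Rightarrow> bool" where "rep M \<equiv> representation Q K M"
abbreviation subs :: "('v, 'a, 'k, 'm) quiver_rep \<Rightarrow> ('v \<Rightarrow> 'm set) set" where "subs M \<equiv> subreps Q K M"
abbreviation Hom :: "('v, 'a, 'k, 'm) quiver_rep \<Rightarrow> ('v, 'a, 'k, 'n) quiver_rep \<Rightarrow> ('v \<Rightarrow> 'm \<Rightarrow> 'n) set"
  where "Hom M N \<equiv> rep_hom Q K M N"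
abbreviation dv :: "('v, 'a, 'k, 'm) quiver_rep \<Rightarrow> 'v \<Rightarrow> nat" where "dv M \<equiv> dim_vector Q K M"
abbreviation car :: "('v, 'a, 'k, 'm) quiver_rep \<Rightarrow> 'v \<Rightarrow> 'm set" where "car M v \<equiv> carrier (space M v)"
abbreviation zer :: "('v, 'a, 'k, 'm) quiver_rep \<Rightarrow> 'v \<Rightarrow> 'm" where "zer M v \<equiv> \<zero>\<^bsub>space M v\<^esub>"
abbreviation iso :: "('v, 'a, 'k, 'm) quiver_rep \<Rightarrow> ('v, 'a, 'k, 'n) quiver_rep \<Rightarrow> bool" (infix "\<approx>" 50)
  where "M \<approx> N \<equiv> isomorphic Q K M N"
abbreviation quot :: "('v, 'a, 'k, 'm) quiver_rep \<Rightarrow> ('v \<Rightarrow> 'm set) \<Rightarrow> ('v, 'a, 'k, 'm set) quiver_rep"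
  where "quot M X \<equiv> quotient_rep Q M X"

lemma finite_I [simp]: "finite I" and finite_arcs [simp]: "finite (arcs Q)"
  using fin_Q by (auto simp: fin_digraph_def fin_digraph_axioms_def)

lemma tail_I [simp]: "a \<in> arcs Q \<Longrightarrow> tail Q a \<in> I" and head_I [simp]: "a \<in> arcs Q \<Longrightarrow> head Q a \<in> I"
  using fin_Q by (auto simp: fin_digraph_def wf_digraph_def)

lemma repD:
  assumes "rep M"
  shows "v \<in> I \<Longrightarrow> VS (space M v)" "v \<in> I \<Longrightarrow> vectorspace K (space M v)"
    "a \<in> arcs Q \<Longrightarrow> arrow_map M a \<in> module_hom K (space M (tail Q a)) (space M (head Q a))"
  using assms by (auto simp: representation_def linear_map_def mod_hom_def mod_hom_axioms_def)

lemma repI: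
  assumes "\<And>v. v \<in> I \<Longrightarrow> VS (space M v)"
    and "\<And>a. a \<in> arcs Q \<Longrightarrow> arrow_map M a \<in> module_hom K (space M (tail Q a)) (space M (head Q a))"
  shows "rep M"
  unfolding representation_def
proof (intro conjI ballI)
  fix a assume a: "a \<in> arcs Q"
  show "linear_map K (space M (tail Q a)) (space M (head Q a)) (arrow_map M a)"
    by (rule mod_hom_of) (use assms(1)[OF tail_I[OF a]] assms(1)[OF head_I[OF a]] assms(2)[OF a] in blast)+
qed (use assms(1) in blast)+

lemma arrow_closed: "rep M \<Longrightarrow> a \<in> arcs Q \<Longrightarrow> x \<in> car M (tail Q a) \<Longrightarrow> arrow_map M a x \<in> car M (head Q a)"
  by (rule module_homD(1)[OF repD(3)])

lemma zer_closed: "rep M \<Longrightarrow> v \<in> I \<Longrightarrow> zer M v \<in> car M v"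
  using repD(2)[of M v] subspace_full[of "space M v"] by (simp add: subspace_iff)

lemma finite_car: "rep M \<Longrightarrow> v \<in> I \<Longrightarrow> finite (car M v)"
  using repD(1) card_VS(1) by blast

lemma card_car: "rep M \<Longrightarrow> v \<in> I \<Longrightarrow> card (car M v) = q ^ dv M v"
  using repD(1)[of M v] card_VS(2)[of "space M v"] by (simp add: dim_vector_def)

lemma subsD:
  assumes "X \<in> subs M"
  shows "X \<in> extensional I" "v \<in> I \<Longrightarrow> subspace K (X v) (space M v)" "v \<in> I \<Longrightarrow> X v \<subseteq> car M v"
    "v \<in> I \<Longrightarrow> zer M v \<in> X v" "a \<in> arcs Q \<Longrightarrow> x \<in> X (tail Q a) \<Longrightarrow> arrow_map M a x \<in> X (head Q a)"
proof -
  show 1: "X \<in> extensional I" "v \<in> I \<Longrightarrow> subspace K (X v) (space M v)"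
    using assms by (auto simp: subreps_def)
  then show "v \<in> I \<Longrightarrow> X v \<subseteq> car M v" "v \<in> I \<Longrightarrow> zer M v \<in> X v" by (simp_all add: subspace_iff)
  show "a \<in> arcs Q \<Longrightarrow> x \<in> X (tail Q a) \<Longrightarrow> arrow_map M a x \<in> X (head Q a)"
    using assms unfolding subreps_def by blast
qed

lemma subs_mem: "X \<in> subs M \<Longrightarrow> v \<in> I \<Longrightarrow> x \<in> X v \<Longrightarrow> x \<in> car M v"
  using subsD(3) by blast

lemma subsI:
  assumes "X \<in> extensional I" "\<And>v. v \<in> I \<Longrightarrow> subspace K (X v) (space M v)"
    "\<And>a x. a \<in> arcs Q \<Longrightarrow> x \<in> X (tail Q a) \<Longrightarrow> arrow_map M a x \<in> X (head Q a)"
  shows "X \<in> subs M"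
  using assms by (auto simp: subreps_def)

lemma sub_rep_simps [simp]:
  "space (sub_rep M X) v = (space M v)\<lparr>carrier := X v\<rparr>" "arrow_map (sub_rep M X) = arrow_map M"
  by (simp_all add: sub_rep_def)

lemma rep_sub_rep:
  assumes "rep M" "X \<in> subs M"
  shows "rep (sub_rep M X)"
proof (rule repI)
  fix v assume "v \<in> I"
  then show "VS (space (sub_rep M X) v)"
    using subspace_VS[OF repD(1)[OF assms(1)] subsD(2)[OF assms(2)], of v] by simp
next
  fix a assume a: "a \<in> arcs Q"
  have "X (tail Q a) \<subseteq> car M (tail Q a)" using subsD(3)[OF assms(2)] a by simp
  then show "arrow_map (sub_rep M X) a \<in> module_hom K (space (sub_rep M X) (tail Q a)) (space (sub_rep M X) (head Q a))"
    using subsD(5)[OF assms(2) a] by (intro module_homI) (simp_all add: module_homD[OF repD(3)[OF assms(1) a]] subset_iff)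
qed

lemma sub_sub_rep [simp]: "sub_rep (sub_rep M X) Y = sub_rep M Y"
  by (simp add: sub_rep_def)

lemma subs_le_iff: "X \<in> subs M \<Longrightarrow> Y \<in> subs M \<Longrightarrow> X \<le> Y \<longleftrightarrow> (\<forall>v\<in>I. X v \<subseteq> Y v)"
  by (auto simp: le_fun_def subreps_def extensional_def)

lemma subs_eqI: "X \<in> subs M \<Longrightarrow> Y \<in> subs N \<Longrightarrow> (\<And>v. v \<in> I \<Longrightarrow> X v = Y v) \<Longrightarrow> X = Y"
  by (auto simp: subreps_def intro: extensionalityI)

lemma subs_sub_rep:
  assumes "rep M" "X \<in> subs M"
  shows "subs (sub_rep M X) = {Y \<in> subs M. Y \<le> X}"
proof -
  have "\<And>v Y. v \<in> I \<Longrightarrow> subspace K (Y v) (space (sub_rep M X) v) \<longleftrightarrow> subspace K (Y v) (space M v) \<and> Y v \<subseteq> X v"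
    using subspace_sub[OF subsD(2)[OF assms(2)]] by simp
  moreover have "\<And>Y. Y \<in> extensional I \<Longrightarrow> Y \<le> X \<longleftrightarrow> (\<forall>v\<in>I. Y v \<subseteq> X v)"
    using subsD(1)[OF assms(2)] by (auto simp: le_fun_def extensional_def)
  ultimately show ?thesis unfolding subreps_def by (auto; blast)
qed

section \<open>The lattice of subrepresentations, images and kernels\<close>

definition zero_sub :: "('v, 'a, 'k, 'm) quiver_rep \<Rightarrow> 'v \<Rightarrow> 'm set" where
  "zero_sub M = (\<lambda>v\<in>I. {zer M v})"
definition full_sub :: "('v, 'a, 'k, 'm) quiver_rep \<Rightarrow> 'v \<Rightarrow> 'm set" where
  "full_sub M = (\<lambda>v\<in>I. car M v)"
definition inter_sub :: "('v \<Rightarrow> 'm set) \<Rightarrow> ('v \<Rightarrow> 'm set) \<Rightarrow> 'v \<Rightarrow> 'm set" where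
  "inter_sub X Y = (\<lambda>v\<in>I. X v \<inter> Y v)"
definition sum_sub :: "('v, 'a, 'k, 'm) quiver_rep \<Rightarrow> ('v \<Rightarrow> 'm set) \<Rightarrow> ('v \<Rightarrow> 'm set) \<Rightarrow> 'v \<Rightarrow> 'm set" where
  "sum_sub M X Y = (\<lambda>v\<in>I. X v <+>\<^bsub>space M v\<^esub> Y v)"
definition im_sub :: "('v \<Rightarrow> 'm \<Rightarrow> 'n) \<Rightarrow> ('v \<Rightarrow> 'm set) \<Rightarrow> 'v \<Rightarrow> 'n set" where
  "im_sub \<phi> X = (\<lambda>v\<in>I. \<phi> v ` X v)"
definition vim_sub :: "('v, 'a, 'k, 'm) quiver_rep \<Rightarrow> ('v \<Rightarrow> 'm \<Rightarrow> 'n) \<Rightarrow> ('v \<Rightarrow> 'n set) \<Rightarrow> 'v \<Rightarrow> 'm set" where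
  "vim_sub M \<phi> Y = (\<lambda>v\<in>I. {x \<in> car M v. \<phi> v x \<in> Y v})"
definition ker_sub :: "('v, 'a, 'k, 'm) quiver_rep \<Rightarrow> ('v, 'a, 'k, 'n) quiver_rep \<Rightarrow> ('v \<Rightarrow> 'm \<Rightarrow> 'n) \<Rightarrow> 'v \<Rightarrow> 'm set" where
  "ker_sub M N \<phi> = (\<lambda>v\<in>I. {x \<in> car M v. \<phi> v x = zer N v})"

lemma HomD:
  assumes "\<phi> \<in> Hom M N"
  shows "v \<in> I \<Longrightarrow> \<phi> v \<in> module_hom K (space M v) (space N v)"
    "v \<in> I \<Longrightarrow> x \<in> car M v \<Longrightarrow> \<phi> v x \<in> car N v"
    "a \<in> arcs Q \<Longrightarrow> x \<in> car M (tail Q a) \<Longrightarrow> \<phi> (head Q a) (arrow_map M a x) = arrow_map N a (\<phi> (tail Q a) x)"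
proof -
  show 1: "v \<in> I \<Longrightarrow> \<phi> v \<in> module_hom K (space M v) (space N v)"
    "a \<in> arcs Q \<Longrightarrow> x \<in> car M (tail Q a) \<Longrightarrow> \<phi> (head Q a) (arrow_map M a x) = arrow_map N a (\<phi> (tail Q a) x)"
    using assms unfolding rep_hom_def by blast+
  show "v \<in> I \<Longrightarrow> x \<in> car M v \<Longrightarrow> \<phi> v x \<in> car N v" by (rule module_homD(1)[OF 1(1)])
qed

lemma HomI:
  assumes "\<And>v. v \<in> I \<Longrightarrow> \<phi> v \<in> module_hom K (space M v) (space N v)"
    "\<And>a x. a \<in> arcs Q \<Longrightarrow> x \<in> car M (tail Q a) \<Longrightarrow> \<phi> (head Q a) (arrow_map M a x) = arrow_map N a (\<phi> (tail Q a) x)"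
  shows "\<phi> \<in> Hom M N"
  using assms by (auto simp: rep_hom_def)

lemma Hom_cong:
  assumes "\<phi> \<in> Hom M N" "rep M" "\<And>v x. v \<in> I \<Longrightarrow> x \<in> car M v \<Longrightarrow> \<psi> v x = \<phi> v x"
  shows "\<psi> \<in> Hom M N"
proof (rule HomI)
  fix v assume "v \<in> I" then show "\<psi> v \<in> module_hom K (space M v) (space N v)"
    using module_hom_cong[OF HomD(1)[OF assms(1)]] assms(3) repD(2)[OF assms(2)] by blast
next
  fix a x assume "a \<in> arcs Q" "x \<in> car M (tail Q a)"
  then show "\<psi> (head Q a) (arrow_map M a x) = arrow_map N a (\<psi> (tail Q a) x)"
    using HomD(3)[OF assms(1)] assms(3) arrow_closed[OF assms(2)] by simp
qed

lemma Hom_comp: "\<phi> \<in> Hom L M \<Longrightarrow> \<psi> \<in> Hom M N \<Longrightarrow> (\<lambda>v x. \<psi> v (\<phi> v x)) \<in> Hom L N"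
proof (rule HomI)
  fix v assume *: "\<phi> \<in> Hom L M" "\<psi> \<in> Hom M N" "v \<in> I"
  show "(\<lambda>x. \<psi> v (\<phi> v x)) \<in> module_hom K (space L v) (space N v)"
    by (rule module_hom_comp[OF HomD(1)[OF *(1,3)] HomD(1)[OF *(2,3)]])
next
  fix a x assume *: "\<phi> \<in> Hom L M" "\<psi> \<in> Hom M N" "a \<in> arcs Q" "x \<in> car L (tail Q a)"
  then show "\<psi> (head Q a) (\<phi> (head Q a) (arrow_map L a x)) = arrow_map N a (\<psi> (tail Q a) (\<phi> (tail Q a) x))"
    using HomD(3)[OF *(1,3,4)] HomD(3)[OF *(2,3) HomD(2)[OF *(1) tail_I[OF *(3)] *(4)]] by simp
qed

lemma Hom_id: "(\<lambda>v x. x) \<in> Hom M M"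
  by (rule HomI) (auto intro!: module_homI)

lemma Hom_zero: "rep M \<Longrightarrow> rep N \<Longrightarrow> \<phi> \<in> Hom M N \<Longrightarrow> v \<in> I \<Longrightarrow> \<phi> v (zer M v) = zer N v"
  by (rule module_hom_zero[OF repD(2) repD(2) HomD(1)])

lemma Hom_incl: "rep M \<Longrightarrow> X \<in> subs M \<Longrightarrow> (\<lambda>v x. x) \<in> Hom (sub_rep M X) M"
  by (rule HomI) (auto intro!: module_homI intro: subs_mem)

lemma Hom_restrict: "rep M \<Longrightarrow> X \<in> subs M \<Longrightarrow> \<phi> \<in> Hom M N \<Longrightarrow> \<phi> \<in> Hom (sub_rep M X) N"
  using Hom_comp[OF Hom_incl] by blast

lemma Hom_corestrict:
  assumes "\<phi> \<in> Hom M N" "rep M" "Y \<in> subs N" "\<And>v x. v \<in> I \<Longrightarrow> x \<in> car M v \<Longrightarrow> \<phi> v x \<in> Y v"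
  shows "\<phi> \<in> Hom M (sub_rep N Y)"
  using assms(4) by (intro HomI module_homI) (simp_all add: HomD(3)[OF assms(1)] module_homD[OF HomD(1)[OF assms(1)]])

lemma zero_sub: "rep M \<Longrightarrow> zero_sub M \<in> subs M"
proof (rule subsI)
  fix a x assume M: "rep M" and a: "a \<in> arcs Q" and x: "x \<in> zero_sub M (tail Q a)"
  show "arrow_map M a x \<in> zero_sub M (head Q a)"
    using module_hom_zero[OF repD(2)[OF M] repD(2)[OF M] repD(3)[OF M a]] a x by (simp add: zero_sub_def)
qed (auto simp: zero_sub_def subspace_zero repD)

lemma full_sub: "rep M \<Longrightarrow> full_sub M \<in> subs M"
  by (rule subsI) (auto simp: full_sub_def subspace_full repD arrow_closed)

lemma inter_sub: "X \<in> subs M \<Longrightarrow> Y \<in> subs M \<Longrightarrow> inter_sub X Y \<in> subs M"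
  by (rule subsI) (auto simp: inter_sub_def subspace_inter subsD)

lemma sum_sub:
  assumes "rep M" "X \<in> subs M" "Y \<in> subs M"
  shows "sum_sub M X Y \<in> subs M"
proof (rule subsI)
  fix a x assume a: "a \<in> arcs Q" and x: "x \<in> sum_sub M X Y (tail Q a)"
  then obtain s t where st: "s \<in> X (tail Q a)" "t \<in> Y (tail Q a)" "x = s \<oplus>\<^bsub>space M (tail Q a)\<^esub> t"
    by (auto simp: sum_sub_def set_add_mem)
  have "s \<in> car M (tail Q a)" "t \<in> car M (tail Q a)" using st a subs_mem[OF assms(2)] subs_mem[OF assms(3)] by auto
  then have "arrow_map M a x = arrow_map M a s \<oplus>\<^bsub>space M (head Q a)\<^esub> arrow_map M a t"
    using st module_homD(2)[OF repD(3)[OF assms(1) a]] by simp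
  then show "arrow_map M a x \<in> sum_sub M X Y (head Q a)"
    using a subsD(5)[OF assms(2) a st(1)] subsD(5)[OF assms(3) a st(2)] by (auto simp: sum_sub_def set_add_mem)
qed (auto simp: sum_sub_def intro!: subspace_set_add subsD(2)[OF assms(2)] subsD(2)[OF assms(3)])

lemma im_sub:
  assumes "rep M" "rep N" "\<phi> \<in> Hom M N" "X \<in> subs M"
  shows "im_sub \<phi> X \<in> subs N"
proof (rule subsI)
  fix v assume "v \<in> I"
  then show "subspace K (im_sub \<phi> X v) (space N v)"
    using subspace_hom_image[OF repD(2)[OF assms(1)] repD(2)[OF assms(2)] HomD(1)[OF assms(3)] subsD(2)[OF assms(4)], of v]
    by (simp add: im_sub_def)
next
  fix a y assume a: "a \<in> arcs Q" and "y \<in> im_sub \<phi> X (tail Q a)"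
  then obtain x where x: "x \<in> X (tail Q a)" "y = \<phi> (tail Q a) x" by (auto simp: im_sub_def)
  have "x \<in> car M (tail Q a)" using x a subs_mem[OF assms(4)] by auto
  then have "arrow_map N a y = \<phi> (head Q a) (arrow_map M a x)" using HomD(3)[OF assms(3) a] x by simp
  then show "arrow_map N a y \<in> im_sub \<phi> X (head Q a)"
    using a subsD(5)[OF assms(4) a x(1)] by (auto simp: im_sub_def)
qed (simp add: im_sub_def)

lemma vim_sub:
  assumes "rep M" "rep N" "\<phi> \<in> Hom M N" "Y \<in> subs N"
  shows "vim_sub M \<phi> Y \<in> subs M"
proof (rule subsI)
  fix v assume "v \<in> I"
  then show "subspace K (vim_sub M \<phi> Y v) (space M v)"
    using subspace_hom_vimage[OF repD(2)[OF assms(1)] repD(2)[OF assms(2)] HomD(1)[OF assms(3)] subsD(2)[OF assms(4)], of v]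
    by (simp add: vim_sub_def)
next
  fix a y assume a: "a \<in> arcs Q" and "y \<in> vim_sub M \<phi> Y (tail Q a)"
  then show "arrow_map M a y \<in> vim_sub M \<phi> Y (head Q a)"
    using HomD(3)[OF assms(3) a] subsD(5)[OF assms(4) a] arrow_closed[OF assms(1) a] by (auto simp: vim_sub_def)
qed (simp add: vim_sub_def)

lemma ker_sub:
  assumes "rep M" "rep N" "\<phi> \<in> Hom M N"
  shows "ker_sub M N \<phi> \<in> subs M"
proof -
  have "ker_sub M N \<phi> = vim_sub M \<phi> (zero_sub N)" by (intro ext) (simp add: ker_sub_def vim_sub_def zero_sub_def restrict_def)
  then show ?thesis using vim_sub[OF assms zero_sub[OF assms(2)]] by simp
qed

lemma zero_le: "X \<in> subs M \<Longrightarrow> rep M \<Longrightarrow> zero_sub M \<le> X"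
  using subs_le_iff[OF zero_sub, of M X] subsD(4)[of X M] by (simp add: zero_sub_def)
lemma le_full: "X \<in> subs M \<Longrightarrow> rep M \<Longrightarrow> X \<le> full_sub M"
  using subs_le_iff[OF _ full_sub, of X M] subsD(3)[of X M] by (simp add: full_sub_def)

lemma inter_le: "X \<in> subs M \<Longrightarrow> Y \<in> subs M \<Longrightarrow> inter_sub X Y \<le> X" "X \<in> subs M \<Longrightarrow> Y \<in> subs M \<Longrightarrow> inter_sub X Y \<le> Y"
  using subs_le_iff[OF inter_sub, of X M Y] by (auto simp: inter_sub_def)

lemma sum_ge:
  assumes "rep M" "X \<in> subs M" "Y \<in> subs M" shows "X \<le> sum_sub M X Y" "Y \<le> sum_sub M X Y"
proof -
  have "x \<in> X v <+>\<^bsub>space M v\<^esub> Y v" if v: "v \<in> I" and x: "x \<in> X v \<or> x \<in> Y v" for v x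
  proof -
    interpret V: vectorspace K "space M v" using repD(2)[OF assms(1) v] .
    have "x \<in> car M v" using x subsD(3)[OF assms(2) v] subsD(3)[OF assms(3) v] by auto
    then have "x = x \<oplus>\<^bsub>space M v\<^esub> zer M v" "x = zer M v \<oplus>\<^bsub>space M v\<^esub> x" by simp_all
    then show ?thesis using x subsD(4)[OF assms(2) v] subsD(4)[OF assms(3) v] unfolding set_add_mem by metis
  qed
  then show "X \<le> sum_sub M X Y" "Y \<le> sum_sub M X Y"
    unfolding subs_le_iff[OF assms(2) sum_sub[OF assms]] subs_le_iff[OF assms(3) sum_sub[OF assms]]
    by (auto simp: sum_sub_def)
qed

lemma finite_subs:
  assumes "rep M" shows "finite (subs M)"
proof -
  have "subs M \<subseteq> (\<Pi>\<^sub>E v\<in>I. Pow (car M v))"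
  proof
    fix X assume "X \<in> subs M"
    then show "X \<in> (\<Pi>\<^sub>E v\<in>I. Pow (car M v))" using subsD(1)[of X M] subsD(3)[of X M] by (simp add: PiE_def Pi_def)
  qed
  then show ?thesis using finite_subset finite_PiE[of I "\<lambda>v. Pow (car M v)"] finite_car[OF assms] by auto
qed

lemma zero_repI: "X \<in> subs M \<Longrightarrow> rep M \<Longrightarrow> zero_rep Q (sub_rep M X) \<longleftrightarrow> X = zero_sub M"
proof -
  assume X: "X \<in> subs M" "rep M"
  have "zero_rep Q (sub_rep M X) \<longleftrightarrow> (\<forall>v\<in>I. X v = zero_sub M v)" by (simp add: zero_rep_def zero_sub_def)
  then show ?thesis using subs_eqI[OF X(1) zero_sub[OF X(2)]] by metis
qed

lemma zero_rep_iff: "rep M \<Longrightarrow> zero_rep Q M \<longleftrightarrow> zero_sub M = full_sub M"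
  using subs_eqI[OF full_sub zero_sub, of M M] unfolding zero_rep_def zero_sub_def full_sub_def
  by (metis (no_types, lifting) restrict_apply')

section \<open>Epimorphisms, monomorphisms and isomorphism\<close>

definition onto :: "('v, 'a, 'k, 'm) quiver_rep \<Rightarrow> ('v, 'a, 'k, 'n) quiver_rep \<Rightarrow> ('v \<Rightarrow> 'm \<Rightarrow> 'n) \<Rightarrow> bool" where
  "onto M N \<phi> \<longleftrightarrow> \<phi> \<in> Hom M N \<and> (\<forall>v\<in>I. \<phi> v ` car M v = car N v)"

definition mono :: "('v, 'a, 'k, 'm) quiver_rep \<Rightarrow> ('v, 'a, 'k, 'n) quiver_rep \<Rightarrow> ('v \<Rightarrow> 'm \<Rightarrow> 'n) \<Rightarrow> bool" where
  "mono M N \<phi> \<longleftrightarrow> \<phi> \<in> Hom M N \<and> (\<forall>v\<in>I. inj_on (\<phi> v) (car M v))"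

lemma mono_iff: "rep M \<Longrightarrow> rep N \<Longrightarrow> \<phi> \<in> Hom M N \<Longrightarrow> mono M N \<phi> \<longleftrightarrow> ker_sub M N \<phi> = zero_sub M"
proof -
  assume a: "rep M" "rep N" "\<phi> \<in> Hom M N"
  have "inj_on (\<phi> v) (car M v) \<longleftrightarrow> ker_sub M N \<phi> v = zero_sub M v" if v: "v \<in> I" for v
    using hom_inj_iff[OF repD(2)[OF a(1) v] repD(2)[OF a(2) v] HomD(1)[OF a(3) v]] v Hom_zero[OF a v] zer_closed[OF a(1) v]
    by (auto simp: ker_sub_def zero_sub_def)
  then show ?thesis using a subs_eqI[OF ker_sub[OF a] zero_sub[OF a(1)]] by (auto simp: mono_def)
qed

lemma iso_iff: "M \<approx> N \<longleftrightarrow> (\<exists>\<phi>. mono M N \<phi> \<and> onto M N \<phi>)"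
  unfolding isomorphic_def rep_iso_def mono_def onto_def bij_betw_def by blast

text \<open>Homomorphism theorem for an arbitrary epimorphism: pick any preimage; two preimages
  differ by an element of the kernel of \<open>\<phi>\<close>, on which \<open>\<psi>\<close>
  vanishes. Avoiding cosets lets it apply to quotients realised on any carrier type.\<close>

lemma factor:
  assumes "rep M" "rep N" "rep L" "onto M N \<phi>" "\<psi> \<in> Hom M L" "ker_sub M N \<phi> \<le> ker_sub M L \<psi>"
  obtains \<eta> where "\<eta> \<in> Hom N L" "\<And>v x. v \<in> I \<Longrightarrow> x \<in> car M v \<Longrightarrow> \<eta> v (\<phi> v x) = \<psi> v x"
proof -
  define s where "s v = inv_into (car M v) (\<phi> v)" for v
  have ph: "\<phi> \<in> Hom M N" and surj: "\<And>v. v \<in> I \<Longrightarrow> \<phi> v ` car M v = car N v" using assms(4) by (auto simp: onto_def)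
  have s: "s v y \<in> car M v" "\<phi> v (s v y) = y" if "v \<in> I" "y \<in> car N v" for v y
    using surj[OF that(1)] that(2) unfolding s_def by (metis inv_into_into, metis f_inv_into_f)
  define \<eta> where "\<eta> v y = \<psi> v (s v y)" for v y
  have eq: "\<eta> v (\<phi> v x) = \<psi> v x" if v: "v \<in> I" and x: "x \<in> car M v" for v x
  proof -
    interpret V: vectorspace K "space M v" using repD(2)[OF assms(1) v] .
    interpret N: vectorspace K "space N v" using repD(2)[OF assms(2) v] .
    interpret L: vectorspace K "space L v" using repD(2)[OF assms(3) v] .
    let ?y = "s v (\<phi> v x)"
    have y: "?y \<in> car M v" "\<phi> v ?y = \<phi> v x" using s[OF v] HomD(2)[OF ph v x] by auto
    have "\<phi> v (?y \<ominus>\<^bsub>space M v\<^esub> x) = \<phi> v x \<ominus>\<^bsub>space N v\<^esub> \<phi> v x"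
      using module_hom_minus(1)[OF V.vectorspace_axioms N.vectorspace_axioms HomD(1)[OF ph v] y(1) x] y by simp
    also have "\<dots> = zer N v" using HomD(2)[OF ph v x] by (simp add: a_minus_def N.r_neg)
    finally have "?y \<ominus>\<^bsub>space M v\<^esub> x \<in> ker_sub M N \<phi> v" using v y x by (simp add: ker_sub_def)
    then have "?y \<ominus>\<^bsub>space M v\<^esub> x \<in> ker_sub M L \<psi> v" using assms(6) by (auto simp: le_fun_def)
    then have "\<psi> v (?y \<ominus>\<^bsub>space M v\<^esub> x) = zer L v" using v by (simp add: ker_sub_def)
    then have "\<psi> v ?y \<ominus>\<^bsub>space L v\<^esub> \<psi> v x = zer L v"
      using module_hom_minus(1)[OF V.vectorspace_axioms L.vectorspace_axioms HomD(1)[OF assms(5) v] y(1) x] by simp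
    then have "(\<psi> v ?y \<ominus>\<^bsub>space L v\<^esub> \<psi> v x) \<oplus>\<^bsub>space L v\<^esub> \<psi> v x = \<psi> v x"
      using HomD(2)[OF assms(5) v x] by simp
    then show ?thesis using HomD(2)[OF assms(5) v x] HomD(2)[OF assms(5) v y(1)]
      by (simp add: \<eta>_def a_minus_def L.a_assoc L.l_neg)
  qed
  have "\<eta> \<in> Hom N L"
  proof (rule HomI)
    fix v assume v: "v \<in> I"
    interpret V: vectorspace K "space M v" using repD(2)[OF assms(1) v] .
    show "\<eta> v \<in> module_hom K (space N v) (space L v)"
    proof (rule module_homI)
      fix y assume "y \<in> car N v" then show "\<eta> v y \<in> car L v" unfolding \<eta>_def using s v HomD(2)[OF assms(5) v] by blast
    next
      fix x y assume x: "x \<in> car N v" "y \<in> car N v"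
      have "x \<oplus>\<^bsub>space N v\<^esub> y = \<phi> v (s v x \<oplus>\<^bsub>space M v\<^esub> s v y)"
        using module_homD(2)[OF HomD(1)[OF ph v]] s[OF v] x by simp
      then have "\<eta> v (x \<oplus>\<^bsub>space N v\<^esub> y) = \<psi> v (s v x \<oplus>\<^bsub>space M v\<^esub> s v y)" using eq[OF v] s[OF v] x by simp
      then show "\<eta> v (x \<oplus>\<^bsub>space N v\<^esub> y) = \<eta> v x \<oplus>\<^bsub>space L v\<^esub> \<eta> v y"
        using module_homD(2)[OF HomD(1)[OF assms(5) v]] s[OF v] x by (simp add: \<eta>_def)
    next
      fix c x assume x: "c \<in> carrier K" "x \<in> car N v"
      have "c \<odot>\<^bsub>space N v\<^esub> x = \<phi> v (c \<odot>\<^bsub>space M v\<^esub> s v x)"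
        using module_homD(3)[OF HomD(1)[OF ph v]] s[OF v] x by simp
      then have "\<eta> v (c \<odot>\<^bsub>space N v\<^esub> x) = \<psi> v (c \<odot>\<^bsub>space M v\<^esub> s v x)" using eq[OF v] s[OF v] x by simp
      then show "\<eta> v (c \<odot>\<^bsub>space N v\<^esub> x) = c \<odot>\<^bsub>space L v\<^esub> \<eta> v x"
        using module_homD(3)[OF HomD(1)[OF assms(5) v]] s[OF v] x by (simp add: \<eta>_def)
    qed
  next
    fix a y assume a: "a \<in> arcs Q" and y: "y \<in> car N (tail Q a)"
    let ?x = "s (tail Q a) y"
    have x: "?x \<in> car M (tail Q a)" "\<phi> (tail Q a) ?x = y" using s a y by auto
    have "arrow_map N a y = \<phi> (head Q a) (arrow_map M a ?x)" using HomD(3)[OF ph a x(1)] x by simp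
    then have "\<eta> (head Q a) (arrow_map N a y) = \<psi> (head Q a) (arrow_map M a ?x)"
      using eq a arrow_closed[OF assms(1) a x(1)] by simp
    then show "\<eta> (head Q a) (arrow_map N a y) = arrow_map L a (\<eta> (tail Q a) y)"
      using HomD(3)[OF assms(5) a x(1)] by (simp add: \<eta>_def)
  qed
  then show ?thesis using that eq by blast
qed

text \<open>The factorisation through the first epimorphism is onto because the second is, and
  injective because the kernels agree. Isomorphisms between quotients are produced this way instead
  of by manipulating cosets.\<close>

lemma iso_of_same_ker:
  assumes "rep M" "rep N" "rep L" "onto M N \<phi>" "onto M L \<psi>" "ker_sub M N \<phi> = ker_sub M L \<psi>"
  shows "N \<approx> L"
proof -
  have ph: "\<phi> \<in> Hom M N" and surj: "\<And>v. v \<in> I \<Longrightarrow> \<phi> v ` car M v = car N v" using assms(4) by (auto simp: onto_def)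
  have ps: "\<psi> \<in> Hom M L" and surj': "\<And>v. v \<in> I \<Longrightarrow> \<psi> v ` car M v = car L v" using assms(5) by (auto simp: onto_def)
  obtain \<eta> where e: "\<eta> \<in> Hom N L" "\<And>v x. v \<in> I \<Longrightarrow> x \<in> car M v \<Longrightarrow> \<eta> v (\<phi> v x) = \<psi> v x"
    by (rule factor[OF assms(1-4) ps]) (use assms(6) in auto)
  have "onto N L \<eta>" unfolding onto_def
  proof (intro conjI ballI e(1))
    fix v assume v: "v \<in> I"
    have "\<eta> v ` car N v = (\<lambda>x. \<eta> v (\<phi> v x)) ` car M v" unfolding surj[OF v, symmetric] by (simp add: image_image)
    then show "\<eta> v ` car N v = car L v" using e(2)[OF v] surj'[OF v] by simp
  qed
  moreover have "mono N L \<eta>" unfolding mono_iff[OF assms(2,3) e(1)]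
  proof (rule subs_eqI[OF ker_sub[OF assms(2,3) e(1)] zero_sub[OF assms(2)]])
    fix v assume v: "v \<in> I"
    have "y = zer N v" if y: "y \<in> car N v" "\<eta> v y = zer L v" for y
    proof -
      obtain x where x: "x \<in> car M v" "y = \<phi> v x" using surj[OF v] y by auto
      then have "x \<in> ker_sub M L \<psi> v" using y e(2) v by (simp add: ker_sub_def)
      then show ?thesis using x v unfolding assms(6)[symmetric] by (simp add: ker_sub_def)
    qed
    moreover have "\<eta> v (zer N v) = zer L v" "zer N v \<in> car N v"
      using Hom_zero[OF assms(2,3) e(1) v] zer_closed[OF assms(2) v] by auto
    ultimately have "{y \<in> car N v. \<eta> v y = zer L v} = {zer N v}" by blast
    then show "ker_sub N L \<eta> v = zero_sub N v"
      using v by (simp add: ker_sub_def zero_sub_def)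
  qed
  ultimately show ?thesis by (auto simp: iso_iff)
qed

lemma onto_id: "onto M M (\<lambda>v x. x)" by (auto simp: onto_def Hom_id)
lemma mono_id: "mono M M (\<lambda>v x. x)" by (auto simp: mono_def Hom_id)
lemma iso_refl: "M \<approx> M" using onto_id mono_id by (auto simp: iso_iff)

lemma onto_comp: "onto L M \<phi> \<Longrightarrow> onto M N \<psi> \<Longrightarrow> onto L N (\<lambda>v x. \<psi> v (\<phi> v x))"
  unfolding onto_def using Hom_comp by (force simp: image_image[symmetric])

lemma mono_comp: "mono L M \<phi> \<Longrightarrow> mono M N \<psi> \<Longrightarrow> mono L N (\<lambda>v x. \<psi> v (\<phi> v x))"
  unfolding mono_def using Hom_comp HomD(2) by (fastforce simp: inj_on_def)

lemma iso_trans: "L \<approx> M \<Longrightarrow> M \<approx> N \<Longrightarrow> L \<approx> N"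
proof -
  assume "L \<approx> M" "M \<approx> N"
  then obtain \<phi> \<psi> where "mono L M \<phi>" "onto L M \<phi>" "mono M N \<psi>" "onto M N \<psi>" by (auto simp: iso_iff)
  then show ?thesis unfolding iso_iff using mono_comp onto_comp by blast
qed

lemma mono_id_ker: "rep M \<Longrightarrow> ker_sub M M (\<lambda>v x. x) = zero_sub M"
  using mono_iff[OF _ _ Hom_id] mono_id by blast

lemma iso_sym: "rep M \<Longrightarrow> rep N \<Longrightarrow> M \<approx> N \<Longrightarrow> N \<approx> M"
proof -
  assume a: "rep M" "rep N" "M \<approx> N"
  then obtain \<phi> where p: "mono M N \<phi>" "onto M N \<phi>" by (auto simp: iso_iff)
  have "ker_sub M N \<phi> = zero_sub M" using p a mono_iff by (auto simp: mono_def)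
  then show ?thesis using iso_of_same_ker[OF a(1) a(2) a(1) p(2) onto_id] mono_id_ker[OF a(1)] by simp
qed

text \<open>Transport of structure for representations: linearity of the new arrow maps is checked
  on preimages.\<close>

lemma rep_image:
  assumes M: "rep M"
    and c: "\<And>v. v \<in> I \<Longrightarrow> VS (space N v) \<and> p v \<in> module_hom K (space M v) (space N v) \<and> car N v = p v ` car M v"
    and a: "\<And>a x. a \<in> arcs Q \<Longrightarrow> x \<in> car M (tail Q a) \<Longrightarrow> arrow_map N a (p (tail Q a) x) = p (head Q a) (arrow_map M a x)"
  shows "rep N" "onto M N p"
proof -
  show "rep N"
  proof (rule repI)
    fix b assume b: "b \<in> arcs Q"
    interpret V: vectorspace K "space M (tail Q b)" using repD(2)[OF M] b by simp
    have pt: "p (tail Q b) \<in> module_hom K (space M (tail Q b)) (space N (tail Q b))"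
      and ph: "p (head Q b) \<in> module_hom K (space M (head Q b)) (space N (head Q b))"
      and ct: "car N (tail Q b) = p (tail Q b) ` car M (tail Q b)" using c b by auto
    note Mb = module_homD[OF repD(3)[OF M b]]
    show "arrow_map N b \<in> module_hom K (space N (tail Q b)) (space N (head Q b))"
    proof (rule module_homI)
      fix x assume "x \<in> car N (tail Q b)"
      then obtain y where y: "y \<in> car M (tail Q b)" "x = p (tail Q b) y" unfolding ct by auto
      then show "arrow_map N b x \<in> car N (head Q b)" using a[OF b y(1)] module_homD(1)[OF ph] Mb(1) by simp
    next
      fix x x' assume "x \<in> car N (tail Q b)" "x' \<in> car N (tail Q b)"
      then obtain y y' where y: "y \<in> car M (tail Q b)" "x = p (tail Q b) y" "y' \<in> car M (tail Q b)" "x' = p (tail Q b) y'"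
        unfolding ct by auto
      have "x \<oplus>\<^bsub>space N (tail Q b)\<^esub> x' = p (tail Q b) (y \<oplus>\<^bsub>space M (tail Q b)\<^esub> y')" using y module_homD(2)[OF pt] by simp
      then show "arrow_map N b (x \<oplus>\<^bsub>space N (tail Q b)\<^esub> x') = arrow_map N b x \<oplus>\<^bsub>space N (head Q b)\<^esub> arrow_map N b x'"
        using y a[OF b] module_homD(2)[OF ph] Mb by simp
    next
      fix e x assume e: "e \<in> carrier K" "x \<in> car N (tail Q b)"
      then obtain y where y: "y \<in> car M (tail Q b)" "x = p (tail Q b) y" unfolding ct by auto
      have "e \<odot>\<^bsub>space N (tail Q b)\<^esub> x = p (tail Q b) (e \<odot>\<^bsub>space M (tail Q b)\<^esub> y)" using y e module_homD(3)[OF pt] by simp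
      then show "arrow_map N b (e \<odot>\<^bsub>space N (tail Q b)\<^esub> x) = e \<odot>\<^bsub>space N (head Q b)\<^esub> arrow_map N b x"
        using y e a[OF b] module_homD(3)[OF ph] Mb by simp
    qed
  qed (use c in blast)
  show "onto M N p" unfolding onto_def
    using c a by (auto intro!: HomI)
qed

section \<open>Quotient representations and copies on natural numbers\<close>

definition proj :: "('v, 'a, 'k, 'm) quiver_rep \<Rightarrow> ('v \<Rightarrow> 'm set) \<Rightarrow> 'v \<Rightarrow> 'm \<Rightarrow> 'm set" where
  "proj M X v x = X v +>\<^bsub>space M v\<^esub> x"

text \<open>Stability of \<open>X\<close> under the arrows makes all cosets in the union that
  defines an arrow map coincide. The three facts present the quotient as an epimorphism with kernel
  \<open>X\<close>, which is the form most later arguments use.\<close>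

lemma quot:
  assumes M: "rep M" and X: "X \<in> subs M"
  shows "rep (quot M X)" "onto M (quot M X) (proj M X)" "ker_sub M (quot M X) (proj M X) = X"
proof -
  have c: "VS (space (quot M X) v) \<and> proj M X v \<in> module_hom K (space M v) (space (quot M X) v) \<and>
      car (quot M X) v = proj M X v ` car M v" if v: "v \<in> I" for v
    using quotient_space[OF repD(1)[OF M v] subsD(2)[OF X v]]
    by (simp add: quotient_rep_def proj_def[abs_def])
  have a: "arrow_map (quot M X) a (proj M X (tail Q a) x) = proj M X (head Q a) (arrow_map M a x)"
    if a: "a \<in> arcs Q" and x: "x \<in> car M (tail Q a)" for a x
  proof -
    note t = subsD(2)[OF X tail_I[OF a]] and h = subsD(2)[OF X head_I[OF a]]
    have "proj M X (head Q a) (arrow_map M a y) = proj M X (head Q a) (arrow_map M a x)" if "y \<in> proj M X (tail Q a) x" for y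
    proof -
      have y: "y \<in> car M (tail Q a)" "y \<ominus>\<^bsub>space M (tail Q a)\<^esub> x \<in> X (tail Q a)"
        using that mem_coset[OF t x] by (auto simp: proj_def)
      have "arrow_map M a (y \<ominus>\<^bsub>space M (tail Q a)\<^esub> x) = arrow_map M a y \<ominus>\<^bsub>space M (head Q a)\<^esub> arrow_map M a x"
        using module_hom_minus(1)[OF repD(2)[OF M] repD(2)[OF M] repD(3)[OF M a] y(1) x] a by simp
      moreover have "arrow_map M a (y \<ominus>\<^bsub>space M (tail Q a)\<^esub> x) \<in> X (head Q a)" using subsD(5)[OF X a y(2)] .
      ultimately show ?thesis
        using coset_eq_iff[OF h arrow_closed[OF M a y(1)] arrow_closed[OF M a x]] by (simp add: proj_def)
    qed
    moreover have "x \<in> proj M X (tail Q a) x"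
      unfolding proj_def using abelian_subgroup.a_rcos_self[OF subspace_additive[OF t] x] .
    ultimately have "(\<Union>y\<in>proj M X (tail Q a) x. proj M X (head Q a) (arrow_map M a y)) = proj M X (head Q a) (arrow_map M a x)"
      by blast
    then show ?thesis by (simp add: quotient_rep_def proj_def)
  qed
  show 1: "rep (quot M X)" and 2: "onto M (quot M X) (proj M X)"
    using rep_image[OF M c a] by blast+
  have 3: "proj M X \<in> Hom M (quot M X)" using 2 by (simp add: onto_def)
  show "ker_sub M (quot M X) (proj M X) = X"
  proof (rule subs_eqI[OF ker_sub[OF M 1 3] X])
    fix v assume v: "v \<in> I"
    interpret V: vectorspace K "space M v" using repD(2)[OF M v] .
    have "zer (quot M X) v = proj M X v (zer M v)" using Hom_zero[OF M 1 3 v] by simp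
    then have "x \<in> ker_sub M (quot M X) (proj M X) v \<longleftrightarrow> x \<in> car M v \<and> x \<ominus>\<^bsub>space M v\<^esub> zer M v \<in> X v" for x
      using coset_eq_iff[OF subsD(2)[OF X v], of x "zer M v"] v
      by (simp add: ker_sub_def proj_def cong: conj_cong)
    moreover have "x \<ominus>\<^bsub>space M v\<^esub> zer M v = x" if "x \<in> car M v" for x using that by (simp add: a_minus_def)
    ultimately have "x \<in> ker_sub M (quot M X) (proj M X) v \<longleftrightarrow> x \<in> X v" for x
      using subs_mem[OF X v, of x] by metis
    then show "ker_sub M (quot M X) (proj M X) v = X v" by blast
  qed
qed

lemma quot_iso:
  assumes "rep M" "rep N" "onto M N \<phi>"
  shows "quot M (ker_sub M N \<phi>) \<approx> N"
proof -
  have X: "ker_sub M N \<phi> \<in> subs M" using ker_sub assms by (auto simp: onto_def)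
  show ?thesis using iso_of_same_ker[OF assms(1) quot(1)[OF assms(1) X] assms(2) quot(2)[OF assms(1) X] assms(3)]
      quot(3)[OF assms(1) X] by simp
qed

text \<open>Finite spaces embed into the natural numbers, and the structure is carried along. This
  gives every representation, on whatever carrier type, a member of its isomorphism class.\<close>

lemma nat_copy:
  assumes M: "rep M"
  obtains N :: "('v, 'a, 'k, nat) quiver_rep" where "rep N" "M \<approx> N"
proof -
  have "\<forall>v. \<exists>f :: 'b \<Rightarrow> nat. v \<in> I \<longrightarrow> inj_on f (car M v)"
    using finite_imp_inj_to_nat_seg finite_car[OF M] by metis
  then obtain p :: "'v \<Rightarrow> 'b \<Rightarrow> nat" where p: "\<And>v. v \<in> I \<Longrightarrow> inj_on (p v) (car M v)" by metis
  define r where "r v = inv_into (car M v) (p v)" for v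
  have r: "r v (p v x) = x" if "v \<in> I" "x \<in> car M v" for v x using p that by (simp add: r_def)
  define N :: "('v, 'a, 'k, nat) quiver_rep" where
    "N = \<lparr>space = (\<lambda>v. \<lparr>carrier = p v ` car M v, mult = undefined, one = undefined,
      zero = p v (zer M v), add = (\<lambda>x y. p v (r v x \<oplus>\<^bsub>space M v\<^esub> r v y)), smult = (\<lambda>c x. p v (c \<odot>\<^bsub>space M v\<^esub> r v x))\<rparr>),
     arrow_map = (\<lambda>a x. p (head Q a) (arrow_map M a (r (tail Q a) x)))\<rparr>"
  have c: "VS (space N v) \<and> p v \<in> module_hom K (space M v) (space N v) \<and> car N v = p v ` car M v" if v: "v \<in> I" for v
  proof -
    have 1: "car N v = p v ` car M v" "zer N v = p v (zer M v)" by (simp_all add: N_def)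
    have 2: "p v x \<oplus>\<^bsub>space N v\<^esub> p v y = p v (x \<oplus>\<^bsub>space M v\<^esub> y)" if "x \<in> car M v" "y \<in> car M v" for x y
      using r[OF v] that by (simp add: N_def)
    have 3: "c \<odot>\<^bsub>space N v\<^esub> p v x = p v (c \<odot>\<^bsub>space M v\<^esub> x)" if "c \<in> carrier K" "x \<in> car M v" for c x
      using r[OF v] that by (simp add: N_def)
    have "VS (space N v)" by (rule vectorspace_image(1)[where p = "p v", OF repD(1)[OF M v] 1]) (use 2 3 in auto)
    moreover have "p v \<in> module_hom K (space M v) (space N v)"
      by (rule vectorspace_image(2)[where p = "p v", OF repD(1)[OF M v] 1]) (use 2 3 in auto)
    ultimately show ?thesis using 1 by simp
  qed
  have a: "arrow_map N a (p (tail Q a) x) = p (head Q a) (arrow_map M a x)"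
    if "a \<in> arcs Q" "x \<in> car M (tail Q a)" for a x
    using r that by (simp add: N_def)
  have N: "rep N" "onto M N p" using rep_image[where p = p, OF M c a] by blast+
  then have "mono M N p" using p by (simp add: mono_def onto_def)
  then show ?thesis using that N iso_iff by blast
qed

end

section \<open>Dimension vectors and isomorphism classes\<close>

context quiver_reps
begin

lemma dv_off [simp]: "v \<notin> I \<Longrightarrow> dv M v = 0"
  by (simp add: dim_vector_def)

lemma dv_vdim: "v \<in> I \<Longrightarrow> dv M v = vdim (space M v)"
  by (simp add: dim_vector_def)

lemma dv_eqI: "(\<And>v. v \<in> I \<Longrightarrow> dv M v = dv N v) \<Longrightarrow> dv M = dv N"
  by (rule ext) (metis dv_off)

lemma dv_card_eq:
  assumes "rep M" "rep N" "v \<in> I" "card (car M v) = card (car N v)"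
  shows "dv M v = dv N v"
  using VS_dim_eqI[OF repD(1)[OF assms(1,3)] repD(1)[OF assms(2,3)] assms(4)] assms(3) by (simp add: dv_vdim)

lemma dv_iso: "rep M \<Longrightarrow> rep N \<Longrightarrow> M \<approx> N \<Longrightarrow> dv M = dv N"
proof (rule dv_eqI)
  fix v assume a: "rep M" "rep N" "M \<approx> N" "v \<in> I"
  then obtain \<phi> where "inj_on (\<phi> v) (car M v)" "\<phi> v ` car M v = car N v" by (auto simp: iso_iff mono_def onto_def)
  then have "card (car M v) = card (car N v)" using card_image by metis
  then show "dv M v = dv N v" using dv_card_eq a by blast
qed

lemma dv_sub: "v \<in> I \<Longrightarrow> dv (sub_rep M X) v = vdim ((space M v)\<lparr>carrier := X v\<rparr>)"
  by (simp add: dim_vector_def)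

lemma dv_hom:
  assumes "rep M" "rep N" "\<phi> \<in> Hom M N"
  shows "dv M v = dv (sub_rep M (ker_sub M N \<phi>)) v + dv (sub_rep N (im_sub \<phi> (full_sub M))) v"
proof (cases "v \<in> I")
  case True
  show ?thesis
    using dim_ker_im[OF repD(1)[OF assms(1) True] repD(1)[OF assms(2) True] HomD(1)[OF assms(3) True]] True
    by (simp add: dv_sub dv_vdim ker_sub_def im_sub_def full_sub_def)
qed simp

lemma dv_full [simp]: "dv (sub_rep M (full_sub M)) = dv M"
  by (rule dv_eqI) (simp add: dv_sub dv_vdim full_sub_def)

lemma im_full: "onto M N \<phi> \<Longrightarrow> im_sub \<phi> (full_sub M) = full_sub N"
  by (auto simp: onto_def im_sub_def full_sub_def restrict_def intro!: ext)

lemma dv_onto: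
  assumes "rep M" "rep N" "onto M N \<phi>"
  shows "dv M v = dv (sub_rep M (ker_sub M N \<phi>)) v + dv N v"
  using dv_hom[OF assms(1,2), of \<phi> v] assms(3) im_full[OF assms(3)] by (simp add: onto_def)

lemma dv_quot: "rep M \<Longrightarrow> X \<in> subs M \<Longrightarrow> dv M v = dv (sub_rep M X) v + dv (quot M X) v"
  using dv_onto[OF _ quot(1) quot(2), of M X v] quot(3)[of M X] by simp

lemma dv_zero [simp]: "rep M \<Longrightarrow> dv (sub_rep M (zero_sub M)) = (\<lambda>v. 0)"
proof
  fix v assume M: "rep M"
  show "dv (sub_rep M (zero_sub M)) v = 0"
  proof (cases "v \<in> I")
    case True
    have "q ^ dv (sub_rep M (zero_sub M)) v = 1"
      using card_car[OF rep_sub_rep[OF M zero_sub[OF M]] True] True by (simp add: zero_sub_def)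
    then show ?thesis using q_ge_2 by simp
  qed simp
qed

lemma card_sub: "rep M \<Longrightarrow> X \<in> subs M \<Longrightarrow> v \<in> I \<Longrightarrow> card (X v) = q ^ dv (sub_rep M X) v"
  using card_car[OF rep_sub_rep, of M X v] by simp

lemma dv_sub_le:
  assumes "rep M" "X \<in> subs M" "Y \<in> subs M" "X \<le> Y"
  shows "dv (sub_rep M X) v \<le> dv (sub_rep M Y) v"
proof -
  have "X \<in> subs (sub_rep M Y)" using subs_sub_rep[OF assms(1,3)] assms by simp
  from dv_quot[OF rep_sub_rep[OF assms(1,3)] this, of v] show ?thesis by simp
qed

lemma subs_eq_dv:
  assumes "rep M" "X \<in> subs M" "Y \<in> subs M" "X \<le> Y" "dv (sub_rep M X) = dv (sub_rep M Y)"
  shows "X = Y"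
proof (rule subs_eqI[OF assms(2,3)])
  fix v assume v: "v \<in> I"
  have "card (X v) = card (Y v)" using card_sub[OF assms(1)] assms v by simp
  moreover have "X v \<subseteq> Y v" using assms(4) by (simp add: le_fun_def)
  moreover have "finite (Y v)" using finite_car[OF assms(1) v] subsD(3)[OF assms(3) v] finite_subset by blast
  ultimately show "X v = Y v" by (simp add: card_subset_eq)
qed

lemma dv_im_sub:
  assumes "rep M" "rep N" "\<phi> \<in> Hom M N" "X \<in> subs M"
  shows "dv (sub_rep M X) v = dv (sub_rep M (inter_sub X (ker_sub M N \<phi>))) v + dv (sub_rep N (im_sub \<phi> X)) v"
proof -
  have "ker_sub (sub_rep M X) N \<phi> = inter_sub X (ker_sub M N \<phi>)"
    using subs_mem[OF assms(4)] by (auto simp: ker_sub_def inter_sub_def restrict_def intro!: ext)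
  moreover have "im_sub \<phi> (full_sub (sub_rep M X)) = im_sub \<phi> X" by (auto simp: im_sub_def full_sub_def restrict_def intro!: ext)
  ultimately show ?thesis
    using dv_hom[OF rep_sub_rep[OF assms(1,4)] assms(2) Hom_restrict[OF assms(1,4,3)], of v] by simp
qed

text \<open>Modulo \<open>Y\<close> the subrepresentations X + Y and X have the same image, while
  they meet \<open>Y\<close> in \<open>Y\<close> and in X \<inter> Y; comparing kernels and images
  gives the modular law.\<close>

lemma dv_modular:
  assumes "rep M" "X \<in> subs M" "Y \<in> subs M"
  shows "dv (sub_rep M (sum_sub M X Y)) v + dv (sub_rep M (inter_sub X Y)) v = dv (sub_rep M X) v + dv (sub_rep M Y) v"
proof -
  note Q = quot[OF assms(1,3)]
  have h: "proj M Y \<in> Hom M (quot M Y)" using Q(2) by (simp add: onto_def)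
  have S: "sum_sub M X Y \<in> subs M" by (rule sum_sub[OF assms])
  have "im_sub (proj M Y) (sum_sub M X Y) = im_sub (proj M Y) X"
  proof (rule subs_eqI[OF im_sub[OF assms(1) Q(1) h S] im_sub[OF assms(1) Q(1) h assms(2)]])
    fix v assume v: "v \<in> I"
    interpret V: vectorspace K "space M v" using repD(2)[OF assms(1) v] .
    have "proj M Y v (x \<oplus>\<^bsub>space M v\<^esub> y) = proj M Y v x" if x: "x \<in> X v" and y: "y \<in> Y v" for x y
    proof -
      have c: "x \<in> car M v" "y \<in> car M v" using x y subs_mem[OF assms(2) v] subs_mem[OF assms(3) v] by auto
      have "(x \<oplus>\<^bsub>space M v\<^esub> y) \<ominus>\<^bsub>space M v\<^esub> x = y" using c
        by (simp add: a_minus_def V.a_assoc V.a_comm V.r_neg1)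
      then show ?thesis using coset_eq_iff[OF subsD(2)[OF assms(3) v], of "x \<oplus>\<^bsub>space M v\<^esub> y" x] c y by (simp add: proj_def)
    qed
    moreover have "X v \<subseteq> sum_sub M X Y v" using sum_ge(1)[OF assms] by (simp add: le_fun_def)
    ultimately have "proj M Y v ` sum_sub M X Y v = proj M Y v ` X v"
      using v by (force simp: sum_sub_def set_add_mem)
    then show "im_sub (proj M Y) (sum_sub M X Y) v = im_sub (proj M Y) X v"
      using v by (simp add: im_sub_def)
  qed
  moreover have "inter_sub (sum_sub M X Y) Y = Y"
  proof (rule subs_eqI[OF inter_sub[OF S assms(3)] assms(3)])
    fix v assume "v \<in> I"
    then show "inter_sub (sum_sub M X Y) Y v = Y v"
      using sum_ge(2)[OF assms] by (auto simp: inter_sub_def le_fun_def)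
  qed
  ultimately show ?thesis
    using dv_im_sub[OF assms(1) Q(1) h S, of v] dv_im_sub[OF assms(1) Q(1) h assms(2), of v] Q(3) by simp
qed

lemma zero_rep_dv: "rep M \<Longrightarrow> zero_rep Q M \<longleftrightarrow> dv M = (\<lambda>v. 0)"
proof -
  assume M: "rep M"
  have "zero_sub M = full_sub M \<longleftrightarrow> dv (sub_rep M (zero_sub M)) = dv (sub_rep M (full_sub M))"
    using subs_eq_dv[OF M zero_sub[OF M] full_sub[OF M] le_full[OF zero_sub[OF M] M]] by auto
  then show ?thesis using zero_rep_iff[OF M] M by auto
qed

lemma sub_zero_iff: "rep M \<Longrightarrow> X \<in> subs M \<Longrightarrow> dv (sub_rep M X) = (\<lambda>v. 0) \<longleftrightarrow> X = zero_sub M"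
  using zero_repI zero_rep_dv rep_sub_rep by blast

lemma sub_full_iff: "rep M \<Longrightarrow> X \<in> subs M \<Longrightarrow> dv (sub_rep M X) = dv M \<longleftrightarrow> X = full_sub M"
  using subs_eq_dv[OF _ _ full_sub le_full, of M X] by auto

section \<open>Additive functions of the dimension vector\<close>

definition wt :: "('v \<Rightarrow> int) \<Rightarrow> ('v, 'a, 'k, 'm) quiver_rep \<Rightarrow> int" where
  "wt w M = (\<Sum>v\<in>I. w v * int (dv M v))"

lemma wt_cong: "dv M = dv N \<Longrightarrow> wt w M = wt w N" by (simp add: wt_def)
lemma wt_zero: "dv M = (\<lambda>v. 0) \<Longrightarrow> wt w M = 0" by (simp add: wt_def)
lemma wt_add: "(\<And>v. dv M v = dv N v + dv L v) \<Longrightarrow> wt w M = wt w N + wt w L"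
  by (simp add: wt_def sum.distrib distrib_left)
lemma wt_quot: "rep M \<Longrightarrow> X \<in> subs M \<Longrightarrow> wt w M = wt w (sub_rep M X) + wt w (quot M X)"
  by (rule wt_add) (rule dv_quot)
lemma wt_modular:
  assumes "rep M" "X \<in> subs M" "Y \<in> subs M"
  shows "wt w (sub_rep M (sum_sub M X Y)) + wt w (sub_rep M (inter_sub X Y)) = wt w (sub_rep M X) + wt w (sub_rep M Y)"
  using dv_modular[OF assms] by (simp add: wt_def flip: sum.distrib distrib_left of_nat_add)
lemma wt_onto: "rep M \<Longrightarrow> rep N \<Longrightarrow> onto M N \<phi> \<Longrightarrow> wt w M = wt w (sub_rep M (ker_sub M N \<phi>)) + wt w N"
  by (rule wt_add) (rule dv_onto)
lemma wt_full: "wt w (sub_rep M (full_sub M)) = wt w M" by (rule wt_cong) simp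
definition size :: "('v, 'a, 'k, 'm) quiver_rep \<Rightarrow> nat" where
  "size M = (\<Sum>v\<in>I. dv M v)"

lemma size_zero_iff: "size M = 0 \<longleftrightarrow> dv M = (\<lambda>v. 0)"
  by (auto simp: size_def fun_eq_iff)

lemma size_cong: "dv M = dv N \<Longrightarrow> size M = size N" by (simp add: size_def)

lemma size_quot: "rep M \<Longrightarrow> X \<in> subs M \<Longrightarrow> size M = size (sub_rep M X) + size (quot M X)"
  by (simp add: size_def dv_quot flip: sum.distrib)

lemma size_onto: "rep M \<Longrightarrow> rep N \<Longrightarrow> onto M N \<phi> \<Longrightarrow> size M = size (sub_rep M (ker_sub M N \<phi>)) + size N"
  by (simp add: size_def dv_onto[of M N \<phi>] flip: sum.distrib)

lemma size_sub_le: "rep M \<Longrightarrow> X \<in> subs M \<Longrightarrow> Y \<in> subs M \<Longrightarrow> X \<le> Y \<Longrightarrow> size (sub_rep M X) \<le> size (sub_rep M Y)"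
  unfolding size_def by (intro sum_mono dv_sub_le)

lemma size_sub_eq:
  assumes "rep M" "X \<in> subs M" "Y \<in> subs M" "X \<le> Y" "size (sub_rep M Y) \<le> size (sub_rep M X)"
  shows "X = Y"
proof (rule subs_eq_dv[OF assms(1-4)])
  have "dv (sub_rep M X) v = dv (sub_rep M Y) v" if v: "v \<in> I" for v
  proof (rule ccontr)
    assume "dv (sub_rep M X) v \<noteq> dv (sub_rep M Y) v"
    then have "dv (sub_rep M X) v < dv (sub_rep M Y) v" using dv_sub_le[OF assms(1-4), of v] by simp
    then have "size (sub_rep M X) < size (sub_rep M Y)"
      unfolding size_def using dv_sub_le[OF assms(1-4)] v by (intro sum_strict_mono_ex1) auto
    then show False using assms(5) by simp
  qed
  then show "dv (sub_rep M X) = dv (sub_rep M Y)" by (rule dv_eqI)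
qed

lemma size_sub_less: "rep M \<Longrightarrow> X \<in> subs M \<Longrightarrow> Y \<in> subs M \<Longrightarrow> X \<le> Y \<Longrightarrow> X \<noteq> Y \<Longrightarrow> size (sub_rep M X) < size (sub_rep M Y)"
  using size_sub_eq by (metis not_le)

lemma size_full: "size (sub_rep M (full_sub M)) = size M" by (rule size_cong) simp

section \<open>Subrepresentations of a quotient, given by an arbitrary epimorphism\<close>

context
  fixes M :: "('v, 'a, 'k, 'm) quiver_rep" and N :: "('v, 'a, 'k, 'n) quiver_rep" and \<phi> X
  assumes M: "rep M" and N: "rep N" and phi: "onto M N \<phi>" and ker: "ker_sub M N \<phi> = X"
begin

lemma phi_hom: "\<phi> \<in> Hom M N" using phi by (simp add: onto_def)
lemma ker_subs: "X \<in> subs M" using ker_sub[OF M N phi_hom] ker by simp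

lemma vim_subs: "Y \<in> subs N \<Longrightarrow> vim_sub M \<phi> Y \<in> subs M" by (rule vim_sub[OF M N phi_hom])
lemma im_subs: "Z \<in> subs M \<Longrightarrow> im_sub \<phi> Z \<in> subs N" by (rule im_sub[OF M N phi_hom])

lemma vim_ge:
  assumes Y: "Y \<in> subs N" shows "X \<le> vim_sub M \<phi> Y"
  using subsD(4)[OF Y] ker unfolding subs_le_iff[OF ker_subs vim_subs[OF Y]]
  by (auto simp: ker_sub_def vim_sub_def)

lemma im_vim: assumes Y: "Y \<in> subs N" shows "im_sub \<phi> (vim_sub M \<phi> Y) = Y"
proof (rule subs_eqI[OF im_subs[OF vim_subs[OF Y]] Y])
  fix v assume v: "v \<in> I"
  have "\<phi> v ` car M v = car N v" using phi v by (simp add: onto_def)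
  then have "\<exists>x\<in>car M v. y = \<phi> v x" if "y \<in> Y v" for y using subs_mem[OF Y v that] by auto
  then show "im_sub \<phi> (vim_sub M \<phi> Y) v = Y v" using v by (auto simp: im_sub_def vim_sub_def)
qed

lemma vim_im:
  assumes Z: "Z \<in> subs M" "X \<le> Z" shows "vim_sub M \<phi> (im_sub \<phi> Z) = Z"
proof (rule subs_eqI[OF vim_subs[OF im_subs[OF Z(1)]] Z(1)])
  fix v assume v: "v \<in> I"
  interpret V: vectorspace K "space M v" using repD(2)[OF M v] .
  interpret N: vectorspace K "space N v" using repD(2)[OF N v] .
  have "x \<in> Z v" if x: "x \<in> car M v" "z \<in> Z v" "\<phi> v x = \<phi> v z" for x z
  proof -
    have z: "z \<in> car M v" using subs_mem[OF Z(1) v x(2)] .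
    have "\<phi> v (x \<ominus>\<^bsub>space M v\<^esub> z) = \<phi> v z \<ominus>\<^bsub>space N v\<^esub> \<phi> v z"
      using module_hom_minus(1)[OF repD(2)[OF M v] repD(2)[OF N v] HomD(1)[OF phi_hom v] x(1) z] x(3) by simp
    also have "\<dots> = zer N v" using HomD(2)[OF phi_hom v z] by (simp add: a_minus_def N.r_neg)
    finally have "x \<ominus>\<^bsub>space M v\<^esub> z \<in> X v" unfolding ker[symmetric] using v x z by (simp add: ker_sub_def)
    then have "x \<ominus>\<^bsub>space M v\<^esub> z \<in> Z v" using Z(2) by (auto simp: le_fun_def)
    then have "(x \<ominus>\<^bsub>space M v\<^esub> z) \<oplus>\<^bsub>space M v\<^esub> z \<in> Z v" using subsD(2)[OF Z(1) v] x(2) by (simp add: subspace_iff)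
    moreover have "(x \<ominus>\<^bsub>space M v\<^esub> z) \<oplus>\<^bsub>space M v\<^esub> z = x" using x(1) z by (simp add: a_minus_def V.a_assoc V.l_neg)
    ultimately show ?thesis by simp
  qed
  then show "vim_sub M \<phi> (im_sub \<phi> Z) v = Z v" using v subs_mem[OF Z(1) v] by (auto simp: vim_sub_def im_sub_def)
qed

lemma im_bij: "bij_betw (im_sub \<phi>) {Z \<in> subs M. X \<le> Z} (subs N)"
  by (rule bij_betw_byWitness[where f' = "vim_sub M \<phi>"]) (use vim_im im_vim vim_subs vim_ge im_subs in auto)

text \<open>Third isomorphism theorem: both sides are images of \<open>M\<close> under epimorphisms
  with kernel \<open>Z\<close>.\<close>

lemma quot_im_iso:
  assumes Z: "Z \<in> subs M" "X \<le> Z" shows "quot M Z \<approx> quot N (im_sub \<phi> Z)"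
proof -
  note QN = quot[OF N im_subs[OF Z(1)]] and QM = quot[OF M Z(1)]
  have o: "onto M (quot N (im_sub \<phi> Z)) (\<lambda>v x. proj N (im_sub \<phi> Z) v (\<phi> v x))" by (rule onto_comp[OF phi QN(2)])
  have "ker_sub M (quot N (im_sub \<phi> Z)) (\<lambda>v x. proj N (im_sub \<phi> Z) v (\<phi> v x)) = Z"
  proof (rule subs_eqI[OF ker_sub[OF M QN(1)] Z(1)])
    show "(\<lambda>v x. proj N (im_sub \<phi> Z) v (\<phi> v x)) \<in> Hom M (quot N (im_sub \<phi> Z))" using o by (simp add: onto_def)
    fix v assume v: "v \<in> I"
    have "y \<in> car N v \<Longrightarrow> proj N (im_sub \<phi> Z) v y = zer (quot N (im_sub \<phi> Z)) v \<longleftrightarrow> y \<in> im_sub \<phi> Z v" for y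
      using fun_cong[OF QN(3), of v] v by (auto simp: ker_sub_def)
    then have "ker_sub M (quot N (im_sub \<phi> Z)) (\<lambda>v x. proj N (im_sub \<phi> Z) v (\<phi> v x)) v = vim_sub M \<phi> (im_sub \<phi> Z) v"
      using v HomD(2)[OF phi_hom v] by (auto simp: ker_sub_def vim_sub_def)
    then show "ker_sub M (quot N (im_sub \<phi> Z)) (\<lambda>v x. proj N (im_sub \<phi> Z) v (\<phi> v x)) v = Z v" using vim_im[OF Z] by simp
  qed
  then show ?thesis using iso_of_same_ker[OF M QM(1) QN(1) QM(2) o] QM(3) by simp
qed

lemma sub_im_onto:
  assumes Z: "Z \<in> subs M" "X \<le> Z"
  shows "onto (sub_rep M Z) (sub_rep N (im_sub \<phi> Z)) \<phi>" "ker_sub (sub_rep M Z) (sub_rep N (im_sub \<phi> Z)) \<phi> = X"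
proof -
  have "\<phi> \<in> Hom (sub_rep M Z) (sub_rep N (im_sub \<phi> Z))"
    by (rule Hom_corestrict[OF Hom_restrict[OF M Z(1) phi_hom] rep_sub_rep[OF M Z(1)] im_subs[OF Z(1)]])
       (auto simp: im_sub_def)
  then show "onto (sub_rep M Z) (sub_rep N (im_sub \<phi> Z)) \<phi>" by (simp add: onto_def im_sub_def)
  have "ker_sub (sub_rep M Z) (sub_rep N (im_sub \<phi> Z)) \<phi> v = X v" if v: "v \<in> I" for v
  proof -
    have "X v \<subseteq> Z v" using Z(2) by (simp add: le_fun_def)
    moreover have "X v = {x \<in> car M v. \<phi> v x = zer N v}" unfolding ker[symmetric] using v by (simp add: ker_sub_def)
    ultimately show ?thesis using v subs_mem[OF Z(1) v] by (auto simp: ker_sub_def)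
  qed
  moreover have "X \<in> extensional I" using ker_subs subsD(1) by blast
  ultimately show "ker_sub (sub_rep M Z) (sub_rep N (im_sub \<phi> Z)) \<phi> = X"
    by (intro ext) (auto simp: ker_sub_def extensional_def)
qed

lemma sub_im_iso:
  assumes Z: "Z \<in> subs M" "X \<le> Z"
  shows "quot (sub_rep M Z) X \<approx> sub_rep N (im_sub \<phi> Z)"
  using quot_iso[OF rep_sub_rep[OF M Z(1)] rep_sub_rep[OF N im_subs[OF Z(1)]] sub_im_onto(1)[OF Z]] sub_im_onto(2)[OF Z] by simp

lemma im_ker: "im_sub \<phi> X = zero_sub N"
proof (rule subs_eqI[OF im_subs[OF ker_subs] zero_sub[OF N]])
  fix v assume v: "v \<in> I"
  have "X v = {x \<in> car M v. \<phi> v x = zer N v}" unfolding ker[symmetric] using v by (simp add: ker_sub_def)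
  moreover have "zer M v \<in> X v" using subsD(4)[OF ker_subs v] .
  ultimately show "im_sub \<phi> X v = zero_sub N v" using v by (auto simp: im_sub_def zero_sub_def)
qed

end

subsection \<open>Isomorphism classes\<close>

text \<open>The argument may live on any carrier type, because the elements of a quotient are
  cosets; the members of the class are always representations on natural numbers.\<close>

definition cls :: "('v, 'a, 'k, 'm) quiver_rep \<Rightarrow> ('v, 'a, 'k) iso_class" where
  "cls M = {N. rep N \<and> M \<approx> N}"

text \<open>Equal classes say something only because they are nonempty: \<open>nat_copy\<close>
  provides a common member that links the two representations.\<close>

lemma cls_eq_iff: "rep M \<Longrightarrow> rep N \<Longrightarrow> cls M = cls N \<longleftrightarrow> M \<approx> N"
proof
  assume a: "rep M" "rep N" "cls M = cls N"
  obtain L :: "('v, 'a, 'k, nat) quiver_rep" where L: "rep L" "M \<approx> L" using nat_copy[OF a(1)] by blast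
  then have "L \<in> cls N" using a(3) by (auto simp: cls_def)
  then have "N \<approx> L" by (simp add: cls_def)
  then show "M \<approx> N" using L iso_sym[OF a(2) L(1)] iso_trans by blast
next
  assume a: "rep M" "rep N" "M \<approx> N"
  have "M \<approx> L \<longleftrightarrow> N \<approx> L" for L :: "('v, 'a, 'k, nat) quiver_rep"
    using iso_trans[OF a(3), of L] iso_trans[OF iso_sym[OF a], of L] by blast
  then show "cls M = cls N" by (simp add: cls_def)
qed

lemma cls_class:
  assumes M: "rep M" shows "cls M \<in> iso_classes Q K"
proof -
  obtain L :: "('v, 'a, 'k, nat) quiver_rep" where L: "rep L" "M \<approx> L" using nat_copy[OF M] by blast
  have "cls M = cls L" using cls_eq_iff[OF M L(1)] L(2) by simp
  also have "\<dots> = {(M, N). rep M \<and> rep N \<and> M \<approx> N} `` {L}" using L by (auto simp: cls_def)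
  also have "\<dots> \<in> iso_classes Q K" unfolding iso_classes_def by (rule quotientI) (use L in simp)
  finally show ?thesis .
qed

lemma representative:
  assumes "c \<in> iso_classes Q K"
  shows "rep (representative c)" "cls (representative c) = c"
proof -
  have "\<exists>L :: ('v, 'a, 'k, nat) quiver_rep. rep L \<and> c = cls L"
    using assms unfolding iso_classes_def quotient_def cls_def by auto
  then obtain L :: "('v, 'a, 'k, nat) quiver_rep" where L: "rep L" "c = cls L" by blast
  then have "L \<in> c" using iso_refl by (simp add: cls_def)
  then have "representative c \<in> c" unfolding representative_def by (rule someI)
  then have "rep (representative c)" "L \<approx> representative c" using L by (auto simp: cls_def)
  then show "rep (representative c)" "cls (representative c) = c" using L cls_eq_iff by auto
qed

lemma rep_cls: "rep M \<Longrightarrow> rep (representative (cls M))" "rep M \<Longrightarrow> M \<approx> representative (cls M)"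
  using representative[OF cls_class] cls_eq_iff by blast+

lemma class_dim_cls: "rep M \<Longrightarrow> class_dim Q K (cls M) = dv M"
  unfolding class_dim_def using dv_iso[OF _ rep_cls(1) rep_cls(2)] by metis

lemma hall_number_alt:
  assumes "r \<in> iso_classes Q K" "u \<in> iso_classes Q K" "v \<in> iso_classes Q K"
  shows "hall_number Q K r u v =
    card {X \<in> subs (representative r). cls (sub_rep (representative r) X) = v \<and> cls (quot (representative r) X) = u}"
proof -
  have "sub_rep (representative r) X \<approx> representative v \<longleftrightarrow> cls (sub_rep (representative r) X) = v"
    "quot (representative r) X \<approx> representative u \<longleftrightarrow> cls (quot (representative r) X) = u"
    if "X \<in> subs (representative r)" for X
    using cls_eq_iff[OF rep_sub_rep[OF representative(1)[OF assms(1)] that] representative(1)[OF assms(3)]]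
      cls_eq_iff[OF quot(1)[OF representative(1)[OF assms(1)] that] representative(1)[OF assms(2)]]
      representative(2)[OF assms(2)] representative(2)[OF assms(3)] by auto
  then show ?thesis unfolding hall_number_def by (metis (no_types, lifting))
qed

lemma sub_full_iso: "rep M \<Longrightarrow> sub_rep M (full_sub M) \<approx> M"
proof -
  assume M: "rep M"
  have h: "(\<lambda>v x. x) \<in> Hom (sub_rep M (full_sub M)) M" by (rule Hom_incl[OF M full_sub[OF M]])
  then show ?thesis unfolding iso_iff mono_def onto_def
    by (intro exI[of _ "\<lambda>v x. x"]) (auto simp: full_sub_def)
qed

lemma quot_zero_iso: "rep M \<Longrightarrow> quot M (zero_sub M) \<approx> M"
  using quot_iso[OF _ _ onto_id, of M] mono_id_ker[of M] by simp

lemma quot_zero_rep: "rep M \<Longrightarrow> X \<in> subs M \<Longrightarrow> dv (quot M X) = (\<lambda>v. 0) \<longleftrightarrow> X = full_sub M"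
proof -
  assume a: "rep M" "X \<in> subs M"
  have "dv (quot M X) = (\<lambda>v. 0) \<longleftrightarrow> dv (sub_rep M X) = dv M"
    using dv_quot[OF a] by (auto simp: fun_eq_iff)
  then show ?thesis using sub_full_iff[OF a] by simp
qed

lemma cls_zero: "zero_class Q K = {M. rep M \<and> dv M = (\<lambda>v. 0)}"
  unfolding zero_class_def using zero_rep_dv by blast

lemma zero_iso:
  assumes "rep M" "rep N" "dv M = (\<lambda>v. 0)" "dv N = (\<lambda>v. 0)" shows "M \<approx> N"
proof -
  have c: "v \<in> I \<Longrightarrow> car M v = {zer M v}" "v \<in> I \<Longrightarrow> car N v = {zer N v}" for v
    using assms zero_rep_dv[of M] zero_rep_dv[of N] by (auto simp: zero_rep_def)
  have o: "onto M N (\<lambda>v x. zer N v)" unfolding onto_def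
  proof (intro conjI ballI HomI module_homI)
    fix v assume v: "v \<in> I"
    interpret N: vectorspace K "space N v" using repD(2)[OF assms(2) v] .
    show "zer N v \<in> car N v" "zer N v = zer N v \<oplus>\<^bsub>space N v\<^esub> zer N v" by simp_all
    show "e \<in> carrier K \<Longrightarrow> zer N v = e \<odot>\<^bsub>space N v\<^esub> zer N v" for e by simp
    show "(\<lambda>x. zer N v) ` car M v = car N v" using c[OF v] by simp
  next
    fix a x assume a: "a \<in> arcs Q"
    show "zer N (head Q a) = arrow_map N a (zer N (tail Q a))"
      using module_hom_zero[OF repD(2)[OF assms(2)] repD(2)[OF assms(2)] repD(3)[OF assms(2) a]] a by simp
  qed
  then have "mono M N (\<lambda>v x. zer N v)" using c by (simp add: mono_def onto_def)
  then show ?thesis using o iso_iff by blast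
qed

lemma cls_eq_zero_class: "rep M \<Longrightarrow> dv M = (\<lambda>v. 0) \<Longrightarrow> cls M = zero_class Q K"
  unfolding cls_zero cls_def using zero_iso dv_iso by (metis (no_types, lifting))

lemma cls_zero_class_iff: "rep M \<Longrightarrow> cls M = zero_class Q K \<longleftrightarrow> dv M = (\<lambda>v. 0)"
proof
  assume M: "rep M" "cls M = zero_class Q K"
  have "representative (cls M) \<in> cls M" using rep_cls[OF M(1)] by (simp add: cls_def)
  then have "dv (representative (cls M)) = (\<lambda>v. 0)" unfolding M(2) by (simp add: cls_zero)
  then show "dv M = (\<lambda>v. 0)" using dv_iso[OF M(1) rep_cls(1)[OF M(1)] rep_cls(2)[OF M(1)]] by simp
qed (rule cls_eq_zero_class)

end

section \<open>Split extensions\<close>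

context finite_field
begin

text \<open>Vector spaces are projective: lift the values on a basis. Together with the dual
  extension property it makes Ext right exact in both arguments.\<close>

lemma hom_lift:
  assumes V: "VS V" and W: "VS W" and U: "VS U" and p: "p \<in> module_hom K W U" "p ` carrier W = carrier U"
    and f: "f \<in> module_hom K V U"
  obtains g where "g \<in> module_hom K V W" "\<And>x. x \<in> carrier V \<Longrightarrow> p (g x) = f x"
proof -
  obtain B where B: "finite B" "vectorspace.basis K V B" "B \<subseteq> carrier V" using basis_ex[OF V] by metis
  have "inv_into (carrier W) p (f b) \<in> carrier W \<and> p (inv_into (carrier W) p (f b)) = f b" if "b \<in> B" for b
  proof -
    have "f b \<in> p ` carrier W" using that B(3) module_homD(1)[OF f] p(2) by auto
    then show ?thesis by (simp add: inv_into_into f_inv_into_f)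
  qed
  then have h: "(\<lambda>b. inv_into (carrier W) p (f b)) \<in> B \<rightarrow> carrier W"
    and h2: "\<And>b. b \<in> B \<Longrightarrow> p (inv_into (carrier W) p (f b)) = f b" by auto
  obtain g where g: "g \<in> module_hom K V W" "\<And>b. b \<in> B \<Longrightarrow> g b = inv_into (carrier W) p (f b)"
    using hom_extend_basis[OF V[THEN conjunct1] W[THEN conjunct1] B(1,2) h] by blast
  have "p (g x) = f x" if "x \<in> carrier V" for x
    by (rule hom_eq_on_basis[OF V[THEN conjunct1] U[THEN conjunct1] module_hom_comp[OF g(1) p(1)] f B(1,2) _ that])
      (use g(2) h2 in simp)
  then show ?thesis using that g(1) by blast
qed

lemma hom_extend_inj:
  assumes V: "VS V" and V': "VS V'" and W: "VS W" and i: "i \<in> module_hom K V V'" "inj_on i (carrier V)"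
    and f: "f \<in> module_hom K V W"
  obtains g where "g \<in> module_hom K V' W" "\<And>x. x \<in> carrier V \<Longrightarrow> g (i x) = f x"
proof -
  let ?S = "i ` carrier V"
  define j where "j = inv_into (carrier V) i"
  have j: "\<And>x. x \<in> carrier V \<Longrightarrow> j (i x) = x" using i(2) by (simp add: j_def)
  interpret V: vectorspace K V using V by simp
  have S: "subspace K ?S V'"
    using subspace_hom_image[OF V[THEN conjunct1] V'[THEN conjunct1] i(1) subspace_full[OF V[THEN conjunct1]]] .
  have "(\<lambda>y. f (j y)) \<in> module_hom K (V'\<lparr>carrier := ?S\<rparr>) W"
  proof (rule module_homI)
    fix x assume "x \<in> carrier (V'\<lparr>carrier := ?S\<rparr>)"
    then show "f (j x) \<in> carrier W" using j module_homD(1)[OF f] by auto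
  next
    fix x y assume "x \<in> carrier (V'\<lparr>carrier := ?S\<rparr>)" "y \<in> carrier (V'\<lparr>carrier := ?S\<rparr>)"
    then obtain a b where ab: "a \<in> carrier V" "x = i a" "b \<in> carrier V" "y = i b" by auto
    have "x \<oplus>\<^bsub>V'\<^esub> y = i (a \<oplus>\<^bsub>V\<^esub> b)" using ab module_homD(2)[OF i(1)] by simp
    then show "f (j (x \<oplus>\<^bsub>V'\<lparr>carrier := ?S\<rparr>\<^esub> y)) = f (j x) \<oplus>\<^bsub>W\<^esub> f (j y)"
      using j ab module_homD(2)[OF f] by simp
  next
    fix c x assume c: "c \<in> carrier K" "x \<in> carrier (V'\<lparr>carrier := ?S\<rparr>)"
    then obtain a where ab: "a \<in> carrier V" "x = i a" by auto
    have "c \<odot>\<^bsub>V'\<^esub> x = i (c \<odot>\<^bsub>V\<^esub> a)" using ab c module_homD(3)[OF i(1)] by simp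
    then show "f (j (c \<odot>\<^bsub>V'\<lparr>carrier := ?S\<rparr>\<^esub> x)) = c \<odot>\<^bsub>W\<^esub> f (j x)"
      using j ab c module_homD(3)[OF f] by simp
  qed
  then obtain g where g: "g \<in> module_hom K V' W" "\<And>x. x \<in> ?S \<Longrightarrow> g x = f (j x)"
    using hom_extend_subspace[OF V' W[THEN conjunct1] S] by blast
  then show ?thesis using that j by auto
qed

end

context quiver_reps
begin

lemma Hom_add:
  assumes "rep M" "rep N" "\<phi> \<in> Hom M N" "\<psi> \<in> Hom M N"
  shows "(\<lambda>v x. \<phi> v x \<oplus>\<^bsub>space N v\<^esub> \<psi> v x) \<in> Hom M N"
proof (rule HomI)
  fix v assume "v \<in> I"
  then show "(\<lambda>x. \<phi> v x \<oplus>\<^bsub>space N v\<^esub> \<psi> v x) \<in> module_hom K (space M v) (space N v)"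
    by (intro module_hom_add repD(2) assms HomD(1))
next
  fix a x assume a: "a \<in> arcs Q" "x \<in> car M (tail Q a)"
  then show "\<phi> (head Q a) (arrow_map M a x) \<oplus>\<^bsub>space N (head Q a)\<^esub> \<psi> (head Q a) (arrow_map M a x) =
      arrow_map N a (\<phi> (tail Q a) x \<oplus>\<^bsub>space N (tail Q a)\<^esub> \<psi> (tail Q a) x)"
    using HomD(3)[OF assms(3) a] HomD(3)[OF assms(4) a] module_homD(2)[OF repD(3)[OF assms(2) a(1)]]
      HomD(2)[OF assms(3)] HomD(2)[OF assms(4)] by simp
qed

lemma mono_dv_iso:
  assumes "rep M" "rep N" "mono M N \<phi>" "dv M = dv N"
  shows "M \<approx> N"
proof -
  have h: "\<phi> \<in> Hom M N" using assms(3) by (simp add: mono_def)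
  have "\<phi> v ` car M v = car N v" if v: "v \<in> I" for v
  proof (rule card_subset_eq[OF finite_car[OF assms(2) v]])
    show "\<phi> v ` car M v \<subseteq> car N v" using HomD(2)[OF h v] by auto
    show "card (\<phi> v ` car M v) = card (car N v)"
      using assms(3) v card_car[OF assms(1) v] card_car[OF assms(2) v] assms(4) by (simp add: mono_def card_image)
  qed
  then have "onto M N \<phi>" using h by (simp add: onto_def)
  then show ?thesis using assms(3) iso_iff by blast
qed

text \<open>\<open>Ext\<^sup>1(M, N) = 0\<close>: every cocycle on arrows is a coboundary.\<close>

definition ext0 :: "('v, 'a, 'k, 'm) quiver_rep \<Rightarrow> ('v, 'a, 'k, 'n) quiver_rep \<Rightarrow> bool" where
  "ext0 M N \<longleftrightarrow> (\<forall>c. (\<forall>a\<in>arcs Q. c a \<in> module_hom K (space M (tail Q a)) (space N (head Q a))) \<longrightarrow>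
     (\<exists>t. (\<forall>v\<in>I. t v \<in> module_hom K (space M v) (space N v)) \<and>
       (\<forall>a\<in>arcs Q. \<forall>x\<in>car M (tail Q a). t (head Q a) (arrow_map M a x) =
          arrow_map N a (t (tail Q a) x) \<oplus>\<^bsub>space N (head Q a)\<^esub> c a x)))"

lemma ext0D:
  assumes "ext0 M N" "\<And>a. a \<in> arcs Q \<Longrightarrow> c a \<in> module_hom K (space M (tail Q a)) (space N (head Q a))"
  shows "\<exists>t. (\<forall>v\<in>I. t v \<in> module_hom K (space M v) (space N v)) \<and>
       (\<forall>a\<in>arcs Q. \<forall>x\<in>car M (tail Q a). t (head Q a) (arrow_map M a x) =
          arrow_map N a (t (tail Q a) x) \<oplus>\<^bsub>space N (head Q a)\<^esub> c a x)"
  using assms(1)[unfolded ext0_def, rule_format, of c, OF assms(2)] .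

text \<open>Right exactness of Ext: a cocycle on \<open>A\<close> extends to \<open>A'\<close> arrow
  by arrow, since families over the arrows of a quiver satisfy no cocycle condition, and a solution
  over \<open>A'\<close> restricts to \<open>A\<close>.\<close>

lemma ext0_mono:
  assumes A: "rep A" and A': "rep A'" and B: "rep B" and m: "mono A A' \<phi>" and e: "ext0 A' B"
  shows "ext0 A B"
  unfolding ext0_def
proof (intro allI impI)
  fix c assume c: "\<forall>a\<in>arcs Q. c a \<in> module_hom K (space A (tail Q a)) (space B (head Q a))"
  have h: "\<phi> \<in> Hom A A'" and inj: "\<And>v. v \<in> I \<Longrightarrow> inj_on (\<phi> v) (car A v)" using m by (auto simp: mono_def)
  have "\<exists>g. g \<in> module_hom K (space A' (tail Q a)) (space B (head Q a)) \<and>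
      (\<forall>x\<in>car A (tail Q a). g (\<phi> (tail Q a) x) = c a x)" if a: "a \<in> arcs Q" for a
    by (rule hom_extend_inj[OF repD(1)[OF A tail_I[OF a]] repD(1)[OF A' tail_I[OF a]] repD(1)[OF B head_I[OF a]]
        HomD(1)[OF h tail_I[OF a]] inj[OF tail_I[OF a]] c[rule_format, OF a]]) blast
  then obtain c' where c': "\<And>a. a \<in> arcs Q \<Longrightarrow> c' a \<in> module_hom K (space A' (tail Q a)) (space B (head Q a))"
    "\<And>a x. a \<in> arcs Q \<Longrightarrow> x \<in> car A (tail Q a) \<Longrightarrow> c' a (\<phi> (tail Q a) x) = c a x" by metis
  obtain t where t: "\<And>v. v \<in> I \<Longrightarrow> t v \<in> module_hom K (space A' v) (space B v)"
    "\<And>a x. a \<in> arcs Q \<Longrightarrow> x \<in> car A' (tail Q a) \<Longrightarrow> t (head Q a) (arrow_map A' a x) =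
          arrow_map B a (t (tail Q a) x) \<oplus>\<^bsub>space B (head Q a)\<^esub> c' a x"
    using ext0D[OF e c'(1)] by blast
  show "\<exists>t. (\<forall>v\<in>I. t v \<in> module_hom K (space A v) (space B v)) \<and>
       (\<forall>a\<in>arcs Q. \<forall>x\<in>car A (tail Q a). t (head Q a) (arrow_map A a x) =
          arrow_map B a (t (tail Q a) x) \<oplus>\<^bsub>space B (head Q a)\<^esub> c a x)"
  proof (intro exI[of _ "\<lambda>v x. t v (\<phi> v x)"] conjI ballI)
    fix v assume v: "v \<in> I"
    show "(\<lambda>x. t v (\<phi> v x)) \<in> module_hom K (space A v) (space B v)"
      by (rule module_hom_comp[OF HomD(1)[OF h v] t(1)[OF v]])
  next
    fix a x assume a: "a \<in> arcs Q" "x \<in> car A (tail Q a)"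
    then show "t (head Q a) (\<phi> (head Q a) (arrow_map A a x)) =
        arrow_map B a (t (tail Q a) (\<phi> (tail Q a) x)) \<oplus>\<^bsub>space B (head Q a)\<^esub> c a x"
      using t(2)[OF a(1) HomD(2)[OF h tail_I[OF a(1)] a(2)]] HomD(3)[OF h a] c'(2)[OF a] by simp
  qed
qed

text \<open>Dual right exactness: lift the cocycle arrow by arrow along \<open>p\<close>, solve over
  \<open>B'\<close>, and push the solution forward.\<close>

lemma ext0_onto:
  assumes A: "rep A" and B': "rep B'" and B: "rep B" and o: "onto B' B p" and e: "ext0 A B'"
  shows "ext0 A B"
  unfolding ext0_def
proof (intro allI impI)
  fix c assume c: "\<forall>a\<in>arcs Q. c a \<in> module_hom K (space A (tail Q a)) (space B (head Q a))"
  have h: "p \<in> Hom B' B" and surj: "\<And>v. v \<in> I \<Longrightarrow> p v ` car B' v = car B v" using o by (auto simp: onto_def)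
  have "\<exists>g. g \<in> module_hom K (space A (tail Q a)) (space B' (head Q a)) \<and>
      (\<forall>x\<in>car A (tail Q a). p (head Q a) (g x) = c a x)" if a: "a \<in> arcs Q" for a
    by (rule hom_lift[OF repD(1)[OF A tail_I[OF a]] repD(1)[OF B' head_I[OF a]] repD(1)[OF B head_I[OF a]]
        HomD(1)[OF h head_I[OF a]] surj[OF head_I[OF a]] c[rule_format, OF a]]) blast
  then obtain c' where c': "\<And>a. a \<in> arcs Q \<Longrightarrow> c' a \<in> module_hom K (space A (tail Q a)) (space B' (head Q a))"
    "\<And>a x. a \<in> arcs Q \<Longrightarrow> x \<in> car A (tail Q a) \<Longrightarrow> p (head Q a) (c' a x) = c a x" by metis
  obtain t where t: "\<And>v. v \<in> I \<Longrightarrow> t v \<in> module_hom K (space A v) (space B' v)"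
    "\<And>a x. a \<in> arcs Q \<Longrightarrow> x \<in> car A (tail Q a) \<Longrightarrow> t (head Q a) (arrow_map A a x) =
          arrow_map B' a (t (tail Q a) x) \<oplus>\<^bsub>space B' (head Q a)\<^esub> c' a x"
    using ext0D[OF e c'(1)] by blast
  show "\<exists>t. (\<forall>v\<in>I. t v \<in> module_hom K (space A v) (space B v)) \<and>
       (\<forall>a\<in>arcs Q. \<forall>x\<in>car A (tail Q a). t (head Q a) (arrow_map A a x) =
          arrow_map B a (t (tail Q a) x) \<oplus>\<^bsub>space B (head Q a)\<^esub> c a x)"
  proof (intro exI[of _ "\<lambda>v x. p v (t v x)"] conjI ballI)
    fix v assume v: "v \<in> I"
    show "(\<lambda>x. p v (t v x)) \<in> module_hom K (space A v) (space B v)"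
      by (rule module_hom_comp[OF t(1)[OF v] HomD(1)[OF h v]])
  next
    fix a x assume a: "a \<in> arcs Q" "x \<in> car A (tail Q a)"
    have tx: "t (tail Q a) x \<in> car B' (tail Q a)" using module_homD(1)[OF t(1)] a by simp
    have "c' a x \<in> car B' (head Q a)" using module_homD(1)[OF c'(1)[OF a(1)] a(2)] .
    then have "p (head Q a) (arrow_map B' a (t (tail Q a) x) \<oplus>\<^bsub>space B' (head Q a)\<^esub> c' a x) =
       p (head Q a) (arrow_map B' a (t (tail Q a) x)) \<oplus>\<^bsub>space B (head Q a)\<^esub> p (head Q a) (c' a x)"
      using module_homD(2)[OF HomD(1)[OF h head_I[OF a(1)]]] arrow_closed[OF B' a(1) tx] by blast
    then show "p (head Q a) (t (head Q a) (arrow_map A a x)) =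
        arrow_map B a (p (tail Q a) (t (tail Q a) x)) \<oplus>\<^bsub>space B (head Q a)\<^esub> c a x"
      using t(2)[OF a] HomD(3)[OF h a(1) tx] c'(2)[OF a] by simp
  qed
qed

lemma ext0_iso:
  assumes "rep A" "rep A'" "rep B" "rep B'" "A \<approx> A'" "B' \<approx> B" "ext0 A' B'"
  shows "ext0 A B"
  using ext0_mono[OF assms(1,2,4)] ext0_onto[OF assms(1,4,3)] assms(5-7) unfolding iso_iff by blast

lemma ext0_sub: "rep A \<Longrightarrow> rep B \<Longrightarrow> X \<in> subs A \<Longrightarrow> ext0 A B \<Longrightarrow> ext0 (sub_rep A X) B"
proof -
  assume a: "rep A" "rep B" "X \<in> subs A" "ext0 A B"
  have "mono (sub_rep A X) A (\<lambda>v x. x)" using Hom_incl[OF a(1,3)] by (simp add: mono_def)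
  then show ?thesis using ext0_mono[OF rep_sub_rep[OF a(1,3)] a(1,2)] a(4) by blast
qed

section \<open>Direct sum decompositions and splitting\<close>

abbreviation comp :: "('v, 'a, 'k, 'm) quiver_rep \<Rightarrow> ('v \<Rightarrow> 'm set) \<Rightarrow> ('v \<Rightarrow> 'm set) \<Rightarrow> bool" where
  "comp M X Y \<equiv> complementary_subreps Q K M X Y"

lemma compD:
  assumes "comp M X Y"
  shows "X \<in> subs M" "Y \<in> subs M" "v \<in> I \<Longrightarrow> X v \<inter> Y v = {zer M v}" "v \<in> I \<Longrightarrow> X v <+>\<^bsub>space M v\<^esub> Y v = car M v"
  using assms by (auto simp: complementary_subreps_def)

lemma comp_sym: "rep M \<Longrightarrow> comp M X Y \<Longrightarrow> comp M Y X"
proof -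
  assume M: "rep M" and c: "comp M X Y"
  have "Y v <+>\<^bsub>space M v\<^esub> X v = X v <+>\<^bsub>space M v\<^esub> Y v" if v: "v \<in> I" for v
  proof -
    interpret V: vectorspace K "space M v" using repD(2)[OF M v] .
    have cm: "x \<oplus>\<^bsub>space M v\<^esub> y = y \<oplus>\<^bsub>space M v\<^esub> x" if "x \<in> X v" "y \<in> Y v" for x y
      by (rule V.a_comm[OF subs_mem[OF compD(1)[OF c] v that(1)] subs_mem[OF compD(2)[OF c] v that(2)]])
    have "z \<in> Y v <+>\<^bsub>space M v\<^esub> X v \<longleftrightarrow> z \<in> X v <+>\<^bsub>space M v\<^esub> Y v" for z
      unfolding set_add_mem using cm by metis
    then show ?thesis by blast
  qed
  then show ?thesis using c by (auto simp: complementary_subreps_def Int_commute)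
qed

lemma comp_iso_quot:
  assumes M: "rep M" and c: "comp M X Y"
  shows "mono (sub_rep M Y) (quot M X) (proj M X)" "onto (sub_rep M Y) (quot M X) (proj M X)"
proof -
  note X = compD(1)[OF c] and Y = compD(2)[OF c]
  note Qu = quot[OF M X]
  have ph: "proj M X \<in> Hom M (quot M X)" using Qu(2) by (simp add: onto_def)
  have h: "proj M X \<in> Hom (sub_rep M Y) (quot M X)" by (rule Hom_restrict[OF M Y ph])
  have "ker_sub (sub_rep M Y) (quot M X) (proj M X) v = {zer M v}" if v: "v \<in> I" for v
  proof -
    have "X v = {x \<in> car M v. proj M X v x = zer (quot M X) v}" using fun_cong[OF Qu(3), of v] v by (simp add: ker_sub_def)
    then show ?thesis using v compD(3)[OF c v] subs_mem[OF Y v] by (auto simp: ker_sub_def)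
  qed
  then have "ker_sub (sub_rep M Y) (quot M X) (proj M X) = zero_sub (sub_rep M Y)"
    by (intro ext) (auto simp: ker_sub_def zero_sub_def)
  then show "mono (sub_rep M Y) (quot M X) (proj M X)"
    using mono_iff[OF rep_sub_rep[OF M Y] Qu(1) h] by simp
  have "\<exists>y\<in>Y v. z = proj M X v y" if v: "v \<in> I" and z: "z \<in> car (quot M X) v" for v z
  proof -
    interpret V: vectorspace K "space M v" using repD(2)[OF M v] .
    have "z \<in> proj M X v ` car M v" using Qu(2) v z by (simp add: onto_def)
    then obtain m where m: "m \<in> car M v" "z = proj M X v m" by blast
    then obtain x y where xy: "x \<in> X v" "y \<in> Y v" "m = x \<oplus>\<^bsub>space M v\<^esub> y"
      using compD(4)[OF c v] unfolding set_add_mem[symmetric] by (metis set_add_mem)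
    have cc: "x \<in> car M v" "y \<in> car M v" using xy subs_mem[OF X v] subs_mem[OF Y v] by auto
    have "m \<ominus>\<^bsub>space M v\<^esub> y = x" using xy cc by (simp add: a_minus_def V.a_assoc V.r_neg)
    then have "proj M X v m = proj M X v y" using coset_eq_iff[OF subsD(2)[OF X v] m(1) cc(2)] xy by (simp add: proj_def)
    then show ?thesis using m xy by auto
  qed
  then have "proj M X v ` Y v = car (quot M X) v" if v: "v \<in> I" for v
    using v HomD(2)[OF ph v] subs_mem[OF Y v] by fastforce
  then show "onto (sub_rep M Y) (quot M X) (proj M X)" using h by (simp add: onto_def)
qed

lemma comp_quot_iso: "rep M \<Longrightarrow> comp M X Y \<Longrightarrow> sub_rep M Y \<approx> quot M X"
  using comp_iso_quot iso_iff by blast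

lemma dv_comp: "rep M \<Longrightarrow> comp M X Y \<Longrightarrow> dv M v = dv (sub_rep M X) v + dv (sub_rep M Y) v"
  using dv_quot[OF _ compD(1), of M X Y v] dv_iso[OF rep_sub_rep[OF _ compD(2)] quot(1)[OF _ compD(1)] comp_quot_iso]
  by metis

text \<open>The projection along \<open>Y\<close> is M -> M/Y followed by the inverse of the
  isomorphism X -> M/Y.\<close>

lemma comp_proj:
  assumes M: "rep M" and c: "comp M X Y"
  obtains p where "p \<in> Hom M (sub_rep M X)" "\<And>v x. v \<in> I \<Longrightarrow> x \<in> X v \<Longrightarrow> p v x = x"
    "\<And>v y. v \<in> I \<Longrightarrow> y \<in> Y v \<Longrightarrow> p v y = zer M v"
proof -
  note c' = comp_sym[OF M c]
  note X = compD(1)[OF c] and Y = compD(2)[OF c]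
  note Qu = quot[OF M Y] and m = comp_iso_quot[OF M c']
  have h: "proj M Y \<in> Hom (sub_rep M X) (quot M Y)" using m(1) by (simp add: mono_def)
  have "ker_sub (sub_rep M X) (quot M Y) (proj M Y) = zero_sub (sub_rep M X)"
    using mono_iff[OF rep_sub_rep[OF M X] Qu(1) h] m by simp
  then obtain \<eta> where e: "\<eta> \<in> Hom (quot M Y) (sub_rep M X)"
    "\<And>v x. v \<in> I \<Longrightarrow> x \<in> X v \<Longrightarrow> \<eta> v (proj M Y v x) = x"
    using factor[OF rep_sub_rep[OF M X] Qu(1) rep_sub_rep[OF M X] m(2) Hom_id]
      mono_id_ker[OF rep_sub_rep[OF M X]] by auto
  have ph: "proj M Y \<in> Hom M (quot M Y)" using Qu(2) by (simp add: onto_def)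
  show ?thesis
  proof (rule that[of "\<lambda>v x. \<eta> v (proj M Y v x)"])
    show "(\<lambda>v x. \<eta> v (proj M Y v x)) \<in> Hom M (sub_rep M X)" by (rule Hom_comp[OF ph e(1)])
    fix v y assume v: "v \<in> I" and y: "y \<in> Y v"
    have "proj M Y v y = zer (quot M Y) v" using fun_cong[OF Qu(3), of v] v y by (auto simp: ker_sub_def)
    then show "\<eta> v (proj M Y v y) = zer M v"
      using Hom_zero[OF Qu(1) rep_sub_rep[OF M X] e(1) v] by simp
  qed (use e(2) in auto)
qed

text \<open>The two isomorphisms, composed with the projections and added, give an injective map
  because the two parts land in complementary subrepresentations; equality of dimensions then makes
  it bijective.\<close>

lemma split_iso:
  assumes M: "rep M" and M': "rep M'" and c: "comp M X Y" and c': "comp M' X' Y'"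
    and iX: "sub_rep M X \<approx> sub_rep M' X'" and iY: "sub_rep M Y \<approx> sub_rep M' Y'"
  shows "M \<approx> M'"
proof -
  note X = compD(1)[OF c] and Y = compD(2)[OF c] and X' = compD(1)[OF c'] and Y' = compD(2)[OF c']
  obtain \<alpha> where al: "mono (sub_rep M X) (sub_rep M' X') \<alpha>" using iX iso_iff by blast
  obtain \<beta> where be: "mono (sub_rep M Y) (sub_rep M' Y') \<beta>" using iY iso_iff by blast
  have alh: "\<alpha> \<in> Hom (sub_rep M X) (sub_rep M' X')" and beh: "\<beta> \<in> Hom (sub_rep M Y) (sub_rep M' Y')"
    using al be by (auto simp: mono_def)
  obtain p where p: "p \<in> Hom M (sub_rep M X)" "\<And>v x. v \<in> I \<Longrightarrow> x \<in> X v \<Longrightarrow> p v x = x"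
    "\<And>v y. v \<in> I \<Longrightarrow> y \<in> Y v \<Longrightarrow> p v y = zer M v" using comp_proj[OF M c] by blast
  obtain r where r: "r \<in> Hom M (sub_rep M Y)" "\<And>v x. v \<in> I \<Longrightarrow> x \<in> Y v \<Longrightarrow> r v x = x"
    "\<And>v y. v \<in> I \<Longrightarrow> y \<in> X v \<Longrightarrow> r v y = zer M v" using comp_proj[OF M comp_sym[OF M c]] by blast
  define A where "A = (\<lambda>v x. \<alpha> v (p v x))"
  define B where "B = (\<lambda>v x. \<beta> v (r v x))"
  have A: "A \<in> Hom M M'" unfolding A_def
    using Hom_comp[OF Hom_comp[OF p(1) alh] Hom_incl[OF M' X']] .
  have B: "B \<in> Hom M M'" unfolding B_def
    using Hom_comp[OF Hom_comp[OF r(1) beh] Hom_incl[OF M' Y']] .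
  let ?f = "\<lambda>v x. A v x \<oplus>\<^bsub>space M' v\<^esub> B v x"
  have f: "?f \<in> Hom M M'" by (rule Hom_add[OF M M' A B])
  have "m = zer M v" if v: "v \<in> I" and m: "m \<in> car M v" "?f v m = zer M' v" for v m
  proof -
    interpret V: vectorspace K "space M v" using repD(2)[OF M v] .
    interpret V': vectorspace K "space M' v" using repD(2)[OF M' v] .
    have pm: "p v m \<in> X v" "r v m \<in> Y v" using HomD(2)[OF p(1) v m(1)] HomD(2)[OF r(1) v m(1)] by auto
    have am: "A v m \<in> X' v" "B v m \<in> Y' v"
      using HomD(2)[OF alh v, of "p v m"] HomD(2)[OF beh v, of "r v m"] pm by (auto simp: A_def B_def)
    have cm: "A v m \<in> car M' v" "B v m \<in> car M' v" using am subs_mem[OF X' v] subs_mem[OF Y' v] by auto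
    have "A v m = \<ominus>\<^bsub>space M' v\<^esub> B v m" using m(2) cm V'.minus_equality by (simp add: V'.a_comm)
    then have "A v m \<in> Y' v" using subspace_minus(2)[OF subsD(2)[OF Y' v] am(2) am(2)] by simp
    then have A0: "A v m = zer M' v" using am compD(3)[OF c' v] by auto
    then have B0: "B v m = zer M' v" using m(2) cm by simp
    have "p v m = zer M v"
      using mono_iff[OF rep_sub_rep[OF M X] rep_sub_rep[OF M' X'] alh] al A0 pm v
      by (auto simp: A_def fun_eq_iff ker_sub_def zero_sub_def split: if_splits)
    moreover have "r v m = zer M v"
      using mono_iff[OF rep_sub_rep[OF M Y] rep_sub_rep[OF M' Y'] beh] be B0 pm v
      by (auto simp: B_def fun_eq_iff ker_sub_def zero_sub_def split: if_splits)
    moreover obtain x y where xy: "x \<in> X v" "y \<in> Y v" "m = x \<oplus>\<^bsub>space M v\<^esub> y"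
      using m(1) unfolding compD(4)[OF c v, symmetric] set_add_mem by blast
    moreover have "p v m = x"
    proof -
      have "p v m = p v x \<oplus>\<^bsub>space M v\<^esub> p v y"
        using module_homD(2)[OF HomD(1)[OF p(1) v]] xy subs_mem[OF X v] subs_mem[OF Y v] by simp
      then show ?thesis using p(2,3)[OF v] xy subs_mem[OF X v] by simp
    qed
    moreover have "r v m = y"
    proof -
      have "r v m = r v x \<oplus>\<^bsub>space M v\<^esub> r v y"
        using module_homD(2)[OF HomD(1)[OF r(1) v]] xy subs_mem[OF X v] subs_mem[OF Y v] by simp
      then show ?thesis using r(2,3)[OF v] xy subs_mem[OF Y v] by simp
    qed
    ultimately show ?thesis by (metis V.l_zero V.zero_closed)
  qed
  then have "ker_sub M M' ?f = zero_sub M"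
    using Hom_zero[OF M M' f] zer_closed[OF M] by (intro ext) (auto simp: ker_sub_def zero_sub_def)
  then have "mono M M' ?f" using mono_iff[OF M M' f] by simp
  moreover have "dv M = dv M'"
    using dv_comp[OF M c] dv_comp[OF M' c'] dv_iso[OF rep_sub_rep[OF M X] rep_sub_rep[OF M' X'] iX]
      dv_iso[OF rep_sub_rep[OF M Y] rep_sub_rep[OF M' Y'] iY] by (intro ext) simp
  ultimately show ?thesis by (rule mono_dv_iso[OF M M'])
qed

lemma section_comp:
  assumes M: "rep M" and A: "rep A" and o: "onto M A \<pi>" and k: "ker_sub M A \<pi> = X"
    and s: "\<sigma> \<in> Hom A M" "\<And>v x. v \<in> I \<Longrightarrow> x \<in> car A v \<Longrightarrow> \<pi> v (\<sigma> v x) = x"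
  shows "comp M X (im_sub \<sigma> (full_sub A))"
proof -
  have ph: "\<pi> \<in> Hom M A" using o by (simp add: onto_def)
  have X: "X \<in> subs M" using ker_sub[OF M A ph] k by simp
  have Y: "im_sub \<sigma> (full_sub A) \<in> subs M" by (rule im_sub[OF A M s(1) full_sub[OF A]])
  have Xv: "X v = {x \<in> car M v. \<pi> v x = zer A v}" if "v \<in> I" for v unfolding k[symmetric] using that by (simp add: ker_sub_def)
  have "X v \<inter> im_sub \<sigma> (full_sub A) v = {zer M v}" if v: "v \<in> I" for v
  proof -
    have "\<sigma> v a = zer M v" if "a \<in> car A v" "\<sigma> v a \<in> X v" for a
      using that Xv[OF v] s(2)[OF v] Hom_zero[OF A M s(1) v] by fastforce
    then show ?thesis using subsD(4)[OF X v] subsD(4)[OF Y v] v by (auto simp: im_sub_def full_sub_def)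
  qed
  moreover have "X v <+>\<^bsub>space M v\<^esub> im_sub \<sigma> (full_sub A) v = car M v" if v: "v \<in> I" for v
  proof
    interpret V: vectorspace K "space M v" using repD(2)[OF M v] .
    interpret A: vectorspace K "space A v" using repD(2)[OF A v] .
    show "X v <+>\<^bsub>space M v\<^esub> im_sub \<sigma> (full_sub A) v \<subseteq> car M v"
      using subs_mem[OF X v] subs_mem[OF Y v] by (auto simp: set_add_mem)
    show "car M v \<subseteq> X v <+>\<^bsub>space M v\<^esub> im_sub \<sigma> (full_sub A) v"
    proof
      fix m assume m: "m \<in> car M v"
      let ?y = "\<sigma> v (\<pi> v m)"
      have pm: "\<pi> v m \<in> car A v" using HomD(2)[OF ph v m] .
      have y: "?y \<in> car M v" using HomD(2)[OF s(1) v pm] .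
      have "\<pi> v (m \<ominus>\<^bsub>space M v\<^esub> ?y) = \<pi> v m \<ominus>\<^bsub>space A v\<^esub> \<pi> v m"
        using module_hom_minus(1)[OF repD(2)[OF M v] repD(2)[OF A v] HomD(1)[OF ph v] m y] s(2)[OF v pm] by simp
      then have "m \<ominus>\<^bsub>space M v\<^esub> ?y \<in> X v" using Xv[OF v] m y pm by (simp add: a_minus_def A.r_neg)
      moreover have "?y \<in> im_sub \<sigma> (full_sub A) v" using v pm by (simp add: im_sub_def full_sub_def)
      moreover have "m = (m \<ominus>\<^bsub>space M v\<^esub> ?y) \<oplus>\<^bsub>space M v\<^esub> ?y"
        using m y by (simp add: a_minus_def V.a_assoc V.l_neg)
      ultimately show "m \<in> X v <+>\<^bsub>space M v\<^esub> im_sub \<sigma> (full_sub A) v" unfolding set_add_mem by blast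
    qed
  qed
  ultimately show ?thesis using X Y by (simp add: complementary_subreps_def)
qed

text \<open>Choose a linear section \<open>s\<close> at each vertex. Its failure \<open>c\<close> to
  commute with the arrows is a cocycle with values in \<open>X\<close>; the sign of \<open>c\<close>
  is such that a solution \<open>t\<close> of the coboundary equation is added to
  \<open>s\<close>.\<close>

lemma ext0_section:
  assumes M: "rep M" and A: "rep A" and o: "onto M A \<pi>" and k: "ker_sub M A \<pi> = X"
    and e: "ext0 A (sub_rep M X)"
  obtains \<sigma> where "\<sigma> \<in> Hom A M" "\<And>v x. v \<in> I \<Longrightarrow> x \<in> car A v \<Longrightarrow> \<pi> v (\<sigma> v x) = x"
proof -
  have ph: "\<pi> \<in> Hom M A" and surj: "\<And>v. v \<in> I \<Longrightarrow> \<pi> v ` car M v = car A v" using o by (auto simp: onto_def)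
  have X: "X \<in> subs M" using ker_sub[OF M A ph] k by simp
  have Xv: "X v = {x \<in> car M v. \<pi> v x = zer A v}" if "v \<in> I" for v unfolding k[symmetric] using that by (simp add: ker_sub_def)
  have "\<exists>g. g \<in> module_hom K (space A v) (space M v) \<and> (\<forall>x\<in>car A v. \<pi> v (g x) = x)" if v: "v \<in> I" for v
  proof -
    have id: "(\<lambda>x. x) \<in> module_hom K (space A v) (space A v)" by (rule module_homI) auto
    show ?thesis
      by (rule hom_lift[OF repD(1)[OF A v] repD(1)[OF M v] repD(1)[OF A v] HomD(1)[OF ph v] surj[OF v] id]) blast
  qed
  then obtain s where s: "\<And>v. v \<in> I \<Longrightarrow> s v \<in> module_hom K (space A v) (space M v)"
    "\<And>v x. v \<in> I \<Longrightarrow> x \<in> car A v \<Longrightarrow> \<pi> v (s v x) = x" by metis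
  define c where "c a x = arrow_map M a (s (tail Q a) x) \<ominus>\<^bsub>space M (head Q a)\<^esub> s (head Q a) (arrow_map A a x)" for a x
  have ca: "c a \<in> module_hom K (space A (tail Q a)) (space (sub_rep M X) (head Q a))" if a: "a \<in> arcs Q" for a
  proof -
    note t = tail_I[OF a] and h = head_I[OF a]
    have 1: "c a \<in> module_hom K (space A (tail Q a)) (space M (head Q a))"
      unfolding c_def[abs_def]
      by (rule module_hom_diff[OF repD(2)[OF A t] repD(2)[OF M h] module_hom_comp[OF s(1)[OF t] repD(3)[OF M a]]
            module_hom_comp[OF repD(3)[OF A a] s(1)[OF h]]])
    have "c a x \<in> X (head Q a)" if x: "x \<in> car A (tail Q a)" for x
    proof -
      interpret Ah: vectorspace K "space A (head Q a)" using repD(2)[OF A h] .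
      have sx: "s (tail Q a) x \<in> car M (tail Q a)" using module_homD(1)[OF s(1)[OF t] x] .
      have ax: "arrow_map A a x \<in> car A (head Q a)" by (rule arrow_closed[OF A a x])
      have "\<pi> (head Q a) (c a x) = \<pi> (head Q a) (arrow_map M a (s (tail Q a) x)) \<ominus>\<^bsub>space A (head Q a)\<^esub> \<pi> (head Q a) (s (head Q a) (arrow_map A a x))"
        unfolding c_def
        by (rule module_hom_minus(1)[OF repD(2)[OF M h] repD(2)[OF A h] HomD(1)[OF ph h] arrow_closed[OF M a sx]
            module_homD(1)[OF s(1)[OF h] ax]])
      also have "\<dots> = zer A (head Q a)"
        using HomD(3)[OF ph a sx] s(2)[OF t x] s(2)[OF h ax] ax by (simp add: a_minus_def Ah.r_neg)
      finally show ?thesis using Xv[OF h] module_homD(1)[OF 1 x] by simp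
    qed
    then show ?thesis by (intro module_homI) (simp_all add: module_homD[OF 1])
  qed
  obtain t where t: "\<And>v. v \<in> I \<Longrightarrow> t v \<in> module_hom K (space A v) (space (sub_rep M X) v)"
    "\<And>a x. a \<in> arcs Q \<Longrightarrow> x \<in> car A (tail Q a) \<Longrightarrow> t (head Q a) (arrow_map A a x) =
          arrow_map M a (t (tail Q a) x) \<oplus>\<^bsub>space M (head Q a)\<^esub> c a x"
    using ext0D[OF e ca] unfolding sub_rep_simps by auto
  have tX: "t v x \<in> X v" if "v \<in> I" "x \<in> car A v" for v x using module_homD(1)[OF t(1)] that by simp
  have tM: "t v \<in> module_hom K (space A v) (space M v)" if v: "v \<in> I" for v
    using tX[OF v] subs_mem[OF X v] module_homD(2,3)[OF t(1)[OF v]] by (intro module_homI) auto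
  define \<sigma> where "\<sigma> v x = s v x \<oplus>\<^bsub>space M v\<^esub> t v x" for v x
  show ?thesis
  proof (rule that[of \<sigma>])
    show "\<sigma> \<in> Hom A M"
    proof (rule HomI)
      fix v assume v: "v \<in> I"
      show "\<sigma> v \<in> module_hom K (space A v) (space M v)" unfolding \<sigma>_def[abs_def]
        by (rule module_hom_add[OF repD(2)[OF A v] repD(2)[OF M v] s(1)[OF v] tM[OF v]])
    next
      fix a x assume a: "a \<in> arcs Q" and x: "x \<in> car A (tail Q a)"
      note ti = tail_I[OF a] and h = head_I[OF a]
      interpret V: vectorspace K "space M (head Q a)" using repD(2)[OF M h] .
      have sx: "s (tail Q a) x \<in> car M (tail Q a)" using module_homD(1)[OF s(1)[OF ti] x] .
      have tx: "t (tail Q a) x \<in> car M (tail Q a)" using module_homD(1)[OF tM[OF ti] x] .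
      have sa: "s (head Q a) (arrow_map A a x) \<in> car M (head Q a)"
        using module_homD(1)[OF s(1)[OF h] arrow_closed[OF A a x]] .
      let ?S = "arrow_map M a (s (tail Q a) x)" and ?T = "arrow_map M a (t (tail Q a) x)"
      have ST: "?S \<in> car M (head Q a)" "?T \<in> car M (head Q a)" using arrow_closed[OF M a] sx tx by auto
      have "\<sigma> (head Q a) (arrow_map A a x) = s (head Q a) (arrow_map A a x) \<oplus>\<^bsub>space M (head Q a)\<^esub>
         (?T \<oplus>\<^bsub>space M (head Q a)\<^esub> (?S \<ominus>\<^bsub>space M (head Q a)\<^esub> s (head Q a) (arrow_map A a x)))"
        using t(2)[OF a x] by (simp add: \<sigma>_def c_def)
      also have "\<dots> = ?S \<oplus>\<^bsub>space M (head Q a)\<^esub> ?T"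
        using sa ST by (simp add: a_minus_def V.a_ac V.r_neg1 V.r_neg)
      also have "\<dots> = arrow_map M a (\<sigma> (tail Q a) x)"
        using module_homD(2)[OF repD(3)[OF M a] sx tx] by (simp add: \<sigma>_def)
      finally show "\<sigma> (head Q a) (arrow_map A a x) = arrow_map M a (\<sigma> (tail Q a) x)" .
    qed
    fix v x assume v: "v \<in> I" and x: "x \<in> car A v"
    interpret V: vectorspace K "space A v" using repD(2)[OF A v] .
    have "\<pi> v (\<sigma> v x) = \<pi> v (s v x) \<oplus>\<^bsub>space A v\<^esub> \<pi> v (t v x)"
      unfolding \<sigma>_def using module_homD(2)[OF HomD(1)[OF ph v]] module_homD(1)[OF s(1)[OF v] x] module_homD(1)[OF tM[OF v] x] by blast
    also have "\<dots> = x" using s(2)[OF v x] tX[OF v x] Xv[OF v] x by simp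
    finally show "\<pi> v (\<sigma> v x) = x" .
  qed
qed

lemma ext0_comp:
  assumes M: "rep M" and X: "X \<in> subs M" and e: "ext0 (quot M X) (sub_rep M X)"
  obtains Y where "comp M X Y"
  using ext0_section[OF M quot[OF M X] e] section_comp[OF M quot[OF M X]] by metis

text \<open>Both extensions split, the second because vanishing of Ext depends only on the
  isomorphism classes of the ends. So the ends determine the middle term, which later isolates a
  single class in a coproduct coefficient.\<close>

lemma ext0_unique:
  assumes M: "rep M" and M': "rep M'" and X: "X \<in> subs M" and X': "X' \<in> subs M'"
    and e: "ext0 (quot M X) (sub_rep M X)"
    and i: "sub_rep M X \<approx> sub_rep M' X'" "quot M X \<approx> quot M' X'"
  shows "M \<approx> M'"
proof -
  obtain Y where Y: "comp M X Y" using ext0_comp[OF M X e] by blast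
  have "ext0 (quot M' X') (sub_rep M' X')"
    by (rule ext0_iso[OF quot(1)[OF M' X'] quot(1)[OF M X] rep_sub_rep[OF M' X'] rep_sub_rep[OF M X]
          iso_sym[OF quot(1)[OF M X] quot(1)[OF M' X'] i(2)] i(1) e])
  then obtain Y' where Y': "comp M' X' Y'" using ext0_comp[OF M' X'] by blast
  have "sub_rep M Y \<approx> sub_rep M' Y'"
    using iso_trans[OF comp_quot_iso[OF M Y] iso_trans[OF i(2)
      iso_sym[OF rep_sub_rep[OF M' compD(2)[OF Y']] quot(1)[OF M' X'] comp_quot_iso[OF M' Y']]]] .
  then show ?thesis using split_iso[OF M M' Y Y' i(1)] by blast
qed

end

section \<open>The Euler form\<close>

context finite_field
begin

lemma VS_exists:
  obtains V :: "('k, nat \<Rightarrow> 'k) module" where "VS V" "vdim V = n"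
proof -
  interpret field K by (rule field_K)
  let ?V = "func_space {..<n}"
  have vs: "vectorspace K ?V"
    unfolding vectorspace_def using func_space_is_module field_K by (auto simp: module_def)
  have car: "carrier ?V = {..<n} \<rightarrow>\<^sub>E carrier K" by (simp add: func_space_def)
  have fin: "finite (carrier ?V)" unfolding car by (rule finite_PiE) (auto simp: finite_K)
  have V: "VS ?V" using vs fin_dimI[OF vs fin] by simp
  have "q ^ vdim ?V = q ^ n" using card_VS(2)[OF V] by (simp add: car card_PiE q_def)
  then have "vdim ?V = n" using q_ge_2 by simp
  then show ?thesis using that V by blast
qed

end

section \<open>The two-term complex of Hom and Ext\<close>

context quiver_reps
begin

text \<open>Dimensions of the two terms of the complex below. They are kept as separate naturals,
  rather than as the difference that is the Euler form, so that they can be exponents of q.\<close>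

definition e0 :: "('v \<Rightarrow> nat) \<Rightarrow> ('v \<Rightarrow> nat) \<Rightarrow> nat" where "e0 x y = (\<Sum>v\<in>I. x v * y v)"
definition e1 :: "('v \<Rightarrow> nat) \<Rightarrow> ('v \<Rightarrow> nat) \<Rightarrow> nat" where "e1 x y = (\<Sum>a\<in>arcs Q. x (tail Q a) * y (head Q a))"

lemma euler_e: "euler_dim Q x y = int (e0 x y) - int (e1 x y)"
  by (simp add: euler_form_def e0_def e1_def)

text \<open>The standard complex of a quiver: the kernel of \<open>cob\<close> from
  \<open>C0\<close> to \<open>C1\<close> is Hom(M, N), the cokernel is Ext(M, N).\<close>

definition C0 :: "('v, 'a, 'k, 'm) quiver_rep \<Rightarrow> ('v, 'a, 'k, 'n) quiver_rep \<Rightarrow> ('v \<Rightarrow> 'm \<Rightarrow> 'n) set" where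
  "C0 M N = (\<Pi>\<^sub>E v\<in>I. LH (space M v) (space N v))"
definition C1 :: "('v, 'a, 'k, 'm) quiver_rep \<Rightarrow> ('v, 'a, 'k, 'n) quiver_rep \<Rightarrow> ('a \<Rightarrow> 'm \<Rightarrow> 'n) set" where
  "C1 M N = (\<Pi>\<^sub>E a\<in>arcs Q. LH (space M (tail Q a)) (space N (head Q a)))"
definition cob :: "('v, 'a, 'k, 'm) quiver_rep \<Rightarrow> ('v, 'a, 'k, 'n) quiver_rep \<Rightarrow> ('v \<Rightarrow> 'm \<Rightarrow> 'n) \<Rightarrow> 'a \<Rightarrow> 'm \<Rightarrow> 'n" where
  "cob M N t = (\<lambda>a\<in>arcs Q. \<lambda>x\<in>car M (tail Q a).
     t (head Q a) (arrow_map M a x) \<ominus>\<^bsub>space N (head Q a)\<^esub> arrow_map N a (t (tail Q a) x))"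
definition HomE :: "('v, 'a, 'k, 'm) quiver_rep \<Rightarrow> ('v, 'a, 'k, 'n) quiver_rep \<Rightarrow> ('v \<Rightarrow> 'm \<Rightarrow> 'n) set" where
  "HomE M N = Hom M N \<inter> C0 M N"

lemma C0_D: "t \<in> C0 M N \<Longrightarrow> v \<in> I \<Longrightarrow> t v \<in> LH (space M v) (space N v)"
  "t \<in> C0 M N \<Longrightarrow> v \<in> I \<Longrightarrow> t v \<in> module_hom K (space M v) (space N v)"
  "t \<in> C0 M N \<Longrightarrow> v \<in> I \<Longrightarrow> t v \<in> extensional (car M v)"
  "t \<in> C0 M N \<Longrightarrow> t \<in> extensional I"
  by (auto simp: C0_def LH_def PiE_def)

lemma C0_I:
  assumes "rep M" "\<And>v. v \<in> I \<Longrightarrow> t v \<in> module_hom K (space M v) (space N v)"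
  shows "(\<lambda>v\<in>I. restrict (t v) (car M v)) \<in> C0 M N"
  unfolding C0_def using restrict_LH[OF assms(2)] repD(2)[OF assms(1)] by auto

lemma C0_eqI:
  assumes "s \<in> C0 M N" "t \<in> C0 M N" "\<And>v x. v \<in> I \<Longrightarrow> x \<in> car M v \<Longrightarrow> s v x = t v x"
  shows "s = t"
proof (rule extensionalityI[OF C0_D(4)[OF assms(1)] C0_D(4)[OF assms(2)]])
  fix v assume v: "v \<in> I"
  show "s v = t v" by (rule extensionalityI[OF C0_D(3)[OF assms(1) v] C0_D(3)[OF assms(2) v] assms(3)[OF v]])
qed

lemma C1_eqI:
  assumes "s \<in> C1 M N" "t \<in> C1 M N" "\<And>a x. a \<in> arcs Q \<Longrightarrow> x \<in> car M (tail Q a) \<Longrightarrow> s a x = t a x"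
  shows "s = t"
proof (rule extensionalityI[of _ "arcs Q"])
  show "s \<in> extensional (arcs Q)" "t \<in> extensional (arcs Q)" using assms by (auto simp: C1_def PiE_def)
  fix a assume a: "a \<in> arcs Q"
  show "s a = t a"
  proof (rule extensionalityI[of _ "car M (tail Q a)"])
    show "s a \<in> extensional (car M (tail Q a))" "t a \<in> extensional (car M (tail Q a))"
      using assms(1,2) a by (auto simp: C1_def LH_def PiE_def Pi_def)
  qed (rule assms(3)[OF a])
qed

lemma HomE_restrict: "rep M \<Longrightarrow> \<phi> \<in> Hom M N \<Longrightarrow> (\<lambda>v\<in>I. restrict (\<phi> v) (car M v)) \<in> HomE M N"
  unfolding HomE_def using C0_I[of M \<phi> N] HomD(1)[of \<phi> M N] by (auto intro: Hom_cong)

lemma card_C0: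
  assumes "rep M" "rep N"
  shows "finite (C0 M N)" "card (C0 M N) = q ^ e0 (dv M) (dv N)"
proof -
  have fin: "finite (LH (space M v) (space N v))" and cd: "card (LH (space M v) (space N v)) = q ^ (dv M v * dv N v)"
    if v: "v \<in> I" for v
    using card_LH[OF repD(1)[OF assms(1) v] repD(1)[OF assms(2) v]] card_car[OF assms(2) v] v
    by (simp_all add: dv_vdim power_mult[symmetric] mult.commute)
  show "finite (C0 M N)" unfolding C0_def using fin by (intro finite_PiE) auto
  show "card (C0 M N) = q ^ e0 (dv M) (dv N)" unfolding C0_def e0_def using cd by (simp add: card_PiE power_sum)
qed

lemma card_C1:
  assumes "rep M" "rep N"
  shows "finite (C1 M N)" "card (C1 M N) = q ^ e1 (dv M) (dv N)"
proof -
  have fin: "finite (LH (space M (tail Q a)) (space N (head Q a)))"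
    and cd: "card (LH (space M (tail Q a)) (space N (head Q a))) = q ^ (dv M (tail Q a) * dv N (head Q a))"
    if a: "a \<in> arcs Q" for a
    using card_LH[OF repD(1)[OF assms(1) tail_I[OF a]] repD(1)[OF assms(2) head_I[OF a]]] card_car[OF assms(2) head_I[OF a]] a
    by (simp_all add: dv_vdim power_mult[symmetric] mult.commute)
  show "finite (C1 M N)" unfolding C1_def using fin by (intro finite_PiE) auto
  show "card (C1 M N) = q ^ e1 (dv M) (dv N)" unfolding C1_def e1_def using cd by (simp add: card_PiE power_sum)
qed

lemma cob_apply: "a \<in> arcs Q \<Longrightarrow> x \<in> car M (tail Q a) \<Longrightarrow> cob M N t a x =
     t (head Q a) (arrow_map M a x) \<ominus>\<^bsub>space N (head Q a)\<^esub> arrow_map N a (t (tail Q a) x)"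
  by (simp add: cob_def)

lemma cob_C1:
  assumes M: "rep M" and N: "rep N" and t: "t \<in> C0 M N"
  shows "cob M N t \<in> C1 M N"
  unfolding C1_def cob_def
proof (rule restrict_PiE_iff[THEN iffD2], rule ballI)
  fix a assume a: "a \<in> arcs Q"
  show "(\<lambda>x\<in>car M (tail Q a). t (head Q a) (arrow_map M a x) \<ominus>\<^bsub>space N (head Q a)\<^esub> arrow_map N a (t (tail Q a) x))
    \<in> LH (space M (tail Q a)) (space N (head Q a))"
    by (rule restrict_LH[OF module_hom_diff[OF repD(2)[OF M tail_I[OF a]] repD(2)[OF N head_I[OF a]]
      module_hom_comp[OF repD(3)[OF M a] C0_D(2)[OF t head_I[OF a]]]
      module_hom_comp[OF C0_D(2)[OF t tail_I[OF a]] repD(3)[OF N a]]] repD(2)[OF M tail_I[OF a]]])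
qed

definition padd :: "('v, 'a, 'k, 'm) quiver_rep \<Rightarrow> ('v, 'a, 'k, 'n) quiver_rep \<Rightarrow> ('v \<Rightarrow> 'm \<Rightarrow> 'n) \<Rightarrow> ('v \<Rightarrow> 'm \<Rightarrow> 'n) \<Rightarrow> 'v \<Rightarrow> 'm \<Rightarrow> 'n" where
  "padd M N s t = (\<lambda>v\<in>I. \<lambda>x\<in>car M v. s v x \<oplus>\<^bsub>space N v\<^esub> t v x)"
definition pdiff :: "('v, 'a, 'k, 'm) quiver_rep \<Rightarrow> ('v, 'a, 'k, 'n) quiver_rep \<Rightarrow> ('v \<Rightarrow> 'm \<Rightarrow> 'n) \<Rightarrow> ('v \<Rightarrow> 'm \<Rightarrow> 'n) \<Rightarrow> 'v \<Rightarrow> 'm \<Rightarrow> 'n" where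
  "pdiff M N s t = (\<lambda>v\<in>I. \<lambda>x\<in>car M v. s v x \<ominus>\<^bsub>space N v\<^esub> t v x)"

lemma padd_C0: "rep M \<Longrightarrow> rep N \<Longrightarrow> s \<in> C0 M N \<Longrightarrow> t \<in> C0 M N \<Longrightarrow> padd M N s t \<in> C0 M N"
  unfolding padd_def
  by (rule C0_I[of M "\<lambda>v x. s v x \<oplus>\<^bsub>space N v\<^esub> t v x" N]) (auto intro: module_hom_add repD C0_D)
lemma pdiff_C0: "rep M \<Longrightarrow> rep N \<Longrightarrow> s \<in> C0 M N \<Longrightarrow> t \<in> C0 M N \<Longrightarrow> pdiff M N s t \<in> C0 M N"
  unfolding pdiff_def
  by (rule C0_I[of M "\<lambda>v x. s v x \<ominus>\<^bsub>space N v\<^esub> t v x" N]) (auto intro: module_hom_diff repD C0_D)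

lemma (in abelian_group) diff_eq_iff:
  assumes "x \<in> carrier G" "y \<in> carrier G" shows "x \<ominus> y = \<zero> \<longleftrightarrow> x = y"
proof
  assume "x \<ominus> y = \<zero>"
  then have "(x \<ominus> y) \<oplus> y = y" using assms by simp
  then show "x = y" using assms by (simp add: a_minus_def a_assoc l_neg)
qed (simp add: assms a_minus_def r_neg)

lemma (in abelian_group) diff_eq_imp:
  assumes "x \<ominus> y = z" "x \<in> carrier G" "y \<in> carrier G" shows "x = y \<oplus> z"
proof -
  have "y \<oplus> (x \<oplus> \<ominus> y) = x \<oplus> (y \<oplus> \<ominus> y)" using assms(2,3) by (simp add: a_lcomm)
  also have "\<dots> = x" using assms(2,3) by (simp add: r_neg)
  finally show ?thesis using assms(1) by (simp add: a_minus_def)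
qed

lemma (in abelian_group) diff_diff_eq_iff:
  assumes "a \<in> carrier G" "b \<in> carrier G" "c \<in> carrier G" "d \<in> carrier G"
  shows "(a \<ominus> b) \<ominus> (c \<ominus> d) = (a \<ominus> c) \<ominus> (b \<ominus> d)"
  using assms by (simp add: a_minus_def minus_add a_ac)

lemma cob_pdiff:
  assumes M: "rep M" and N: "rep N" and s: "s \<in> C0 M N" and t: "t \<in> C0 M N"
    and a: "a \<in> arcs Q" and x: "x \<in> car M (tail Q a)"
  shows "cob M N (pdiff M N s t) a x = cob M N s a x \<ominus>\<^bsub>space N (head Q a)\<^esub> cob M N t a x"
proof -
  interpret N: vectorspace K "space N (head Q a)" using repD(2)[OF N head_I[OF a]] .
  have Mx: "arrow_map M a x \<in> car M (head Q a)" by (rule arrow_closed[OF M a x])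
  have c: "s (tail Q a) x \<in> car N (tail Q a)" "t (tail Q a) x \<in> car N (tail Q a)"
     "s (head Q a) (arrow_map M a x) \<in> car N (head Q a)" "t (head Q a) (arrow_map M a x) \<in> car N (head Q a)"
    using module_homD(1)[OF C0_D(2)[OF s tail_I[OF a]] x] module_homD(1)[OF C0_D(2)[OF t tail_I[OF a]] x]
      module_homD(1)[OF C0_D(2)[OF s head_I[OF a]] Mx] module_homD(1)[OF C0_D(2)[OF t head_I[OF a]] Mx] by auto
  have "arrow_map N a (s (tail Q a) x \<ominus>\<^bsub>space N (tail Q a)\<^esub> t (tail Q a) x) =
     arrow_map N a (s (tail Q a) x) \<ominus>\<^bsub>space N (head Q a)\<^esub> arrow_map N a (t (tail Q a) x)"
    by (rule module_hom_minus(1)[OF repD(2)[OF N tail_I[OF a]] repD(2)[OF N head_I[OF a]] repD(3)[OF N a] c(1,2)])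
  then show ?thesis using a x Mx c arrow_closed[OF N a c(1)] arrow_closed[OF N a c(2)]
    by (simp add: cob_apply pdiff_def N.diff_diff_eq_iff)
qed

lemma cob_zero_iff:
  assumes M: "rep M" and N: "rep N" and t: "t \<in> C0 M N"
  shows "t \<in> Hom M N \<longleftrightarrow> (\<forall>a\<in>arcs Q. \<forall>x\<in>car M (tail Q a). cob M N t a x = zer N (head Q a))"
proof -
  have "cob M N t a x = zer N (head Q a) \<longleftrightarrow> t (head Q a) (arrow_map M a x) = arrow_map N a (t (tail Q a) x)"
    if a: "a \<in> arcs Q" and x: "x \<in> car M (tail Q a)" for a x
  proof -
    interpret N: vectorspace K "space N (head Q a)" using repD(2)[OF N head_I[OF a]] .
    have "t (head Q a) (arrow_map M a x) \<in> car N (head Q a)"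
      by (rule module_homD(1)[OF C0_D(2)[OF t head_I[OF a]] arrow_closed[OF M a x]])
    moreover have "arrow_map N a (t (tail Q a) x) \<in> car N (head Q a)"
      by (rule arrow_closed[OF N a module_homD(1)[OF C0_D(2)[OF t tail_I[OF a]] x]])
    ultimately show ?thesis using N.diff_eq_iff a x by (simp add: cob_apply)
  qed
  then show ?thesis using C0_D(2)[OF t] unfolding rep_hom_def by auto
qed

text \<open>\<open>cob\<close> is additive, so each nonempty fibre is a translate of the kernel, and
  translation by \<open>t0\<close> is the bijection.\<close>

lemma cob_fibre:
  assumes M: "rep M" and N: "rep N" and t0: "t0 \<in> C0 M N"
  shows "card {t \<in> C0 M N. cob M N t = cob M N t0} = card (HomE M N)"
proof -
  have iff: "cob M N t = cob M N t0 \<longleftrightarrow> pdiff M N t t0 \<in> Hom M N" if t: "t \<in> C0 M N" for t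
  proof -
    have "(\<forall>a\<in>arcs Q. \<forall>x\<in>car M (tail Q a). cob M N (pdiff M N t t0) a x = zer N (head Q a)) \<longleftrightarrow>
      (\<forall>a\<in>arcs Q. \<forall>x\<in>car M (tail Q a). cob M N t a x = cob M N t0 a x)"
    proof (intro ball_cong refl)
      fix a x assume a: "a \<in> arcs Q" and x: "x \<in> car M (tail Q a)"
      interpret N: vectorspace K "space N (head Q a)" using repD(2)[OF N head_I[OF a]] .
      have "cob M N t a x \<in> car N (head Q a)" "cob M N t0 a x \<in> car N (head Q a)"
        using cob_C1[OF M N t] cob_C1[OF M N t0] a x unfolding C1_def LH_def
        by (auto simp: PiE_def Pi_def dest!: module_homD(1))
      then show "cob M N (pdiff M N t t0) a x = zer N (head Q a) \<longleftrightarrow> cob M N t a x = cob M N t0 a x"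
        using cob_pdiff[OF M N t t0 a x] N.diff_eq_iff by simp
    qed
    also have "\<dots> \<longleftrightarrow> cob M N t = cob M N t0" by (auto simp: cob_def fun_eq_iff)
    finally show ?thesis using cob_zero_iff[OF M N pdiff_C0[OF M N t t0]] by simp
  qed
  have "bij_betw (\<lambda>t. pdiff M N t t0) {t \<in> C0 M N. cob M N t = cob M N t0} (HomE M N)"
  proof (rule bij_betw_byWitness[where f' = "\<lambda>h. padd M N h t0"])
    have r: "padd M N (pdiff M N t t0) t0 = t" "pdiff M N (padd M N t t0) t0 = t" if t: "t \<in> C0 M N" for t
    proof -
      have "(t v x \<ominus>\<^bsub>space N v\<^esub> t0 v x) \<oplus>\<^bsub>space N v\<^esub> t0 v x = t v x"
        "(t v x \<oplus>\<^bsub>space N v\<^esub> t0 v x) \<ominus>\<^bsub>space N v\<^esub> t0 v x = t v x" if v: "v \<in> I" and x: "x \<in> car M v" for v x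
      proof -
        interpret N: vectorspace K "space N v" using repD(2)[OF N v] .
        have "t v x \<in> car N v" "t0 v x \<in> car N v"
          using module_homD(1)[OF C0_D(2)[OF t v] x] module_homD(1)[OF C0_D(2)[OF t0 v] x] by auto
        then show "(t v x \<ominus>\<^bsub>space N v\<^esub> t0 v x) \<oplus>\<^bsub>space N v\<^esub> t0 v x = t v x"
          "(t v x \<oplus>\<^bsub>space N v\<^esub> t0 v x) \<ominus>\<^bsub>space N v\<^esub> t0 v x = t v x"
          by (simp_all add: a_minus_def N.a_assoc N.l_neg N.r_neg)
      qed
      then show "padd M N (pdiff M N t t0) t0 = t" "pdiff M N (padd M N t t0) t0 = t"
        using padd_C0[OF M N pdiff_C0[OF M N t t0] t0] pdiff_C0[OF M N padd_C0[OF M N t t0] t0] t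
        by (auto intro!: C0_eqI simp: padd_def pdiff_def)
    qed
    show "\<forall>t\<in>{t \<in> C0 M N. cob M N t = cob M N t0}. padd M N (pdiff M N t t0) t0 = t" using r by auto
    show "\<forall>h\<in>HomE M N. pdiff M N (padd M N h t0) t0 = h" using r by (auto simp: HomE_def)
    show "(\<lambda>t. pdiff M N t t0) ` {t \<in> C0 M N. cob M N t = cob M N t0} \<subseteq> HomE M N"
      using iff pdiff_C0[OF M N _ t0] by (auto simp: HomE_def)
    show "(\<lambda>h. padd M N h t0) ` HomE M N \<subseteq> {t \<in> C0 M N. cob M N t = cob M N t0}"
      using iff padd_C0[OF M N _ t0] r by (auto simp: HomE_def)
  qed
  then show ?thesis by (rule bij_betw_same_card)
qed

lemma card_C0_HomE:
  assumes M: "rep M" and N: "rep N"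
  shows "card (HomE M N) * card (cob M N ` C0 M N) = q ^ e0 (dv M) (dv N)"
proof -
  have "card (C0 M N) = (\<Sum>c\<in>cob M N ` C0 M N. card {t \<in> C0 M N. cob M N t = c})"
    using sum.image_gen[OF card_C0(1)[OF M N], of "\<lambda>_. 1::nat" "cob M N"] by simp
  also have "\<dots> = (\<Sum>c\<in>cob M N ` C0 M N. card (HomE M N))"
    using cob_fibre[OF M N] by (intro sum.cong) auto
  finally show ?thesis using card_C0(2)[OF M N] by simp
qed

lemma ext0_iff_surj:
  assumes M: "rep M" and N: "rep N"
  shows "ext0 M N \<longleftrightarrow> cob M N ` C0 M N = C1 M N"
proof
  assume e: "ext0 M N"
  show "cob M N ` C0 M N = C1 M N"
  proof
    show "cob M N ` C0 M N \<subseteq> C1 M N" using cob_C1[OF M N] by auto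
    show "C1 M N \<subseteq> cob M N ` C0 M N"
    proof
      fix c assume c: "c \<in> C1 M N"
      have ch: "\<And>a. a \<in> arcs Q \<Longrightarrow> c a \<in> module_hom K (space M (tail Q a)) (space N (head Q a))"
        using c by (auto simp: C1_def LH_def PiE_def Pi_def)
      obtain t where t: "\<And>v. v \<in> I \<Longrightarrow> t v \<in> module_hom K (space M v) (space N v)"
        "\<And>a x. a \<in> arcs Q \<Longrightarrow> x \<in> car M (tail Q a) \<Longrightarrow> t (head Q a) (arrow_map M a x) =
          arrow_map N a (t (tail Q a) x) \<oplus>\<^bsub>space N (head Q a)\<^esub> c a x"
        using ext0D[OF e ch] by blast
      let ?t = "\<lambda>v\<in>I. restrict (t v) (car M v)"
      have t': "?t \<in> C0 M N" by (rule C0_I[OF M t(1)])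
      have "cob M N ?t a x = c a x" if a: "a \<in> arcs Q" and x: "x \<in> car M (tail Q a)" for a x
      proof -
        interpret N: vectorspace K "space N (head Q a)" using repD(2)[OF N head_I[OF a]] .
        have 1: "arrow_map N a (t (tail Q a) x) \<in> car N (head Q a)"
          by (rule arrow_closed[OF N a module_homD(1)[OF t(1)[OF tail_I[OF a]] x]])
        have 2: "c a x \<in> car N (head Q a)" by (rule module_homD(1)[OF ch[OF a] x])
        show ?thesis using a x 1 2 t(2)[OF a x] arrow_closed[OF M a x]
          by (simp add: cob_apply a_minus_def) (simp add: N.a_ac N.r_neg2 N.r_neg1 N.r_neg)
      qed
      then have "cob M N ?t = c" by (rule C1_eqI[OF cob_C1[OF M N t'] c])
      then show "c \<in> cob M N ` C0 M N" using t' by blast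
    qed
  qed
next
  assume e: "cob M N ` C0 M N = C1 M N"
  show "ext0 M N" unfolding ext0_def
  proof (intro allI impI)
    fix c assume c: "\<forall>a\<in>arcs Q. c a \<in> module_hom K (space M (tail Q a)) (space N (head Q a))"
    have "(\<lambda>a\<in>arcs Q. restrict (c a) (car M (tail Q a))) \<in> C1 M N"
      unfolding C1_def
    proof (rule restrict_PiE_iff[THEN iffD2], rule ballI)
      fix a assume a: "a \<in> arcs Q"
      show "restrict (c a) (car M (tail Q a)) \<in> LH (space M (tail Q a)) (space N (head Q a))"
        by (rule restrict_LH[OF c[rule_format, OF a] repD(2)[OF M tail_I[OF a]]])
    qed
    then have "(\<lambda>a\<in>arcs Q. restrict (c a) (car M (tail Q a))) \<in> cob M N ` C0 M N" unfolding e .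
    then obtain t where t': "(\<lambda>a\<in>arcs Q. restrict (c a) (car M (tail Q a))) = cob M N t" "t \<in> C0 M N" by (rule imageE)
    note t = t'(2) t'(1)[symmetric]
    have "t (head Q a) (arrow_map M a x) = arrow_map N a (t (tail Q a) x) \<oplus>\<^bsub>space N (head Q a)\<^esub> c a x"
      if a: "a \<in> arcs Q" and x: "x \<in> car M (tail Q a)" for a x
    proof -
      interpret N: vectorspace K "space N (head Q a)" using repD(2)[OF N head_I[OF a]] .
      have "t (head Q a) (arrow_map M a x) \<ominus>\<^bsub>space N (head Q a)\<^esub> arrow_map N a (t (tail Q a) x) = c a x"
        using cob_apply[of a x M N t] t(2) a x by simp
      moreover have "t (head Q a) (arrow_map M a x) \<in> car N (head Q a)"
        by (rule module_homD(1)[OF C0_D(2)[OF t(1) head_I[OF a]] arrow_closed[OF M a x]])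
      moreover have "arrow_map N a (t (tail Q a) x) \<in> car N (head Q a)"
        by (rule arrow_closed[OF N a module_homD(1)[OF C0_D(2)[OF t(1) tail_I[OF a]] x]])
      ultimately show ?thesis by (rule N.diff_eq_imp)
    qed
    then show "\<exists>t. (\<forall>v\<in>I. t v \<in> module_hom K (space M v) (space N v)) \<and>
       (\<forall>a\<in>arcs Q. \<forall>x\<in>car M (tail Q a). t (head Q a) (arrow_map M a x) =
          arrow_map N a (t (tail Q a) x) \<oplus>\<^bsub>space N (head Q a)\<^esub> c a x)" using C0_D(2)[OF t(1)] by blast
  qed
qed

text \<open>When Ext is nonzero the image is a proper subgroup. Its translate by a cochain
  \<open>c\<close> outside it is disjoint from it and stays inside \<open>C1\<close>, so the index
  is at least 2.\<close>

lemma card_im_half: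
  assumes M: "rep M" and N: "rep N" and e: "\<not> ext0 M N"
  shows "2 * card (cob M N ` C0 M N) \<le> q ^ e1 (dv M) (dv N)"
proof -
  let ?Im = "cob M N ` C0 M N"
  have sub: "?Im \<subseteq> C1 M N" using cob_C1[OF M N] by auto
  then obtain c where c: "c \<in> C1 M N" "c \<notin> ?Im" using e ext0_iff_surj[OF M N] by auto
  have ev: "i a x \<in> car N (head Q a)" if "i \<in> C1 M N" "a \<in> arcs Q" "x \<in> car M (tail Q a)" for i a x
    using that unfolding C1_def LH_def by (auto simp: PiE_def Pi_def dest!: module_homD(1))
  define sh where "sh i = (\<lambda>a\<in>arcs Q. \<lambda>x\<in>car M (tail Q a). i a x \<oplus>\<^bsub>space N (head Q a)\<^esub> c a x)" for i
  have sh: "sh i \<in> C1 M N" if i: "i \<in> C1 M N" for i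
    unfolding C1_def sh_def
  proof (rule restrict_PiE_iff[THEN iffD2], rule ballI)
    fix a assume a: "a \<in> arcs Q"
    have "i a \<in> module_hom K (space M (tail Q a)) (space N (head Q a))" "c a \<in> module_hom K (space M (tail Q a)) (space N (head Q a))"
      using i c(1) a by (auto simp: C1_def LH_def PiE_def Pi_def)
    then show "(\<lambda>x\<in>car M (tail Q a). i a x \<oplus>\<^bsub>space N (head Q a)\<^esub> c a x) \<in> LH (space M (tail Q a)) (space N (head Q a))"
      by (rule restrict_LH[OF module_hom_add[OF repD(2)[OF M tail_I[OF a]] repD(2)[OF N head_I[OF a]]] repD(2)[OF M tail_I[OF a]]])
  qed
  have inj: "inj_on sh ?Im"
  proof (rule inj_onI)
    fix i j assume i: "i \<in> ?Im" and j: "j \<in> ?Im" and e: "sh i = sh j"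
    show "i = j"
    proof (rule C1_eqI)
      fix a x assume a: "a \<in> arcs Q" and x: "x \<in> car M (tail Q a)"
      interpret N: vectorspace K "space N (head Q a)" using repD(2)[OF N head_I[OF a]] .
      have "sh i a x = sh j a x" using e by simp
      moreover have "i a x \<in> car N (head Q a)" "j a x \<in> car N (head Q a)" "c a x \<in> car N (head Q a)"
        using ev[OF _ a x] i j c(1) sub by blast+
      ultimately show "i a x = j a x" using a x by (simp add: sh_def)
    qed (use i j sub in auto)
  qed
  have nIm: "sh i \<notin> ?Im" if i: "i \<in> ?Im" for i
  proof
    assume "sh i \<in> ?Im"
    then obtain s where s: "s \<in> C0 M N" "sh i = cob M N s" by auto
    obtain t where t: "t \<in> C0 M N" "i = cob M N t" using i by auto
    have "c = cob M N (pdiff M N s t)"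
    proof (rule C1_eqI[OF c(1) cob_C1[OF M N pdiff_C0[OF M N s(1) t(1)]]])
      fix a x assume a: "a \<in> arcs Q" and x: "x \<in> car M (tail Q a)"
      interpret N: vectorspace K "space N (head Q a)" using repD(2)[OF N head_I[OF a]] .
      have "cob M N s a x = cob M N t a x \<oplus>\<^bsub>space N (head Q a)\<^esub> c a x"
        using s(2) t(2) a x by (metis (no_types, lifting) sh_def restrict_apply')
      moreover have "cob M N t a x \<in> car N (head Q a)" "c a x \<in> car N (head Q a)"
        using ev[OF _ a x] c(1) cob_C1[OF M N t(1)] by auto
      ultimately have "cob M N s a x \<ominus>\<^bsub>space N (head Q a)\<^esub> cob M N t a x = c a x"
        by (simp add: a_minus_def) (simp add: N.a_ac N.r_neg2 N.r_neg1 N.r_neg)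
      then show "c a x = cob M N (pdiff M N s t) a x" using cob_pdiff[OF M N s(1) t(1) a x] by simp
    qed
    then show False using c(2) pdiff_C0[OF M N s(1) t(1)] by blast
  qed
  have dis: "?Im \<inter> sh ` ?Im = {}"
  proof (intro equals0I)
    fix j assume jj: "j \<in> ?Im \<inter> sh ` ?Im"
    have j: "j \<in> ?Im" "j \<in> sh ` ?Im" using IntD1[OF jj] IntD2[OF jj] .
    from j(2) obtain i where "j = sh i" "i \<in> ?Im" by (rule imageE)
    then show False using nIm j(1) by simp
  qed
  have fin: "finite ?Im" using card_C0(1)[OF M N] by simp
  have "card (?Im \<union> sh ` ?Im) \<le> card (C1 M N)"
    using sub sh by (intro card_mono card_C1(1)[OF M N]) auto
  then show ?thesis using card_Un_disjoint[OF fin finite_imageI[OF fin] dis] card_image[OF inj] card_C1(2)[OF M N] by simp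
qed

text \<open>Multiplicative form of dim Hom - dim Ext = <dim M, dim N>, arranged so that neither
  subtraction nor a negative power occurs. The factor 2 is what makes a nonzero Ext visible to
  counting.\<close>

lemma HomE_ge:
  assumes M: "rep M" and N: "rep N"
  shows "q ^ e0 (dv M) (dv N) \<le> card (HomE M N) * q ^ e1 (dv M) (dv N)"
    and "ext0 M N \<Longrightarrow> q ^ e0 (dv M) (dv N) = card (HomE M N) * q ^ e1 (dv M) (dv N)"
    and "\<not> ext0 M N \<Longrightarrow> 2 * q ^ e0 (dv M) (dv N) \<le> card (HomE M N) * q ^ e1 (dv M) (dv N)"
proof -
  note c = card_C0_HomE[OF M N]
  show e: "q ^ e0 (dv M) (dv N) = card (HomE M N) * q ^ e1 (dv M) (dv N)" if "ext0 M N"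
    using c that ext0_iff_surj[OF M N] card_C1(2)[OF M N] by simp
  show n: "2 * q ^ e0 (dv M) (dv N) \<le> card (HomE M N) * q ^ e1 (dv M) (dv N)" if "\<not> ext0 M N"
    using mult_le_mono2[OF card_im_half[OF M N that], of "card (HomE M N)"] c by (simp add: mult.left_commute mult.commute)
  show "q ^ e0 (dv M) (dv N) \<le> card (HomE M N) * q ^ e1 (dv M) (dv N)" using e n by (cases "ext0 M N") auto
qed

end

section \<open>Random representations\<close>

lemma (in finite_field) card_LH_kill:
  assumes V: "VS V" and W: "VS W" and S: "subspace K S V"
  shows "card {g \<in> LH V W. \<forall>x\<in>S. g x = \<zero>\<^bsub>W\<^esub>} \<le> q ^ (vdim W * (vdim V - vdim (V\<lparr>carrier := S\<rparr>)))"
  using card_hom_agree_le[OF V W S, of "\<lambda>_. \<zero>\<^bsub>W\<^esub>"] card_VS(2)[OF W] by (simp add: power_mult)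

lemma card_Sigma_le:
  assumes "finite S" "\<And>x. x \<in> S \<Longrightarrow> finite (T x)" "card S \<le> m" "\<And>x. x \<in> S \<Longrightarrow> card (T x) \<le> n"
  shows "card (Sigma S T) \<le> m * n"
proof -
  have "card (Sigma S T) = (\<Sum>x\<in>S. card (T x))" using assms by (simp add: card_SigmaI)
  also have "\<dots> \<le> (\<Sum>x\<in>S. n)" using assms by (intro sum_mono) auto
  also have "\<dots> = card S * n" by simp
  also have "\<dots> \<le> m * n" using assms(3) by simp
  finally show ?thesis .
qed

lemma card_PiE_le:
  assumes "finite J" "\<And>i. i \<in> J \<Longrightarrow> finite (S i)" "\<And>i. i \<in> J \<Longrightarrow> card (S i) \<le> m ^ e i"
  shows "card (Pi\<^sub>E J S) \<le> m ^ (\<Sum>i\<in>J. e i)"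
  using assms prod_mono[of J "\<lambda>i. card (S i)" "\<lambda>i. m ^ e i"] by (simp add: card_PiE power_sum)

text \<open>The spaces are fixed once and for all; a representation on them is then a family of
  linear maps, and all such families are counted with equal weight.\<close>

locale random_rep = quiver_reps K Q for K :: "('k, 'e) ring_scheme" and Q :: "('v, 'a) pre_digraph" +
  fixes E :: "'v \<Rightarrow> ('k, 'r) module"
  assumes VS_E: "v \<in> I \<Longrightarrow> VS (E v)"
begin

definition d :: "'v \<Rightarrow> nat" where "d v = (if v \<in> I then vdim (E v) else 0)"
definition reps :: "('a \<Rightarrow> 'r \<Rightarrow> 'r) set" where
  "reps = (\<Pi>\<^sub>E a\<in>arcs Q. LH (E (tail Q a)) (E (head Q a)))"
definition mk :: "('a \<Rightarrow> 'r \<Rightarrow> 'r) \<Rightarrow> ('v, 'a, 'k, 'r) quiver_rep" where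
  "mk \<rho> = \<lparr>space = E, arrow_map = \<rho>\<rparr>"

lemma mk_simps [simp]: "space (mk \<rho>) = E" "arrow_map (mk \<rho>) = \<rho>" by (simp_all add: mk_def)

lemma rep_mk: "\<rho> \<in> reps \<Longrightarrow> rep (mk \<rho>)"
  by (rule repI) (auto simp: VS_E reps_def LH_def PiE_def Pi_def)

lemma dv_mk: "dv (mk \<rho>) = d"
  by (auto simp: dim_vector_def d_def)

lemma finite_LH: "a \<in> arcs Q \<Longrightarrow> finite (LH (E (tail Q a)) (E (head Q a)))"
  using card_LH(1)[OF VS_E[OF tail_I] VS_E[OF head_I]] by blast

lemma card_reps: "finite reps" "card reps = q ^ e1 d d"
proof -
  have cd: "card (LH (E (tail Q a)) (E (head Q a))) = q ^ (d (tail Q a) * d (head Q a))" if a: "a \<in> arcs Q" for a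
    using card_LH(2)[OF VS_E[OF tail_I[OF a]] VS_E[OF head_I[OF a]]] card_VS(2)[OF VS_E[OF head_I[OF a]]] a
    by (simp add: d_def power_mult[symmetric] mult.commute)
  show "finite reps" unfolding reps_def using finite_LH by (intro finite_PiE) auto
  show "card reps = q ^ e1 d d" unfolding reps_def e1_def using cd by (simp add: card_PiE power_sum)
qed

text \<open>Fix the map first: it is a family of linear maps on A/X. Given it, each arrow map is
  prescribed on the image at its tail and free on a complement. In exponents the number of pairs is
  at most |reps| q^(<dim A, d> - <dim X, d>); the terms are rearranged to avoid subtraction.\<close>

lemma count_kernel:
  assumes A: "rep A" and X: "X \<in> subs A"
  shows "finite {(\<phi>, \<rho>). \<rho> \<in> reps \<and> \<phi> \<in> HomE A (mk \<rho>) \<and> ker_sub A (mk \<rho>) \<phi> = X}" (is "finite ?P")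
    "card {(\<phi>, \<rho>). \<rho> \<in> reps \<and> \<phi> \<in> HomE A (mk \<rho>) \<and> ker_sub A (mk \<rho>) \<phi> = X}
      * q ^ e1 (dv A) d * q ^ e0 (dv (sub_rep A X)) d \<le> card reps * q ^ e0 (dv A) d * q ^ e1 (dv (sub_rep A X)) d"
proof -
  define k where "k = dv (sub_rep A X)"
  have k_le: "k v \<le> dv A v" for v using dv_quot[OF A X, of v] by (simp add: k_def)
  define Phi where "Phi = {\<phi> \<in> (\<Pi>\<^sub>E v\<in>I. {g \<in> LH (space A v) (E v). \<forall>x\<in>X v. g x = \<zero>\<^bsub>E v\<^esub>}).
     \<forall>v\<in>I. {x \<in> car A v. \<phi> v x = \<zero>\<^bsub>E v\<^esub>} = X v}"
  define R where "R \<phi> = {\<rho> \<in> reps. \<forall>a\<in>arcs Q. \<forall>x\<in>car A (tail Q a). \<phi> (head Q a) (arrow_map A a x) = \<rho> a (\<phi> (tail Q a) x)}" for \<phi>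
  let ?n = "q ^ (\<Sum>v\<in>I. d v * (dv A v - k v))"
  let ?m = "q ^ (\<Sum>a\<in>arcs Q. d (head Q a) * (d (tail Q a) - (dv A (tail Q a) - k (tail Q a))))"
  have finL: "finite (LH (space A v) (E v))" if "v \<in> I" for v
    using card_LH(1)[OF repD(1)[OF A that] VS_E[OF that]] .
  have finP: "finite (\<Pi>\<^sub>E v\<in>I. {g \<in> LH (space A v) (E v). \<forall>x\<in>X v. g x = \<zero>\<^bsub>E v\<^esub>})"
    using finL by (intro finite_PiE) auto
  then have finPhi: "finite Phi" by (simp add: Phi_def)
  have "card {g \<in> LH (space A v) (E v). \<forall>x\<in>X v. g x = \<zero>\<^bsub>E v\<^esub>} \<le> q ^ (d v * (dv A v - k v))" if v: "v \<in> I" for v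
    using card_LH_kill[OF repD(1)[OF A v] VS_E[OF v] subsD(2)[OF X v]] v
    by (simp add: d_def k_def dv_vdim)
  then have "card (\<Pi>\<^sub>E v\<in>I. {g \<in> LH (space A v) (E v). \<forall>x\<in>X v. g x = \<zero>\<^bsub>E v\<^esub>}) \<le> ?n"
    using finL by (intro card_PiE_le) auto
  moreover have "card Phi \<le> card (\<Pi>\<^sub>E v\<in>I. {g \<in> LH (space A v) (E v). \<forall>x\<in>X v. g x = \<zero>\<^bsub>E v\<^esub>})"
    by (rule card_mono[OF finP]) (auto simp: Phi_def)
  ultimately have cPhi: "card Phi \<le> ?n" by simp
  have finR: "finite (R \<phi>)" for \<phi> using card_reps(1) by (simp add: R_def)
  have cR: "card (R \<phi>) \<le> ?m" if phi: "\<phi> \<in> Phi" for \<phi>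
  proof -
    have ph: "\<phi> v \<in> module_hom K (space A v) (E v)" if "v \<in> I" for v using phi that by (auto simp: Phi_def LH_def PiE_def Pi_def)
    let ?S = "\<lambda>a. \<phi> (tail Q a) ` car A (tail Q a)"
    let ?h = "\<lambda>a y. \<phi> (head Q a) (arrow_map A a (inv_into (car A (tail Q a)) (\<phi> (tail Q a)) y))"
    let ?L = "\<lambda>a. {g \<in> LH (E (tail Q a)) (E (head Q a)). \<forall>y\<in>?S a. g y = ?h a y}"
    have s1: "R \<phi> \<subseteq> (\<Pi>\<^sub>E a\<in>arcs Q. ?L a)"
    proof
      fix \<rho> assume r: "\<rho> \<in> R \<phi>"
      have "\<rho> a y = ?h a y" if a: "a \<in> arcs Q" and y: "y \<in> ?S a" for a y
        using r a inv_into_into[OF y] f_inv_into_f[OF y] by (auto simp: R_def)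
      then show "\<rho> \<in> (\<Pi>\<^sub>E a\<in>arcs Q. ?L a)" using r by (auto simp: R_def reps_def PiE_def Pi_def)
    qed
    have s2: "finite (\<Pi>\<^sub>E a\<in>arcs Q. ?L a)" using finite_LH by (intro finite_PiE) auto
    have s3: "card (\<Pi>\<^sub>E a\<in>arcs Q. ?L a) \<le> ?m"
    proof (rule card_PiE_le)
      fix a assume a: "a \<in> arcs Q"
      note t = tail_I[OF a] and h = head_I[OF a]
      have S: "subspace K (?S a) (E (tail Q a))"
        using subspace_hom_image[OF repD(2)[OF A t] VS_E[OF t, THEN conjunct1] ph[OF t] subspace_full[OF repD(2)[OF A t]]] .
      have "vdim (space A (tail Q a)) = vdim ((space A (tail Q a))\<lparr>carrier := X (tail Q a)\<rparr>) + vdim ((E (tail Q a))\<lparr>carrier := ?S a\<rparr>)"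
        using dim_ker_im[OF repD(1)[OF A t] VS_E[OF t] ph[OF t]] phi t by (simp add: Phi_def)
      then have "vdim ((E (tail Q a))\<lparr>carrier := ?S a\<rparr>) = dv A (tail Q a) - k (tail Q a)"
        using t by (simp add: dv_vdim k_def)
      then show "card (?L a) \<le> q ^ (d (head Q a) * (d (tail Q a) - (dv A (tail Q a) - k (tail Q a))))"
        using card_hom_agree_le[OF VS_E[OF t] VS_E[OF h] S, of "?h a"] card_VS(2)[OF VS_E[OF h]] t h
        by (simp add: d_def power_mult)
    qed (use finite_LH in auto)
    show ?thesis by (rule le_trans[OF card_mono[OF s2 s1] s3])
  qed
  have sub: "?P \<subseteq> Sigma Phi R"
  proof (clarsimp)
    fix \<phi> \<rho> assume r: "\<rho> \<in> reps" and p: "\<phi> \<in> HomE A (mk \<rho>)" and k: "X = ker_sub A (mk \<rho>) \<phi>"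
    have C: "\<phi> \<in> C0 A (mk \<rho>)" and h: "\<phi> \<in> Hom A (mk \<rho>)" using p by (auto simp: HomE_def)
    have "\<phi> \<in> Phi" using C0_D(1,4)[OF C] by (auto simp: Phi_def k ker_sub_def PiE_def)
    moreover have "\<rho> \<in> R \<phi>" using r HomD(3)[OF h] by (simp add: R_def)
    ultimately show "\<phi> \<in> Phi \<and> \<rho> \<in> R \<phi>" by simp
  qed
  have finS: "finite (Sigma Phi R)" using finPhi finR by (intro finite_SigmaI) auto
  show "finite ?P" by (rule finite_subset[OF sub finS])
  have c1: "card ?P \<le> ?n * ?m"
    using card_mono[OF finS sub] card_Sigma_le[of Phi R, OF finPhi finR cPhi cR] by linarith
  show "card ?P * q ^ e1 (dv A) d * q ^ e0 (dv (sub_rep A X)) d \<le> card reps * q ^ e0 (dv A) d * q ^ e1 (dv (sub_rep A X)) d"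
  proof (cases "?P = {}")
    case True then show ?thesis by (simp only: True card.empty mult_zero_left le0)
  next
    case False
    then obtain \<phi> \<rho> where "\<rho> \<in> reps" "\<phi> \<in> HomE A (mk \<rho>)" "ker_sub A (mk \<rho>) \<phi> = X" by auto
    \<comment> \<open>Once a pair exists, A/X embeds into the given spaces, so the truncated
      subtractions in the exponents are genuine ones.\<close>
    then have le: "dv A v - k v \<le> d v" for v
    proof -
      have rho: "rep (mk \<rho>)" using rep_mk \<open>\<rho> \<in> reps\<close> by blast
      have h: "\<phi> \<in> Hom A (mk \<rho>)" using \<open>\<phi> \<in> HomE A (mk \<rho>)\<close> by (simp add: HomE_def)
      have "dv (sub_rep (mk \<rho>) (im_sub \<phi> (full_sub A))) v \<le> d v"
        using dv_quot[OF rho im_sub[OF A rho h full_sub[OF A]], of v] by (simp add: dv_mk)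
      then show ?thesis using dv_hom[OF A rho h, of v] \<open>ker_sub A (mk \<rho>) \<phi> = X\<close> by (simp add: k_def)
    qed
    have 1: "(\<Sum>v\<in>I. d v * (dv A v - k v)) + e0 k d = e0 (dv A) d"
      unfolding e0_def using k_le by (simp flip: sum.distrib add: diff_mult_distrib2 mult.commute)
    have 2: "(\<Sum>a\<in>arcs Q. d (head Q a) * (d (tail Q a) - (dv A (tail Q a) - k (tail Q a)))) + e1 (dv A) d = e1 d d + e1 k d"
    proof -
      have "d (head Q a) * (d (tail Q a) - (dv A (tail Q a) - k (tail Q a))) + dv A (tail Q a) * d (head Q a)
         = d (tail Q a) * d (head Q a) + k (tail Q a) * d (head Q a)" for a
      proof -
        have "d (tail Q a) - (dv A (tail Q a) - k (tail Q a)) + dv A (tail Q a) = d (tail Q a) + k (tail Q a)"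
          using k_le[of "tail Q a"] le[of "tail Q a"] by simp
        then have "(d (tail Q a) - (dv A (tail Q a) - k (tail Q a)) + dv A (tail Q a)) * d (head Q a) = (d (tail Q a) + k (tail Q a)) * d (head Q a)"
          by (simp only:)
        then show ?thesis by (simp only: distrib_right mult.commute[of "d (head Q a)"])
      qed
      then show ?thesis unfolding e1_def by (simp flip: sum.distrib)
    qed
    have "card ?P * q ^ e1 (dv A) d * q ^ e0 k d \<le> ?n * ?m * q ^ e1 (dv A) d * q ^ e0 k d"
      using c1 by simp
    also have "\<dots> = q ^ ((\<Sum>v\<in>I. d v * (dv A v - k v)) + e0 k d + ((\<Sum>a\<in>arcs Q. d (head Q a) * (d (tail Q a) - (dv A (tail Q a) - k (tail Q a)))) + e1 (dv A) d))"
      by (simp add: power_add)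
    also have "\<dots> = card reps * q ^ e0 (dv A) d * q ^ e1 k d" unfolding 1 2 card_reps(2) by (simp add: power_add)
    finally show ?thesis by (simp add: k_def)
  qed
qed

text \<open>Dual count: choose a map onto \<open>W\<close> at each vertex; each arrow map must then
  lift a prescribed map along the surjection at its head, which leaves only the kernel there free.
  The bound reads |reps| q^<d, dim W>.\<close>

lemma count_image:
  assumes B: "rep B" and W: "W \<in> subs B"
  shows "finite {(\<psi>, \<rho>). \<rho> \<in> reps \<and> \<psi> \<in> HomE (mk \<rho>) B \<and> im_sub \<psi> (full_sub (mk \<rho>)) = W}" (is "finite ?P")
    "card {(\<psi>, \<rho>). \<rho> \<in> reps \<and> \<psi> \<in> HomE (mk \<rho>) B \<and> im_sub \<psi> (full_sub (mk \<rho>)) = W}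
      * q ^ e1 d (dv (sub_rep B W)) \<le> card reps * q ^ e0 d (dv (sub_rep B W))"
proof -
  define w where "w = dv (sub_rep B W)"
  define Psi where "Psi = {\<psi> \<in> (\<Pi>\<^sub>E v\<in>I. LH (E v) ((space B v)\<lparr>carrier := W v\<rparr>)). \<forall>v\<in>I. \<psi> v ` carrier (E v) = W v}"
  define R where "R \<psi> = {\<rho> \<in> reps. \<forall>a\<in>arcs Q. \<forall>x\<in>carrier (E (tail Q a)). \<psi> (head Q a) (\<rho> a x) = arrow_map B a (\<psi> (tail Q a) x)}" for \<psi>
  let ?n = "q ^ (\<Sum>v\<in>I. w v * d v)"
  let ?m = "q ^ (\<Sum>a\<in>arcs Q. (d (head Q a) - w (head Q a)) * d (tail Q a))"
  have VW: "VS ((space B v)\<lparr>carrier := W v\<rparr>)" if v: "v \<in> I" for v by (rule subspace_VS[OF repD(1)[OF B v] subsD(2)[OF W v]])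
  have cL: "finite (LH (E v) ((space B v)\<lparr>carrier := W v\<rparr>))" "card (LH (E v) ((space B v)\<lparr>carrier := W v\<rparr>)) = q ^ (w v * d v)"
    if v: "v \<in> I" for v
    using card_LH[OF VS_E[OF v] VW[OF v]] card_sub[OF B W v] v by (simp_all add: d_def w_def power_mult)
  have finP: "finite (\<Pi>\<^sub>E v\<in>I. LH (E v) ((space B v)\<lparr>carrier := W v\<rparr>))" using cL by (intro finite_PiE) auto
  then have finPsi: "finite Psi" by (simp add: Psi_def)
  have "card (\<Pi>\<^sub>E v\<in>I. LH (E v) ((space B v)\<lparr>carrier := W v\<rparr>)) \<le> ?n"
    using cL by (intro card_PiE_le) auto
  moreover have "card Psi \<le> card (\<Pi>\<^sub>E v\<in>I. LH (E v) ((space B v)\<lparr>carrier := W v\<rparr>))"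
    by (rule card_mono[OF finP]) (auto simp: Psi_def)
  ultimately have cPsi: "card Psi \<le> ?n" by simp
  have finR: "finite (R \<psi>)" for \<psi> using card_reps(1) by (simp add: R_def)
  have cR: "card (R \<psi>) \<le> ?m" if psi: "\<psi> \<in> Psi" for \<psi>
  proof -
    have ph: "\<psi> v \<in> module_hom K (E v) ((space B v)\<lparr>carrier := W v\<rparr>)" if "v \<in> I" for v
      using psi that by (auto simp: Psi_def LH_def PiE_def Pi_def)
    let ?L = "\<lambda>a. {g \<in> LH (E (tail Q a)) (E (head Q a)). \<forall>x\<in>carrier (E (tail Q a)). \<psi> (head Q a) (g x) = arrow_map B a (\<psi> (tail Q a) x)}"
    have s1: "R \<psi> \<subseteq> (\<Pi>\<^sub>E a\<in>arcs Q. ?L a)" by (auto simp: R_def reps_def PiE_def Pi_def)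
    have s2: "finite (\<Pi>\<^sub>E a\<in>arcs Q. ?L a)" using finite_LH by (intro finite_PiE) auto
    have s3: "card (\<Pi>\<^sub>E a\<in>arcs Q. ?L a) \<le> ?m"
    proof (rule card_PiE_le)
      fix a assume a: "a \<in> arcs Q"
      note t = tail_I[OF a] and h = head_I[OF a]
      let ?N = "{y \<in> carrier (E (head Q a)). \<psi> (head Q a) y = \<zero>\<^bsub>(space B (head Q a))\<lparr>carrier := W (head Q a)\<rparr>\<^esub>}"
      have N: "subspace K ?N (E (head Q a))"
        using subspace_hom_vimage[OF VS_E[OF h, THEN conjunct1] VW[OF h, THEN conjunct1] ph[OF h] subspace_zero[OF VW[OF h, THEN conjunct1]]]
        by simp
      have img: "\<psi> (head Q a) ` carrier (E (head Q a)) = W (head Q a)" using psi h by (simp add: Psi_def)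
      have "vdim (E (head Q a)) = vdim ((E (head Q a))\<lparr>carrier := ?N\<rparr>) + w (head Q a)"
        using dim_ker_im[OF VS_E[OF h] VW[OF h] ph[OF h]] h img by (simp add: w_def dv_sub)
      then have "card ?N = q ^ (d (head Q a) - w (head Q a))"
        using card_VS(2)[OF subspace_VS[OF VS_E[OF h] N]] h by (simp add: d_def)
      then show "card (?L a) \<le> q ^ ((d (head Q a) - w (head Q a)) * d (tail Q a))"
        using card_hom_lift_le[OF VS_E[OF t] VS_E[OF h] VW[OF h] ph[OF h], of "\<lambda>x. arrow_map B a (\<psi> (tail Q a) x)"] t
        by (simp add: d_def power_mult)
    qed (use finite_LH in auto)
    show ?thesis by (rule le_trans[OF card_mono[OF s2 s1] s3])
  qed
  have sub: "?P \<subseteq> Sigma Psi R"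
  proof (clarsimp)
    fix \<psi> \<rho> assume r: "\<rho> \<in> reps" and p: "\<psi> \<in> HomE (mk \<rho>) B" and k: "W = im_sub \<psi> (full_sub (mk \<rho>))"
    have C: "\<psi> \<in> C0 (mk \<rho>) B" and h: "\<psi> \<in> Hom (mk \<rho>) B" using p by (auto simp: HomE_def)
    have Wv: "\<psi> v ` carrier (E v) = W v" if "v \<in> I" for v using that by (simp add: k im_sub_def full_sub_def)
    have "\<psi> v \<in> LH (E v) ((space B v)\<lparr>carrier := W v\<rparr>)" if v: "v \<in> I" for v
      using C0_D(3)[OF C v] module_homD(2,3)[OF C0_D(2)[OF C v]] Wv[OF v]
      by (auto simp: LH_def intro!: module_homI)
    then have "\<psi> \<in> Psi" using Wv C0_D(4)[OF C] by (auto simp: Psi_def PiE_def)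
    moreover have "\<rho> \<in> R \<psi>" using r HomD(3)[OF h] by (simp add: R_def)
    ultimately show "\<psi> \<in> Psi \<and> \<rho> \<in> R \<psi>" by simp
  qed
  have finS: "finite (Sigma Psi R)" using finPsi finR by (intro finite_SigmaI) auto
  show "finite ?P" by (rule finite_subset[OF sub finS])
  have c1: "card ?P \<le> ?n * ?m"
    using card_mono[OF finS sub] card_Sigma_le[of Psi R, OF finPsi finR cPsi cR] by linarith
  show "card ?P * q ^ e1 d (dv (sub_rep B W)) \<le> card reps * q ^ e0 d (dv (sub_rep B W))"
  proof (cases "?P = {}")
    case True then show ?thesis by (simp only: True card.empty mult_zero_left le0)
  next
    case False
    then obtain \<psi> \<rho> where *: "\<rho> \<in> reps" "\<psi> \<in> HomE (mk \<rho>) B" "im_sub \<psi> (full_sub (mk \<rho>)) = W" by auto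
    have le: "w v \<le> d v" for v
    proof -
      have h: "\<psi> \<in> Hom (mk \<rho>) B" using *(2) by (simp add: HomE_def)
      show ?thesis using dv_hom[OF rep_mk[OF *(1)] B h, of v] *(3) by (simp add: w_def dv_mk)
    qed
    have 2: "(\<Sum>a\<in>arcs Q. (d (head Q a) - w (head Q a)) * d (tail Q a)) + e1 d w = e1 d d"
    proof -
      have "(d (head Q a) - w (head Q a)) * d (tail Q a) + d (tail Q a) * w (head Q a) = d (tail Q a) * d (head Q a)" for a
      proof -
        have "d (head Q a) - w (head Q a) + w (head Q a) = d (head Q a)" using le[of "head Q a"] by simp
        then have "(d (head Q a) - w (head Q a) + w (head Q a)) * d (tail Q a) = d (head Q a) * d (tail Q a)"
          by (simp only:)
        then show ?thesis by (simp only: distrib_right mult.commute[of "d (tail Q a)"])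
      qed
      then show ?thesis unfolding e1_def by (simp flip: sum.distrib)
    qed
    have "card ?P * q ^ e1 d w \<le> ?n * ?m * q ^ e1 d w"
      using c1 by simp
    also have "\<dots> = q ^ ((\<Sum>v\<in>I. w v * d v) + ((\<Sum>a\<in>arcs Q. (d (head Q a) - w (head Q a)) * d (tail Q a)) + e1 d w))"
      by (simp add: power_add)
    also have "\<dots> = card reps * q ^ e0 d w" unfolding 2 card_reps(2) by (simp add: power_add e0_def mult.commute)
    finally show ?thesis by (simp add: w_def)
  qed
qed

end

context quiver_reps
begin

lemma e0_scale: "e0 y (\<lambda>v. N * x v) = N * e0 y x" "e0 (\<lambda>v. N * x v) y = N * e0 x y"
  by (simp_all add: e0_def sum_distrib_left mult.left_commute mult.assoc)
lemma e1_scale: "e1 y (\<lambda>v. N * x v) = N * e1 y x" "e1 (\<lambda>v. N * x v) y = N * e1 x y"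
  by (simp_all add: e1_def sum_distrib_left mult.left_commute mult.assoc)

text \<open>Counting argument: a random representation of dimension \<open>N * x\<close> with \<open>N\<close> large contains \<open>A\<close> and has
  no extensions by \<open>B\<close>.\<close>

lemma ext0_generic:
  assumes A: "rep A" and B: "rep B"
    and hA: "\<And>X. X \<in> subs A \<Longrightarrow> X \<noteq> zero_sub A \<Longrightarrow> e1 (dv (sub_rep A X)) x < e0 (dv (sub_rep A X)) x"
    and hB: "\<And>W. W \<in> subs B \<Longrightarrow> W \<noteq> full_sub B \<Longrightarrow>
       e0 x (dv (sub_rep B W)) + e1 x (dv B) < e0 x (dv B) + e1 x (dv (sub_rep B W))"
  shows "ext0 A B"
proof -
  define nA nB where "nA = card (subs A)" and "nB = card (subs B)"
  \<comment> \<open>The hypotheses provide a gap of at least 1, which becomes N after scaling. It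
    has to beat a union bound over all subrepresentations of \<open>A\<close> and of
    \<open>B\<close>, and nA + nB < q^N suffices.\<close>
  define N where "N = nA + nB"
  have qN: "nA + nB < q ^ N"
    using order_less_le_trans[OF less_exp[of N] power_mono[OF q_ge_2, of N]] unfolding N_def by simp
  have "\<forall>v. \<exists>V :: ('k, nat \<Rightarrow> 'k) module. VS V \<and> vdim V = N * x v" using VS_exists by metis
  then obtain E :: "'v \<Rightarrow> ('k, nat \<Rightarrow> 'k) module" where E: "\<And>v. VS (E v)" "\<And>v. vdim (E v) = N * x v" by metis
  interpret random_rep K Q E by unfold_locales (rule E(1))
  have d: "d = (\<lambda>v. if v \<in> I then N * x v else 0)" by (simp add: d_def E(2) fun_eq_iff)
  have e: "e0 y d = N * e0 y x" "e0 d y = N * e0 x y" "e1 y d = N * e1 y x" "e1 d y = N * e1 x y" for y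
    unfolding e0_scale[symmetric] e1_scale[symmetric] by (simp_all add: e0_def e1_def d ac_simps)
  define bad1 where "bad1 = {\<rho> \<in> reps. \<not> (\<exists>\<phi>. mono A (mk \<rho>) \<phi>)}"
  define bad2 where "bad2 = {\<rho> \<in> reps. \<not> ext0 (mk \<rho>) B}"
  have finb: "finite bad1" "finite bad2" using card_reps(1) by (auto simp: bad1_def bad2_def)
  have reps_pos: "card reps > 0" using card_reps(2) q_ge_2 by simp
  have finH: "finite (HomE A (mk \<rho>))" "finite (HomE (mk \<rho>) B)" if "\<rho> \<in> reps" for \<rho>
    using card_C0(1)[OF A rep_mk[OF that]] card_C0(1)[OF rep_mk[OF that] B] by (auto simp: HomE_def)
  \<comment> \<open>If \<open>A\<close> does not embed into a given representation, all its
    homomorphisms there, at least q^<dim A, d> many, have nonzero kernel. Those with a given nonzero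
    kernel X are rarer on average by a factor q^<dim X, d>, which is at least q^N.\<close>
  have c1: "card bad1 * q ^ N \<le> nA * card reps"
  proof -
    define P where "P X = {(\<phi>, \<rho>). \<rho> \<in> reps \<and> \<phi> \<in> HomE A (mk \<rho>) \<and> ker_sub A (mk \<rho>) \<phi> = X}" for X
    let ?S = "Sigma bad1 (\<lambda>\<rho>. HomE A (mk \<rho>))" and ?T = "subs A - {zero_sub A}"
    have PX: "card (P X) * q ^ e1 (dv A) d * q ^ N \<le> card reps * q ^ e0 (dv A) d" if X: "X \<in> ?T" for X
    proof -
      let ?k = "dv (sub_rep A X)"
      have "e1 ?k d + N \<le> e0 ?k d" using mult_le_mono2[OF Suc_leI[OF hA[of X]], of N] X by (simp add: e)
      then have "q ^ (e1 ?k d + N) \<le> q ^ e0 ?k d" using q_ge_2 by (intro power_increasing) auto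
      then have "card (P X) * q ^ e1 (dv A) d * (q ^ e1 ?k d * q ^ N) \<le> card (P X) * q ^ e1 (dv A) d * q ^ e0 ?k d"
        by (simp add: power_add)
      also have "\<dots> \<le> card reps * q ^ e0 (dv A) d * q ^ e1 ?k d" using count_kernel(2)[OF A, of X] X by (simp add: P_def)
      finally have "(card (P X) * q ^ e1 (dv A) d * q ^ N) * q ^ e1 ?k d \<le> (card reps * q ^ e0 (dv A) d) * q ^ e1 ?k d"
        by (simp add: mult.assoc mult.left_commute mult.commute)
      then show ?thesis using q_ge_2 by simp
    qed
    have sub: "prod.swap ` ?S \<subseteq> (\<Union>X\<in>?T. P X)"
    proof
      fix z assume "z \<in> prod.swap ` ?S"
      then obtain \<rho> \<phi> where z: "z = (\<phi>, \<rho>)" "\<rho> \<in> bad1" "\<phi> \<in> HomE A (mk \<rho>)" by auto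
      have r: "\<rho> \<in> reps" and nm: "\<not> mono A (mk \<rho>) \<phi>" using z(2) by (auto simp: bad1_def)
      have h: "\<phi> \<in> Hom A (mk \<rho>)" using z(3) by (simp add: HomE_def)
      have "ker_sub A (mk \<rho>) \<phi> \<in> ?T" using nm mono_iff[OF A rep_mk[OF r] h] ker_sub[OF A rep_mk[OF r] h] by simp
      then show "z \<in> (\<Union>X\<in>?T. P X)" using z r by (auto simp: P_def)
    qed
    have finT: "finite ?T" using finite_subs[OF A] by simp
    have finP: "finite (P X)" if "X \<in> ?T" for X using count_kernel(1)[OF A, of X] that by (simp add: P_def)
    have "card bad1 * q ^ e0 (dv A) d \<le> (\<Sum>\<rho>\<in>bad1. card (HomE A (mk \<rho>)) * q ^ e1 (dv A) d)"
    proof -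
      have "card bad1 * q ^ e0 (dv A) d = (\<Sum>\<rho>\<in>bad1. q ^ e0 (dv A) d)" by simp
      also have "\<dots> \<le> (\<Sum>\<rho>\<in>bad1. card (HomE A (mk \<rho>)) * q ^ e1 (dv A) d)"
        using HomE_ge(1)[OF A rep_mk] by (intro sum_mono) (auto simp: bad1_def dv_mk)
      finally show ?thesis .
    qed
    also have "\<dots> = card ?S * q ^ e1 (dv A) d"
      using finb finH by (subst card_SigmaI) (auto simp: sum_distrib_right bad1_def)
    also have "card ?S = card (prod.swap ` ?S)" by (simp add: card_image)
    also have "card (prod.swap ` ?S) \<le> card (\<Union>X\<in>?T. P X)" by (rule card_mono[OF _ sub]) (use finT finP in auto)
    also have "card (\<Union>X\<in>?T. P X) \<le> (\<Sum>X\<in>?T. card (P X))" by (rule card_UN_le[OF finT])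
    finally have "card bad1 * q ^ e0 (dv A) d \<le> (\<Sum>X\<in>?T. card (P X)) * q ^ e1 (dv A) d" by simp
    then have "card bad1 * q ^ e0 (dv A) d * q ^ N \<le> (\<Sum>X\<in>?T. card (P X)) * q ^ e1 (dv A) d * q ^ N" by simp
    also have "\<dots> = (\<Sum>X\<in>?T. card (P X) * q ^ e1 (dv A) d * q ^ N)" by (simp add: sum_distrib_right)
    also have "\<dots> \<le> (\<Sum>X\<in>?T. card reps * q ^ e0 (dv A) d)" by (rule sum_mono[OF PX])
    also have "\<dots> = card ?T * (card reps * q ^ e0 (dv A) d)" by simp
    also have "\<dots> \<le> nA * (card reps * q ^ e0 (dv A) d)"
      unfolding nA_def using finite_subs[OF A] by (intro mult_le_mono1 card_mono) auto
    finally have "(card bad1 * q ^ N) * q ^ e0 (dv A) d \<le> (nA * card reps) * q ^ e0 (dv A) d"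
      by (simp add: mult.assoc mult.left_commute mult.commute)
    then show ?thesis using q_ge_2 by simp
  qed
  \<comment> \<open>Each representation has at least q^<d, dim B> homomorphisms to \<open>B\<close>,
    and twice as many if it has extensions by \<open>B\<close>. Surjective ones use up at most one
    such share on average, so the excess is bounded by those with proper image, which are rarer by a
    factor q^N.\<close>
  have c2: "card bad2 * q ^ N \<le> nB * card reps"
  proof -
    define P where "P W = {(\<psi>, \<rho>). \<rho> \<in> reps \<and> \<psi> \<in> HomE (mk \<rho>) B \<and> im_sub \<psi> (full_sub (mk \<rho>)) = W}" for W
    let ?S = "Sigma reps (\<lambda>\<rho>. HomE (mk \<rho>) B)" and ?T = "subs B - {full_sub B}"
    have PW: "card (P W) * q ^ e1 d (dv B) * q ^ N \<le> card reps * q ^ e0 d (dv B)" if W: "W \<in> ?T" for W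
    proof -
      let ?w = "dv (sub_rep B W)"
      have "e0 d ?w + e1 d (dv B) + N \<le> e0 d (dv B) + e1 d ?w"
        using mult_le_mono2[OF Suc_leI[OF hB[of W]], of N] W by (simp add: e algebra_simps)
      then have le: "q ^ (e0 d ?w + e1 d (dv B) + N) \<le> q ^ (e0 d (dv B) + e1 d ?w)" using q_ge_2 by (intro power_increasing) auto
      have "(card (P W) * q ^ e1 d (dv B) * q ^ N) * q ^ e1 d ?w = (card (P W) * q ^ e1 d ?w) * (q ^ e1 d (dv B) * q ^ N)"
        by simp
      also have "\<dots> \<le> (card reps * q ^ e0 d ?w) * (q ^ e1 d (dv B) * q ^ N)"
        using count_image(2)[OF B, of W] W by (intro mult_le_mono1) (simp add: P_def)
      also have "\<dots> = card reps * q ^ (e0 d ?w + e1 d (dv B) + N)" by (simp add: power_add)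
      also have "\<dots> \<le> card reps * q ^ (e0 d (dv B) + e1 d ?w)" using le by simp
      also have "\<dots> = (card reps * q ^ e0 d (dv B)) * q ^ e1 d ?w" by (simp add: power_add)
      finally show ?thesis using q_ge_2 by simp
    qed
    have PF: "card (P (full_sub B)) * q ^ e1 d (dv B) \<le> card reps * q ^ e0 d (dv B)"
      using count_image(2)[OF B full_sub[OF B]] by (simp add: P_def)
    have sub: "prod.swap ` ?S \<subseteq> (\<Union>W\<in>subs B. P W)"
    proof
      fix z assume "z \<in> prod.swap ` ?S"
      then obtain \<rho> \<psi> where z: "z = (\<psi>, \<rho>)" "\<rho> \<in> reps" "\<psi> \<in> HomE (mk \<rho>) B" by auto
      have h: "\<psi> \<in> Hom (mk \<rho>) B" using z(3) by (simp add: HomE_def)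
      have "im_sub \<psi> (full_sub (mk \<rho>)) \<in> subs B" using im_sub[OF rep_mk[OF z(2)] B h full_sub[OF rep_mk[OF z(2)]]] .
      then show "z \<in> (\<Union>W\<in>subs B. P W)" using z by (auto simp: P_def)
    qed
    have finT: "finite (subs B)" using finite_subs[OF B] .
    have finP: "finite (P W)" if "W \<in> subs B" for W using count_image(1)[OF B that] by (simp add: P_def)
    have "(card reps + card bad2) * q ^ e0 d (dv B) \<le> (\<Sum>\<rho>\<in>reps. card (HomE (mk \<rho>) B) * q ^ e1 d (dv B))"
    proof -
      have "(card reps + card bad2) * q ^ e0 d (dv B) = (\<Sum>\<rho>\<in>reps. q ^ e0 d (dv B)) + (\<Sum>\<rho>\<in>bad2. q ^ e0 d (dv B))"
        by (simp add: algebra_simps)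
      also have "(\<Sum>\<rho>\<in>bad2. q ^ e0 d (dv B)) = (\<Sum>\<rho>\<in>reps. if \<not> ext0 (mk \<rho>) B then q ^ e0 d (dv B) else 0)"
        unfolding bad2_def by (rule sum.inter_filter[OF card_reps(1)])
      also have "(\<Sum>\<rho>\<in>reps. q ^ e0 d (dv B)) + \<dots> = (\<Sum>\<rho>\<in>reps. q ^ e0 d (dv B) + (if \<not> ext0 (mk \<rho>) B then q ^ e0 d (dv B) else 0))"
        by (rule sum.distrib[symmetric])
      also have "\<dots> \<le> (\<Sum>\<rho>\<in>reps. card (HomE (mk \<rho>) B) * q ^ e1 d (dv B))"
      proof (intro sum_mono)
        fix \<rho> assume "\<rho> \<in> reps"
        then show "q ^ e0 d (dv B) + (if \<not> ext0 (mk \<rho>) B then q ^ e0 d (dv B) else 0) \<le> card (HomE (mk \<rho>) B) * q ^ e1 d (dv B)"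
          using HomE_ge(1,3)[OF rep_mk B, of \<rho>] by (simp add: dv_mk mult_2)
      qed
      finally show ?thesis .
    qed
    also have "\<dots> = card ?S * q ^ e1 d (dv B)"
      using card_reps(1) finH by (subst card_SigmaI) (auto simp: sum_distrib_right)
    also have "card ?S = card (prod.swap ` ?S)" by (simp add: card_image)
    also have "card (prod.swap ` ?S) \<le> card (\<Union>W\<in>subs B. P W)" by (rule card_mono[OF _ sub]) (use finT finP in auto)
    also have "card (\<Union>W\<in>subs B. P W) \<le> (\<Sum>W\<in>subs B. card (P W))" by (rule card_UN_le[OF finT])
    also have "(\<Sum>W\<in>subs B. card (P W)) = card (P (full_sub B)) + (\<Sum>W\<in>?T. card (P W))"
      by (rule sum.remove[OF finT full_sub[OF B]])
    finally have "(card reps + card bad2) * q ^ e0 d (dv B)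
       \<le> card (P (full_sub B)) * q ^ e1 d (dv B) + (\<Sum>W\<in>?T. card (P W)) * q ^ e1 d (dv B)" by (simp add: algebra_simps)
    then have "card bad2 * q ^ e0 d (dv B) \<le> (\<Sum>W\<in>?T. card (P W)) * q ^ e1 d (dv B)"
      using PF by (simp add: algebra_simps)
    then have "card bad2 * q ^ e0 d (dv B) * q ^ N \<le> (\<Sum>W\<in>?T. card (P W)) * q ^ e1 d (dv B) * q ^ N" by simp
    also have "\<dots> = (\<Sum>W\<in>?T. card (P W) * q ^ e1 d (dv B) * q ^ N)" by (simp add: sum_distrib_right)
    also have "\<dots> \<le> (\<Sum>W\<in>?T. card reps * q ^ e0 d (dv B))" by (rule sum_mono[OF PW])
    also have "\<dots> = card ?T * (card reps * q ^ e0 d (dv B))" by simp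
    also have "\<dots> \<le> nB * (card reps * q ^ e0 d (dv B))"
      unfolding nB_def using finT by (intro mult_le_mono1 card_mono) auto
    finally have "(card bad2 * q ^ N) * q ^ e0 d (dv B) \<le> (nB * card reps) * q ^ e0 d (dv B)"
      by (simp add: mult.assoc mult.left_commute mult.commute)
    then show ?thesis using q_ge_2 by simp
  qed
  have "bad1 \<union> bad2 \<noteq> reps"
  proof
    assume "bad1 \<union> bad2 = reps"
    then have "card reps * q ^ N \<le> (card bad1 + card bad2) * q ^ N" using card_Un_le[of bad1 bad2] by simp
    also have "\<dots> \<le> (nA + nB) * card reps" using c1 c2 by (simp add: algebra_simps)
    also have "\<dots> < q ^ N * card reps" using qN reps_pos by simp
    finally show False by (simp add: mult.commute)
  qed
  moreover have "bad1 \<union> bad2 \<subseteq> reps" by (auto simp: bad1_def bad2_def)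
  ultimately obtain \<rho> where "\<rho> \<in> reps" "\<rho> \<notin> bad1" "\<rho> \<notin> bad2" by blast
  then obtain \<phi> where "\<rho> \<in> reps" "mono A (mk \<rho>) \<phi>" "ext0 (mk \<rho>) B" by (auto simp: bad1_def bad2_def)
  then show ?thesis using ext0_mono[OF A rep_mk B] by blast
qed

text \<open>\<open>wl\<close> and \<open>wr\<close> are the coefficient vectors of the linear forms
  <x, -> and <-, x>, so that both slots of the Euler form become weights and share the calculus of
  \<open>wt\<close>.\<close>

definition wl :: "('v \<Rightarrow> nat) \<Rightarrow> 'v \<Rightarrow> int" where
  "wl x v = int (x v) - (\<Sum>a | a \<in> arcs Q \<and> head Q a = v. int (x (tail Q a)))"
definition wr :: "('v \<Rightarrow> nat) \<Rightarrow> 'v \<Rightarrow> int" where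
  "wr x v = int (x v) - (\<Sum>a | a \<in> arcs Q \<and> tail Q a = v. int (x (head Q a)))"

lemma sum_arcs_head: "(\<Sum>v\<in>I. \<Sum>a | a \<in> arcs Q \<and> head Q a = v. f a v) = (\<Sum>a\<in>arcs Q. f a (head Q a))"
proof -
  have "(\<Sum>v\<in>I. \<Sum>a | a \<in> arcs Q \<and> head Q a = v. f a v) = (\<Sum>v\<in>I. \<Sum>a | a \<in> arcs Q \<and> head Q a = v. f a (head Q a))"
    by (intro sum.cong) auto
  then show ?thesis using sum.group[OF finite_arcs finite_I, of "head Q" "\<lambda>a. f a (head Q a)"] by (simp add: image_subset_iff)
qed

lemma sum_arcs_tail: "(\<Sum>v\<in>I. \<Sum>a | a \<in> arcs Q \<and> tail Q a = v. f a v) = (\<Sum>a\<in>arcs Q. f a (tail Q a))"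
proof -
  have "(\<Sum>v\<in>I. \<Sum>a | a \<in> arcs Q \<and> tail Q a = v. f a v) = (\<Sum>v\<in>I. \<Sum>a | a \<in> arcs Q \<and> tail Q a = v. f a (tail Q a))"
    by (intro sum.cong) auto
  then show ?thesis using sum.group[OF finite_arcs finite_I, of "tail Q" "\<lambda>a. f a (tail Q a)"] by (simp add: image_subset_iff)
qed

lemma wt_wl: "wt (wl x) M = int (e0 x (dv M)) - int (e1 x (dv M))"
proof -
  have "wt (wl x) M = (\<Sum>v\<in>I. int (x v) * int (dv M v)) - (\<Sum>v\<in>I. \<Sum>a | a \<in> arcs Q \<and> head Q a = v. int (x (tail Q a)) * int (dv M v))"
    by (simp add: wt_def wl_def left_diff_distrib sum_subtractf sum_distrib_right)
  then show ?thesis unfolding sum_arcs_head by (simp add: e0_def e1_def)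
qed

lemma wt_wr: "wt (wr x) M = int (e0 (dv M) x) - int (e1 (dv M) x)"
proof -
  have "wt (wr x) M = (\<Sum>v\<in>I. int (x v) * int (dv M v)) - (\<Sum>v\<in>I. \<Sum>a | a \<in> arcs Q \<and> tail Q a = v. int (x (head Q a)) * int (dv M v))"
    by (simp add: wt_def wr_def left_diff_distrib sum_subtractf sum_distrib_right)
  then show ?thesis unfolding sum_arcs_tail by (simp add: e0_def e1_def mult.commute)
qed

lemma ext0_generic':
  assumes A: "rep A" and B: "rep B"
    and hA: "\<And>X. X \<in> subs A \<Longrightarrow> X \<noteq> zero_sub A \<Longrightarrow> wt (wr x) (sub_rep A X) > 0"
    and hB: "\<And>W. W \<in> subs B \<Longrightarrow> W \<noteq> full_sub B \<Longrightarrow> wt (wl x) (sub_rep B W) < wt (wl x) B"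
  shows "ext0 A B"
  by (rule ext0_generic[OF A B, of x]) (use hA hB in \<open>fastforce simp: wt_wl wt_wr\<close>)+

lemma wl_lin: "wl (\<lambda>v. m * x v + y v) v = int m * wl x v + wl y v"
  by (simp add: wl_def sum.distrib sum_distrib_left algebra_simps)
lemma wr_lin: "wr (\<lambda>v. m * x v + y v) v = int m * wr x v + wr y v"
  by (simp add: wr_def sum.distrib sum_distrib_left algebra_simps)
lemma wt_lin: "wt (\<lambda>v. m * w v + w' v) M = m * wt w M + wt w' M"
  by (simp add: wt_def sum.distrib sum_distrib_left algebra_simps)
lemma wt_wl_lin: "wt (wl (\<lambda>v. m * x v + y v)) M = int m * wt (wl x) M + wt (wl y) M"
  unfolding wt_lin[symmetric] wl_lin[symmetric] ..
lemma wt_wr_lin: "wt (wr (\<lambda>v. m * x v + y v)) M = int m * wt (wr x) M + wt (wr y) M"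
  unfolding wt_lin[symmetric] wr_lin[symmetric] ..

lemma wt_ge_size: "(\<And>v. v \<in> I \<Longrightarrow> w v \<ge> 1) \<Longrightarrow> wt w M \<ge> int (size M)"
proof -
  assume w: "\<And>v. v \<in> I \<Longrightarrow> w v \<ge> 1"
  have "(\<Sum>v\<in>I. int (dv M v)) \<le> (\<Sum>v\<in>I. w v * int (dv M v))"
    using w by (intro sum_mono) (metis mult_right_mono mult_1 of_nat_0_le_iff)
  then show ?thesis by (simp add: wt_def size_def)
qed

text \<open>Let \<open>h\<close> count the vertices reachable from a vertex; by acyclicity it drops
  along arrows. With N above the number of arrows, N^h at a vertex exceeds the sum of N^h over the
  heads of its outgoing arrows; \<open>g\<close> does the same backwards. The resulting forms are
  positive on nonzero dimension vectors and later perturb \<delta>.\<close>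

lemma weights_exist:
  assumes ac: "acyclic_quiver Q"
  obtains y z where "\<And>v. v \<in> I \<Longrightarrow> wr y v \<ge> 1" "\<And>v. v \<in> I \<Longrightarrow> wl z v \<ge> 1"
proof -
  let ?r = "arcs_ends Q"
  have ends: "?r = (\<lambda>a. (tail Q a, head Q a)) ` arcs Q" by (auto simp: arcs_ends_def arc_to_ends_def)
  have finr: "finite ?r" unfolding ends by simp
  have fint: "finite (?r\<^sup>+)" using finr by simp
  have acr: "acyclic ?r" using ac by (simp add: acyclic_quiver_def)
  define N where "N = card (arcs Q) + 1"
  define h where "h v = card {w. (v, w) \<in> ?r\<^sup>+}" for v
  define g where "g v = card {w. (w, v) \<in> ?r\<^sup>+}" for v
  have fin1: "finite {w. (v, w) \<in> ?r\<^sup>+}" for v by (rule finite_subset[OF _ finite_imageI[OF fint, of snd]]) force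
  have fin2: "finite {w. (w, v) \<in> ?r\<^sup>+}" for v by (rule finite_subset[OF _ finite_imageI[OF fint, of fst]]) force
  have hl: "h (head Q a) < h (tail Q a)" if a: "a \<in> arcs Q" for a
  proof -
    have e: "(tail Q a, head Q a) \<in> ?r" using a ends by auto
    have "{w. (head Q a, w) \<in> ?r\<^sup>+} \<subset> {w. (tail Q a, w) \<in> ?r\<^sup>+}"
      using e acr by (auto simp: acyclic_def intro: trancl_into_trancl2)
    then show ?thesis unfolding h_def by (rule psubset_card_mono[OF fin1])
  qed
  have gl: "g (tail Q a) < g (head Q a)" if a: "a \<in> arcs Q" for a
  proof -
    have e: "(tail Q a, head Q a) \<in> ?r" using a ends by auto
    have "{w. (w, tail Q a) \<in> ?r\<^sup>+} \<subset> {w. (w, head Q a) \<in> ?r\<^sup>+}"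
      using e acr by (auto simp: acyclic_def intro: trancl_into_trancl)
    then show ?thesis unfolding g_def by (rule psubset_card_mono[OF fin2])
  qed
  have key: "(\<Sum>a\<in>S. int (N ^ u a)) < int (N ^ n)" if "S \<subseteq> arcs Q" "\<And>a. a \<in> S \<Longrightarrow> u a < n" for S u n
  proof (cases n)
    case 0
    then have "S = {}" using that(2) by auto
    then show ?thesis by (simp add: N_def)
  next
    case (Suc m)
    have "(\<Sum>a\<in>S. int (N ^ u a)) \<le> (\<Sum>a\<in>S. int (N ^ m))"
    proof (intro sum_mono)
      fix a assume "a \<in> S"
      then have "u a \<le> m" using that(2)[of a] Suc by simp
      then have "N ^ u a \<le> N ^ m" by (intro power_increasing) (auto simp: N_def)
      then show "int (N ^ u a) \<le> int (N ^ m)" by (simp only: zle_int)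
    qed
    also have "\<dots> = int (card S) * int (N ^ m)" by simp
    also have "\<dots> < int N * int (N ^ m)"
      using card_mono[OF finite_arcs that(1)] by (intro mult_strict_right_mono) (auto simp: N_def)
    finally show ?thesis using Suc by simp
  qed
  show ?thesis
  proof (rule that[of "\<lambda>v. N ^ h v" "\<lambda>v. N ^ g v"])
    fix v
    show "wr (\<lambda>v. N ^ h v) v \<ge> 1"
      using key[of "{a \<in> arcs Q. tail Q a = v}" "\<lambda>a. h (head Q a)" "h v"] hl by (fastforce simp: wr_def)
    show "wl (\<lambda>v. N ^ g v) v \<ge> 1"
      using key[of "{a \<in> arcs Q. head Q a = v}" "\<lambda>a. g (tail Q a)" "g v"] gl by (fastforce simp: wl_def)
  qed
qed

end

section \<open>Torsion pairs and regular representations\<close>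

lemma graph_connected:
  assumes g: "has_underlying_graph Q n es" and fin: "finite (arcs Q)"
    and wf: "\<And>a. a \<in> arcs Q \<Longrightarrow> tail Q a \<in> verts Q \<and> head Q a \<in> verts Q"
    and conn: "\<And>(P :: nat \<Rightarrow> bool) j. (\<And>i j. (i, j) \<in> set es \<Longrightarrow> P i = P j) \<Longrightarrow> j \<le> n \<Longrightarrow> P j = P 0"
    and S: "S \<subseteq> verts Q" "\<And>a. a \<in> arcs Q \<Longrightarrow> tail Q a \<in> S \<longleftrightarrow> head Q a \<in> S"
  shows "S = {} \<or> S = verts Q"
proof -
  obtain \<phi> where phi: "bij_betw \<phi> (verts Q) {0..n}"
    and m: "image_mset (\<lambda>a. {\<phi> (tail Q a), \<phi> (head Q a)}) (mset_set (arcs Q)) = image_mset (\<lambda>(i, j). {i, j}) (mset es)"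
    using g by (auto simp: has_underlying_graph_def)
  define P where "P i \<longleftrightarrow> i \<in> \<phi> ` S" for i
  have inj: "inj_on \<phi> (verts Q)" using phi by (simp add: bij_betw_def)
  have P: "P (\<phi> u) \<longleftrightarrow> u \<in> S" if "u \<in> verts Q" for u
    unfolding P_def by (rule inj_on_image_mem_iff[OF inj that S(1)])
  have pe: "P i = P j" if ij: "(i, j) \<in> set es" for i j
  proof -
    have "{i, j} \<in># image_mset (\<lambda>(i, j). {i, j}) (mset es)" using ij by force
    then obtain a where a: "a \<in> arcs Q" "{\<phi> (tail Q a), \<phi> (head Q a)} = {i, j}"
      unfolding m[symmetric] using fin by auto
    have "P (\<phi> (tail Q a)) = P (\<phi> (head Q a))" using P wf[OF a(1)] S(2)[OF a(1)] by simp
    then show ?thesis using a(2) by (auto simp: doubleton_eq_iff)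
  qed
  have all: "P j = P 0" if "j \<le> n" for j by (rule conn[of P, OF pe that])
  have "u \<in> S \<longleftrightarrow> P 0" if "u \<in> verts Q" for u
  proof -
    have "\<phi> u \<le> n" using phi that by (auto simp: bij_betw_def)
    then show ?thesis using all[of "\<phi> u"] P[OF that] by blast
  qed
  then show ?thesis using S(1) by (cases "P 0") blast+
qed

lemma conn_A:
  assumes "\<And>i j. (i, j) \<in> set (edges_A n) \<Longrightarrow> P i = P j" "j \<le> n" shows "P j = P (0::nat)"
  using assms(2)
proof (induction j)
  case (Suc j)
  have "(j, Suc j) \<in> set (edges_A n)" using Suc.prems by (auto simp: edges_A_def image_iff)
  then show ?case using Suc assms(1) by simp
qed simp

lemma conn_D:
  assumes e: "\<And>i j. (i, j) \<in> set (edges_D n) \<Longrightarrow> P i = P j" and n: "4 \<le> n" and j: "j \<le> n" shows "P j = P (0::nat)"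
proof -
  have 0: "P 0 = P 2" "P 1 = P 2" "P (n - 2) = P (n - 1)" "P (n - 2) = P n"
    by (rule e; simp add: edges_D_def)+
  have step: "P (Suc i) = P i" if "2 \<le> i" "i < n - 2" for i
    using that by (intro e[symmetric]) (auto simp: edges_D_def image_iff)
  have mid: "P j = P 2" if "2 \<le> j" "j \<le> n - 2" for j
    using that by (induction j rule: dec_induct) (auto simp: step)
  have "j = 0 \<or> j = 1 \<or> (2 \<le> j \<and> j \<le> n - 2) \<or> j = n - 1 \<or> j = n" using j n by linarith
  then show ?thesis using 0 mid[of j] mid[of "n - 2"] n by auto
qed

lemma conn_E6:
  assumes "\<And>i j. (i, j) \<in> set edges_E6 \<Longrightarrow> P i = P j" "j \<le> 6" shows "P j = P (0::nat)"
proof -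
  have "P 0 = P 1" "P 1 = P 2" "P 2 = P 3" "P 3 = P 4" "P 2 = P 5" "P 5 = P 6"
    by (rule assms(1); simp add: edges_E6_def)+
  moreover have "j = 0 \<or> j = 1 \<or> j = 2 \<or> j = 3 \<or> j = 4 \<or> j = 5 \<or> j = 6" using assms(2) by linarith
  ultimately show ?thesis by metis
qed

lemma conn_E7:
  assumes "\<And>i j. (i, j) \<in> set edges_E7 \<Longrightarrow> P i = P j" "j \<le> 7" shows "P j = P (0::nat)"
proof -
  have "P 0 = P 1" "P 1 = P 2" "P 2 = P 3" "P 3 = P 4" "P 4 = P 5" "P 5 = P 6" "P 3 = P 7"
    by (rule assms(1); simp add: edges_E7_def)+
  moreover have "j = 0 \<or> j = 1 \<or> j = 2 \<or> j = 3 \<or> j = 4 \<or> j = 5 \<or> j = 6 \<or> j = 7" using assms(2) by linarith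
  ultimately show ?thesis by metis
qed

lemma conn_E8:
  assumes "\<And>i j. (i, j) \<in> set edges_E8 \<Longrightarrow> P i = P j" "j \<le> 8" shows "P j = P (0::nat)"
proof -
  have "P 0 = P 1" "P 1 = P 2" "P 2 = P 3" "P 3 = P 4" "P 4 = P 5" "P 5 = P 6" "P 6 = P 7" "P 2 = P 8"
    by (rule assms(1); simp add: edges_E8_def)+
  moreover have "j = 0 \<or> j = 1 \<or> j = 2 \<or> j = 3 \<or> j = 4 \<or> j = 5 \<or> j = 6 \<or> j = 7 \<or> j = 8" using assms(2) by linarith
  ultimately show ?thesis by metis
qed

text \<open>Besides finiteness, this is what the list of diagrams contributes: connectedness and at
  least two vertices. Positivity of forms comes from the kernel vector \<delta>.\<close>

lemma affine_connected:
  assumes "affine_quiver Q"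
  shows "\<exists>n\<ge>1. card (verts Q) = n + 1 \<and> (\<forall>S. S \<subseteq> verts Q \<longrightarrow> (\<forall>a\<in>arcs Q. tail Q a \<in> S \<longleftrightarrow> head Q a \<in> S) \<longrightarrow> S = {} \<or> S = verts Q)"
proof -
  have fd: "fin_digraph Q" using assms by (simp add: affine_quiver_def)
  have fin: "finite (arcs Q)" and wf: "\<And>a. a \<in> arcs Q \<Longrightarrow> tail Q a \<in> verts Q \<and> head Q a \<in> verts Q"
    using fd by (auto simp: fin_digraph_def fin_digraph_axioms_def wf_digraph_def)
  have main: ?thesis if g: "has_underlying_graph Q n es" and n: "n \<ge> 1"
    and conn: "\<And>(P :: nat \<Rightarrow> bool) j. (\<And>i j. (i, j) \<in> set es \<Longrightarrow> P i = P j) \<Longrightarrow> j \<le> n \<Longrightarrow> P j = P (0::nat)" for n es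
  proof (intro exI[of _ n] conjI n allI impI)
    show "card (verts Q) = n + 1" using g bij_betw_same_card by (fastforce simp: has_underlying_graph_def)
    fix S assume "S \<subseteq> verts Q" "\<forall>a\<in>arcs Q. tail Q a \<in> S \<longleftrightarrow> head Q a \<in> S"
    then show "S = {} \<or> S = verts Q" by (intro graph_connected[OF g fin wf conn]) auto
  qed
  consider n where "n \<ge> 1" "has_underlying_graph Q n (edges_A n)" | n where "n \<ge> 4" "has_underlying_graph Q n (edges_D n)"
    | "has_underlying_graph Q 6 edges_E6" | "has_underlying_graph Q 7 edges_E7" | "has_underlying_graph Q 8 edges_E8"
    using assms by (auto simp: affine_quiver_def)
  then show ?thesis
  proof cases
    case 1 show ?thesis by (rule main[OF 1(2,1)]) (rule conn_A)
  next
    case 2 show ?thesis by (rule main[OF 2(2)]) (use 2(1) in simp, rule conn_D[OF _ 2(1)])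
  next
    case 3 show ?thesis by (rule main[OF 3]) (simp, rule conn_E6)
  next
    case 4 show ?thesis by (rule main[OF 4]) (simp, rule conn_E7)
  next
    case 5 show ?thesis by (rule main[OF 5]) (simp, rule conn_E8)
  qed
qed

section \<open>The torsion pair of a weight\<close>

context quiver_reps
begin

text \<open>\<open>clsA\<close> and \<open>clsB\<close> are the torsion-free and the torsion class
  of the weight: nonzero subrepresentations are negative, respectively quotients are nonnegative,
  the latter expressed through subrepresentations by additivity. \<open>hn\<close> singles out the
  torsion subrepresentation.\<close>

definition clsA :: "('v \<Rightarrow> int) \<Rightarrow> ('v, 'a, 'k, 'm) quiver_rep \<Rightarrow> bool" where
  "clsA w M \<longleftrightarrow> (\<forall>X\<in>subs M. X \<noteq> zero_sub M \<longrightarrow> wt w (sub_rep M X) < 0)"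
definition clsB :: "('v \<Rightarrow> int) \<Rightarrow> ('v, 'a, 'k, 'm) quiver_rep \<Rightarrow> bool" where
  "clsB w M \<longleftrightarrow> (\<forall>X\<in>subs M. wt w (sub_rep M X) \<le> wt w M)"
definition hn :: "('v \<Rightarrow> int) \<Rightarrow> ('v, 'a, 'k, 'm) quiver_rep \<Rightarrow> ('v \<Rightarrow> 'm set) \<Rightarrow> bool" where
  "hn w M X \<longleftrightarrow> X \<in> subs M \<and> clsB w (sub_rep M X) \<and> clsA w (quot M X)"

lemma clsB_sub: "rep M \<Longrightarrow> X \<in> subs M \<Longrightarrow> clsB w (sub_rep M X) \<longleftrightarrow> (\<forall>Y\<in>subs M. Y \<le> X \<longrightarrow> wt w (sub_rep M Y) \<le> wt w (sub_rep M X))"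
  unfolding clsB_def using subs_sub_rep[of M X] by auto

lemma wt_sub_im:
  assumes "rep M" "rep N" "onto M N \<phi>" "ker_sub M N \<phi> = X" "Z \<in> subs M" "X \<le> Z"
  shows "wt w (sub_rep M Z) = wt w (sub_rep M X) + wt w (sub_rep N (im_sub \<phi> Z))"
  using wt_onto[OF rep_sub_rep[OF assms(1,5)] rep_sub_rep[OF assms(2) im_subs[OF assms(1-5)]] sub_im_onto(1)[OF assms]]
    sub_im_onto(2)[OF assms] by simp

lemma im_zero_iff:
  assumes "rep M" "rep N" "onto M N \<phi>" "ker_sub M N \<phi> = X" "Z \<in> subs M" "X \<le> Z"
  shows "im_sub \<phi> Z = zero_sub N \<longleftrightarrow> Z = X"
proof -
  have "inj_on (im_sub \<phi>) {Z \<in> subs M. X \<le> Z}" using im_bij[OF assms(1-4)] by (simp add: bij_betw_def)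
  then show ?thesis using im_ker[OF assms(1-4)] assms(5,6) ker_subs[OF assms(1-4)] by (auto simp: inj_on_def)
qed

lemma clsA_onto:
  assumes "rep M" "rep N" "onto M N \<phi>" "ker_sub M N \<phi> = X"
  shows "clsA w N \<longleftrightarrow> (\<forall>Z\<in>subs M. X \<le> Z \<longrightarrow> Z \<noteq> X \<longrightarrow> wt w (sub_rep M Z) < wt w (sub_rep M X))"
proof -
  have img: "subs N = im_sub \<phi> ` {Z \<in> subs M. X \<le> Z}" using im_bij[OF assms] by (simp add: bij_betw_def)
  have "clsA w N \<longleftrightarrow> (\<forall>Z\<in>{Z \<in> subs M. X \<le> Z}. im_sub \<phi> Z \<noteq> zero_sub N \<longrightarrow> wt w (sub_rep N (im_sub \<phi> Z)) < 0)"
    unfolding clsA_def img by blast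
  also have "\<dots> \<longleftrightarrow> (\<forall>Z\<in>{Z \<in> subs M. X \<le> Z}. Z \<noteq> X \<longrightarrow> wt w (sub_rep M Z) < wt w (sub_rep M X))"
    using im_zero_iff[OF assms] wt_sub_im[OF assms, of _ w] by (intro ball_cong) auto
  finally show ?thesis by blast
qed

lemma clsB_onto:
  assumes "rep M" "rep N" "onto M N \<phi>" "ker_sub M N \<phi> = X"
  shows "clsB w N \<longleftrightarrow> (\<forall>Z\<in>subs M. X \<le> Z \<longrightarrow> wt w (sub_rep M Z) \<le> wt w M)"
proof -
  have img: "subs N = im_sub \<phi> ` {Z \<in> subs M. X \<le> Z}" using im_bij[OF assms] by (simp add: bij_betw_def)
  have "wt w M = wt w (sub_rep M X) + wt w N" using wt_onto[OF assms(1-3), of w] assms(4) by simp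
  then have "wt w (sub_rep N (im_sub \<phi> Z)) \<le> wt w N \<longleftrightarrow> wt w (sub_rep M Z) \<le> wt w M" if "Z \<in> subs M" "X \<le> Z" for Z
    using wt_sub_im[OF assms that, of w] by simp
  then show ?thesis unfolding clsB_def img by blast
qed

lemma clsA_quot: "rep M \<Longrightarrow> X \<in> subs M \<Longrightarrow> clsA w (quot M X) \<longleftrightarrow>
    (\<forall>Z\<in>subs M. X \<le> Z \<longrightarrow> Z \<noteq> X \<longrightarrow> wt w (sub_rep M Z) < wt w (sub_rep M X))"
  using clsA_onto[OF _ quot] by blast

lemma clsB_quot: "rep M \<Longrightarrow> X \<in> subs M \<Longrightarrow> clsB w (quot M X) \<longleftrightarrow>
    (\<forall>Z\<in>subs M. X \<le> Z \<longrightarrow> wt w (sub_rep M Z) \<le> wt w M)"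
  using clsB_onto[OF _ quot] by blast

lemma clsB_quot_of: "rep M \<Longrightarrow> X \<in> subs M \<Longrightarrow> clsB w M \<Longrightarrow> clsB w (quot M X)"
  using clsB_quot[of M X w] by (auto simp: clsB_def)

lemma cls_iso:
  assumes "rep M" "rep N" "M \<approx> N"
  shows "clsA w M \<longleftrightarrow> clsA w N" "clsB w M \<longleftrightarrow> clsB w N"
proof -
  obtain \<phi> where p: "mono M N \<phi>" "onto M N \<phi>" using assms(3) iso_iff by blast
  have k: "ker_sub M N \<phi> = zero_sub M" using mono_iff[OF assms(1,2)] p by (auto simp: mono_def)
  have 0: "wt w (sub_rep M (zero_sub M)) = 0" using assms(1) by (simp add: wt_zero)
  show "clsA w M \<longleftrightarrow> clsA w N" unfolding clsA_onto[OF assms(1,2) p(2) k] using zero_le[OF _ assms(1)] 0 by (auto simp: clsA_def)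
  show "clsB w M \<longleftrightarrow> clsB w N" unfolding clsB_onto[OF assms(1,2) p(2) k] using zero_le[OF _ assms(1)] by (auto simp: clsB_def)
qed

text \<open>Among the subrepresentations of maximal weight take one of maximal size. The first
  maximality makes its quotients nonnegative, the second makes everything strictly above it strictly
  lighter. The maximal weight is exported because it later shows that this subrepresentation has
  defect zero.\<close>

lemma hn_exists:
  assumes M: "rep M" shows "\<exists>X. hn w M X \<and> (\<forall>Y\<in>subs M. wt w (sub_rep M Y) \<le> wt w (sub_rep M X))"
proof -
  let ?f = "\<lambda>X. wt w (sub_rep M X)" and ?g = "\<lambda>X. size (sub_rep M X)"
  have fin: "finite (subs M)" and ne: "subs M \<noteq> {}" using finite_subs[OF M] zero_sub[OF M] by auto
  define S where "S = {X \<in> subs M. ?f X = Max (?f ` subs M)}"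
  have "Max (?f ` subs M) \<in> ?f ` subs M" using fin ne by (intro Max_in) auto
  then have neS: "S \<noteq> {}" and finS: "finite S" using fin by (auto simp: S_def)
  have "Max (?g ` S) \<in> ?g ` S" using finS neS by (intro Max_in) auto
  then obtain X where X: "X \<in> S" "?g X = Max (?g ` S)" by auto
  have XM: "X \<in> subs M" using X by (simp add: S_def)
  have f: "?f Y \<le> ?f X" if "Y \<in> subs M" for Y using X fin that by (auto simp: S_def)
  have "?f Z < ?f X" if Z: "Z \<in> subs M" "X \<le> Z" "Z \<noteq> X" for Z
  proof (rule ccontr)
    assume "\<not> ?f Z < ?f X"
    then have "Z \<in> S" using f[OF Z(1)] X Z(1) by (simp add: S_def)
    then have "?g Z \<le> ?g X" using X finS by simp
    then show False using size_sub_less[OF M XM Z(1,2)] Z(3) by auto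
  qed
  then have "hn w M X" unfolding hn_def clsB_sub[OF M XM] clsA_quot[OF M XM] using f XM by auto
  then show ?thesis using f by blast
qed

text \<open>If X' were not contained in X, then X + X' would be lighter than X while X \<inter> X'
  is no heavier than X', against additivity on sums and intersections.\<close>

lemma hn_unique:
  assumes M: "rep M" and "hn w M X" "hn w M X'"
  shows "X = X'"
proof -
  have le: "X' \<le> X" if X: "hn w M X" and X': "hn w M X'" for X X'
  proof (rule ccontr)
    assume n: "\<not> X' \<le> X"
    have s: "X \<in> subs M" "X' \<in> subs M" using X X' by (auto simp: hn_def)
    let ?Z = "sum_sub M X X'"
    have Z: "?Z \<in> subs M" "X \<le> ?Z" "X' \<le> ?Z" using sum_sub[OF M s] sum_ge[OF M s] by auto
    then have "?Z \<noteq> X" using n by auto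
    then have "wt w (sub_rep M ?Z) < wt w (sub_rep M X)" using X clsA_quot[OF M s(1)] Z by (auto simp: hn_def)
    moreover have "wt w (sub_rep M (inter_sub X X')) \<le> wt w (sub_rep M X')"
      using X' clsB_sub[OF M s(2)] inter_sub[OF s] inter_le(2)[OF s] by (auto simp: hn_def)
    ultimately show False using wt_modular[OF M s, of w] by simp
  qed
  show ?thesis using le[OF assms(2,3)] le[OF assms(3,2)] by (rule antisym[rotated])
qed

lemma clsA_zero: "rep M \<Longrightarrow> clsA w M \<Longrightarrow> wt w M \<ge> 0 \<Longrightarrow> dv M = (\<lambda>v. 0)"
  using full_sub[of M] wt_full[of w M] zero_rep_iff zero_rep_dv unfolding clsA_def by force

lemma clsA_neg: "rep M \<Longrightarrow> clsA w M \<Longrightarrow> dv M \<noteq> (\<lambda>v. 0) \<Longrightarrow> wt w M < 0"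
  using clsA_zero not_le by blast

lemma clsB_nonneg: "rep M \<Longrightarrow> clsB w M \<Longrightarrow> wt w M \<ge> 0"
  using zero_sub[of M] wt_zero[of "sub_rep M (zero_sub M)" w] by (auto simp: clsB_def)

text \<open>Composing the two projections gives a retraction of \<open>M\<close> onto
  \<open>Z\<close>, whose kernel is a complement.\<close>

lemma summand_trans:
  assumes M: "rep M" and c: "comp M X Y" and c': "comp (sub_rep M X) Z Z'"
  shows "\<exists>Y'. comp M Z Y'"
proof -
  have X: "X \<in> subs M" using compD(1)[OF c] .
  note RX = rep_sub_rep[OF M X]
  have "Z \<in> subs (sub_rep M X)" using compD(1)[OF c'] .
  then have Z: "Z \<in> subs M" "Z \<le> X" using subs_sub_rep[OF M X] by auto
  obtain p where p: "p \<in> Hom M (sub_rep M X)" "\<And>v x. v \<in> I \<Longrightarrow> x \<in> X v \<Longrightarrow> p v x = x"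
    "\<And>v y. v \<in> I \<Longrightarrow> y \<in> Y v \<Longrightarrow> p v y = zer M v" using comp_proj[OF M c] by blast
  obtain r where r': "r \<in> Hom (sub_rep M X) (sub_rep (sub_rep M X) Z)" "\<And>v x. v \<in> I \<Longrightarrow> x \<in> Z v \<Longrightarrow> r v x = x"
    "\<And>v y. v \<in> I \<Longrightarrow> y \<in> Z' v \<Longrightarrow> r v y = zer (sub_rep M X) v" using comp_proj[OF RX c'] by blast
  have r: "r \<in> Hom (sub_rep M X) (sub_rep M Z)" "\<And>v x. v \<in> I \<Longrightarrow> x \<in> Z v \<Longrightarrow> r v x = x" using r'(1,2) by simp_all
  let ?f = "\<lambda>v x. r v (p v x)"
  have f: "?f \<in> Hom M (sub_rep M Z)" by (rule Hom_comp[OF p(1) r(1)])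
  have id: "?f v x = x" if "v \<in> I" "x \<in> Z v" for v x
  proof -
    have "x \<in> X v" using that Z(2) by (auto simp: le_fun_def)
    then show ?thesis using that p(2) r(2) by simp
  qed
  have o: "onto M (sub_rep M Z) ?f" unfolding onto_def
  proof (intro conjI ballI f subset_antisym)
    fix v assume v: "v \<in> I"
    show "?f v ` car M v \<subseteq> car (sub_rep M Z) v" using HomD(2)[OF f v] by auto
    show "car (sub_rep M Z) v \<subseteq> ?f v ` car M v"
    proof
      fix x assume x: "x \<in> car (sub_rep M Z) v"
      then have "x = ?f v x" "x \<in> car M v" using id[OF v] subs_mem[OF Z(1) v] by auto
      then show "x \<in> ?f v ` car M v" by blast
    qed
  qed
  have "comp M (ker_sub M (sub_rep M Z) ?f) (im_sub (\<lambda>v x. x) (full_sub (sub_rep M Z)))"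
    by (rule section_comp[OF M rep_sub_rep[OF M Z(1)] o refl Hom_incl[OF M Z(1)]]) (use id in auto)
  moreover have "im_sub (\<lambda>v x. x) (full_sub (sub_rep M Z)) = Z"
    using subsD(1)[OF Z(1)] by (intro ext) (auto simp: im_sub_def full_sub_def extensional_def)
  ultimately show ?thesis using comp_sym[OF M] by auto
qed

lemma comp_full_zero: "rep M \<Longrightarrow> comp M (full_sub M) (zero_sub M)"
proof -
  assume M: "rep M"
  have "car M v <+>\<^bsub>space M v\<^esub> {zer M v} = car M v" if v: "v \<in> I" for v
  proof -
    interpret V: vectorspace K "space M v" using repD(2)[OF M v] .
    show ?thesis by (auto simp: set_add_def')
  qed
  then show ?thesis using full_sub[OF M] zero_sub[OF M] zer_closed[OF M]
    by (auto simp: complementary_subreps_def full_sub_def zero_sub_def)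
qed

lemma wt_comp: "rep M \<Longrightarrow> comp M X Y \<Longrightarrow> wt w M = wt w (sub_rep M X) + wt w (sub_rep M Y)"
  by (rule wt_add) (rule dv_comp)

lemma size_comp: "rep M \<Longrightarrow> comp M X Y \<Longrightarrow> size M = size (sub_rep M X) + size (sub_rep M Y)"
  by (simp add: size_def dv_comp[of M X Y] flip: sum.distrib)

lemma decomposable:
  assumes M: "rep M" and "\<not> indecomposable Q K M" "dv M \<noteq> (\<lambda>v. 0)"
  obtains X Y where "comp M X Y" "dv (sub_rep M X) \<noteq> (\<lambda>v. 0)" "dv (sub_rep M Y) \<noteq> (\<lambda>v. 0)"
  using assms zero_rep_dv[OF M] zero_rep_dv[OF rep_sub_rep[OF M]] compD(1,2)
  unfolding indecomposable_def by metis

end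

section \<open>The radical vector and the defect\<close>

locale affine = quiver_reps K Q for K :: "('k, 'e) ring_scheme" and Q :: "('v, 'a) pre_digraph" +
  fixes \<delta> :: "'v \<Rightarrow> nat"
  assumes affine_Q: "affine_quiver Q" and acyclic_Q: "acyclic_quiver Q"
    and root: "indivisible_imaginary_root Q \<delta>"
begin

lemma kernel_vertex:
  assumes v: "v \<in> I"
  shows "2 * int (\<delta> v) = (\<Sum>a | a \<in> arcs Q \<and> head Q a = v. int (\<delta> (tail Q a))) + (\<Sum>a | a \<in> arcs Q \<and> tail Q a = v. int (\<delta> (head Q a)))"
proof -
  have "(\<lambda>v. int (\<delta> v)) \<in> {\<lambda>v. n * int (\<delta> v) | n. True}" by (rule CollectI, rule exI[of _ 1]) simp
  then have k: "\<And>y. y \<in> int_vectors Q \<Longrightarrow> sym_euler_form Q (\<lambda>v. int (\<delta> v)) y = 0"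
    using root unfolding indivisible_imaginary_root_def by blast
  have "sym_euler_form Q (\<lambda>v. int (\<delta> v)) (\<lambda>u. if u = v then 1 else 0) = 0"
    by (rule k) (use v in \<open>auto simp: int_vectors_def\<close>)
  moreover have "(\<Sum>a\<in>arcs Q. int (\<delta> (tail Q a)) * (if head Q a = v then 1 else 0)) = (\<Sum>a | a \<in> arcs Q \<and> head Q a = v. int (\<delta> (tail Q a)))"
    by (simp add: sum.inter_filter) (intro sum.cong, auto)
  moreover have "(\<Sum>a\<in>arcs Q. (if tail Q a = v then 1 else 0) * int (\<delta> (head Q a))) = (\<Sum>a | a \<in> arcs Q \<and> tail Q a = v. int (\<delta> (head Q a)))"
    by (simp add: sum.inter_filter) (intro sum.cong, auto)
  moreover have "(\<Sum>u\<in>I. int (\<delta> u) * (if u = v then 1 else 0)) = int (\<delta> v)" using v by (simp add: if_distrib sum.delta cong: if_cong)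
  moreover have "(\<Sum>u\<in>I. (if u = v then 1 else 0) * int (\<delta> u)) = int (\<delta> v)" using v by (simp add: if_distrib[of "\<lambda>x. x * _"] sum.delta cong: if_cong)
  ultimately show ?thesis by (simp add: sym_euler_form_def euler_form_def)
qed

text \<open>At a vertex where \<delta> vanishes, the sum over the neighbours is zero, so \<delta>
  vanishes at each of them; by connectedness it would vanish everywhere, against gcd 1.\<close>

lemma delta_pos: assumes v: "v \<in> I" shows "\<delta> v > 0"
proof -
  define S where "S = {v \<in> I. \<delta> v = 0}"
  have nb: "\<delta> (tail Q a) = 0 \<longleftrightarrow> \<delta> (head Q a) = 0" if a: "a \<in> arcs Q" for a
  proof
    assume 0: "\<delta> (tail Q a) = 0"
    have "(\<Sum>b | b \<in> arcs Q \<and> tail Q b = tail Q a. int (\<delta> (head Q b))) \<le> 0"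
      using kernel_vertex[OF tail_I[OF a]] 0 sum_nonneg[of "{b \<in> arcs Q. head Q b = tail Q a}" "\<lambda>b. int (\<delta> (tail Q b))"] by simp
    moreover have "int (\<delta> (head Q a)) \<le> (\<Sum>b | b \<in> arcs Q \<and> tail Q b = tail Q a. int (\<delta> (head Q b)))"
      using a by (intro member_le_sum[of a _ "\<lambda>b. int (\<delta> (head Q b))"]) auto
    ultimately show "\<delta> (head Q a) = 0" by simp
  next
    assume 0: "\<delta> (head Q a) = 0"
    have "(\<Sum>b | b \<in> arcs Q \<and> head Q b = head Q a. int (\<delta> (tail Q b))) \<le> 0"
      using kernel_vertex[OF head_I[OF a]] 0 sum_nonneg[of "{b \<in> arcs Q. tail Q b = head Q a}" "\<lambda>b. int (\<delta> (head Q b))"] by simp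
    moreover have "int (\<delta> (tail Q a)) \<le> (\<Sum>b | b \<in> arcs Q \<and> head Q b = head Q a. int (\<delta> (tail Q b)))"
      using a by (intro member_le_sum[of a _ "\<lambda>b. int (\<delta> (tail Q b))"]) auto
    ultimately show "\<delta> (tail Q a) = 0" by simp
  qed
  have "S \<subseteq> I" "\<forall>a\<in>arcs Q. tail Q a \<in> S \<longleftrightarrow> head Q a \<in> S" using nb by (auto simp: S_def)
  then have "S = {} \<or> S = I" using affine_connected[OF affine_Q] by blast
  moreover have "S \<noteq> I"
  proof
    assume "S = I"
    then have "\<delta> ` I = {0}" using v by (force simp: S_def)
    moreover have "Gcd (\<delta> ` I) = 1" using root by (simp add: indivisible_imaginary_root_def)
    ultimately show False by simp
  qed
  ultimately show ?thesis using v by (auto simp: S_def)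
qed

text \<open>Real values are needed because the sum-of-squares identity in \<open>q_pos\<close> takes
  y = x^2/\<delta> at each vertex.\<close>

lemma kernel_real:
  fixes y :: "'v \<Rightarrow> real"
  shows "2 * (\<Sum>v\<in>I. real (\<delta> v) * y v) = (\<Sum>a\<in>arcs Q. real (\<delta> (tail Q a)) * y (head Q a) + real (\<delta> (head Q a)) * y (tail Q a))"
proof -
  have kv: "2 * real (\<delta> v) = (\<Sum>a | a \<in> arcs Q \<and> head Q a = v. real (\<delta> (tail Q a))) + (\<Sum>a | a \<in> arcs Q \<and> tail Q a = v. real (\<delta> (head Q a)))"
    if v: "v \<in> I" for v
  proof -
    have "real_of_int (2 * int (\<delta> v)) = real_of_int ((\<Sum>a | a \<in> arcs Q \<and> head Q a = v. int (\<delta> (tail Q a))) + (\<Sum>a | a \<in> arcs Q \<and> tail Q a = v. int (\<delta> (head Q a))))"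
      using kernel_vertex[OF v] by simp
    then show ?thesis by simp
  qed
  have "2 * (\<Sum>v\<in>I. real (\<delta> v) * y v) = (\<Sum>v\<in>I. 2 * real (\<delta> v) * y v)" by (simp add: sum_distrib_left mult.assoc)
  also have "\<dots> = (\<Sum>v\<in>I. \<Sum>a | a \<in> arcs Q \<and> head Q a = v. real (\<delta> (tail Q a)) * y v) + (\<Sum>v\<in>I. \<Sum>a | a \<in> arcs Q \<and> tail Q a = v. real (\<delta> (head Q a)) * y v)"
    unfolding sum.distrib[symmetric] by (intro sum.cong refl) (simp add: kv distrib_right sum_distrib_right)
  finally show ?thesis unfolding sum_arcs_head sum_arcs_tail by (simp add: sum.distrib)
qed

text \<open>The defect, whose sign separates preprojective, regular and preinjective
  indecomposables.\<close>

abbreviation th :: "('v, 'a, 'k, 'm) quiver_rep \<Rightarrow> int" where "th M \<equiv> wt (wl \<delta>) M"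

lemma th_euler: "th M = euler_dim Q \<delta> (dv M)" by (simp add: wt_wl euler_e)

lemma th_real: "2 * real_of_int (th M) = (\<Sum>a\<in>arcs Q. real (\<delta> (head Q a)) * real (dv M (tail Q a)) - real (\<delta> (tail Q a)) * real (dv M (head Q a)))"
  using kernel_real[of "\<lambda>v. real (dv M v)"] by (simp add: wt_wl e0_def e1_def sum.distrib sum_subtractf algebra_simps)

lemma wr_delta: "wt (wr \<delta>) M = - th M"
proof -
  have "2 * real_of_int (wt (wr \<delta>) M + th M) = 0"
    using kernel_real[of "\<lambda>v. real (dv M v)"]
    by (simp add: wt_wl wt_wr e0_def e1_def sum.distrib sum_subtractf algebra_simps)
  then have "real_of_int (wt (wr \<delta>) M + th M) = 0" by simp
  then have "wt (wr \<delta>) M + th M = 0" by (simp only: of_int_eq_0_iff)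
  then show ?thesis by linarith
qed

text \<open>Twice the Euler form of x is the sum over the arrows s -> t of \<delta>_s \<delta>_t
  (x_s/\<delta>_s - x_t/\<delta>_t)^2. If it vanishes, x is proportional to \<delta> along every
  arrow, and \<open>th_real\<close> makes the defect zero.\<close>

lemma q_pos:
  assumes "th M \<noteq> 0"
  shows "e1 (dv M) (dv M) < e0 (dv M) (dv M)"
proof -
  define D where "D v = real (\<delta> v)" for v
  define x where "x v = real (dv M v)" for v
  have D: "v \<in> I \<Longrightarrow> D v > 0" for v using delta_pos by (simp add: D_def)
  let ?f = "\<lambda>a. D (tail Q a) * D (head Q a) * (x (tail Q a) / D (tail Q a) - x (head Q a) / D (head Q a))\<^sup>2"
  have "2 * (\<Sum>v\<in>I. x v * x v) = 2 * (\<Sum>v\<in>I. D v * (x v * x v / D v))" using D by (force intro!: sum.cong)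
  also have "\<dots> = (\<Sum>a\<in>arcs Q. D (tail Q a) * (x (head Q a) * x (head Q a) / D (head Q a)) + D (head Q a) * (x (tail Q a) * x (tail Q a) / D (tail Q a)))"
    unfolding D_def by (rule kernel_real)
  also have "\<dots> = (\<Sum>a\<in>arcs Q. ?f a + 2 * (x (tail Q a) * x (head Q a)))"
  proof (rule sum.cong)
    fix a assume "a \<in> arcs Q"
    then have "D (tail Q a) > 0" "D (head Q a) > 0" using D by auto
    then show "D (tail Q a) * (x (head Q a) * x (head Q a) / D (head Q a)) + D (head Q a) * (x (tail Q a) * x (tail Q a) / D (tail Q a))
       = ?f a + 2 * (x (tail Q a) * x (head Q a))" by (simp add: field_simps power2_eq_square)
  qed simp
  finally have id: "2 * ((\<Sum>v\<in>I. x v * x v) - (\<Sum>a\<in>arcs Q. x (tail Q a) * x (head Q a))) = (\<Sum>a\<in>arcs Q. ?f a)"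
    by (simp add: sum.distrib sum_distrib_left)
  have nn: "?f a \<ge> 0" if "a \<in> arcs Q" for a using D[OF tail_I[OF that]] D[OF head_I[OF that]] by simp
  have ne: "(\<Sum>a\<in>arcs Q. ?f a) \<noteq> 0"
  proof
    assume "(\<Sum>a\<in>arcs Q. ?f a) = 0"
    then have z: "?f a = 0" if "a \<in> arcs Q" for a using sum_nonneg_eq_0_iff[OF finite_arcs nn] that by simp
    have "D (head Q a) * x (tail Q a) - D (tail Q a) * x (head Q a) = 0" if a: "a \<in> arcs Q" for a
    proof -
      have "D (tail Q a) > 0" "D (head Q a) > 0" using D a by auto
      then show ?thesis using z[OF a] by (simp add: field_simps)
    qed
    then have "2 * real_of_int (th M) = 0" unfolding th_real D_def x_def by simp
    then show False using assms by simp
  qed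
  have ge: "(\<Sum>a\<in>arcs Q. ?f a) \<ge> 0" by (rule sum_nonneg[OF nn])
  have "0 < 2 * ((\<Sum>v\<in>I. x v * x v) - (\<Sum>a\<in>arcs Q. x (tail Q a) * x (head Q a)))"
    unfolding id by (rule le_neq_trans[OF ge ne[symmetric]])
  then have "(\<Sum>a\<in>arcs Q. x (tail Q a) * x (head Q a)) < (\<Sum>v\<in>I. x v * x v)" by simp
  then have "real (e1 (dv M) (dv M)) < real (e0 (dv M) (dv M))" by (simp add: e0_def e1_def x_def)
  then show ?thesis by simp
qed

text \<open>Generic dimension m \<delta> + z. On a nonzero subrepresentation of \<open>A\<close> the
  form <-, \<delta>> is at least 1, and a large m swamps the contribution of z; on a nonzero
  quotient of \<open>B\<close> the form <\<delta>, -> is only nonnegative, and the positive form <z,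
  -> makes the sum strictly positive.\<close>

lemma ext0_AB:
  assumes A: "rep A" and B: "rep B" and cA: "clsA (wl \<delta>) A" and cB: "clsB (wl \<delta>) B"
  shows "ext0 A B"
proof -
  obtain z where z: "\<And>v. v \<in> I \<Longrightarrow> wl z v \<ge> 1" using weights_exist[OF acyclic_Q] by blast
  \<comment> \<open>Any number above all |<dim X, z>| will do; the sum over the finitely many X
    yields one.\<close>
  define m where "m = Suc (\<Sum>X\<in>subs A. nat \<bar>wt (wr z) (sub_rep A X)\<bar>)"
  have m: "int m > \<bar>wt (wr z) (sub_rep A X)\<bar>" if "X \<in> subs A" for X
  proof -
    have "nat \<bar>wt (wr z) (sub_rep A X)\<bar> \<le> (\<Sum>X\<in>subs A. nat \<bar>wt (wr z) (sub_rep A X)\<bar>)"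
      using finite_subs[OF A] that by (intro member_le_sum) auto
    then have "\<bar>wt (wr z) (sub_rep A X)\<bar> \<le> int (\<Sum>X\<in>subs A. nat \<bar>wt (wr z) (sub_rep A X)\<bar>)" by (simp only: nat_le_iff)
    then show ?thesis unfolding m_def of_nat_Suc by linarith
  qed
  show ?thesis
  proof (rule ext0_generic'[OF A B, of "\<lambda>v. m * \<delta> v + z v"])
    fix X assume X: "X \<in> subs A" "X \<noteq> zero_sub A"
    then have "th (sub_rep A X) \<le> - 1" using cA by (force simp: clsA_def)
    then have "int m * th (sub_rep A X) \<le> int m * (- 1)" by (intro mult_left_mono) auto
    then show "0 < wt (wr (\<lambda>v. m * \<delta> v + z v)) (sub_rep A X)"
      using m[OF X(1)] by (simp add: wt_wr_lin wr_delta)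
  next
    fix W assume W: "W \<in> subs B" "W \<noteq> full_sub B"
    have "int m * th (sub_rep B W) \<le> int m * th B" using cB W by (intro mult_left_mono) (auto simp: clsB_def)
    moreover have "wt (wl z) B = wt (wl z) (sub_rep B W) + wt (wl z) (quot B W)" by (rule wt_quot[OF B W(1)])
    moreover have "int (size (quot B W)) \<le> wt (wl z) (quot B W)" by (rule wt_ge_size[OF z])
    moreover have "size (quot B W) \<noteq> 0" using W quot_zero_rep[OF B W(1)] size_zero_iff by blast
    ultimately show "wt (wl (\<lambda>v. m * \<delta> v + z v)) (sub_rep B W) < wt (wl (\<lambda>v. m * \<delta> v + z v)) B"
      by (simp add: wt_wl_lin)
  qed
qed

text \<open>Mirror image of \<open>ext0_AB\<close>: strictness now sits in the second argument, so
  the perturbation y has to be positive in the form <-, y>, and m has to dominate <y, ->. It serves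
  to split off a part that carries the whole defect.\<close>

lemma ext0_RI:
  assumes A: "rep A" and B: "rep B" and cA: "\<And>X. X \<in> subs A \<Longrightarrow> th (sub_rep A X) \<le> 0"
    and cB: "\<And>W. W \<in> subs B \<Longrightarrow> W \<noteq> full_sub B \<Longrightarrow> th (sub_rep B W) < th B"
  shows "ext0 A B"
proof -
  obtain y where y: "\<And>v. v \<in> I \<Longrightarrow> wr y v \<ge> 1" using weights_exist[OF acyclic_Q] by blast
  define m where "m = Suc (\<Sum>W\<in>subs B. nat \<bar>wt (wl y) (quot B W)\<bar>)"
  have m: "int m > \<bar>wt (wl y) (quot B W)\<bar>" if "W \<in> subs B" for W
  proof -
    have "nat \<bar>wt (wl y) (quot B W)\<bar> \<le> (\<Sum>W\<in>subs B. nat \<bar>wt (wl y) (quot B W)\<bar>)"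
      using finite_subs[OF B] that by (intro member_le_sum) auto
    then have "\<bar>wt (wl y) (quot B W)\<bar> \<le> int (\<Sum>W\<in>subs B. nat \<bar>wt (wl y) (quot B W)\<bar>)" by (simp only: nat_le_iff)
    then show ?thesis unfolding m_def of_nat_Suc by linarith
  qed
  show ?thesis
  proof (rule ext0_generic'[OF A B, of "\<lambda>v. m * \<delta> v + y v"])
    fix X assume X: "X \<in> subs A" "X \<noteq> zero_sub A"
    have "int m * th (sub_rep A X) \<le> 0" using cA[OF X(1)] by (simp add: mult_nonneg_nonpos)
    moreover have "int (size (sub_rep A X)) \<le> wt (wr y) (sub_rep A X)" by (rule wt_ge_size[OF y])
    moreover have "size (sub_rep A X) \<noteq> 0" using X sub_zero_iff[OF A X(1)] size_zero_iff by blast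
    ultimately show "0 < wt (wr (\<lambda>v. m * \<delta> v + y v)) (sub_rep A X)" by (simp add: wt_wr_lin wr_delta)
  next
    fix W assume W: "W \<in> subs B" "W \<noteq> full_sub B"
    have "wt (wl y) B = wt (wl y) (sub_rep B W) + wt (wl y) (quot B W)" by (rule wt_quot[OF B W(1)])
    moreover have "int m * 1 \<le> int m * (th B - th (sub_rep B W))" using cB[OF W] by (intro mult_left_mono) auto
    ultimately show "wt (wl (\<lambda>v. m * \<delta> v + y v)) (sub_rep B W) < wt (wl (\<lambda>v. m * \<delta> v + y v)) B"
      using m[OF W(1)] by (simp add: wt_wl_lin right_diff_distrib)
  qed
qed

section \<open>Regular representations as semistable representations of defect zero\<close>

definition RR :: "('v, 'a, 'k, 'm) quiver_rep \<Rightarrow> bool" where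
  "RR M \<longleftrightarrow> th M = 0 \<and> clsB (wl \<delta>) M"

lemma RR_iso: "rep M \<Longrightarrow> rep N \<Longrightarrow> M \<approx> N \<Longrightarrow> RR M \<longleftrightarrow> RR N"
  unfolding RR_def using cls_iso(2) wt_cong[OF dv_iso] by metis

lemma RR_sub_le: "RR M \<Longrightarrow> X \<in> subs M \<Longrightarrow> th (sub_rep M X) \<le> 0"
  by (auto simp: RR_def clsB_def)

lemma RR_sub: "rep M \<Longrightarrow> RR M \<Longrightarrow> X \<in> subs M \<Longrightarrow> th (sub_rep M X) = 0 \<Longrightarrow> RR (sub_rep M X)"
  unfolding RR_def using clsB_sub[of M X "wl \<delta>"] by (auto simp: clsB_def)

lemma RR_quot: "rep M \<Longrightarrow> RR M \<Longrightarrow> X \<in> subs M \<Longrightarrow> th (sub_rep M X) = 0 \<Longrightarrow> RR (quot M X)"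
  unfolding RR_def using clsB_quot_of[of M X "wl \<delta>"] wt_quot[of M X "wl \<delta>"] by auto

lemma hn_split: "rep M \<Longrightarrow> hn (wl \<delta>) M X \<Longrightarrow> ext0 (quot M X) (sub_rep M X)"
  unfolding hn_def using ext0_AB[OF quot(1) rep_sub_rep] by blast

text \<open>Regularity constrains indecomposable summands; splitting a summand further and adding up
  defects extends the constraint to all of them.\<close>

lemma regular_summand:
  assumes M: "rep M" and reg: "regular_rep Q K \<delta> M"
  shows "comp M X Y \<Longrightarrow> th (sub_rep M X) = 0"
proof (induction "size (sub_rep M X)" arbitrary: X Y rule: less_induct)
  case less
  have X: "X \<in> subs M" using compD(1)[OF less.prems] .
  note RX = rep_sub_rep[OF M X]
  show ?case
  proof (cases "dv (sub_rep M X) = (\<lambda>v. 0)")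
    case True then show ?thesis by (rule wt_zero)
  next
    case nz: False
    show ?thesis
    proof (cases "indecomposable Q K (sub_rep M X)")
      case True
      then show ?thesis using reg less.prems unfolding regular_rep_def direct_summand_def th_euler by blast
    next
      case False
      obtain Z Z' where Z: "comp (sub_rep M X) Z Z'" "dv (sub_rep M Z) \<noteq> (\<lambda>v. 0)" "dv (sub_rep M Z') \<noteq> (\<lambda>v. 0)"
        using decomposable[OF RX False nz] by auto
      obtain V V' where V: "comp M Z V" "comp M Z' V'"
        using summand_trans[OF M less.prems Z(1)] summand_trans[OF M less.prems comp_sym[OF RX Z(1)]] by blast
      have "size (sub_rep M X) = size (sub_rep M Z) + size (sub_rep M Z')" using size_comp[OF RX Z(1)] by simp
      moreover have "size (sub_rep M Z) > 0" "size (sub_rep M Z') > 0" using Z size_zero_iff by auto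
      ultimately have "th (sub_rep M Z) = 0" "th (sub_rep M Z') = 0"
        using less.hyps[OF _ V(1)] less.hyps[OF _ V(2)] by auto
      then show ?thesis using wt_comp[OF RX Z(1), of "wl \<delta>"] by simp
    qed
  qed
qed

text \<open>The torsion part of a regular \<open>M\<close> is a summand, so its complement has
  defect zero; being torsion-free, it is zero. Conversely two complementary summands have defects at
  most 0 with sum 0.\<close>

lemma regular_iff:
  assumes M: "rep M" shows "regular_rep Q K \<delta> M \<longleftrightarrow> RR M"
proof
  assume reg: "regular_rep Q K \<delta> M"
  obtain X where X: "hn (wl \<delta>) M X" using hn_exists[OF M] by blast
  have XM: "X \<in> subs M" using X by (simp add: hn_def)
  obtain Y where Y: "comp M X Y" using ext0_comp[OF M XM hn_split[OF M X]] by blast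
  have "th (sub_rep M Y) = 0" by (rule regular_summand[OF M reg comp_sym[OF M Y]])
  then have "th (quot M X) = 0"
    using wt_cong[OF dv_iso[OF rep_sub_rep[OF M compD(2)[OF Y]] quot(1)[OF M XM] comp_quot_iso[OF M Y]]] by simp
  then have "dv (quot M X) = (\<lambda>v. 0)" using clsA_zero[OF quot(1)[OF M XM]] X by (auto simp: hn_def)
  then have XF: "X = full_sub M" using quot_zero_rep[OF M XM] by simp
  have "clsB (wl \<delta>) M" using X cls_iso(2)[OF rep_sub_rep[OF M full_sub[OF M]] M sub_full_iso[OF M]] XF by (simp add: hn_def)
  moreover have "th M = 0" using regular_summand[OF M reg Y] wt_full[of "wl \<delta>" M] XF by simp
  ultimately show "RR M" by (simp add: RR_def)
next
  assume R: "RR M"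
  show "regular_rep Q K \<delta> M" unfolding regular_rep_def direct_summand_def
  proof (intro allI impI, elim conjE exE)
    fix X Y assume c: "comp M X Y"
    have "th (sub_rep M X) = 0"
      using wt_comp[OF M c, of "wl \<delta>"] RR_sub_le[OF R compD(1)[OF c]] RR_sub_le[OF R compD(2)[OF c]] R by (simp add: RR_def)
    then show "euler_dim Q \<delta> (dv (sub_rep M X)) = 0" by (simp add: th_euler)
  qed
qed

end

section \<open>Counting homomorphisms\<close>

lemma card_le_fibres:
  assumes "finite S" "finite T" "f ` S \<subseteq> T" "\<And>t. t \<in> T \<Longrightarrow> card {x \<in> S. f x = t} \<le> k"
  shows "card S \<le> k * card T"
proof -
  have "card S = (\<Sum>t\<in>f ` S. card {x \<in> S. f x = t})"
    using sum.image_gen[OF assms(1), of "\<lambda>_. 1::nat" f] by simp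
  also have "\<dots> \<le> (\<Sum>t\<in>f ` S. k)" using assms(3,4) by (intro sum_mono) auto
  also have "\<dots> \<le> k * card T" using card_mono[OF assms(2,3)] by simp
  finally show ?thesis .
qed

lemma (in abelian_group) add_minus_cancel:
  "x \<in> carrier G \<Longrightarrow> y \<in> carrier G \<Longrightarrow> x \<oplus> (\<ominus> y \<oplus> \<ominus> x) = \<ominus> y"
  by (simp add: a_comm[of "\<ominus> y" "\<ominus> x"] r_neg2)

lemma (in abelian_group) add_diff_add:
  assumes "x \<in> carrier G" "y \<in> carrier G" "z \<in> carrier G"
  shows "(x \<oplus> y) \<ominus> (x \<oplus> z) = y \<ominus> z"
proof -
  have "y \<oplus> (\<ominus> x \<oplus> \<ominus> z) = \<ominus> x \<oplus> (y \<oplus> \<ominus> z)" by (rule a_lcomm) (use assms in simp_all)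
  then show ?thesis using assms by (simp add: a_minus_def minus_add a_assoc r_neg2)
qed

section \<open>Homomorphisms counted as extensional families\<close>

context quiver_reps
begin

definition nrm :: "('v, 'a, 'k, 'm) quiver_rep \<Rightarrow> ('v \<Rightarrow> 'm \<Rightarrow> 'n) \<Rightarrow> 'v \<Rightarrow> 'm \<Rightarrow> 'n" where
  "nrm M \<phi> = (\<lambda>v\<in>I. restrict (\<phi> v) (car M v))"

lemma nrm_simp [simp]: "v \<in> I \<Longrightarrow> x \<in> car M v \<Longrightarrow> nrm M \<phi> v x = \<phi> v x" by (simp add: nrm_def)

lemma nrm_HomE: "rep M \<Longrightarrow> \<phi> \<in> Hom M N \<Longrightarrow> nrm M \<phi> \<in> HomE M N"
  unfolding nrm_def by (rule HomE_restrict)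

lemma HomE_hom: "\<phi> \<in> HomE M N \<Longrightarrow> \<phi> \<in> Hom M N" by (simp add: HomE_def)

lemma HomE_eqI:
  assumes "s \<in> HomE M N" "t \<in> HomE M N" "\<And>v x. v \<in> I \<Longrightarrow> x \<in> car M v \<Longrightarrow> s v x = t v x"
  shows "s = t"
  using assms by (intro C0_eqI[of s M N t]) (auto simp: HomE_def)

lemma finite_HomE: "rep M \<Longrightarrow> rep N \<Longrightarrow> finite (HomE M N)"
  by (rule finite_subset[OF _ card_C0(1)]) (auto simp: HomE_def)

lemma zero_hom: "rep M \<Longrightarrow> rep N \<Longrightarrow> (\<lambda>v x. zer N v) \<in> Hom M N"
proof (rule HomI)
  fix v assume a: "rep M" "rep N" "v \<in> I"
  interpret V: vectorspace K "space M v" using repD(2)[OF a(1,3)] .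
  interpret N: vectorspace K "space N v" using repD(2)[OF a(2,3)] .
  show "(\<lambda>x. zer N v) \<in> module_hom K (space M v) (space N v)" by (rule module_homI) simp_all
next
  fix a x assume a: "rep M" "rep N" "a \<in> arcs Q"
  show "zer N (head Q a) = arrow_map N a (zer N (tail Q a))"
    using module_hom_zero[OF repD(2)[OF a(2) tail_I[OF a(3)]] repD(2)[OF a(2) head_I[OF a(3)]] repD(3)[OF a(2,3)]] by simp
qed

lemma HomE_pos: "rep M \<Longrightarrow> rep N \<Longrightarrow> card (HomE M N) \<ge> 1"
  using nrm_HomE[OF _ zero_hom] finite_HomE card_gt_0_iff[of "HomE M N"] by (metis One_nat_def Suc_leI empty_iff)

lemma ker_full_iff:
  assumes "rep M" "rep N" "\<phi> \<in> Hom M N"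
  shows "ker_sub M N \<phi> = full_sub M \<longleftrightarrow> (\<forall>v\<in>I. \<forall>x\<in>car M v. \<phi> v x = zer N v)"
proof -
  have "ker_sub M N \<phi> = full_sub M \<longleftrightarrow> (\<forall>v\<in>I. ker_sub M N \<phi> v = full_sub M v)"
    using subs_eqI[OF ker_sub[OF assms] full_sub[OF assms(1)]] by auto
  also have "\<dots> \<longleftrightarrow> (\<forall>v\<in>I. \<forall>x\<in>car M v. \<phi> v x = zer N v)" by (auto simp: ker_sub_def full_sub_def)
  finally show ?thesis .
qed

lemma nonzero_hom:
  assumes "rep M" "rep N" "card (HomE M N) \<ge> 2"
  obtains \<phi> where "\<phi> \<in> Hom M N" "ker_sub M N \<phi> \<noteq> full_sub M"
proof -
  let ?z = "nrm M (\<lambda>v x. zer N v) :: 'v \<Rightarrow> _ \<Rightarrow> _"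
  have z: "?z \<in> HomE M N" by (rule nrm_HomE[OF assms(1) zero_hom[OF assms(1,2)]])
  have "HomE M N \<noteq> {?z}" using assms(3) by auto
  then obtain \<phi> where p: "\<phi> \<in> HomE M N" "\<phi> \<noteq> ?z" using z by auto
  have "ker_sub M N \<phi> \<noteq> full_sub M"
  proof
    assume "ker_sub M N \<phi> = full_sub M"
    then have "\<forall>v\<in>I. \<forall>x\<in>car M v. \<phi> v x = zer N v" using ker_full_iff[OF assms(1,2) HomE_hom[OF p(1)]] by simp
    then have "\<phi> = ?z" by (intro HomE_eqI[OF p(1) z]) simp
    then show False using p(2) by simp
  qed
  then show ?thesis using that HomE_hom[OF p(1)] by blast
qed

lemma Hom_diff:
  assumes "rep M" "rep N" "\<phi> \<in> Hom M N" "\<psi> \<in> Hom M N"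
  shows "(\<lambda>v x. \<phi> v x \<ominus>\<^bsub>space N v\<^esub> \<psi> v x) \<in> Hom M N"
proof (rule HomI)
  fix v assume "v \<in> I"
  then show "(\<lambda>x. \<phi> v x \<ominus>\<^bsub>space N v\<^esub> \<psi> v x) \<in> module_hom K (space M v) (space N v)"
    by (intro module_hom_diff repD(2) assms HomD(1))
next
  fix a x assume a: "a \<in> arcs Q" "x \<in> car M (tail Q a)"
  show "\<phi> (head Q a) (arrow_map M a x) \<ominus>\<^bsub>space N (head Q a)\<^esub> \<psi> (head Q a) (arrow_map M a x) =
      arrow_map N a (\<phi> (tail Q a) x \<ominus>\<^bsub>space N (tail Q a)\<^esub> \<psi> (tail Q a) x)"
    using HomD(3)[OF assms(3) a] HomD(3)[OF assms(4) a]
      module_hom_minus(1)[OF repD(2)[OF assms(2) tail_I[OF a(1)]] repD(2)[OF assms(2) head_I[OF a(1)]] repD(3)[OF assms(2) a(1)]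
        HomD(2)[OF assms(3) tail_I[OF a(1)] a(2)] HomD(2)[OF assms(4) tail_I[OF a(1)] a(2)]] by simp
qed

lemma diff_zero_iff:
  assumes "rep N" "v \<in> I" "x \<in> car N v" "y \<in> car N v"
  shows "x \<ominus>\<^bsub>space N v\<^esub> y = zer N v \<longleftrightarrow> x = y"
proof -
  interpret N: vectorspace K "space N v" using repD(2)[OF assms(1,2)] .
  show ?thesis by (rule N.diff_eq_iff[OF assms(3,4)])
qed

text \<open>Two homomorphisms with the same restriction to \<open>X\<close> differ by one that
  factors through M/X, here any epimorphic image \<open>L\<close> of \<open>M\<close> with kernel
  \<open>X\<close>.\<close>

lemma hom_restrict_fibre:
  assumes M: "rep M" and N: "rep N" and L: "rep L" and o: "onto M L \<pi>" and k: "ker_sub M L \<pi> = X"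
    and X: "X \<in> subs M"
  shows "card {\<phi> \<in> HomE M N. nrm (sub_rep M X) \<phi> = t} \<le> card (HomE L N)"
proof (cases "{\<phi> \<in> HomE M N. nrm (sub_rep M X) \<phi> = t} = {}")
  case True then show ?thesis by (simp only: True card.empty le0)
next
  case False
  let ?F = "{\<phi> \<in> HomE M N. nrm (sub_rep M X) \<phi> = t}"
  obtain \<phi>0 where p0: "\<phi>0 \<in> ?F" using False by blast
  have ex: "\<exists>\<eta>. \<eta> \<in> HomE L N \<and> (\<forall>v\<in>I. \<forall>x\<in>car M v. \<eta> v (\<pi> v x) = \<phi> v x \<ominus>\<^bsub>space N v\<^esub> \<phi>0 v x)" if p: "\<phi> \<in> ?F" for \<phi>
  proof -
    let ?d = "\<lambda>v x. \<phi> v x \<ominus>\<^bsub>space N v\<^esub> \<phi>0 v x"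
    have h: "\<phi> \<in> Hom M N" "\<phi>0 \<in> Hom M N" using p p0 HomE_hom by auto
    have d: "?d \<in> Hom M N" by (rule Hom_diff[OF M N h])
    have "X v \<subseteq> ker_sub M N ?d v" if v: "v \<in> I" for v
    proof
      fix x assume x: "x \<in> X v"
      have xM: "x \<in> car M v" by (rule subs_mem[OF X v x])
      have "nrm (sub_rep M X) \<phi> v x = nrm (sub_rep M X) \<phi>0 v x" using p p0 by simp
      then have "\<phi> v x = \<phi>0 v x" using v x by simp
      then show "x \<in> ker_sub M N ?d v"
        using v xM diff_zero_iff[OF N v HomD(2)[OF h(1) v xM] HomD(2)[OF h(2) v xM]] by (simp add: ker_sub_def)
    qed
    then have "ker_sub M L \<pi> \<le> ker_sub M N ?d" unfolding k using subs_le_iff[OF X ker_sub[OF M N d]] by simp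
    then obtain \<eta> where e: "\<eta> \<in> Hom L N" "\<And>v x. v \<in> I \<Longrightarrow> x \<in> car M v \<Longrightarrow> \<eta> v (\<pi> v x) = ?d v x"
      using factor[OF M L N o d] by blast
    have "\<pi> \<in> Hom M L" using o by (simp add: onto_def)
    then have "nrm L \<eta> v (\<pi> v x) = ?d v x" if "v \<in> I" "x \<in> car M v" for v x
      using HomD(2)[of \<pi> M L v x] e(2)[OF that] that by simp
    then show ?thesis using nrm_HomE[OF L e(1)] by blast
  qed
  define g where "g \<phi> = (SOME \<eta>. \<eta> \<in> HomE L N \<and> (\<forall>v\<in>I. \<forall>x\<in>car M v. \<eta> v (\<pi> v x) = \<phi> v x \<ominus>\<^bsub>space N v\<^esub> \<phi>0 v x))" for \<phi>
  have g0: "g \<phi> \<in> HomE L N \<and> (\<forall>v\<in>I. \<forall>x\<in>car M v. g \<phi> v (\<pi> v x) = \<phi> v x \<ominus>\<^bsub>space N v\<^esub> \<phi>0 v x)" if "\<phi> \<in> ?F" for \<phi>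
    unfolding g_def by (rule someI_ex[OF ex[OF that]])
  have g: "g \<phi> \<in> HomE L N" "v \<in> I \<Longrightarrow> x \<in> car M v \<Longrightarrow> g \<phi> v (\<pi> v x) = \<phi> v x \<ominus>\<^bsub>space N v\<^esub> \<phi>0 v x" if "\<phi> \<in> ?F" for \<phi> v x
    using g0[OF that] by auto
  have "inj_on g ?F"
  proof (rule inj_onI)
    fix \<phi> \<psi> assume p: "\<phi> \<in> ?F" and s: "\<psi> \<in> ?F" and e: "g \<phi> = g \<psi>"
    show "\<phi> = \<psi>"
    proof (rule HomE_eqI[of _ M N])
      fix v x assume v: "v \<in> I" and x: "x \<in> car M v"
      interpret N: vectorspace K "space N v" using repD(2)[OF N v] .
      have c: "\<phi> v x \<in> car N v" "\<psi> v x \<in> car N v" "\<phi>0 v x \<in> car N v" using p s p0 HomE_hom HomD(2)[OF _ v x] by blast+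
      have "\<phi> v x \<ominus>\<^bsub>space N v\<^esub> \<phi>0 v x = \<psi> v x \<ominus>\<^bsub>space N v\<^esub> \<phi>0 v x" using g(2)[OF p v x] g(2)[OF s v x] e by simp
      then show "\<phi> v x = \<psi> v x" using c by (simp add: a_minus_def)
    qed (use p s in auto)
  qed
  then show ?thesis using card_inj_on_le[of g ?F "HomE L N"] g(1) finite_HomE[OF L N] by blast
qed

text \<open>The fibres of restriction to \<open>X\<close> are bounded by Hom(M/X, N). If restriction
  misses some \<psi>, one value fewer is attained and the bound becomes strict.\<close>

lemma card_HomE_ses_left:
  assumes M: "rep M" and N: "rep N" and X: "X \<in> subs M"
  shows "card (HomE M N) \<le> card (HomE (quot M X) N) * card (HomE (sub_rep M X) N)"
    and "\<psi> \<in> HomE (sub_rep M X) N \<Longrightarrow> (\<And>\<phi>. \<phi> \<in> Hom M N \<Longrightarrow> nrm (sub_rep M X) \<phi> \<noteq> \<psi>) \<Longrightarrow>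
       card (HomE M N) < card (HomE (quot M X) N) * card (HomE (sub_rep M X) N)"
proof -
  note Qu = quot[OF M X] and RX = rep_sub_rep[OF M X]
  have im: "nrm (sub_rep M X) ` HomE M N \<subseteq> HomE (sub_rep M X) N"
    using nrm_HomE[OF RX Hom_restrict[OF M X HomE_hom]] by blast
  note fb = hom_restrict_fibre[OF M N Qu(1,2,3) X]
  show "card (HomE M N) \<le> card (HomE (quot M X) N) * card (HomE (sub_rep M X) N)"
    by (rule card_le_fibres[OF finite_HomE[OF M N] finite_HomE[OF RX N] im fb])
  assume psi: "\<psi> \<in> HomE (sub_rep M X) N" and no: "\<And>\<phi>. \<phi> \<in> Hom M N \<Longrightarrow> nrm (sub_rep M X) \<phi> \<noteq> \<psi>"
  have im': "nrm (sub_rep M X) ` HomE M N \<subseteq> HomE (sub_rep M X) N - {\<psi>}" using im no HomE_hom by blast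
  have "card (HomE M N) \<le> card (HomE (quot M X) N) * card (HomE (sub_rep M X) N - {\<psi>})"
    by (rule card_le_fibres[OF finite_HomE[OF M N] _ im' fb]) (simp add: finite_HomE[OF RX N])
  also have "\<dots> < card (HomE (quot M X) N) * card (HomE (sub_rep M X) N)"
    using card_Diff1_less[OF finite_HomE[OF RX N] psi] HomE_pos[OF Qu(1) N] by simp
  finally show "card (HomE M N) < card (HomE (quot M X) N) * card (HomE (sub_rep M X) N)" .
qed

text \<open>Two homomorphisms with the same composite to M/X differ by one with values in
  \<open>X\<close>.\<close>

lemma card_HomE_ses_right:
  assumes L: "rep L" and M: "rep M" and X: "X \<in> subs M"
  shows "card (HomE L M) \<le> card (HomE L (sub_rep M X)) * card (HomE L (quot M X))"
proof -
  note Qu = quot[OF M X] and RX = rep_sub_rep[OF M X]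
  have ph: "proj M X \<in> Hom M (quot M X)" using Qu(2) by (simp add: onto_def)
  let ?f = "\<lambda>\<phi>. nrm L (\<lambda>v x. proj M X v (\<phi> v x))"
  have im: "?f ` HomE L M \<subseteq> HomE L (quot M X)"
    using nrm_HomE[OF L Hom_comp[OF HomE_hom ph]] by blast
  have fb: "card {\<phi> \<in> HomE L M. ?f \<phi> = t} \<le> card (HomE L (sub_rep M X))" for t
  proof (cases "{\<phi> \<in> HomE L M. ?f \<phi> = t} = {}")
    case True then show ?thesis by (simp only: True card.empty le0)
  next
    case False
    let ?F = "{\<phi> \<in> HomE L M. ?f \<phi> = t}"
    obtain \<phi>0 where p0: "\<phi>0 \<in> ?F" using False by blast
    let ?g = "\<lambda>\<phi>. nrm L (\<lambda>v x. \<phi> v x \<ominus>\<^bsub>space M v\<^esub> \<phi>0 v x)"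
    have "?g \<phi> \<in> HomE L (sub_rep M X)" if p: "\<phi> \<in> ?F" for \<phi>
    proof (rule nrm_HomE[OF L Hom_corestrict[OF Hom_diff[OF L M] L X]])
      show h: "\<phi> \<in> Hom L M" "\<phi>0 \<in> Hom L M" using p p0 HomE_hom by auto
      fix v x assume v: "v \<in> I" and x: "x \<in> car L v"
      have "?f \<phi> v x = ?f \<phi>0 v x" using p p0 by simp
      then have "proj M X v (\<phi> v x) = proj M X v (\<phi>0 v x)" using v x by simp
      then show "\<phi> v x \<ominus>\<^bsub>space M v\<^esub> \<phi>0 v x \<in> X v"
        using coset_eq_iff[OF subsD(2)[OF X v] HomD(2)[OF h(1) v x] HomD(2)[OF h(2) v x]] by (simp add: proj_def)
    qed
    moreover have "inj_on ?g ?F"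
    proof (rule inj_onI)
      fix \<phi> \<psi> assume p: "\<phi> \<in> ?F" and s: "\<psi> \<in> ?F" and e: "?g \<phi> = ?g \<psi>"
      show "\<phi> = \<psi>"
      proof (rule HomE_eqI[of _ L M])
        fix v x assume v: "v \<in> I" and x: "x \<in> car L v"
        interpret N: vectorspace K "space M v" using repD(2)[OF M v] .
        have c: "\<phi> v x \<in> car M v" "\<psi> v x \<in> car M v" "\<phi>0 v x \<in> car M v" using p s p0 HomE_hom HomD(2)[OF _ v x] by blast+
        have "?g \<phi> v x = ?g \<psi> v x" using e by simp
        then have "\<phi> v x \<ominus>\<^bsub>space M v\<^esub> \<phi>0 v x = \<psi> v x \<ominus>\<^bsub>space M v\<^esub> \<phi>0 v x" using v x by simp
        then show "\<phi> v x = \<psi> v x" using c by (simp add: a_minus_def)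
      qed (use p s in auto)
    qed
    ultimately show ?thesis using card_inj_on_le[of ?g ?F "HomE L (sub_rep M X)"] finite_HomE[OF L RX] by blast
  qed
  show ?thesis by (rule card_le_fibres[OF finite_HomE[OF L M] finite_HomE[OF L Qu(1)] im fb])
qed

lemma card_HomE_mono:
  assumes "rep M" "rep N" "rep M'" "rep N'" "onto M' M \<pi>" "mono N N' \<iota>"
  shows "card (HomE M N) \<le> card (HomE M' N')"
proof -
  let ?f = "\<lambda>\<phi>. nrm M' (\<lambda>v x. \<iota> v (\<phi> v (\<pi> v x)))"
  have ph: "\<pi> \<in> Hom M' M" "\<iota> \<in> Hom N N'" using assms(5,6) by (auto simp: onto_def mono_def)
  have "inj_on ?f (HomE M N)"
  proof (rule inj_onI)
    fix \<phi> \<psi> assume p: "\<phi> \<in> HomE M N" and s: "\<psi> \<in> HomE M N" and e: "?f \<phi> = ?f \<psi>"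
    show "\<phi> = \<psi>"
    proof (rule HomE_eqI[OF p s])
      fix v x assume v: "v \<in> I" and x: "x \<in> car M v"
      have "x \<in> \<pi> v ` car M' v" using assms(5) v x by (simp add: onto_def)
      then obtain y where y: "y \<in> car M' v" "x = \<pi> v y" by blast
      have "?f \<phi> v y = ?f \<psi> v y" using e by simp
      then have "\<iota> v (\<phi> v x) = \<iota> v (\<psi> v x)" using v y by simp
      then show "\<phi> v x = \<psi> v x"
        using assms(6) v HomD(2)[OF HomE_hom[OF p] v x] HomD(2)[OF HomE_hom[OF s] v x] by (simp add: mono_def inj_on_def)
    qed
  qed
  moreover have "?f ` HomE M N \<subseteq> HomE M' N'"
    using nrm_HomE[OF assms(3) Hom_comp[OF Hom_comp[OF ph(1) HomE_hom] ph(2)]] by blast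
  ultimately show ?thesis using card_inj_on_le[of ?f] finite_HomE[OF assms(3,4)] by blast
qed

lemma card_HomE_iso:
  assumes "rep M" "rep N" "rep M'" "rep N'" "M \<approx> M'" "N \<approx> N'"
  shows "card (HomE M N) = card (HomE M' N')"
proof (rule antisym)
  obtain a where a: "onto M' M a" using iso_sym[OF assms(1,3,5)] iso_iff by blast
  obtain b where b: "mono N N' b" using assms(6) iso_iff by blast
  show "card (HomE M N) \<le> card (HomE M' N')" by (rule card_HomE_mono[OF assms(1-4) a b])
  obtain c where c: "onto M M' c" using assms(5) iso_iff by blast
  obtain d where d: "mono N' N d" using iso_sym[OF assms(2,4,6)] iso_iff by blast
  show "card (HomE M' N') \<le> card (HomE M N)" by (rule card_HomE_mono[OF assms(3,4,1,2) c d])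
qed

lemma add_cancel_comp:
  assumes M: "rep M" and c: "comp M X Y" and v: "v \<in> I"
    and "x \<in> X v" "x' \<in> X v" "y \<in> Y v" "y' \<in> Y v" "x \<oplus>\<^bsub>space M v\<^esub> y = x' \<oplus>\<^bsub>space M v\<^esub> y'"
  shows "x = x'" "y = y'"
proof -
  interpret V: vectorspace K "space M v" using repD(2)[OF M v] .
  have cc: "x \<in> car M v" "x' \<in> car M v" "y \<in> car M v" "y' \<in> car M v"
    using subs_mem[OF compD(1)[OF c] v] subs_mem[OF compD(2)[OF c] v] assms by auto
  have s1: "x \<ominus>\<^bsub>space M v\<^esub> x' \<in> X v" by (rule subspace_minus(1)[OF subsD(2)[OF compD(1)[OF c] v] assms(4,5)])
  have s2: "y' \<ominus>\<^bsub>space M v\<^esub> y \<in> Y v" by (rule subspace_minus(1)[OF subsD(2)[OF compD(2)[OF c] v] assms(7,6)])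
  have "x \<ominus>\<^bsub>space M v\<^esub> x' = (x \<oplus>\<^bsub>space M v\<^esub> y) \<ominus>\<^bsub>space M v\<^esub> (x' \<oplus>\<^bsub>space M v\<^esub> y)"
    using cc by (simp add: a_minus_def V.minus_add V.a_ac V.r_neg1 V.r_neg2 V.add_minus_cancel)
  also have "\<dots> = y' \<ominus>\<^bsub>space M v\<^esub> y"
    unfolding assms(8) by (rule V.add_diff_add[OF cc(2,4,3)])
  finally have e: "x \<ominus>\<^bsub>space M v\<^esub> x' = y' \<ominus>\<^bsub>space M v\<^esub> y" .
  then have "x \<ominus>\<^bsub>space M v\<^esub> x' = zer M v" using s1 s2 compD(3)[OF c v] by auto
  then show "x = x'" using cc V.diff_eq_iff by simp
  then show "y = y'" using assms(8) cc by simp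
qed

lemma card_HomE_comp_left:
  assumes M: "rep M" and N: "rep N" and c: "comp M X Y"
  shows "card (HomE (sub_rep M X) N) * card (HomE (sub_rep M Y) N) \<le> card (HomE M N)"
proof -
  note X = compD(1)[OF c] and Y = compD(2)[OF c]
  note RX = rep_sub_rep[OF M X] and RY = rep_sub_rep[OF M Y]
  obtain p where p: "p \<in> Hom M (sub_rep M X)" "\<And>v x. v \<in> I \<Longrightarrow> x \<in> X v \<Longrightarrow> p v x = x"
    "\<And>v y. v \<in> I \<Longrightarrow> y \<in> Y v \<Longrightarrow> p v y = zer M v" using comp_proj[OF M c] by blast
  obtain r where r: "r \<in> Hom M (sub_rep M Y)" "\<And>v x. v \<in> I \<Longrightarrow> x \<in> Y v \<Longrightarrow> r v x = x"
    "\<And>v y. v \<in> I \<Longrightarrow> y \<in> X v \<Longrightarrow> r v y = zer M v" using comp_proj[OF M comp_sym[OF M c]] by blast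
  let ?S = "HomE (sub_rep M X) N \<times> HomE (sub_rep M Y) N"
  let ?f = "\<lambda>(\<alpha>, \<beta>). nrm M (\<lambda>v x. \<alpha> v (p v x) \<oplus>\<^bsub>space N v\<^esub> \<beta> v (r v x))"
  have "?f ` ?S \<subseteq> HomE M N"
    using nrm_HomE[OF M Hom_add[OF M N Hom_comp[OF p(1) HomE_hom] Hom_comp[OF r(1) HomE_hom]]] by force
  moreover have "inj_on ?f ?S"
  proof (rule inj_onI, clarify)
    fix \<alpha> \<beta> \<alpha>' \<beta>' assume h: "\<alpha> \<in> HomE (sub_rep M X) N" "\<beta> \<in> HomE (sub_rep M Y) N"
      "\<alpha>' \<in> HomE (sub_rep M X) N" "\<beta>' \<in> HomE (sub_rep M Y) N"
      and e: "nrm M (\<lambda>v x. \<alpha> v (p v x) \<oplus>\<^bsub>space N v\<^esub> \<beta> v (r v x)) = nrm M (\<lambda>v x. \<alpha>' v (p v x) \<oplus>\<^bsub>space N v\<^esub> \<beta>' v (r v x))"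
    have ev: "\<alpha> v (p v x) \<oplus>\<^bsub>space N v\<^esub> \<beta> v (r v x) = \<alpha>' v (p v x) \<oplus>\<^bsub>space N v\<^esub> \<beta>' v (r v x)" if "v \<in> I" "x \<in> car M v" for v x
      using fun_cong[OF fun_cong[OF e, of v], of x] that by simp
    have "\<alpha> = \<alpha>'"
    proof (rule HomE_eqI[OF h(1,3)])
      fix v x assume v: "v \<in> I" and x: "x \<in> car (sub_rep M X) v"
      interpret N: vectorspace K "space N v" using repD(2)[OF N v] .
      have xx: "x \<in> X v" "x \<in> car M v" using x subs_mem[OF X v] by auto
      have "\<alpha> v x \<in> car N v" "\<alpha>' v x \<in> car N v" using HomD(2)[OF HomE_hom v x] h by auto
      then show "\<alpha> v x = \<alpha>' v x"
        using ev[OF v xx(2)] p(2)[OF v xx(1)] r(3)[OF v xx(1)] Hom_zero[OF RY N HomE_hom[OF h(2)] v] Hom_zero[OF RY N HomE_hom[OF h(4)] v] by simp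
    qed
    moreover have "\<beta> = \<beta>'"
    proof (rule HomE_eqI[OF h(2,4)])
      fix v x assume v: "v \<in> I" and x: "x \<in> car (sub_rep M Y) v"
      interpret N: vectorspace K "space N v" using repD(2)[OF N v] .
      have xx: "x \<in> Y v" "x \<in> car M v" using x subs_mem[OF Y v] by auto
      have "\<beta> v x \<in> car N v" "\<beta>' v x \<in> car N v" using HomD(2)[OF HomE_hom v x] h by auto
      then show "\<beta> v x = \<beta>' v x"
        using ev[OF v xx(2)] r(2)[OF v xx(1)] p(3)[OF v xx(1)] Hom_zero[OF RX N HomE_hom[OF h(1)] v] Hom_zero[OF RX N HomE_hom[OF h(3)] v] by simp
    qed
    ultimately show "\<alpha> = \<alpha>' \<and> \<beta> = \<beta>'" by simp
  qed
  ultimately have "card ?S \<le> card (HomE M N)" using card_inj_on_le[of ?f ?S "HomE M N"] finite_HomE[OF M N] by blast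
  then show ?thesis by (simp add: card_cartesian_product)
qed

lemma card_HomE_comp_right:
  assumes L: "rep L" and M: "rep M" and c: "comp M X Y"
  shows "card (HomE L (sub_rep M X)) * card (HomE L (sub_rep M Y)) \<le> card (HomE L M)"
proof -
  note X = compD(1)[OF c] and Y = compD(2)[OF c]
  note RX = rep_sub_rep[OF M X] and RY = rep_sub_rep[OF M Y]
  let ?S = "HomE L (sub_rep M X) \<times> HomE L (sub_rep M Y)"
  let ?f = "\<lambda>(\<alpha>, \<beta>). nrm L (\<lambda>v x. \<alpha> v x \<oplus>\<^bsub>space M v\<^esub> \<beta> v x)"
  have inc: "\<phi> \<in> Hom L M" if "\<phi> \<in> HomE L (sub_rep M Z)" "Z \<in> subs M" for \<phi> Z
    using Hom_comp[OF HomE_hom[OF that(1)] Hom_incl[OF M that(2)]] .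
  have "?f ` ?S \<subseteq> HomE L M"
    using nrm_HomE[OF L Hom_add[OF L M inc[OF _ X] inc[OF _ Y]]] by force
  moreover have "inj_on ?f ?S"
  proof (rule inj_onI, clarify)
    fix \<alpha> \<beta> \<alpha>' \<beta>' assume h: "\<alpha> \<in> HomE L (sub_rep M X)" "\<beta> \<in> HomE L (sub_rep M Y)"
      "\<alpha>' \<in> HomE L (sub_rep M X)" "\<beta>' \<in> HomE L (sub_rep M Y)"
      and e: "nrm L (\<lambda>v x. \<alpha> v x \<oplus>\<^bsub>space M v\<^esub> \<beta> v x) = nrm L (\<lambda>v x. \<alpha>' v x \<oplus>\<^bsub>space M v\<^esub> \<beta>' v x)"
    have ev: "\<alpha> v x = \<alpha>' v x \<and> \<beta> v x = \<beta>' v x" if v: "v \<in> I" and x: "x \<in> car L v" for v x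
    proof -
      have "\<alpha> v x \<in> X v" "\<alpha>' v x \<in> X v" "\<beta> v x \<in> Y v" "\<beta>' v x \<in> Y v"
        using HomD(2)[OF HomE_hom v x] h by fastforce+
      moreover have "\<alpha> v x \<oplus>\<^bsub>space M v\<^esub> \<beta> v x = \<alpha>' v x \<oplus>\<^bsub>space M v\<^esub> \<beta>' v x"
        using fun_cong[OF fun_cong[OF e, of v], of x] v x by simp
      ultimately show ?thesis using add_cancel_comp[OF M c v] by blast
    qed
    show "\<alpha> = \<alpha>' \<and> \<beta> = \<beta>'" using HomE_eqI[OF h(1,3)] HomE_eqI[OF h(2,4)] ev by blast
  qed
  ultimately have "card ?S \<le> card (HomE L M)" using card_inj_on_le[of ?f ?S "HomE L M"] finite_HomE[OF L M] by blast
  then show ?thesis by (simp add: card_cartesian_product)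
qed

text \<open>If the extension \<open>U'\<close> does not split, the identity of \<open>X\<close> does not extend to \<open>U'\<close>, which makes one of the exact-sequence bounds strict.\<close>

lemma End_less:
  assumes U: "rep U" and U': "rep U'" and c: "comp U Y Z" and X: "X \<in> subs U'"
    and iZ: "sub_rep U' X \<approx> sub_rep U Z" and iY: "quot U' X \<approx> sub_rep U Y" and n: "\<not> U' \<approx> U"
  shows "card (HomE U' U') < card (HomE U U)"
proof -
  note RX = rep_sub_rep[OF U' X] and QX = quot(1)[OF U' X]
  note RZ = rep_sub_rep[OF U compD(2)[OF c]] and RY = rep_sub_rep[OF U compD(1)[OF c]]
  let ?Z = "sub_rep U Z" and ?Y = "sub_rep U Y" and ?X = "sub_rep U' X"
  let ?psi = "nrm ?X (\<lambda>v x. x)"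
  have psi: "?psi \<in> HomE ?X ?X" by (rule nrm_HomE[OF RX Hom_id])
  \<comment> \<open>A homomorphism that restricts to the identity of \<open>X\<close> is a
    retraction, so \<open>X\<close> is a summand with complement isomorphic to U'/X; then U' is the
    direct sum of the same two pieces as \<open>U\<close>.\<close>
  have no: "nrm ?X \<phi> \<noteq> ?psi" if phi: "\<phi> \<in> Hom U' ?X" for \<phi>
  proof
    assume e: "nrm ?X \<phi> = ?psi"
    have id: "\<phi> v x = x" if v: "v \<in> I" and x: "x \<in> X v" for v x
      using fun_cong[OF fun_cong[OF e, of v], of x] v x by simp
    have o: "onto U' ?X \<phi>" unfolding onto_def
    proof (intro conjI ballI phi subset_antisym)
      fix v assume v: "v \<in> I"
      show "\<phi> v ` car U' v \<subseteq> car ?X v" using HomD(2)[OF phi v] by auto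
      show "car ?X v \<subseteq> \<phi> v ` car U' v"
      proof
        fix x assume "x \<in> car ?X v"
        then have "x = \<phi> v x" "x \<in> car U' v" using id[OF v] subs_mem[OF X v] by auto
        then show "x \<in> \<phi> v ` car U' v" by blast
      qed
    qed
    have "comp U' (ker_sub U' ?X \<phi>) (im_sub (\<lambda>v x. x) (full_sub ?X))"
      by (rule section_comp[OF U' RX o refl Hom_incl[OF U' X]]) (use id in auto)
    moreover have "im_sub (\<lambda>v x. x) (full_sub ?X) = X"
      using subsD(1)[OF X] by (intro ext) (auto simp: im_sub_def full_sub_def extensional_def)
    ultimately obtain Y' where Y': "comp U' X Y'" using comp_sym[OF U'] by fastforce
    have "sub_rep U' Y' \<approx> sub_rep U Y" by (rule iso_trans[OF comp_quot_iso[OF U' Y'] iY])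
    then have "U' \<approx> U" by (rule split_iso[OF U' U Y' comp_sym[OF U c] iZ])
    then show False using n by simp
  qed
  have 1: "card (HomE U' ?X) < card (HomE (quot U' X) ?X) * card (HomE ?X ?X)"
    by (rule card_HomE_ses_left(2)[OF U' RX X psi no])
  have 2: "card (HomE U' (quot U' X)) \<le> card (HomE (quot U' X) (quot U' X)) * card (HomE ?X (quot U' X))"
    by (rule card_HomE_ses_left(1)[OF U' QX X])
  have 3: "card (HomE U' U') \<le> card (HomE U' ?X) * card (HomE U' (quot U' X))"
    by (rule card_HomE_ses_right[OF U' U' X])
  have i: "card (HomE (quot U' X) ?X) = card (HomE ?Y ?Z)" "card (HomE ?X ?X) = card (HomE ?Z ?Z)"
    "card (HomE (quot U' X) (quot U' X)) = card (HomE ?Y ?Y)" "card (HomE ?X (quot U' X)) = card (HomE ?Z ?Y)"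
    by (rule card_HomE_iso; (rule RX RY RZ QX iY iZ))+
  have 4: "card (HomE ?Y ?Z) * card (HomE ?Z ?Z) \<le> card (HomE U ?Z)"
    "card (HomE ?Y ?Y) * card (HomE ?Z ?Y) \<le> card (HomE U ?Y)"
    by (rule card_HomE_comp_left[OF U _ c]; rule RY RZ)+
  have 5: "card (HomE U ?Y) * card (HomE U ?Z) \<le> card (HomE U U)" by (rule card_HomE_comp_right[OF U U c])
  \<comment> \<open>For U' the product of the four Hom cardinalities between the pieces is an upper
    bound, strict in one factor; for the direct sum \<open>U\<close> the same product is a lower
    bound.\<close>
  have "card (HomE U' U') \<le> card (HomE U' ?X) * card (HomE U' (quot U' X))" by (rule 3)
  also have "\<dots> \<le> card (HomE U' ?X) * card (HomE U ?Y)" using 2 4(2) i by (intro mult_le_mono2) simp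
  also have "\<dots> < card (HomE U ?Z) * card (HomE U ?Y)"
    using 1 4(1) i HomE_pos[OF U RY] by (intro mult_strict_right_mono) simp_all
  also have "\<dots> \<le> card (HomE U U)" using 5 by (simp add: mult.commute)
  finally show ?thesis .
qed

text \<open>A brick with positive Euler form is rigid: otherwise its endomorphisms act freely on a nonzero extension class.\<close>

lemma brick_rigid:
  assumes U: "rep U" and br: "\<And>\<phi>. \<phi> \<in> Hom U U \<Longrightarrow> ker_sub U U \<phi> = full_sub U \<or> ker_sub U U \<phi> = zero_sub U"
    and pos: "e1 (dv U) (dv U) < e0 (dv U) (dv U)"
  shows "ext0 U U"
proof (rule ccontr)
  assume n: "\<not> ext0 U U"
  let ?Im = "cob U U ` C0 U U" and ?E = "HomE U U"
  have sub: "?Im \<subseteq> C1 U U" using cob_C1[OF U U] by auto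
  then obtain c where c: "c \<in> C1 U U" "c \<notin> ?Im" using n ext0_iff_surj[OF U U] by auto
  have ch: "i a \<in> module_hom K (space U (tail Q a)) (space U (head Q a))" if "i \<in> C1 U U" "a \<in> arcs Q" for i a
    using that by (auto simp: C1_def LH_def PiE_def Pi_def)
  have ev: "i a x \<in> car U (head Q a)" if "i \<in> C1 U U" "a \<in> arcs Q" "x \<in> car U (tail Q a)" for i a x
    by (rule module_homD(1)[OF ch[OF that(1,2)] that(3)])
  \<comment> \<open>If \<open>c\<close> is not a coboundary, the cochains "image of c under an
    endomorphism plus a coboundary" are pairwise distinct. Then |End U| |Im| \<le> |C1|, whereas the
    left side equals |C0| = q^e0.\<close>
  define g where "g = (\<lambda>(\<phi>, i). \<lambda>a\<in>arcs Q. \<lambda>x\<in>car U (tail Q a). \<phi> (head Q a) (c a x) \<oplus>\<^bsub>space U (head Q a)\<^esub> i a x)"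
  have "g ` (?E \<times> ?Im) \<subseteq> C1 U U"
  proof (clarsimp simp del: image_eqI)
    fix \<phi> t assume p: "\<phi> \<in> ?E" and t: "t \<in> C0 U U"
    show "g (\<phi>, cob U U t) \<in> C1 U U" unfolding C1_def g_def prod.case
    proof (rule restrict_PiE_iff[THEN iffD2], rule ballI)
      fix a assume a: "a \<in> arcs Q"
      show "(\<lambda>x\<in>car U (tail Q a). \<phi> (head Q a) (c a x) \<oplus>\<^bsub>space U (head Q a)\<^esub> cob U U t a x) \<in> LH (space U (tail Q a)) (space U (head Q a))"
        by (rule restrict_LH[OF module_hom_add[OF repD(2)[OF U tail_I[OF a]] repD(2)[OF U head_I[OF a]]
          module_hom_comp[OF ch[OF c(1) a] HomD(1)[OF HomE_hom[OF p] head_I[OF a]]] ch[OF cob_C1[OF U U t] a]] repD(2)[OF U tail_I[OF a]]])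
    qed
  qed
  moreover have "inj_on g (?E \<times> ?Im)"
  proof (rule inj_onI, clarify)
    fix \<phi> \<psi> s t assume p: "\<phi> \<in> ?E" "\<psi> \<in> ?E" and s: "s \<in> C0 U U" and t: "t \<in> C0 U U"
      and e: "g (\<phi>, cob U U s) = g (\<psi>, cob U U t)"
    have h: "\<phi> \<in> Hom U U" "\<psi> \<in> Hom U U" using p HomE_hom by auto
    let ?d = "\<lambda>v x. \<phi> v x \<ominus>\<^bsub>space U v\<^esub> \<psi> v x"
    have d: "?d \<in> Hom U U" by (rule Hom_diff[OF U U h])
    have eq: "?d (head Q a) (c a x) = cob U U (pdiff U U t s) a x" and eq2: "\<phi> (head Q a) (c a x) \<oplus>\<^bsub>space U (head Q a)\<^esub> cob U U s a x =
       \<psi> (head Q a) (c a x) \<oplus>\<^bsub>space U (head Q a)\<^esub> cob U U t a x" if a: "a \<in> arcs Q" and x: "x \<in> car U (tail Q a)" for a x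
    proof -
      interpret V: vectorspace K "space U (head Q a)" using repD(2)[OF U head_I[OF a]] .
      have cc: "\<phi> (head Q a) (c a x) \<in> car U (head Q a)" "\<psi> (head Q a) (c a x) \<in> car U (head Q a)"
        "cob U U s a x \<in> car U (head Q a)" "cob U U t a x \<in> car U (head Q a)"
        using HomD(2)[OF h(1) head_I[OF a] ev[OF c(1) a x]] HomD(2)[OF h(2) head_I[OF a] ev[OF c(1) a x]]
          ev[OF cob_C1[OF U U s] a x] ev[OF cob_C1[OF U U t] a x] by auto
      show e2: "\<phi> (head Q a) (c a x) \<oplus>\<^bsub>space U (head Q a)\<^esub> cob U U s a x = \<psi> (head Q a) (c a x) \<oplus>\<^bsub>space U (head Q a)\<^esub> cob U U t a x"
        using fun_cong[OF fun_cong[OF e, of a], of x] a x by (simp add: g_def)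
      let ?A = "\<phi> (head Q a) (c a x)" and ?B = "\<psi> (head Q a) (c a x)" and ?S = "cob U U s a x" and ?T = "cob U U t a x"
      have "?A \<ominus>\<^bsub>space U (head Q a)\<^esub> ?B = ((?A \<oplus>\<^bsub>space U (head Q a)\<^esub> ?S) \<ominus>\<^bsub>space U (head Q a)\<^esub> ?S) \<ominus>\<^bsub>space U (head Q a)\<^esub> ?B"
        using cc by (simp add: a_minus_def V.a_assoc V.r_neg)
      also have "\<dots> = ((?B \<oplus>\<^bsub>space U (head Q a)\<^esub> ?T) \<ominus>\<^bsub>space U (head Q a)\<^esub> ?S) \<ominus>\<^bsub>space U (head Q a)\<^esub> ?B" unfolding e2 ..
      also have "\<dots> = ?T \<ominus>\<^bsub>space U (head Q a)\<^esub> ?S"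
        using cc by (simp add: a_minus_def V.a_ac V.r_neg1 V.r_neg2 V.add_minus_cancel)
      finally show "?d (head Q a) (c a x) = cob U U (pdiff U U t s) a x" using cob_pdiff[OF U U t s a x] by simp
    qed
    \<comment> \<open>A nonzero difference of endomorphisms is invertible by the brick condition,
      and applying its inverse to \<open>eq\<close> would exhibit \<open>c\<close> as a
      coboundary.\<close>
    have "ker_sub U U ?d = full_sub U"
    proof (rule ccontr)
      assume "ker_sub U U ?d \<noteq> full_sub U"
      then have k: "ker_sub U U ?d = zero_sub U" using br[OF d] by blast
      have mono: "mono U U ?d" using mono_iff[OF U U d] k by simp
      have "?d v ` car U v = car U v" if v: "v \<in> I" for v
        using endo_inj_surj[OF finite_car[OF U v], of "?d v"] mono HomD(2)[OF d v] v by (auto simp: mono_def)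
      then have o: "onto U U ?d" using d by (simp add: onto_def)
      have le: "ker_sub U U ?d \<le> ker_sub U U (\<lambda>v x. x)" using k mono_id_ker[OF U] by simp
      obtain \<eta> where \<eta>: "\<eta> \<in> Hom U U" "\<And>v x. v \<in> I \<Longrightarrow> x \<in> car U v \<Longrightarrow> \<eta> v (?d v x) = x"
        using factor[OF U U U o Hom_id le] by blast
      let ?t = "pdiff U U t s"
      let ?u = "nrm U (\<lambda>v x. \<eta> v (?t v x))"
      have tC: "?t \<in> C0 U U" by (rule pdiff_C0[OF U U t s])
      have uC: "?u \<in> C0 U U" unfolding nrm_def
        by (rule C0_I[OF U]) (rule module_hom_comp[OF C0_D(2)[OF tC] HomD(1)[OF \<eta>(1)]])
      have "c = cob U U ?u"
      proof (rule C1_eqI[OF c(1) cob_C1[OF U U uC]])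
        fix a x assume a: "a \<in> arcs Q" and x: "x \<in> car U (tail Q a)"
        have Ux: "arrow_map U a x \<in> car U (head Q a)" by (rule arrow_closed[OF U a x])
        have tx: "?t (tail Q a) x \<in> car U (tail Q a)" "?t (head Q a) (arrow_map U a x) \<in> car U (head Q a)"
          using module_homD(1)[OF C0_D(2)[OF tC tail_I[OF a]] x] module_homD(1)[OF C0_D(2)[OF tC head_I[OF a]] Ux] by auto
        have "cob U U ?u a x = \<eta> (head Q a) (?t (head Q a) (arrow_map U a x)) \<ominus>\<^bsub>space U (head Q a)\<^esub> arrow_map U a (\<eta> (tail Q a) (?t (tail Q a) x))"
          using a x Ux by (simp add: cob_apply)
        also have "\<dots> = \<eta> (head Q a) (cob U U ?t a x)"
          using module_hom_minus(1)[OF repD(2)[OF U head_I[OF a]] repD(2)[OF U head_I[OF a]] HomD(1)[OF \<eta>(1) head_I[OF a]] tx(2) arrow_closed[OF U a tx(1)]]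
            HomD(3)[OF \<eta>(1) a tx(1)] a x by (simp add: cob_apply)
        also have "\<dots> = \<eta> (head Q a) (?d (head Q a) (c a x))" using eq[OF a x] by simp
        also have "\<dots> = c a x" by (rule \<eta>(2)[OF head_I[OF a] ev[OF c(1) a x]])
        finally show "c a x = cob U U ?u a x" by simp
      qed
      then show False using c(2) uC by blast
    qed
    then have dz: "\<phi> v x = \<psi> v x" if v: "v \<in> I" and x: "x \<in> car U v" for v x
      using ker_full_iff[OF U U d] diff_zero_iff[OF U v HomD(2)[OF h(1) v x] HomD(2)[OF h(2) v x]] v x by blast
    then have "\<phi> = \<psi>" by (rule HomE_eqI[OF p])
    moreover have "cob U U s = cob U U t"
    proof (rule C1_eqI[OF cob_C1[OF U U s] cob_C1[OF U U t]])
      fix a x assume a: "a \<in> arcs Q" and x: "x \<in> car U (tail Q a)"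
      interpret V: vectorspace K "space U (head Q a)" using repD(2)[OF U head_I[OF a]] .
      show "cob U U s a x = cob U U t a x"
        using eq2[OF a x] dz[OF head_I[OF a] ev[OF c(1) a x]] HomD(2)[OF h(2) head_I[OF a] ev[OF c(1) a x]]
          ev[OF cob_C1[OF U U s] a x] ev[OF cob_C1[OF U U t] a x] by simp
    qed
    ultimately show "\<phi> = \<psi> \<and> cob U U s = cob U U t" by simp
  qed
  ultimately have "card (?E \<times> ?Im) \<le> card (C1 U U)" using card_inj_on_le[of g "?E \<times> ?Im" "C1 U U"] card_C1(1)[OF U U] by blast
  then have "q ^ e0 (dv U) (dv U) \<le> q ^ e1 (dv U) (dv U)"
    using card_C0_HomE[OF U U] card_C1(2)[OF U U] by (simp add: card_cartesian_product)
  then show False using pos q_ge_2 power_strict_increasing[OF pos, of q] by simp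
qed

end

section \<open>Rigid bricks\<close>

context quiver_reps
begin

text \<open>Realises a quotient on the carrier type over which the induction in
  \<open>indecomposable_brick\<close> runs.\<close>

lemma nat_quot:
  assumes M: "rep M" and X: "X \<in> subs M"
  obtains N :: "('v, 'a, 'k, nat) quiver_rep" and \<pi> where "rep N" "onto M N \<pi>" "ker_sub M N \<pi> = X"
proof -
  note Qu = quot[OF M X]
  obtain N :: "('v, 'a, 'k, nat) quiver_rep" where N: "rep N" "quot M X \<approx> N" using nat_copy[OF Qu(1)] by blast
  obtain \<phi> where m: "mono (quot M X) N \<phi>" "onto (quot M X) N \<phi>" using N(2) iso_iff by blast
  have h: "\<phi> \<in> Hom (quot M X) N" using m(1) by (simp add: mono_def)
  have pr: "proj M X \<in> Hom M (quot M X)" using Qu(2) by (simp add: onto_def)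
  let ?p = "\<lambda>v x. \<phi> v (proj M X v x)"
  have k: "ker_sub (quot M X) N \<phi> = zero_sub (quot M X)" using mono_iff[OF Qu(1) N(1) h] m(1) by simp
  have e: "\<phi> v y = zer N v \<longleftrightarrow> y = zer (quot M X) v" if "v \<in> I" "y \<in> car (quot M X) v" for v y
  proof -
    have "y \<in> ker_sub (quot M X) N \<phi> v \<longleftrightarrow> y \<in> zero_sub (quot M X) v" using k by simp
    then show ?thesis using that by (simp add: ker_sub_def zero_sub_def)
  qed
  have "ker_sub M N ?p = ker_sub M (quot M X) (proj M X)"
  proof
    fix v show "ker_sub M N ?p v = ker_sub M (quot M X) (proj M X) v"
      using e[of v] HomD(2)[OF pr, of v] by (cases "v \<in> I") (auto simp: ker_sub_def)
  qed
  then have "ker_sub M N ?p = X" using Qu(3) by simp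
  then show ?thesis using that N(1) onto_comp[OF Qu(2) m(2)] by blast
qed

lemma comp_dims:
  assumes M: "rep M" and X: "X \<in> subs M" and Y: "Y \<in> subs M" and i: "inter_sub X Y = zero_sub M"
    and d: "\<And>v. dv M v = dv (sub_rep M X) v + dv (sub_rep M Y) v"
  shows "comp M X Y"
proof -
  have "dv (sub_rep M (sum_sub M X Y)) = dv M"
  proof
    fix v show "dv (sub_rep M (sum_sub M X Y)) v = dv M v" using dv_modular[OF M X Y, of v] d[of v] M by (simp add: i)
  qed
  then have s: "sum_sub M X Y = full_sub M" using sub_full_iff[OF M sum_sub[OF M X Y]] by simp
  have "X v \<inter> Y v = {zer M v} \<and> X v <+>\<^bsub>space M v\<^esub> Y v = car M v" if v: "v \<in> I" for v
    using fun_cong[OF i, of v] fun_cong[OF s, of v] v by (simp add: inter_sub_def zero_sub_def sum_sub_def full_sub_def)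
  then show ?thesis unfolding complementary_subreps_def using X Y by blast
qed

text \<open>Keep splitting: if both halves of a summand lay in \<open>k\<close>, so would the
  summand. Hence some indecomposable piece stays outside \<open>k\<close>.\<close>

lemma summand_nonzero:
  assumes C: "rep C" and k: "k \<in> subs C" "k \<noteq> full_sub C"
  shows "\<exists>D D'. comp C D D' \<and> indecomposable Q K (sub_rep C D) \<and> \<not> D \<le> k"
proof -
  have main: "comp C X Y \<Longrightarrow> \<not> X \<le> k \<Longrightarrow> \<exists>D D'. comp C D D' \<and> indecomposable Q K (sub_rep C D) \<and> \<not> D \<le> k" for X Y
  proof (induction "size (sub_rep C X)" arbitrary: X Y rule: less_induct)
    case less
    note c = less.prems(1)
    have X: "X \<in> subs C" using compD(1)[OF c] .
    note RX = rep_sub_rep[OF C X]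
    show ?case
    proof (cases "indecomposable Q K (sub_rep C X)")
      case True then show ?thesis using less.prems by blast
    next
      case False
      have nz: "dv (sub_rep C X) \<noteq> (\<lambda>v. 0)" using sub_zero_iff[OF C X] zero_le[OF k(1) C] less.prems(2) by auto
      obtain Z Z' where Z: "comp (sub_rep C X) Z Z'" "dv (sub_rep C Z) \<noteq> (\<lambda>v. 0)" "dv (sub_rep C Z') \<noteq> (\<lambda>v. 0)"
        using decomposable[OF RX False nz] by auto
      obtain V V' where V: "comp C Z V" "comp C Z' V'"
        using summand_trans[OF C c Z(1)] summand_trans[OF C c comp_sym[OF RX Z(1)]] by blast
      have sz: "size (sub_rep C X) = size (sub_rep C Z) + size (sub_rep C Z')" using size_comp[OF RX Z(1)] by simp
      have p: "size (sub_rep C Z) > 0" "size (sub_rep C Z') > 0" using Z size_zero_iff by auto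
      have "\<not> (Z \<le> k \<and> Z' \<le> k)"
      proof
        assume le: "Z \<le> k \<and> Z' \<le> k"
        have "x \<in> k v" if v: "v \<in> I" and x: "x \<in> X v" for v x
        proof -
          have "x \<in> Z v <+>\<^bsub>space (sub_rep C X) v\<^esub> Z' v" using compD(4)[OF Z(1) v] x by simp
          then obtain a b where ab: "a \<in> Z v" "b \<in> Z' v" "x = a \<oplus>\<^bsub>space C v\<^esub> b" by (auto simp: set_add_mem)
          have "a \<in> k v" "b \<in> k v" using ab le by (auto simp: le_fun_def)
          then show ?thesis using subsD(2)[OF k(1) v] ab(3) by (simp add: subspace_iff)
        qed
        then have "X \<le> k" using subs_le_iff[OF X k(1)] by blast
        then show False using less.prems(2) by blast
      qed
      then consider "\<not> Z \<le> k" | "\<not> Z' \<le> k" by blast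
      then show ?thesis
      proof cases
        case 1 show ?thesis by (rule less.hyps[OF _ V(1) 1]) (use sz p in simp)
      next
        case 2 show ?thesis by (rule less.hyps[OF _ V(2) 2]) (use sz p in simp)
      qed
    qed
  qed
  have "\<not> full_sub C \<le> k" using le_full[OF k(1) C] k(2) by (metis antisym)
  then show ?thesis using main[OF comp_full_zero[OF C]] by blast
qed

lemma HomE_two:
  assumes M: "rep M" and N: "rep N" and p: "\<phi> \<in> Hom M N" "ker_sub M N \<phi> \<noteq> full_sub M"
  shows "card (HomE M N) \<ge> 2"
proof -
  let ?z = "nrm M (\<lambda>v x. zer N v)" and ?p = "nrm M \<phi>"
  have s: "{?z, ?p} \<subseteq> HomE M N" using nrm_HomE[OF M zero_hom[OF M N]] nrm_HomE[OF M p(1)] by blast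
  have "?z \<noteq> ?p"
  proof
    assume e: "?z = ?p"
    have "\<phi> v x = zer N v" if "v \<in> I" "x \<in> car M v" for v x
      using fun_cong[OF fun_cong[OF e, of v], of x] that by simp
    then show False using p(2) ker_full_iff[OF M N p(1)] by blast
  qed
  then have "card {?z, ?p} = 2" by simp
  then show ?thesis using card_mono[OF finite_HomE[OF M N] s] by simp
qed

text \<open>Pull the torsion subrepresentation of M/X back to \<open>M\<close>. Each X thus lies at
  the bottom of exactly one chain of the Harder-Narasimhan recursion.\<close>

lemma hn_rel:
  assumes M: "rep M" and X: "X \<in> subs M"
  shows "\<exists>!X'. X' \<in> subs M \<and> X \<le> X' \<and> clsB w (quot (sub_rep M X') X) \<and> clsA w (quot M X')"
proof -
  note Qu = quot[OF M X]
  let ?f = "im_sub (proj M X)"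
  have iff: "clsB w (quot (sub_rep M Z) X) \<and> clsA w (quot M Z) \<longleftrightarrow> hn w (quot M X) (?f Z)" if Z: "Z \<in> subs M" "X \<le> Z" for Z
  proof -
    have XZ: "X \<in> subs (sub_rep M Z)" using subs_sub_rep[OF M Z(1)] X Z by simp
    have f: "?f Z \<in> subs (quot M X)" by (rule im_subs[OF M Qu Z(1)])
    show ?thesis unfolding hn_def
      using cls_iso(2)[OF quot(1)[OF rep_sub_rep[OF M Z(1)] XZ] rep_sub_rep[OF Qu(1) f] sub_im_iso[OF M Qu Z], of w]
        cls_iso(1)[OF quot(1)[OF M Z(1)] quot(1)[OF Qu(1) f] quot_im_iso[OF M Qu Z], of w] f by simp
  qed
  obtain Y where Y: "hn w (quot M X) Y" using hn_exists[OF Qu(1)] by blast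
  have bij: "bij_betw ?f {Z \<in> subs M. X \<le> Z} (subs (quot M X))" by (rule im_bij[OF M Qu])
  have "Y \<in> subs (quot M X)" using Y by (simp add: hn_def)
  then have "Y \<in> ?f ` {Z \<in> subs M. X \<le> Z}" using bij by (simp add: bij_betw_def)
  then obtain Z where Z: "Z \<in> subs M" "X \<le> Z" "Y = ?f Z" by blast
  show ?thesis
  proof (rule ex1I[of _ Z])
    show "Z \<in> subs M \<and> X \<le> Z \<and> clsB w (quot (sub_rep M Z) X) \<and> clsA w (quot M Z)" using Z Y iff by blast
    fix Z' assume Z': "Z' \<in> subs M \<and> X \<le> Z' \<and> clsB w (quot (sub_rep M Z') X) \<and> clsA w (quot M Z')"
    then have "hn w (quot M X) (?f Z')" using iff by blast
    then have "?f Z' = ?f Z" using hn_unique[OF Qu(1) _ Y] Z(3) by blast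
    then show "Z' = Z" using bij Z Z' by (auto simp: bij_betw_def inj_on_def)
  qed
qed

text \<open>Reineke: a rigid brick is stable for the weight \<open>\<langle>dim U, -\<rangle> - \<langle>-, dim U\<rangle>\<close>.\<close>

context
  fixes U :: "('v, 'a, 'k, 'm) quiver_rep" and w :: "'v \<Rightarrow> int"
  assumes U: "rep U" and brick: "\<And>\<phi>. \<phi> \<in> Hom U U \<Longrightarrow> ker_sub U U \<phi> = full_sub U \<or> ker_sub U U \<phi> = zero_sub U"
    and rigid: "ext0 U U" and nonzero: "dv U \<noteq> (\<lambda>v. 0)" and w: "w = (\<lambda>v. wl (dv U) v - wr (dv U) v)"
begin

lemma wt_w: "wt w N = wt (wl (dv U)) N - wt (wr (dv U)) N"
  by (simp add: w wt_def left_diff_distrib sum_subtractf)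

lemma wt_w_U: "dv N = dv U \<Longrightarrow> wt w N = 0"
  by (simp add: wt_w wt_wl wt_wr)

lemma zero_neq_full: "zero_sub U \<noteq> full_sub U"
  using zero_rep_iff[OF U] zero_rep_dv[OF U] nonzero by simp

text \<open>The inclusion is a nonzero map and Ext(X, U) = 0 by rigidity, so <X, U> > 0. A nonzero
  map U -> X would be a nonzero, hence bijective, endomorphism of \<open>U\<close> with image in
  \<open>X\<close>; so Hom(U, X) = 0 and <U, X> \<le> 0.\<close>

lemma brick_stable:
  assumes X: "X \<in> subs U" "X \<noteq> zero_sub U" "X \<noteq> full_sub U"
  shows "wt w (sub_rep U X) < 0"
proof -
  note RX = rep_sub_rep[OF U X(1)]
  let ?X = "sub_rep U X"
  have "\<exists>v\<in>I. \<exists>x\<in>X v. x \<noteq> zer U v"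
  proof (rule ccontr)
    assume n: "\<not> (\<exists>v\<in>I. \<exists>x\<in>X v. x \<noteq> zer U v)"
    then have "X \<le> zero_sub U" using subs_le_iff[OF X(1) zero_sub[OF U]] by (auto simp: zero_sub_def)
    then show False using zero_le[OF X(1) U] X(2) by (metis antisym)
  qed
  then have "ker_sub ?X U (\<lambda>v x. x) \<noteq> full_sub ?X" using ker_full_iff[OF RX U Hom_incl[OF U X(1)]] by auto
  then have 2: "2 \<le> card (HomE ?X U)" by (rule HomE_two[OF RX U Hom_incl[OF U X(1)]])
  have "q ^ e0 (dv ?X) (dv U) = card (HomE ?X U) * q ^ e1 (dv ?X) (dv U)"
    by (rule HomE_ge(2)[OF RX U ext0_sub[OF U U X(1) rigid]])
  moreover have "2 * q ^ e1 (dv ?X) (dv U) \<le> card (HomE ?X U) * q ^ e1 (dv ?X) (dv U)" by (rule mult_le_mono1[OF 2])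
  moreover have "0 < q ^ e1 (dv ?X) (dv U)" using q_ge_2 by simp
  ultimately have "q ^ e1 (dv ?X) (dv U) < q ^ e0 (dv ?X) (dv U)" by linarith
  then have a: "e1 (dv ?X) (dv U) < e0 (dv ?X) (dv U)" using q_ge_2 by (simp add: power_strict_increasing_iff)
  have "\<not> 2 \<le> card (HomE U ?X)"
  proof
    assume "2 \<le> card (HomE U ?X)"
    then obtain \<phi> where p: "\<phi> \<in> Hom U ?X" "ker_sub U ?X \<phi> \<noteq> full_sub U" using nonzero_hom[OF U RX] by blast
    have h: "\<phi> \<in> Hom U U" using Hom_comp[OF p(1) Hom_incl[OF U X(1)]] by simp
    have "ker_sub U U \<phi> = ker_sub U ?X \<phi>" by (simp add: ker_sub_def)
    then have "ker_sub U U \<phi> = zero_sub U" using brick[OF h] p(2) by simp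
    then have "mono U U \<phi>" using mono_iff[OF U U h] by simp
    then have inj: "inj_on (\<phi> v) (car U v)" if "v \<in> I" for v using that by (simp add: mono_def)
    have "car U v \<subseteq> X v" if v: "v \<in> I" for v
    proof -
      have "\<phi> v ` car U v = car U v"
        using endo_inj_surj[OF finite_car[OF U v] _ inj[OF v]] HomD(2)[OF h v] by blast
      moreover have "\<phi> v ` car U v \<subseteq> X v" using HomD(2)[OF p(1) v] by auto
      ultimately show ?thesis by simp
    qed
    then have "full_sub U \<le> X" using subs_le_iff[OF full_sub[OF U] X(1)] by (simp add: full_sub_def)
    then show False using le_full[OF X(1) U] X(3) by (metis antisym)
  qed
  then have c1: "card (HomE U ?X) \<le> 1" by simp
  have "q ^ e0 (dv U) (dv ?X) \<le> card (HomE U ?X) * q ^ e1 (dv U) (dv ?X)" by (rule HomE_ge(1)[OF U RX])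
  also have "\<dots> \<le> 1 * q ^ e1 (dv U) (dv ?X)" by (rule mult_le_mono1[OF c1])
  finally have "q ^ e0 (dv U) (dv ?X) \<le> q ^ e1 (dv U) (dv ?X)" by simp
  then have "e0 (dv U) (dv ?X) \<le> e1 (dv U) (dv ?X)" using q_ge_2 by (simp add: power_increasing_iff)
  then show ?thesis using a by (simp add: wt_w wt_wl wt_wr)
qed

lemma brick_clsB: "clsB w U"
  unfolding clsB_def
proof
  fix X assume "X \<in> subs U"
  then show "wt w (sub_rep U X) \<le> wt w U"
    using brick_stable[of X] wt_w_U[of U] wt_w_U[of "sub_rep U X"] wt_zero[of "sub_rep U X" w] U by fastforce
qed

text \<open>Rigidity gives q^<U, U> = |End U| \<ge> 2, and equality of dimensions carries the bound
  over to Hom(U, N). A proper nonzero kernel would have negative weight and force an image of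
  positive weight in \<open>N\<close>; so a nonzero map is injective, and dimensions make it
  bijective.\<close>

lemma clsB_brick:
  assumes N: "rep N" and d: "dv N = dv U" and B: "clsB w N"
  shows "U \<approx> N"
proof -
  have "ker_sub U U (\<lambda>v x. x) \<noteq> full_sub U" using mono_id_ker[OF U] zero_neq_full by simp
  then have "2 * q ^ e1 (dv U) (dv U) \<le> card (HomE U U) * q ^ e1 (dv U) (dv U)"
    by (intro mult_le_mono1 HomE_two[OF U U Hom_id])
  also have "\<dots> = q ^ e0 (dv U) (dv U)" using HomE_ge(2)[OF U U rigid] by simp
  also have "\<dots> \<le> card (HomE U N) * q ^ e1 (dv U) (dv U)" using HomE_ge(1)[OF U N] d by simp
  finally have "2 \<le> card (HomE U N)" using q_ge_2 by simp
  then obtain \<phi> where p: "\<phi> \<in> Hom U N" "ker_sub U N \<phi> \<noteq> full_sub U" using nonzero_hom[OF U N] by blast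
  note k = ker_sub[OF U N p(1)]
  have "ker_sub U N \<phi> = zero_sub U"
  proof (rule ccontr)
    assume "ker_sub U N \<phi> \<noteq> zero_sub U"
    then have neg: "wt w (sub_rep U (ker_sub U N \<phi>)) < 0" by (rule brick_stable[OF k _ p(2)])
    have "wt w U = wt w (sub_rep U (ker_sub U N \<phi>)) + wt w (sub_rep N (im_sub \<phi> (full_sub U)))"
      by (rule wt_add) (rule dv_hom[OF U N p(1)])
    moreover have "wt w (sub_rep N (im_sub \<phi> (full_sub U))) \<le> wt w N"
      using B im_sub[OF U N p(1) full_sub[OF U]] by (simp add: clsB_def)
    ultimately show False using neg wt_w_U[of U] wt_w_U[OF d] by simp
  qed
  then have "mono U N \<phi>" using mono_iff[OF U N p(1)] by simp
  then show ?thesis by (rule mono_dv_iso[OF U N _ d[symmetric]])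
qed

end

end

section \<open>Indecomposables of nonzero defect in the torsion class are rigid bricks\<close>

context affine
begin

text \<open>Strict variant of \<open>clsB\<close>: by additivity, every nonzero quotient has
  positive defect, as is the case for preinjective representations.\<close>

definition clsI :: "('v, 'a, 'k, 'm) quiver_rep \<Rightarrow> bool" where
  "clsI M \<longleftrightarrow> (\<forall>W\<in>subs M. W \<noteq> full_sub M \<longrightarrow> th (sub_rep M W) < th M)"

lemma clsI_onto:
  assumes M: "rep M" and N: "rep N" and o: "onto M N \<phi>" and c: "clsI M"
  shows "clsI N"
  unfolding clsI_def
proof (intro ballI impI)
  fix W assume W: "W \<in> subs N" "W \<noteq> full_sub N"
  let ?V = "vim_sub M \<phi> W"
  have V: "?V \<in> subs M" by (rule vim_subs[OF M N o refl W(1)])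
  have ge: "ker_sub M N \<phi> \<le> ?V" by (rule vim_ge[OF M N o refl W(1)])
  have im: "im_sub \<phi> ?V = W" by (rule im_vim[OF M N o refl W(1)])
  have "?V \<noteq> full_sub M" using im im_full[OF o] W(2) by auto
  then have "th (sub_rep M ?V) < th M" using c V by (simp add: clsI_def)
  then show "th (sub_rep N W) < th N"
    using wt_sub_im[OF M N o refl V ge, of "wl \<delta>"] wt_onto[OF M N o, of "wl \<delta>"] im by simp
qed

lemma clsI_pos:
  assumes M: "rep M" and c: "clsI M" and n: "dv M \<noteq> (\<lambda>v. 0)"
  shows "th M > 0"
proof -
  have "zero_sub M \<noteq> full_sub M" using zero_rep_iff[OF M] zero_rep_dv[OF M] n by simp
  then have "th (sub_rep M (zero_sub M)) < th M" using c zero_sub[OF M] by (simp add: clsI_def)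
  then show ?thesis using wt_zero[OF dv_zero[OF M]] by simp
qed

lemma indecomposable_dv: "rep M \<Longrightarrow> indecomposable Q K M \<Longrightarrow> dv M \<noteq> (\<lambda>v. 0)"
  unfolding indecomposable_def using zero_rep_dv by blast

text \<open>A nonzero non-injective endomorphism of minimal image \<open>J\<close> factors through \<open>U/J\<close>; a summand of \<open>U/J\<close>
  mapping onto \<open>J\<close> is rigid by induction, so it lifts to a summand of \<open>U\<close>.\<close>

lemma indecomposable_brick:
  fixes U :: "('v, 'a, 'k, nat) quiver_rep"
  assumes "rep U" "indecomposable Q K U" "clsI U" "\<phi> \<in> Hom U U"
  shows "ker_sub U U \<phi> = full_sub U \<or> ker_sub U U \<phi> = zero_sub U"
  using assms
proof (induction "size U" arbitrary: U \<phi> rule: less_induct)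
  case less
  note U = less.prems(1) and ind = less.prems(2) and cI = less.prems(3)
  let ?bad = "\<lambda>\<phi>. \<phi> \<in> Hom U U \<and> ker_sub U U \<phi> \<noteq> full_sub U \<and> ker_sub U U \<phi> \<noteq> zero_sub U"
  let ?im = "\<lambda>\<phi>. im_sub \<phi> (full_sub U)"
  note F = full_sub[OF U]
  show ?case
  proof (rule ccontr)
    assume "\<not> ?case"
    then have "?bad \<phi>" using less.prems(4) by blast
    then obtain \<phi> where bad: "?bad \<phi>" and min: "\<And>\<psi>. ?bad \<psi> \<Longrightarrow> size (sub_rep U (?im \<phi>)) \<le> size (sub_rep U (?im \<psi>))"
      using ex_has_least_nat[of ?bad \<phi> "\<lambda>\<phi>. size (sub_rep U (?im \<phi>))"] by blast
    define J where "J = ?im \<phi>"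
    define k where "k = ker_sub U U \<phi>"
    have ph: "\<phi> \<in> Hom U U" and kF: "k \<noteq> full_sub U" and k0: "k \<noteq> zero_sub U" using bad by (auto simp: k_def)
    have ks: "k \<in> subs U" unfolding k_def by (rule ker_sub[OF U U ph])
    have Js: "J \<in> subs U" unfolding J_def by (rule im_sub[OF U U ph F])
    have J_mem: "x \<in> J v \<longleftrightarrow> (\<exists>y\<in>car U v. x = \<phi> v y)" if "v \<in> I" for v x
      using that by (auto simp: J_def im_sub_def full_sub_def)
    have k_mem: "x \<in> k v \<longleftrightarrow> x \<in> car U v \<and> \<phi> v x = zer U v" if "v \<in> I" for v x using that by (simp add: k_def ker_sub_def)
    have dim: "dv U v = dv (sub_rep U J) v + dv (sub_rep U k) v" for v
      using dv_hom[OF U U ph, of v] by (simp add: J_def k_def)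
    have J0: "J \<noteq> zero_sub U"
    proof
      assume "J = zero_sub U"
      then have "dv (sub_rep U k) = dv U" using dim U by (intro ext) simp
      then show False using sub_full_iff[OF U ks] kF by simp
    qed
    have JF: "dv (sub_rep U J) \<noteq> dv U"
    proof
      assume "dv (sub_rep U J) = dv U"
      then have "dv (sub_rep U k) = (\<lambda>v. 0)" using dim by (intro ext) (metis add_cancel_right_right)
      then show False using sub_zero_iff[OF U ks] k0 by simp
    qed
    \<comment> \<open>Such a \<open>\<psi>\<close> is not injective because \<open>J\<close> is
      smaller than \<open>U\<close>; so it competes in the minimality and its image cannot be
      smaller than \<open>J\<close>.\<close>
    have min': "?im \<psi> = J" if ps: "\<psi> \<in> Hom U U" "ker_sub U U \<psi> \<noteq> full_sub U" "?im \<psi> \<le> J" for \<psi>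
    proof -
      have ims: "?im \<psi> \<in> subs U" by (rule im_sub[OF U U ps(1) F])
      have "ker_sub U U \<psi> \<noteq> zero_sub U"
      proof
        assume "ker_sub U U \<psi> = zero_sub U"
        then have e: "dv U v = dv (sub_rep U (?im \<psi>)) v" for v using dv_hom[OF U U ps(1), of v] U by simp
        have "dv (sub_rep U J) v = dv U v" for v
          using dv_sub_le[OF U ims Js ps(3), of v] dim[of v] e[of v] by simp
        then show False using JF by blast
      qed
      then have "size (sub_rep U J) \<le> size (sub_rep U (?im \<psi>))" using min[of \<psi>] ps by (simp add: J_def)
      then show ?thesis by (rule size_sub_eq[OF U ims Js ps(3)])
    qed
    \<comment> \<open>Fitting's argument: if \<open>\<phi>\<close> did not kill \<open>J\<close>,
      its square would be nonzero with image \<open>J\<close>; then \<open>\<phi>\<close> would be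
      bijective on \<open>J\<close>, and \<open>U\<close> the direct sum of the nonzero
      \<open>J\<close> and \<open>k\<close>.\<close>
    have Jk: "J \<le> k"
    proof (rule ccontr)
      assume "\<not> J \<le> k"
      then obtain v x where v: "v \<in> I" and x: "x \<in> J v" "x \<notin> k v" using subs_le_iff[OF Js ks] by blast
      let ?p2 = "\<lambda>v x. \<phi> v (\<phi> v x)"
      have h2: "?p2 \<in> Hom U U" by (rule Hom_comp[OF ph ph])
      obtain y where y: "y \<in> car U v" "x = \<phi> v y" using x(1) J_mem[OF v] by blast
      have "?p2 v y \<noteq> zer U v" using x(2) y k_mem[OF v] HomD(2)[OF ph v y(1)] by simp
      then have "ker_sub U U ?p2 \<noteq> full_sub U" using ker_full_iff[OF U U h2] v y(1) by blast
      moreover have im2: "?im ?p2 = im_sub \<phi> J"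
        by (intro ext) (auto simp: J_def im_sub_def full_sub_def image_image)
      moreover have "im_sub \<phi> J \<le> J"
        unfolding subs_le_iff[OF im_sub[OF U U ph Js] Js]
        using J_mem subs_mem[OF Js] by (fastforce simp: im_sub_def)
      ultimately have eJ: "im_sub \<phi> J = J" using min'[OF h2] by simp
      have "dv (sub_rep U (inter_sub J k)) v = 0" for v
        using dv_im_sub[OF U U ph Js, of v] eJ by (simp add: k_def)
      then have "inter_sub J k = zero_sub U" using sub_zero_iff[OF U inter_sub[OF Js ks]] by blast
      then have "comp U J k" by (rule comp_dims[OF U Js ks _ dim])
      then have "zero_rep Q (sub_rep U J) \<or> zero_rep Q (sub_rep U k)" using ind by (simp add: indecomposable_def)
      then show False using zero_repI[OF Js U] zero_repI[OF ks U] J0 k0 by blast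
    qed
    obtain C :: "('v, 'a, 'k, nat) quiver_rep" and \<pi> where C: "rep C" "onto U C \<pi>" "ker_sub U C \<pi> = J"
      using nat_quot[OF U Js] by blast
    have pi: "\<pi> \<in> Hom U C" and pi_surj: "\<And>v. v \<in> I \<Longrightarrow> \<pi> v ` car U v = car C v" using C(2) by (auto simp: onto_def)
    obtain \<eta> where eta: "\<eta> \<in> Hom C U" "\<And>v x. v \<in> I \<Longrightarrow> x \<in> car U v \<Longrightarrow> \<eta> v (\<pi> v x) = \<phi> v x"
      using factor[OF U C(1) U C(2) ph] Jk C(3) unfolding k_def by blast
    have eks: "ker_sub C U \<eta> \<in> subs C" by (rule ker_sub[OF C(1) U eta(1)])
    have "ker_sub C U \<eta> \<noteq> full_sub C"
    proof
      assume e: "ker_sub C U \<eta> = full_sub C"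
      have "\<phi> v x = zer U v" if "v \<in> I" "x \<in> car U v" for v x
        using ker_full_iff[OF C(1) U eta(1)] e eta(2)[OF that] HomD(2)[OF pi that] that(1) by simp
      then show False using kF ker_full_iff[OF U U ph] unfolding k_def by blast
    qed
    \<comment> \<open>\<open>\<eta>\<close> is the map U/J -> U induced by \<open>\<phi>\<close>. It
      is nonzero on some indecomposable summand \<open>D\<close>, and by minimality it maps
      \<open>D\<close> onto all of \<open>J\<close>.\<close>
    then obtain D D' where D: "comp C D D'" "indecomposable Q K (sub_rep C D)" "\<not> D \<le> ker_sub C U \<eta>"
      using summand_nonzero[OF C(1) eks] by blast
    have Ds: "D \<in> subs C" using compD(1)[OF D(1)] .
    let ?A = "sub_rep C D"
    have A: "rep ?A" by (rule rep_sub_rep[OF C(1) Ds])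
    obtain p where p: "p \<in> Hom C ?A" "\<And>v x. v \<in> I \<Longrightarrow> x \<in> D v \<Longrightarrow> p v x = x"
      "\<And>v y. v \<in> I \<Longrightarrow> y \<in> D' v \<Longrightarrow> p v y = zer C v" using comp_proj[OF C(1) D(1)] by blast
    have po: "onto C ?A p" unfolding onto_def
    proof (intro conjI ballI p(1) subset_antisym)
      fix v assume v: "v \<in> I"
      show "p v ` car C v \<subseteq> car ?A v" using HomD(2)[OF p(1) v] by blast
      show "car ?A v \<subseteq> p v ` car C v"
      proof
        fix x assume "x \<in> car ?A v"
        then have "x \<in> D v" by simp
        then have "x = p v x" "x \<in> car C v" using p(2)[OF v] subs_mem[OF Ds v] by auto
        then show "x \<in> p v ` car C v" by blast
      qed
    qed
    let ?pp = "\<lambda>v x. p v (\<pi> v x)"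
    have ppo: "onto U ?A ?pp" by (rule onto_comp[OF C(2) po])
    have pph: "?pp \<in> Hom U ?A" using ppo by (simp add: onto_def)
    let ?psi = "\<lambda>v x. \<eta> v (p v (\<pi> v x))"
    have eA: "\<eta> \<in> Hom ?A U" by (rule Hom_restrict[OF C(1) Ds eta(1)])
    have psi: "?psi \<in> Hom U U" by (rule Hom_comp[OF pph eA])
    have etaJ: "\<eta> v x \<in> J v" if v: "v \<in> I" and x: "x \<in> car C v" for v x
    proof -
      obtain y where "y \<in> car U v" "x = \<pi> v y" using pi_surj[OF v] x by blast
      then show ?thesis using eta(2)[OF v] J_mem[OF v] by auto
    qed
    have ppC: "?pp v x \<in> D v" "?pp v x \<in> car C v" if "v \<in> I" "x \<in> car U v" for v x
      using HomD(2)[OF pph that] subs_mem[OF Ds that(1)] by auto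
    have lift: "\<exists>y\<in>car U v. ?pp v y = x" if v: "v \<in> I" and x: "x \<in> D v" for v x
    proof -
      have "x \<in> ?pp v ` car U v" using ppo v x by (simp add: onto_def)
      then show ?thesis by blast
    qed
    obtain v0 x0 where x0: "v0 \<in> I" "x0 \<in> D v0" "\<eta> v0 x0 \<noteq> zer U v0"
      using D(3) subs_le_iff[OF Ds eks] subs_mem[OF Ds] by (auto simp: ker_sub_def)
    obtain y0 where y0: "y0 \<in> car U v0" "?pp v0 y0 = x0" using lift[OF x0(1,2)] by blast
    have "?im ?psi = J"
    proof (rule min'[OF psi])
      show "ker_sub U U ?psi \<noteq> full_sub U" using ker_full_iff[OF U U psi] x0 y0 by auto
      show "?im ?psi \<le> J" unfolding subs_le_iff[OF im_sub[OF U U psi F] Js]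
        using etaJ ppC(2) by (auto simp: im_sub_def full_sub_def)
    qed
    then have imJ: "?psi v ` car U v = J v" if "v \<in> I" for v using that by (auto simp: im_sub_def full_sub_def fun_eq_iff split: if_splits)
    have RJ: "rep (sub_rep U J)" by (rule rep_sub_rep[OF U Js])
    have etao: "onto ?A (sub_rep U J) \<eta>" unfolding onto_def
    proof (intro conjI ballI)
      show "\<eta> \<in> Hom ?A (sub_rep U J)"
        by (rule Hom_corestrict[OF eA A Js]) (use etaJ subs_mem[OF Ds] in auto)
      fix v assume v: "v \<in> I"
      have "?pp v ` car U v = D v" using ppo v by (simp add: onto_def)
      then have "\<eta> v ` D v = ?psi v ` car U v" by (metis image_image)
      then show "\<eta> v ` car ?A v = car (sub_rep U J) v" using imJ[OF v] by simp
    qed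
    have cA: "clsI ?A" by (rule clsI_onto[OF U A ppo cI])
    have "size (sub_rep C D) \<le> size C" using size_sub_le[OF C(1) Ds full_sub[OF C(1)] le_full[OF Ds C(1)]] size_full[of C] by simp
    moreover have "size U = size (sub_rep U J) + size C" using size_onto[OF U C(1,2)] C(3) by simp
    moreover have "size (sub_rep U J) \<noteq> 0" using size_zero_iff sub_zero_iff[OF U Js] J0 by blast
    ultimately have sz: "size ?A < size U" by simp
    have brick: "\<And>\<phi>. \<phi> \<in> Hom ?A ?A \<Longrightarrow> ker_sub ?A ?A \<phi> = full_sub ?A \<or> ker_sub ?A ?A \<phi> = zero_sub ?A"
      by (rule less.hyps[OF sz A D(2) cA])
    \<comment> \<open>The smaller indecomposable \<open>D\<close> is a brick by induction and has
      positive Euler form, so it is rigid; as \<open>J\<close> is a quotient of it, Ext(D, J)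
      vanishes.\<close>
    have "th ?A > 0" by (rule clsI_pos[OF A cA indecomposable_dv[OF A D(2)]])
    then have "th ?A \<noteq> 0" by linarith
    then have "ext0 ?A ?A" by (intro brick_rigid[OF A brick q_pos])
    then have ext: "ext0 ?A (sub_rep U J)" by (rule ext0_onto[OF A A RJ etao])
    \<comment> \<open>The preimage of \<open>D\<close> in \<open>U\<close> is an extension of
      \<open>D\<close> by \<open>J\<close>. It splits, and the section makes \<open>D\<close> a
      summand of \<open>U\<close> whose complement contains the nonzero \<open>J\<close>.
      Indecomposability then forces the section to be zero, against the choice of
      \<open>x0\<close>.\<close>
    let ?P = "vim_sub U \<pi> D"
    have Ps: "?P \<in> subs U" by (rule vim_subs[OF U C(1,2,3) Ds])
    have JP: "J \<le> ?P" by (rule vim_ge[OF U C(1,2,3) Ds])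
    have imP: "im_sub \<pi> ?P = D" by (rule im_vim[OF U C(1,2,3) Ds])
    have o2: "onto (sub_rep U ?P) ?A \<pi>" "ker_sub (sub_rep U ?P) ?A \<pi> = J"
      using sub_im_onto[OF U C(1,2,3) Ps JP] imP by simp_all
    have RP: "rep (sub_rep U ?P)" by (rule rep_sub_rep[OF U Ps])
    have ext': "ext0 ?A (sub_rep (sub_rep U ?P) J)" using ext by simp
    obtain \<sigma> where s: "\<sigma> \<in> Hom ?A (sub_rep U ?P)" "\<And>v x. v \<in> I \<Longrightarrow> x \<in> car ?A v \<Longrightarrow> \<pi> v (\<sigma> v x) = x"
      using ext0_section[OF RP A o2 ext'] by blast
    have sU: "\<sigma> \<in> Hom ?A U" using Hom_comp[OF s(1) Hom_incl[OF U Ps]] by simp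
    have "comp U (ker_sub U ?A ?pp) (im_sub \<sigma> (full_sub ?A))"
      by (rule section_comp[OF U A ppo refl sU]) (use s(2) p(2) in simp)
    then have z: "zero_rep Q (sub_rep U (ker_sub U ?A ?pp)) \<or> zero_rep Q (sub_rep U (im_sub \<sigma> (full_sub ?A)))"
      using ind by (simp add: indecomposable_def)
    have kps: "ker_sub U ?A ?pp \<in> subs U" by (rule ker_sub[OF U A pph])
    have "J \<le> ker_sub U ?A ?pp" unfolding subs_le_iff[OF Js kps]
    proof (intro ballI subsetI)
      fix v x assume v: "v \<in> I" and x: "x \<in> J v"
      have xU: "x \<in> car U v" by (rule subs_mem[OF Js v x])
      have "x \<in> ker_sub U C \<pi> v" using x C(3) by simp
      then have "\<pi> v x = zer C v" using v by (simp add: ker_sub_def)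
      then have "?pp v x = zer ?A v" using Hom_zero[OF C(1) A p(1) v] by simp
      then show "x \<in> ker_sub U ?A ?pp v" using v xU by (simp add: ker_sub_def)
    qed
    then have "ker_sub U ?A ?pp \<noteq> zero_sub U" using zero_le[OF Js U] J0 by (metis antisym)
    then have "zero_rep Q (sub_rep U (im_sub \<sigma> (full_sub ?A)))" using z zero_repI[OF kps U] by blast
    then have "im_sub \<sigma> (full_sub ?A) = zero_sub U"
      using zero_repI[OF im_sub[OF A U sU full_sub[OF A]] U] by blast
    then have "\<sigma> v0 x0 \<in> zero_sub U v0" using x0 by (auto simp: im_sub_def full_sub_def fun_eq_iff split: if_splits)
    then have "\<sigma> v0 x0 = zer U v0" using x0(1) by (simp add: zero_sub_def)
    then have "x0 = zer C v0" using s(2)[of v0 x0] x0 Hom_zero[OF U C(1) pi x0(1)] by simp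
    then show False using x0(3) Hom_zero[OF C(1) U eta(1) x0(1)] by simp
  qed
qed

text \<open>Take a smallest subrepresentation \<open>W\<close> that carries the whole defect of
  \<open>U\<close>. Then U/W has no subrepresentation of positive defect and \<open>W\<close> no
  proper one of the same defect, so the extension splits by \<open>ext0_RI\<close>; the nonzero
  \<open>W\<close> is all of \<open>U\<close>.\<close>

lemma clsI_of_indecomposable:
  assumes U: "rep U" and ind: "indecomposable Q K U" and B: "clsB (wl \<delta>) U" and pos: "th U \<noteq> 0"
  shows "clsI U"
proof -
  let ?P = "\<lambda>W. W \<in> subs U \<and> th (sub_rep U W) = th U"
  have "?P (full_sub U)" using full_sub[OF U] wt_full by blast
  then obtain W where W: "?P W" and min: "\<And>Z. ?P Z \<Longrightarrow> size (sub_rep U W) \<le> size (sub_rep U Z)"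
    using ex_has_least_nat[of ?P "full_sub U" "\<lambda>W. size (sub_rep U W)"] by blast
  have Ws: "W \<in> subs U" using W by blast
  have RW: "rep (sub_rep U W)" by (rule rep_sub_rep[OF U Ws])
  have lt: "th (sub_rep U Z) < th U" if Z: "Z \<in> subs U" "Z \<le> W" "Z \<noteq> W" for Z
  proof -
    have "\<not> size (sub_rep U W) \<le> size (sub_rep U Z)" using size_sub_less[OF U Z(1) Ws Z(2,3)] by simp
    then have "th (sub_rep U Z) \<noteq> th U" using min[of Z] Z(1) by blast
    then show ?thesis using B Z(1) by (force simp: clsB_def)
  qed
  have fW: "full_sub (sub_rep U W) = W" using subsD(1)[OF Ws] by (intro ext) (auto simp: full_sub_def extensional_def)
  have cQ: "th (sub_rep (quot U W) X) \<le> 0" if "X \<in> subs (quot U W)" for X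
    using clsB_quot_of[OF U Ws B] that wt_quot[OF U Ws, of "wl \<delta>"] W by (simp add: clsB_def)
  have "ext0 (quot U W) (sub_rep U W)"
  proof (rule ext0_RI[OF quot(1)[OF U Ws] RW cQ])
    fix Z assume "Z \<in> subs (sub_rep U W)" "Z \<noteq> full_sub (sub_rep U W)"
    then show "th (sub_rep (sub_rep U W) Z) < th (sub_rep U W)"
      using lt[of Z] subs_sub_rep[OF U Ws] fW W by simp
  qed
  then obtain Y where c: "comp U W Y" using ext0_comp[OF U Ws] by blast
  have "zero_rep Q (sub_rep U W) \<or> zero_rep Q (sub_rep U Y)" using ind c by (simp add: indecomposable_def)
  moreover have "\<not> zero_rep Q (sub_rep U W)" using zero_rep_dv[OF RW] wt_zero[of "sub_rep U W" "wl \<delta>"] W pos by auto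
  ultimately have "dv (sub_rep U Y) = (\<lambda>v. 0)" using zero_rep_dv[OF rep_sub_rep[OF U compD(2)[OF c]]] by blast
  then have "dv (sub_rep U W) = dv U" using dv_comp[OF U c] by (intro ext) simp
  then have "W = full_sub U" using sub_full_iff[OF U Ws] by simp
  then show ?thesis using lt le_full[OF _ U] by (auto simp: clsI_def)
qed

end

section \<open>Weighted counts of subrepresentations\<close>

lemma sum_card_swap:
  assumes "finite A" "finite B"
  shows "(\<Sum>x\<in>A. card {y \<in> B. r x y}) = (\<Sum>y\<in>B. card {x \<in> A. r x y})"
  using sum.swap_restrict[OF assms, of "\<lambda>_ _. 1::nat" r] by simp

text \<open>Grouping the inner sums by the value of \<open>h\<close> turns the total into a
  combination of level-set counts, each of which vanishes or has coefficient 0.\<close>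

lemma sum_level_sets:
  fixes \<mu> :: "'c \<Rightarrow> complex" and w :: "'y \<Rightarrow> nat"
  assumes S: "finite S" and T: "\<And>c. c \<in> S \<Longrightarrow> finite (T c)"
    and lev: "\<And>y. w y \<noteq> 0 \<Longrightarrow> (\<Sum>c\<in>S. \<mu> c * of_nat (card {X \<in> T c. h c X = y})) = 0"
  shows "(\<Sum>c\<in>S. \<mu> c * of_nat (\<Sum>X\<in>T c. w (h c X))) = 0"
proof -
  let ?Y = "\<Union>c\<in>S. h c ` T c"
  have fin: "finite ?Y" using S T by blast
  have grp: "(\<Sum>X\<in>T c. w (h c X)) = (\<Sum>y\<in>?Y. card {X \<in> T c. h c X = y} * w y)" if c: "c \<in> S" for c
  proof -
    have "(\<Sum>X\<in>T c. w (h c X)) = (\<Sum>y\<in>?Y. \<Sum>X\<in>{X \<in> T c. h c X = y}. w (h c X))"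
      by (rule sum.group[symmetric, OF T[OF c] fin]) (use c in blast)
    also have "\<dots> = (\<Sum>y\<in>?Y. \<Sum>X\<in>{X \<in> T c. h c X = y}. w y)" by (intro sum.cong refl) simp
    finally show ?thesis by simp
  qed
  have "(\<Sum>c\<in>S. \<mu> c * of_nat (\<Sum>X\<in>T c. w (h c X))) =
      (\<Sum>c\<in>S. \<Sum>y\<in>?Y. of_nat (w y) * (\<mu> c * of_nat (card {X \<in> T c. h c X = y})))"
  proof (rule sum.cong[OF refl])
    fix c assume c: "c \<in> S"
    show "\<mu> c * of_nat (\<Sum>X\<in>T c. w (h c X)) = (\<Sum>y\<in>?Y. of_nat (w y) * (\<mu> c * of_nat (card {X \<in> T c. h c X = y})))"
      unfolding grp[OF c] of_nat_sum of_nat_mult sum_distrib_left by (intro sum.cong refl) (simp add: mult_ac)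
  qed
  also have "\<dots> = (\<Sum>y\<in>?Y. of_nat (w y) * (\<Sum>c\<in>S. \<mu> c * of_nat (card {X \<in> T c. h c X = y})))"
    unfolding sum_distrib_left by (rule sum.swap)
  also have "\<dots> = 0"
  proof (rule sum.neutral, rule ballI)
    fix y show "of_nat (w y) * (\<Sum>c\<in>S. \<mu> c * of_nat (card {X \<in> T c. h c X = y})) = (0::complex)"
      using lev[of y] by (cases "w y = 0") auto
  qed
  finally show ?thesis .
qed

section \<open>Counting subrepresentations by class\<close>

context quiver_reps
begin

abbreviation R :: "('v, 'a, 'k) iso_class \<Rightarrow> ('v, 'a, 'k, nat) quiver_rep" where "R \<equiv> representative"

lemma cls_isoI: "rep M \<Longrightarrow> rep N \<Longrightarrow> cls M = cls N \<Longrightarrow> M \<approx> N" by (simp add: cls_eq_iff)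

lemma cls_cls: "rep M \<Longrightarrow> cls (R (cls M)) = cls M" by (rule representative(2)[OF cls_class])

lemma dv_cls: "rep M \<Longrightarrow> dv (R (cls M)) = dv M"
  using dv_iso[OF _ rep_cls(1) rep_cls(2)] by metis

lemma cls_dv: "rep M \<Longrightarrow> rep N \<Longrightarrow> cls M = cls N \<Longrightarrow> dv M = dv N"
  by (rule dv_iso[OF _ _ cls_isoI])

lemma clsB_cls: "rep M \<Longrightarrow> clsB w (R (cls M)) \<longleftrightarrow> clsB w M"
  using cls_iso(2)[OF _ rep_cls(1) rep_cls(2)] by blast

lemma clsB_zero: "rep M \<Longrightarrow> dv M = (\<lambda>v. 0) \<Longrightarrow> clsB w M"
  unfolding clsB_def
proof
  fix X assume M: "rep M" and z: "dv M = (\<lambda>v. 0)" and X: "X \<in> subs M"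
  have "dv (sub_rep M X) = (\<lambda>v. 0)" using dv_quot[OF M X] z by (intro ext) (metis add_is_0)
  then show "wt w (sub_rep M X) \<le> wt w M" using z by (simp add: wt_zero)
qed

lemma clsA_zero_rep: "rep M \<Longrightarrow> dv M = (\<lambda>v. 0) \<Longrightarrow> clsA w M"
  unfolding clsA_def
proof (intro ballI impI)
  fix X assume M: "rep M" and z: "dv M = (\<lambda>v. 0)" and X: "X \<in> subs M" "X \<noteq> zero_sub M"
  have "dv (sub_rep M X) = (\<lambda>v. 0)" using dv_quot[OF M X(1)] z by (intro ext) (metis add_is_0)
  then show "wt w (sub_rep M X) < 0" using sub_zero_iff[OF M X(1)] X(2) by blast
qed

lemma iso_subs:
  assumes M: "rep M" and N: "rep N" and i: "M \<approx> N"
  obtains f where "bij_betw f (subs M) (subs N)" "\<And>X. X \<in> subs M \<Longrightarrow> sub_rep M X \<approx> sub_rep N (f X)"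
    "\<And>X. X \<in> subs M \<Longrightarrow> quot M X \<approx> quot N (f X)"
proof -
  obtain \<phi> where p: "mono M N \<phi>" "onto M N \<phi>" using i iso_iff by blast
  have h: "\<phi> \<in> Hom M N" using p(1) by (simp add: mono_def)
  have k: "ker_sub M N \<phi> = zero_sub M" using mono_iff[OF M N h] p(1) by simp
  have "{Z \<in> subs M. zero_sub M \<le> Z} = subs M" using zero_le[OF _ M] by blast
  then have "bij_betw (im_sub \<phi>) (subs M) (subs N)" using im_bij[OF M N p(2) k] by simp
  moreover have "sub_rep M X \<approx> sub_rep N (im_sub \<phi> X)" if X: "X \<in> subs M" for X
  proof -
    note RX = rep_sub_rep[OF M X]
    have z: "zero_sub (sub_rep M X) = zero_sub M" by (simp add: zero_sub_def)
    have i1: "quot (sub_rep M X) (zero_sub M) \<approx> sub_rep M X" using quot_zero_iso[OF RX] z by simp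
    have r: "rep (quot (sub_rep M X) (zero_sub M))" using quot(1)[OF RX zero_sub[OF RX]] z by simp
    show ?thesis
      by (rule iso_trans[OF iso_sym[OF r RX i1] sub_im_iso[OF M N p(2) k X zero_le[OF X M]]])
  qed
  moreover have "quot M X \<approx> quot N (im_sub \<phi> X)" if X: "X \<in> subs M" for X
    by (rule quot_im_iso[OF M N p(2) k X zero_le[OF X M]])
  ultimately show ?thesis by (rule that)
qed

text \<open>The predicate receives the class of the subrepresentation first and that of the quotient
  second, the reverse of the order in \<open>hall_number\<close>.\<close>

definition cnt :: "(('v, 'a, 'k) iso_class \<Rightarrow> ('v, 'a, 'k) iso_class \<Rightarrow> bool) \<Rightarrow> ('v, 'a, 'k, 'm) quiver_rep \<Rightarrow> nat" where
  "cnt p M = card {X \<in> subs M. p (cls (sub_rep M X)) (cls (quot M X))}"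

lemma cnt_iso:
  assumes M: "rep M" and N: "rep N" and i: "M \<approx> N"
  shows "cnt p M = cnt p N"
proof -
  obtain f where f: "bij_betw f (subs M) (subs N)" "\<And>X. X \<in> subs M \<Longrightarrow> sub_rep M X \<approx> sub_rep N (f X)"
    "\<And>X. X \<in> subs M \<Longrightarrow> quot M X \<approx> quot N (f X)" using iso_subs[OF M N i] by blast
  have fX: "f X \<in> subs N" if "X \<in> subs M" for X using f(1) that by (auto simp: bij_betw_def)
  have e: "cls (sub_rep N (f X)) = cls (sub_rep M X)" "cls (quot N (f X)) = cls (quot M X)" if X: "X \<in> subs M" for X
    using cls_eq_iff[OF rep_sub_rep[OF M X] rep_sub_rep[OF N fX[OF X]]] cls_eq_iff[OF quot(1)[OF M X] quot(1)[OF N fX[OF X]]]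
      f(2,3)[OF X] by auto
  let ?A = "{X \<in> subs M. p (cls (sub_rep M X)) (cls (quot M X))}" and ?B = "{X \<in> subs N. p (cls (sub_rep N X)) (cls (quot N X))}"
  have "f ` ?A = ?B"
  proof (intro subset_antisym subsetI)
    fix Y assume "Y \<in> f ` ?A" then show "Y \<in> ?B" using e fX by auto
  next
    fix Y assume Y: "Y \<in> ?B"
    then have "Y \<in> f ` subs M" using f(1) by (simp add: bij_betw_def)
    then obtain X where X: "X \<in> subs M" "Y = f X" by blast
    then have "X \<in> ?A" using Y e[OF X(1)] by simp
    then show "Y \<in> f ` ?A" using X(2) by blast
  qed
  moreover have "inj_on f ?A" using f(1) by (auto simp: bij_betw_def inj_on_def)
  ultimately show ?thesis unfolding cnt_def using card_image[of f ?A] by simp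
qed

lemma cnt_cls: "rep M \<Longrightarrow> cnt p (R (cls M)) = cnt p M"
  using cnt_iso[OF _ rep_cls(1) rep_cls(2)] by metis

lemma cnt_pos:
  assumes "rep M" "cnt p M \<noteq> 0"
  obtains X where "X \<in> subs M" "p (cls (sub_rep M X)) (cls (quot M X))"
  using assms(2) unfolding cnt_def by (metis (mono_tags, lifting) card.empty empty_Collect_eq)

lemma cnt_nonzero: "rep M \<Longrightarrow> X \<in> subs M \<Longrightarrow> p (cls (sub_rep M X)) (cls (quot M X)) \<Longrightarrow> cnt p M \<noteq> 0"
  unfolding cnt_def using finite_subs[of M] by auto

lemma cnt_lower:
  assumes "rep M" "X' \<in> subs M"
  shows "cnt p (sub_rep M X') = card {X \<in> subs M. X \<le> X' \<and> p (cls (sub_rep M X)) (cls (quot (sub_rep M X') X))}"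
  unfolding cnt_def subs_sub_rep[OF assms] sub_sub_rep by (rule arg_cong[of _ _ card]) blast

text \<open>Correspondence theorem. Together with \<open>cnt_lower\<close> it reads a flag X \<le>
  X' either in the quotient by X or inside X', which is what counting flags in two ways
  requires.\<close>

lemma cnt_upper:
  assumes M: "rep M" and X: "X \<in> subs M"
  shows "cnt p (quot M X) = card {X' \<in> subs M. X \<le> X' \<and> p (cls (quot (sub_rep M X') X)) (cls (quot M X'))}"
proof -
  note Qu = quot[OF M X]
  let ?f = "im_sub (proj M X)" and ?D = "{Z \<in> subs M. X \<le> Z}"
  let ?A = "{X' \<in> subs M. X \<le> X' \<and> p (cls (quot (sub_rep M X') X)) (cls (quot M X'))}"
  let ?B = "{Y \<in> subs (quot M X). p (cls (sub_rep (quot M X) Y)) (cls (quot (quot M X) Y))}"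
  have f: "bij_betw ?f ?D (subs (quot M X))" by (rule im_bij[OF M Qu])
  have fX: "?f Z \<in> subs (quot M X)" if "Z \<in> subs M" for Z by (rule im_subs[OF M Qu that])
  have e: "cls (sub_rep (quot M X) (?f Z)) = cls (quot (sub_rep M Z) X)" "cls (quot (quot M X) (?f Z)) = cls (quot M Z)"
    if Z: "Z \<in> subs M" "X \<le> Z" for Z
  proof -
    have XZ: "X \<in> subs (sub_rep M Z)" using subs_sub_rep[OF M Z(1)] X Z(2) by simp
    show "cls (sub_rep (quot M X) (?f Z)) = cls (quot (sub_rep M Z) X)"
      using cls_eq_iff[OF quot(1)[OF rep_sub_rep[OF M Z(1)] XZ] rep_sub_rep[OF Qu(1) fX[OF Z(1)]]] sub_im_iso[OF M Qu Z] by simp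
    show "cls (quot (quot M X) (?f Z)) = cls (quot M Z)"
      using cls_eq_iff[OF quot(1)[OF M Z(1)] quot(1)[OF Qu(1) fX[OF Z(1)]]] quot_im_iso[OF M Qu Z] by simp
  qed
  have "?f ` ?A = ?B"
  proof (intro subset_antisym subsetI)
    fix Y assume "Y \<in> ?f ` ?A" then show "Y \<in> ?B" using e fX by auto
  next
    fix Y assume Y: "Y \<in> ?B"
    then have "Y \<in> ?f ` ?D" using f by (simp add: bij_betw_def)
    then obtain Z where Z: "Z \<in> subs M" "X \<le> Z" "Y = ?f Z" by blast
    then have "Z \<in> ?A" using Y e[OF Z(1,2)] by simp
    then show "Y \<in> ?f ` ?A" using Z(3) by blast
  qed
  moreover have "inj_on ?f ?A" using f by (auto simp: bij_betw_def inj_on_def)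
  ultimately show ?thesis unfolding cnt_def using card_image[of ?f ?A] by simp
qed

lemma HomE_iff: "rep M \<Longrightarrow> \<phi> \<in> HomE M N \<longleftrightarrow> \<phi> \<in> Hom M N \<and> nrm M \<phi> = \<phi>"
proof -
  assume M: "rep M"
  have "nrm M \<phi> = \<phi>" if p: "\<phi> \<in> HomE M N"
    by (rule HomE_eqI[OF nrm_HomE[OF M HomE_hom[OF p]] p]) simp
  then show ?thesis using nrm_HomE[OF M, of \<phi> N] HomE_hom[of \<phi> M N] by auto
qed

definition surj_count :: "('v, 'a, 'k, 'm) quiver_rep \<Rightarrow> ('v, 'a, 'k, 'n) quiver_rep \<Rightarrow> nat" where
  "surj_count V M = card {\<phi> \<in> HomE V M. onto V M \<phi>}"

lemma onto_cong:
  assumes "rep V" "onto V M \<phi>" "\<And>v x. v \<in> I \<Longrightarrow> x \<in> car V v \<Longrightarrow> \<psi> v x = \<phi> v x"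
  shows "onto V M \<psi>"
proof -
  have "\<psi> v ` car V v = \<phi> v ` car V v" if "v \<in> I" for v by (intro image_cong refl) (rule assms(3)[OF that])
  then show ?thesis using assms(2) Hom_cong[OF _ assms(1), of \<phi> M \<psi>] assms(3) by (auto simp: onto_def)
qed

lemma surj_count_le:
  assumes V: "rep V" and M: "rep M" and N: "rep N" and i: "M \<approx> N"
  shows "surj_count V M \<le> surj_count V N"
proof -
  obtain \<iota> where t: "mono M N \<iota>" "onto M N \<iota>" using i iso_iff by blast
  let ?f = "\<lambda>\<phi>. nrm V (\<lambda>v x. \<iota> v (\<phi> v x))"
  have "?f \<phi> \<in> {\<phi> \<in> HomE V N. onto V N \<phi>}" if "\<phi> \<in> {\<phi> \<in> HomE V M. onto V M \<phi>}" for \<phi>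
  proof -
    have o: "onto V N (\<lambda>v x. \<iota> v (\<phi> v x))" using onto_comp[OF _ t(2)] that by blast
    have "?f \<phi> \<in> HomE V N" by (rule nrm_HomE[OF V]) (use o in \<open>simp add: onto_def\<close>)
    moreover have "onto V N (?f \<phi>)" by (rule onto_cong[OF V o]) simp
    ultimately show ?thesis by simp
  qed
  moreover have "inj_on ?f {\<phi> \<in> HomE V M. onto V M \<phi>}"
  proof (rule inj_onI, clarify)
    fix \<phi> \<psi> assume p: "\<phi> \<in> HomE V M" and s: "\<psi> \<in> HomE V M" and e: "?f \<phi> = ?f \<psi>"
    show "\<phi> = \<psi>"
    proof (rule HomE_eqI[OF p s])
      fix v x assume v: "v \<in> I" and x: "x \<in> car V v"
      have "\<iota> v (\<phi> v x) = \<iota> v (\<psi> v x)" using fun_cong[OF fun_cong[OF e, of v], of x] v x by simp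
      then show "\<phi> v x = \<psi> v x"
        using t(1) v HomD(2)[OF HomE_hom[OF p] v x] HomD(2)[OF HomE_hom[OF s] v x] by (simp add: mono_def inj_on_def)
    qed
  qed
  moreover have "finite {\<phi> \<in> HomE V N. onto V N \<phi>}" using finite_HomE[OF V N] by simp
  ultimately show ?thesis unfolding surj_count_def
    using card_inj_on_le[of ?f "{\<phi> \<in> HomE V M. onto V M \<phi>}" "{\<phi> \<in> HomE V N. onto V N \<phi>}"] by blast
qed

lemma surj_count_cls:
  assumes V: "rep V" and M: "rep M" shows "surj_count V (R (cls M)) = surj_count V M"
  by (rule antisym) (rule surj_count_le[OF V rep_cls(1)[OF M] M iso_sym[OF M rep_cls[OF M]]],
    rule surj_count_le[OF V M rep_cls[OF M]])

text \<open>Homomorphisms are sorted by image, and each is an epimorphism onto it. The number of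
  epimorphisms depends only on the class of the image, so |Hom(V, M)| becomes a weighted count of
  subrepresentations.\<close>

lemma card_HomE_images:
  assumes V: "rep V" and M: "rep M"
  shows "card (HomE V M) = (\<Sum>Y\<in>subs M. surj_count V (R (cls (sub_rep M Y))))"
proof -
  let ?im = "\<lambda>\<phi>. im_sub \<phi> (full_sub V)"
  have im: "?im ` HomE V M \<subseteq> subs M" using im_sub[OF V M HomE_hom full_sub[OF V]] by blast
  have "card (HomE V M) = (\<Sum>Y\<in>subs M. card {\<phi> \<in> HomE V M. ?im \<phi> = Y})"
    using sum.group[OF finite_HomE[OF V M] finite_subs[OF M] im, of "\<lambda>_. 1::nat"] by simp
  also have "\<dots> = (\<Sum>Y\<in>subs M. surj_count V (R (cls (sub_rep M Y))))"
  proof (rule sum.cong[OF refl])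
    fix Y assume Y: "Y \<in> subs M"
    note RY = rep_sub_rep[OF M Y]
    have "\<phi> \<in> HomE V M \<and> ?im \<phi> = Y \<longleftrightarrow> \<phi> \<in> HomE V (sub_rep M Y) \<and> onto V (sub_rep M Y) \<phi>" for \<phi>
    proof
      assume a: "\<phi> \<in> HomE V M \<and> ?im \<phi> = Y"
      have im: "\<phi> v ` car V v = Y v" if "v \<in> I" for v
        using a that by (auto simp: im_sub_def full_sub_def)
      have "\<phi> \<in> Hom V (sub_rep M Y)"
        by (rule Hom_corestrict[OF HomE_hom V Y]) (use a im in blast)+
      moreover have "nrm V \<phi> = \<phi>" using a HomE_iff[OF V, of \<phi> M] by blast
      ultimately show "\<phi> \<in> HomE V (sub_rep M Y) \<and> onto V (sub_rep M Y) \<phi>"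
        using im HomE_iff[OF V, of \<phi> "sub_rep M Y"] unfolding onto_def by simp
    next
      assume a: "\<phi> \<in> HomE V (sub_rep M Y) \<and> onto V (sub_rep M Y) \<phi>"
      have "\<phi> \<in> Hom V M" using Hom_comp[OF HomE_hom Hom_incl[OF M Y]] a by blast
      moreover have "?im \<phi> = Y"
      proof
        fix v show "?im \<phi> v = Y v"
          using a subsD(1)[OF Y] by (cases "v \<in> I") (auto simp: im_sub_def full_sub_def onto_def extensional_def)
      qed
      ultimately show "\<phi> \<in> HomE V M \<and> ?im \<phi> = Y" using a HomE_iff[OF V] by blast
    qed
    then have "{\<phi> \<in> HomE V M. ?im \<phi> = Y} = {\<phi> \<in> HomE V (sub_rep M Y). onto V (sub_rep M Y) \<phi>}" by blast
    then show "card {\<phi> \<in> HomE V M. ?im \<phi> = Y} = surj_count V (R (cls (sub_rep M Y)))"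
      unfolding surj_count_cls[OF V RY] by (simp add: surj_count_def)
  qed
  finally show ?thesis .
qed

end

section \<open>Linear functionals on counts and triangular elimination\<close>

locale weighted_classes = affine K Q \<delta> for K :: "('k, 'e) ring_scheme" and Q :: "('v, 'a) pre_digraph" and \<delta> +
  fixes S :: "('v, 'a, 'k) iso_class set" and \<mu> :: "('v, 'a, 'k) iso_class \<Rightarrow> complex"
  assumes finite_S: "finite S" and S_iso: "S \<subseteq> iso_classes Q K"
begin

definition lvl :: "(('v, 'a, 'k, nat) quiver_rep \<Rightarrow> nat) \<Rightarrow> complex" where
  "lvl f = (\<Sum>c\<in>S. \<mu> c * of_nat (f (R c)))"

lemma S_rep: "c \<in> S \<Longrightarrow> rep (R c)" using S_iso representative(1) by blast

lemma lvl_cong: "(\<And>c. c \<in> S \<Longrightarrow> f (R c) = g (R c)) \<Longrightarrow> lvl f = lvl g"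
  unfolding lvl_def by (intro sum.cong) auto

lemma lvl_add: "lvl (\<lambda>M. f M + g M) = lvl f + lvl g"
  by (simp add: lvl_def sum.distrib distrib_left)

lemma lvl_mult: "lvl (\<lambda>M. f M * n) = lvl f * of_nat n"
  by (simp add: lvl_def sum_distrib_right mult.assoc)

text \<open>If no member of the support has such a subrepresentation, all terms are 0. So a proof of
  vanishing may assume an actual pair (M, X), which supplies the constraints on dimension and
  defect.\<close>

lemma lvl_instance:
  assumes "\<And>c X. c \<in> S \<Longrightarrow> X \<in> subs (R c) \<Longrightarrow> p (R c) X \<Longrightarrow> lvl (\<lambda>M. card {X \<in> subs M. p M X}) = 0"
  shows "lvl (\<lambda>M. card {X \<in> subs M. p M X}) = 0"
proof (cases "\<exists>c\<in>S. \<exists>X\<in>subs (R c). p (R c) X")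
  case True then show ?thesis using assms by blast
next
  case False
  then have e: "{X \<in> subs (R c). p (R c) X} = {}" if "c \<in> S" for c using that by blast
  show ?thesis unfolding lvl_def
  proof (rule sum.neutral, rule ballI)
    fix c assume c: "c \<in> S"
    show "\<mu> c * of_nat (card {X \<in> subs (R c). p (R c) X}) = 0" unfolding e[OF c] by simp
  qed
qed

lemma lvl_zero:
  assumes "\<And>y. w y \<noteq> 0 \<Longrightarrow> lvl (\<lambda>M. card {X \<in> subs M. P M X \<and> h M X = y}) = 0"
  shows "lvl (\<lambda>M. \<Sum>X\<in>{X \<in> subs M. P M X}. w (h M X)) = 0"
proof -
  have e: "{X \<in> {X \<in> subs (R c). P (R c) X}. h (R c) X = y} = {X \<in> subs (R c). P (R c) X \<and> h (R c) X = y}" for c y by blast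
  show ?thesis unfolding lvl_def
  proof (rule sum_level_sets[OF finite_S, of "\<lambda>c. {X \<in> subs (R c). P (R c) X}" w \<mu> "\<lambda>c. h (R c)"])
    show "finite {X \<in> subs (R c). P (R c) X}" if "c \<in> S" for c using finite_subs[OF S_rep[OF that]] by simp
    show "(\<Sum>c\<in>S. \<mu> c * of_nat (card {X \<in> {X \<in> subs (R c). P (R c) X}. h (R c) X = y})) = 0" if "w y \<noteq> 0" for y
      using assms[OF that] unfolding lvl_def e .
  qed
qed

text \<open>One step of triangular elimination: the total vanishes, every other level vanishes, and
  the remaining coefficient \<open>w y0\<close> is nonzero.\<close>

lemma lvl_split:
  assumes lev: "\<And>y. y \<noteq> y0 \<Longrightarrow> w y \<noteq> 0 \<Longrightarrow> lvl (\<lambda>M. card {X \<in> subs M. P M X \<and> h M X = y}) = 0"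
    and tot: "lvl (\<lambda>M. \<Sum>X\<in>{X \<in> subs M. P M X}. w (h M X)) = 0" and y0: "w y0 \<noteq> 0"
  shows "lvl (\<lambda>M. card {X \<in> subs M. P M X \<and> h M X = y0}) = 0"
proof -
  let ?w = "\<lambda>y. if y = y0 then 0 else w y"
  have z: "lvl (\<lambda>M. \<Sum>X\<in>{X \<in> subs M. P M X}. ?w (h M X)) = 0"
    by (rule lvl_zero) (use lev in \<open>auto split: if_splits\<close>)
  have "lvl (\<lambda>M. \<Sum>X\<in>{X \<in> subs M. P M X}. w (h M X)) =
      lvl (\<lambda>M. (\<Sum>X\<in>{X \<in> subs M. P M X}. ?w (h M X)) + card {X \<in> subs M. P M X \<and> h M X = y0} * w y0)"
  proof (rule lvl_cong)
    fix c assume c: "c \<in> S"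
    let ?T = "{X \<in> subs (R c). P (R c) X}"
    have fin: "finite ?T" using finite_subs[OF S_rep[OF c]] by simp
    have "(\<Sum>X\<in>?T. w (h (R c) X)) = (\<Sum>X\<in>?T. ?w (h (R c) X) + (if h (R c) X = y0 then w y0 else 0))"
      by (intro sum.cong) auto
    also have "\<dots> = (\<Sum>X\<in>?T. ?w (h (R c) X)) + (\<Sum>X\<in>{X \<in> ?T. h (R c) X = y0}. w y0)"
      unfolding sum.distrib sum.inter_filter[OF fin] ..
    also have "{X \<in> ?T. h (R c) X = y0} = {X \<in> subs (R c). P (R c) X \<and> h (R c) X = y0}" by blast
    finally show "(\<Sum>X\<in>?T. w (h (R c) X)) = (\<Sum>X\<in>?T. ?w (h (R c) X)) + card {X \<in> subs (R c). P (R c) X \<and> h (R c) X = y0} * w y0"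
      by simp
  qed
  then have "lvl (\<lambda>M. card {X \<in> subs M. P M X \<and> h M X = y0}) * of_nat (w y0) = 0"
    using z tot unfolding lvl_add lvl_mult by simp
  then show ?thesis using y0 by simp
qed

end

section \<open>Vanishing of all proper coproduct coefficients of a regular cuspidal function\<close>

locale regular_cuspidal_data = weighted_classes K Q \<delta> S \<mu>
  for K :: "('k, 'e) ring_scheme" and Q :: "('v, 'a) pre_digraph" and \<delta> S \<mu> +
  fixes D :: "'v \<Rightarrow> nat"
  assumes S_RR: "c \<in> S \<Longrightarrow> RR (R c)" and S_dv: "c \<in> S \<Longrightarrow> dv (R c) = D"
    and total: "(\<Sum>c\<in>S. \<mu> c) = 0"
    and cusp: "rep A \<Longrightarrow> rep B \<Longrightarrow> RR A \<Longrightarrow> RR B \<Longrightarrow> dv A \<noteq> (\<lambda>v. 0) \<Longrightarrow> dv B \<noteq> (\<lambda>v. 0) \<Longrightarrow>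
      lvl (cnt (\<lambda>s t. s = cls (B :: ('v, 'a, 'k, nat) quiver_rep) \<and> t = cls (A :: ('v, 'a, 'k, nat) quiver_rep))) = 0"
begin

text \<open>Here, and only here, the vanishing of the linear form enters.\<close>

lemma lvl_const: "lvl (\<lambda>M. n) = 0"
  using total by (simp add: lvl_def sum_distrib_right[symmetric])

lemma sub_dv_le: "rep M \<Longrightarrow> X \<in> subs M \<Longrightarrow> dv (sub_rep M X) v \<le> dv M v"
  using dv_quot[of M X v] by simp

text \<open>A copy X of \<open>V\<close> contains exactly one copy Y of \<open>H\<close> with X/Y
  isomorphic to V/H, by uniqueness of the torsion part. Conversely such a Y forces X to be
  isomorphic to \<open>V\<close>, since the extension splits. Hence copies of \<open>V\<close> are
  counted over copies Y of \<open>H\<close>, as copies of V/H inside M/Y.\<close>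

lemma cnt_sub_hn:
  assumes M: "rep M" and V: "rep V" and H: "hn (wl \<delta>) V H"
  shows "cnt (\<lambda>s t. s = cls V) M =
    (\<Sum>Y\<in>{Y \<in> subs M. cls (sub_rep M Y) = cls (sub_rep V H)}. cnt (\<lambda>s t. s = cls (quot V H)) (R (cls (quot M Y))))"
proof -
  let ?A = "{Y \<in> subs M. cls (sub_rep M Y) = cls (sub_rep V H)}"
  let ?r = "\<lambda>Y X. Y \<le> X \<and> cls (quot (sub_rep M X) Y) = cls (quot V H)"
  have Hs: "H \<in> subs V" using H by (simp add: hn_def)
  note RH = rep_sub_rep[OF V Hs] and QH = quot(1)[OF V Hs]
  have fin: "finite (subs M)" by (rule finite_subs[OF M])
  have one: "card {Y \<in> ?A. ?r Y X} = (if cls (sub_rep M X) = cls V then 1 else 0)" if X: "X \<in> subs M" for X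
  proof -
    note RX = rep_sub_rep[OF M X]
    have isos: "sub_rep V H \<approx> sub_rep M Y" "quot V H \<approx> quot (sub_rep M X) Y" "Y \<in> subs (sub_rep M X)"
      if Y: "Y \<in> ?A" "?r Y X" for Y
    proof -
      have Ys: "Y \<in> subs M" using Y by simp
      show YX: "Y \<in> subs (sub_rep M X)" using subs_sub_rep[OF M X] Y Ys by simp
      show "sub_rep V H \<approx> sub_rep M Y" using cls_isoI[OF RH rep_sub_rep[OF M Ys]] Y by simp
      show "quot V H \<approx> quot (sub_rep M X) Y" using cls_isoI[OF QH quot(1)[OF RX YX]] Y by simp
    qed
    show ?thesis
    proof (cases "cls (sub_rep M X) = cls V")
      case False
      have "\<not> ?r Y X" if Y: "Y \<in> ?A" for Y
      proof
        assume r: "?r Y X"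
        have "V \<approx> sub_rep M X"
          using ext0_unique[OF V RX Hs isos(3)[OF Y r] hn_split[OF V H]] isos(1,2)[OF Y r] by simp
        then show False using False cls_eq_iff[OF V RX] by simp
      qed
      then have "{Y \<in> ?A. ?r Y X} = {}" by blast
      then show ?thesis using False by (simp only: card.empty if_False)
    next
      case True
      have VX: "V \<approx> sub_rep M X" using cls_isoI[OF V RX] True by simp
      obtain f where f: "bij_betw f (subs V) (subs (sub_rep M X))" "\<And>Z. Z \<in> subs V \<Longrightarrow> sub_rep V Z \<approx> sub_rep (sub_rep M X) (f Z)"
        "\<And>Z. Z \<in> subs V \<Longrightarrow> quot V Z \<approx> quot (sub_rep M X) (f Z)" using iso_subs[OF V RX VX] by blast
      have fH: "f H \<in> subs (sub_rep M X)" using f(1) Hs by (auto simp: bij_betw_def)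
      then have fM: "f H \<in> subs M" "f H \<le> X" using subs_sub_rep[OF M X] by auto
      have c1: "cls (sub_rep M (f H)) = cls (sub_rep V H)"
        using cls_eq_iff[OF RH rep_sub_rep[OF M fM(1)]] f(2)[OF Hs] by simp
      have c2: "cls (quot (sub_rep M X) (f H)) = cls (quot V H)"
        using cls_eq_iff[OF QH quot(1)[OF RX fH]] f(3)[OF Hs] by simp
      have hn: "hn (wl \<delta>) (sub_rep M X) Y" if Y: "Y \<in> ?A" "?r Y X" for Y
      proof -
        have Ys: "Y \<in> subs M" using Y by simp
        show ?thesis using H isos[OF Y] cls_iso(2)[OF RH rep_sub_rep[OF M Ys] isos(1)[OF Y]]
          cls_iso(1)[OF QH quot(1)[OF RX isos(3)[OF Y]] isos(2)[OF Y]] by (simp add: hn_def)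
      qed
      have "{Y \<in> ?A. ?r Y X} = {f H}"
      proof (intro subset_antisym subsetI)
        fix Y assume Y: "Y \<in> {Y \<in> ?A. ?r Y X}"
        have "hn (wl \<delta>) (sub_rep M X) Y" using hn Y by blast
        moreover have "hn (wl \<delta>) (sub_rep M X) (f H)" by (rule hn) (use fM c1 c2 in simp_all)
        ultimately show "Y \<in> {f H}" using hn_unique[OF RX] by blast
      qed (use fM c1 c2 in simp)
      then show ?thesis using True by simp
    qed
  qed
  have up: "cnt (\<lambda>s t. s = cls (quot V H)) (R (cls (quot M Y))) = card {X \<in> subs M. ?r Y X}" if "Y \<in> ?A" for Y
    using that cnt_cls[OF quot(1)[OF M]] cnt_upper[OF M] by simp
  have "(\<Sum>Y\<in>?A. cnt (\<lambda>s t. s = cls (quot V H)) (R (cls (quot M Y)))) = (\<Sum>Y\<in>?A. card {X \<in> subs M. ?r Y X})"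
    by (rule sum.cong[OF refl up])
  also have "\<dots> = (\<Sum>X\<in>subs M. card {Y \<in> ?A. ?r Y X})" by (rule sum_card_swap) (use fin in simp_all)
  also have "\<dots> = (\<Sum>X\<in>subs M. if cls (sub_rep M X) = cls V then 1 else 0)" by (rule sum.cong[OF refl one])
  also have "\<dots> = cnt (\<lambda>s t. s = cls V) M"
    unfolding sum.inter_filter[OF fin, symmetric] by (simp add: cnt_def)
  finally show ?thesis by simp
qed

text \<open>Either the maximal subrepresentation \<open>H\<close> of \<open>V\<close> with nonnegative subobject weight is nonzero and regular, and
  copies of \<open>V\<close> in \<open>M\<close> are counted over copies of \<open>H\<close>; or \<open>V\<close> is preprojective, and \<open>|Hom(V, M)|\<close>, which does not
  depend on \<open>M\<close>, is counted over images.\<close>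

lemma sub_level_zero:
  fixes V :: "('v, 'a, 'k, nat) quiver_rep"
  assumes "rep V" "dv V \<noteq> D"
  shows "lvl (cnt (\<lambda>s t. s = cls V)) = 0"
  using assms
proof (induction "size V" arbitrary: V rule: less_induct)
  case less
  note V = less.prems(1)
  show ?case unfolding cnt_def
  proof (rule lvl_instance)
    fix c X assume c: "c \<in> S" and X: "X \<in> subs (R c)" and XV: "cls (sub_rep (R c) X) = cls V"
    note M = S_rep[OF c]
    have VX: "V \<approx> sub_rep (R c) X" using cls_isoI[OF V rep_sub_rep[OF M X]] XV by simp
    have dvV: "dv V = dv (sub_rep (R c) X)" by (rule dv_iso[OF V rep_sub_rep[OF M X] VX])
    have leD: "dv V v \<le> D v" for v using sub_dv_le[OF M X, of v] dvV S_dv[OF c] by simp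
    \<comment> \<open>\<open>V\<close> sits inside a regular representation, so its
      subrepresentations have defect at most 0; its torsion part then has defect exactly 0 and is
      regular.\<close>
    have th_le: "th (sub_rep V W) \<le> 0" if W: "W \<in> subs V" for W
    proof -
      obtain f where f: "bij_betw f (subs V) (subs (sub_rep (R c) X))" "\<And>Z. Z \<in> subs V \<Longrightarrow> sub_rep V Z \<approx> sub_rep (sub_rep (R c) X) (f Z)"
        "\<And>Z. Z \<in> subs V \<Longrightarrow> quot V Z \<approx> quot (sub_rep (R c) X) (f Z)" using iso_subs[OF V rep_sub_rep[OF M X] VX] by blast
      have "f W \<in> subs (sub_rep (R c) X)" using f(1) W by (auto simp: bij_betw_def)
      then have fW: "f W \<in> subs (R c)" using subs_sub_rep[OF M X] by simp
      have i: "sub_rep V W \<approx> sub_rep (R c) (f W)" using f(2)[OF W] by simp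
      have "th (sub_rep V W) = th (sub_rep (R c) (f W))"
        by (rule wt_cong[OF dv_iso[OF rep_sub_rep[OF V W] rep_sub_rep[OF M fW] i]])
      then show ?thesis using RR_sub_le[OF S_RR[OF c] fW] by simp
    qed
    have "lvl (cnt (\<lambda>s t. s = cls V)) = 0"
    proof (cases "dv V = (\<lambda>v. 0)")
      case True
      have "lvl (cnt (\<lambda>s t. s = cls V)) = lvl (\<lambda>M. 1)"
      proof (rule lvl_cong)
        fix c assume c: "c \<in> S"
        note M = S_rep[OF c]
        have "cls (sub_rep (R c) X) = cls V \<longleftrightarrow> X = zero_sub (R c)" if X: "X \<in> subs (R c)" for X
          using cls_zero_class_iff[OF rep_sub_rep[OF M X]] cls_eq_zero_class[OF V True] sub_zero_iff[OF M X] by simp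
        then have "{X \<in> subs (R c). cls (sub_rep (R c) X) = cls V} = {zero_sub (R c)}" using zero_sub[OF M] by blast
        then show "cnt (\<lambda>s t. s = cls V) (R c) = 1" by (simp add: cnt_def)
      qed
      then show ?thesis using lvl_const by simp
    next
      case nz: False
      obtain H where H: "hn (wl \<delta>) V H" and max: "\<And>Y. Y \<in> subs V \<Longrightarrow> th (sub_rep V Y) \<le> th (sub_rep V H)"
        using hn_exists[OF V] by blast
      have Hs: "H \<in> subs V" using H by (simp add: hn_def)
      note RH = rep_sub_rep[OF V Hs] and QH = quot(1)[OF V Hs]
      have thH: "th (sub_rep V H) = 0" using max[OF zero_sub[OF V]] th_le[OF Hs] wt_zero[OF dv_zero[OF V]] by simp
      show ?thesis
      proof (cases "H = zero_sub V")
        case False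
        have dvH: "dv (sub_rep V H) \<noteq> (\<lambda>v. 0)" using sub_zero_iff[OF V Hs] False by simp
        have RRH: "RR (sub_rep V H)" using thH H by (simp add: RR_def hn_def)
        let ?w = "\<lambda>u. cnt (\<lambda>s t. s = cls (quot V H)) (R u)"
        have "lvl (cnt (\<lambda>s t. s = cls V)) = lvl (\<lambda>M. \<Sum>Y\<in>{Y \<in> subs M. cls (sub_rep M Y) = cls (sub_rep V H)}. ?w (cls (quot M Y)))"
          by (rule lvl_cong) (rule cnt_sub_hn[OF S_rep V H])
        also have "\<dots> = 0"
        proof (rule lvl_zero[where w = ?w and P = "\<lambda>M X. cls (sub_rep M X) = cls (sub_rep V H)" and h = "\<lambda>M X. cls (quot M X)"])
          fix u assume w: "?w u \<noteq> 0"
          show "lvl (\<lambda>M. card {X \<in> subs M. cls (sub_rep M X) = cls (sub_rep V H) \<and> cls (quot M X) = u}) = 0"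
          proof (rule lvl_instance)
            fix c Y assume c: "c \<in> S" and Y: "Y \<in> subs (R c)" and "cls (sub_rep (R c) Y) = cls (sub_rep V H) \<and> cls (quot (R c) Y) = u"
            then have Y1: "cls (sub_rep (R c) Y) = cls (sub_rep V H)" and Y2: "u = cls (quot (R c) Y)" by auto
            note M = S_rep[OF c]
            note RY = rep_sub_rep[OF M Y] and QY = quot(1)[OF M Y]
            have dvY: "dv (sub_rep (R c) Y) = dv (sub_rep V H)" by (rule cls_dv[OF RY RH Y1])
            have RRQ: "RR (quot (R c) Y)" by (rule RR_quot[OF M S_RR[OF c] Y]) (use thH wt_cong[OF dvY] in simp)
            have u: "R u \<approx> quot (R c) Y" "rep (R u)" "cls (R u) = u"
              using iso_sym[OF QY] rep_cls[OF QY] cls_cls[OF QY] Y2 by auto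
            have RRu: "RR (R u)" using RR_iso[OF u(2) QY u(1)] RRQ by simp
            \<comment> \<open>A zero quotient would give \<open>H\<close> the dimension D and embed
              V/H into 0, so that \<open>V\<close> itself had dimension D, which is
              excluded.\<close>
            have dvu: "dv (R u) \<noteq> (\<lambda>v. 0)"
            proof
              assume z: "dv (R u) = (\<lambda>v. 0)"
              have "dv (quot (R c) Y) = (\<lambda>v. 0)" using dv_iso[OF u(2) QY u(1)] z by simp
              then have dY: "dv (sub_rep V H) = D" using quot_zero_rep[OF M Y] dvY S_dv[OF c] by simp
              obtain W where W: "W \<in> subs (R u)" "cls (sub_rep (R u) W) = cls (quot V H)" using cnt_pos[OF u(2) w] by blast
              have "dv (quot V H) = dv (sub_rep (R u) W)" using cls_dv[OF rep_sub_rep[OF u(2) W(1)] QH W(2)] by simp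
              then have "dv (quot V H) v = 0" for v using sub_dv_le[OF u(2) W(1), of v] z by simp
              then have "dv V = dv (sub_rep V H)" using dv_quot[OF V Hs] by (intro ext) simp
              then show False using dY less.prems(2) by simp
            qed
            obtain B :: "('v, 'a, 'k, nat) quiver_rep" where B: "rep B" "cls B = cls (sub_rep V H)" "RR B" "dv B \<noteq> (\<lambda>v. 0)"
              using RH RRH dvH by blast
            have "lvl (cnt (\<lambda>s t. s = cls B \<and> t = cls (R u))) = 0" by (rule cusp[OF u(2) B(1) RRu B(3) dvu B(4)])
            then show "lvl (\<lambda>M. card {X \<in> subs M. cls (sub_rep M X) = cls (sub_rep V H) \<and> cls (quot M X) = u}) = 0"
              unfolding cnt_def B(2) u(3) .
          qed
        qed
        finally show ?thesis .
      next
        case True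
        have "clsA (wl \<delta>) (quot V (zero_sub V))" using H True by (simp add: hn_def)
        then have A: "clsA (wl \<delta>) V" using cls_iso(1)[OF quot(1)[OF V zero_sub[OF V]] V quot_zero_iso[OF V]] by simp
        let ?w = "\<lambda>y. surj_count V (R y)"
        \<comment> \<open>Ext(V, M) = 0 for every M in the support, so |Hom(V, M)| is determined by
          the dimension vectors and is constant there.\<close>
        have hom: "card (HomE V (R c')) = card (HomE V (R c))" if c': "c' \<in> S" for c'
        proof -
          have e: "q ^ e0 (dv V) D = card (HomE V (R c)) * q ^ e1 (dv V) D" if c: "c \<in> S" for c
            using HomE_ge(2)[OF V S_rep[OF c] ext0_AB[OF V S_rep[OF c] A]] S_RR[OF c] S_dv[OF c] by (simp add: RR_def)
          have "card (HomE V (R c')) * q ^ e1 (dv V) D = card (HomE V (R c)) * q ^ e1 (dv V) D"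
            by (rule trans[OF e[OF c', symmetric] e[OF c]])
          moreover have "q ^ e1 (dv V) D \<noteq> 0" using q_ge_2 by auto
          ultimately show ?thesis using mult_right_cancel[of "q ^ e1 (dv V) D"] by blast
        qed
        have "lvl (\<lambda>M. \<Sum>Y\<in>{Y \<in> subs M. True}. ?w (cls (sub_rep M Y))) = lvl (\<lambda>M. card (HomE V (R c)))"
          by (rule lvl_cong) (use card_HomE_images[OF V S_rep] hom in simp)
        then have tot: "lvl (\<lambda>M. \<Sum>Y\<in>{Y \<in> subs M. True}. ?w (cls (sub_rep M Y))) = 0" using lvl_const by simp
        have VV: "?w (cls V) \<noteq> 0"
        proof -
          have "nrm V (\<lambda>v x. x) \<in> {\<phi> \<in> HomE V V. onto V V \<phi>}"
            using nrm_HomE[OF V Hom_id] onto_cong[OF V onto_id, of "nrm V (\<lambda>v x. x)"] by simp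
          moreover have "finite {\<phi> \<in> HomE V V. onto V V \<phi>}" using finite_HomE[OF V V] by simp
          ultimately have "surj_count V V \<noteq> 0" unfolding surj_count_def using card_0_eq by blast
          then show ?thesis using surj_count_cls[OF V V] by simp
        qed
        \<comment> \<open>Images of \<open>V\<close> not isomorphic to \<open>V\<close> are proper
          quotients, hence smaller, and not of dimension D because dim V \<le> D; they vanish by
          induction, and only the copies of \<open>V\<close> remain.\<close>
        have "lvl (\<lambda>M. card {X \<in> subs M. True \<and> cls (sub_rep M X) = cls V}) = 0"
        proof (rule lvl_split[where w = ?w and P = "\<lambda>M X. True" and h = "\<lambda>M X. cls (sub_rep M X)", OF _ tot VV])
          fix y assume y: "y \<noteq> cls V" and w: "?w y \<noteq> 0"
          show "lvl (\<lambda>M. card {X \<in> subs M. True \<and> cls (sub_rep M X) = y}) = 0"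
          proof (rule lvl_instance)
            fix c' Y assume c': "c' \<in> S" and Y: "Y \<in> subs (R c')" and "True \<and> cls (sub_rep (R c') Y) = y"
            then have yY: "y = cls (sub_rep (R c') Y)" by simp
            note RY = rep_sub_rep[OF S_rep[OF c'] Y]
            have u: "rep (R y)" "cls (R y) = y" using rep_cls[OF RY] cls_cls[OF RY] yY by auto
            have "{\<phi> \<in> HomE V (R y). onto V (R y) \<phi>} \<noteq> {}" using w unfolding surj_count_def by (metis card.empty)
            then obtain \<phi> where o: "onto V (R y) \<phi>" by blast
            have k: "ker_sub V (R y) \<phi> \<in> subs V" using ker_sub[OF V u(1)] o by (simp add: onto_def)
            have sz: "size V = size (sub_rep V (ker_sub V (R y) \<phi>)) + size (R y)" by (rule size_onto[OF V u(1) o])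
            have "size (sub_rep V (ker_sub V (R y) \<phi>)) \<noteq> 0"
            proof
              assume "size (sub_rep V (ker_sub V (R y) \<phi>)) = 0"
              then have kz: "ker_sub V (R y) \<phi> = zero_sub V" using size_zero_iff sub_zero_iff[OF V k] by blast
              have "mono V (R y) \<phi>" using mono_iff[OF V u(1)] o kz by (simp add: onto_def)
              then have "V \<approx> R y" using o iso_iff by blast
              then show False using y cls_eq_iff[OF V u(1)] u(2) by simp
            qed
            then have lt: "size (R y) < size V" using sz by simp
            have "dv (R y) \<noteq> D"
            proof
              assume "dv (R y) = D"
              then have "size V \<le> size (R y)" unfolding size_def using leD by (intro sum_mono) simp
              then show False using lt by simp
            qed
            then have "lvl (cnt (\<lambda>s t. s = cls (R y))) = 0" by (rule less.hyps[OF lt u(1)])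
            then show "lvl (\<lambda>M. card {X \<in> subs M. True \<and> cls (sub_rep M X) = y}) = 0" unfolding cnt_def u(2) by simp
          qed
        qed
        then show ?thesis unfolding cnt_def by simp
      qed
    qed
    then show "lvl (\<lambda>M. card {X \<in> subs M. cls (sub_rep M X) = cls V}) = 0" unfolding cnt_def .
  qed
qed

text \<open>Coefficient of the Harder-Narasimhan recursion: copies of \<open>V\<close> in
  \<open>y\<close> whose quotient lies in the torsion class of \<open>w\<close>.\<close>

definition B_count :: "('v \<Rightarrow> int) \<Rightarrow> ('v, 'a, 'k, nat) quiver_rep \<Rightarrow> ('v, 'a, 'k) iso_class \<Rightarrow> nat" where
  "B_count w V y = cnt (\<lambda>s t. s = cls V \<and> clsB w (R t)) (R y)"

text \<open>Every copy X of \<open>V\<close> lies in exactly one X' with X'/X torsion and M/X'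
  torsion-free, so the copies can be grouped by X'.\<close>

lemma cnt_sub_clsA:
  assumes M: "rep M"
  shows "cnt (\<lambda>s t. s = cls V) M = (\<Sum>X'\<in>{X' \<in> subs M. clsA w (quot M X')}. B_count w V (cls (sub_rep M X')))"
proof -
  let ?A = "{X \<in> subs M. cls (sub_rep M X) = cls V}" and ?B = "{X' \<in> subs M. clsA w (quot M X')}"
  let ?r = "\<lambda>X X'. X \<le> X' \<and> clsB w (quot (sub_rep M X') X)"
  have fin: "finite (subs M)" by (rule finite_subs[OF M])
  have one: "card {X' \<in> ?B. ?r X X'} = 1" if X: "X \<in> ?A" for X
  proof -
    have Xs: "X \<in> subs M" using X by simp
    obtain Z where Z: "Z \<in> subs M \<and> X \<le> Z \<and> clsB w (quot (sub_rep M Z) X) \<and> clsA w (quot M Z)"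
      "\<And>Z'. Z' \<in> subs M \<and> X \<le> Z' \<and> clsB w (quot (sub_rep M Z') X) \<and> clsA w (quot M Z') \<Longrightarrow> Z' = Z"
      using hn_rel[OF M Xs, of w] by (elim ex1E) blast
    have "{X' \<in> ?B. ?r X X'} = {Z}"
    proof (intro subset_antisym subsetI)
      fix Z' assume "Z' \<in> {X' \<in> ?B. ?r X X'}"
      then have "Z' = Z" by (intro Z(2)) simp
      then show "Z' \<in> {Z}" by simp
    qed (use Z(1) in simp)
    then show ?thesis by simp
  qed
  have low: "card {X \<in> ?A. ?r X X'} = B_count w V (cls (sub_rep M X'))" if X': "X' \<in> ?B" for X'
  proof -
    have s: "X' \<in> subs M" using X' by simp
    note RX = rep_sub_rep[OF M s]
    have "B_count w V (cls (sub_rep M X')) = card {X \<in> subs M. X \<le> X' \<and> cls (sub_rep M X) = cls V \<and> clsB w (R (cls (quot (sub_rep M X') X)))}"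
      unfolding B_count_def cnt_cls[OF RX] cnt_lower[OF M s] ..
    also have "{X \<in> subs M. X \<le> X' \<and> cls (sub_rep M X) = cls V \<and> clsB w (R (cls (quot (sub_rep M X') X)))} = {X \<in> ?A. ?r X X'}"
    proof (intro Collect_cong)
      fix X
      have "clsB w (R (cls (quot (sub_rep M X') X))) \<longleftrightarrow> clsB w (quot (sub_rep M X') X)" if "X \<in> subs M" "X \<le> X'"
        using clsB_cls[OF quot(1)[OF RX]] subs_sub_rep[OF M s] that by simp
      then show "X \<in> subs M \<and> X \<le> X' \<and> cls (sub_rep M X) = cls V \<and> clsB w (R (cls (quot (sub_rep M X') X))) \<longleftrightarrow> X \<in> ?A \<and> ?r X X'" by blast
    qed
    finally show ?thesis ..
  qed
  have "cnt (\<lambda>s t. s = cls V) M = (\<Sum>X\<in>?A. 1)" by (simp add: cnt_def)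
  also have "\<dots> = (\<Sum>X\<in>?A. card {X' \<in> ?B. ?r X X'})" by (intro sum.cong refl one[symmetric])
  also have "\<dots> = (\<Sum>X'\<in>?B. card {X \<in> ?A. ?r X X'})" by (rule sum_card_swap) (use fin in simp_all)
  also have "\<dots> = (\<Sum>X'\<in>?B. B_count w V (cls (sub_rep M X')))" by (rule sum.cong[OF refl low])
  finally show ?thesis .
qed

lemma lvl_B_count:
  fixes V :: "('v, 'a, 'k, nat) quiver_rep"
  assumes "rep V" "dv V \<noteq> D"
  shows "lvl (\<lambda>M. \<Sum>X'\<in>{X' \<in> subs M. clsA w (quot M X')}. B_count w V (cls (sub_rep M X'))) = 0"
proof -
  have "lvl (cnt (\<lambda>s t. s = cls V)) = lvl (\<lambda>M. \<Sum>X'\<in>{X' \<in> subs M. clsA w (quot M X')}. B_count w V (cls (sub_rep M X')))"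
    by (rule lvl_cong) (rule cnt_sub_clsA[OF S_rep])
  then show ?thesis using sub_level_zero[OF assms] by simp
qed

text \<open>In the recursion for \<open>V\<close> the class of \<open>V\<close> has a nonzero
  coefficient, and every other class y that occurs is strictly larger, so the induction runs upwards
  in size. No such y has dimension D: torsion-freeness of M/X gives wt M < wt V, and the torsion
  quotient gives wt V \<le> wt y.\<close>

lemma stable_level_zero:
  fixes V :: "('v, 'a, 'k, nat) quiver_rep"
  assumes "rep V" "dv V \<noteq> D"
  shows "lvl (\<lambda>M. card {X \<in> subs M. clsA w (quot M X) \<and> cls (sub_rep M X) = cls V}) = 0"
  using assms
proof (induction "(\<Sum>v\<in>I. D v) - size V" arbitrary: V rule: less_induct)
  case less
  note V = less.prems(1)
  show ?case
  proof (rule lvl_instance)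
    fix c X assume c: "c \<in> S" and X: "X \<in> subs (R c)" and cX: "clsA w (quot (R c) X) \<and> cls (sub_rep (R c) X) = cls V"
    note M = S_rep[OF c]
    note QX = quot(1)[OF M X]
    have dvX: "dv (sub_rep (R c) X) = dv V" using cls_dv[OF rep_sub_rep[OF M X] V] cX by blast
    have "X \<noteq> full_sub (R c)" using dvX less.prems(2) S_dv[OF c] by auto
    then have "wt w (quot (R c) X) < 0" using clsA_neg[OF QX] cX quot_zero_rep[OF M X] by blast
    then have neg: "wt w (R c) < wt w V" using wt_quot[OF M X, of w] wt_cong[OF dvX, of w] by simp
    have BV: "B_count w V (cls V) \<noteq> 0"
    proof -
      have "cls (sub_rep V (full_sub V)) = cls V" using cls_eq_iff[OF rep_sub_rep[OF V full_sub[OF V]] V] sub_full_iso[OF V] by simp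
      moreover have "clsB w (R (cls (quot V (full_sub V))))"
        using clsB_cls[OF quot(1)[OF V full_sub[OF V]]] clsB_zero[OF quot(1)[OF V full_sub[OF V]]] quot_zero_rep[OF V full_sub[OF V]] by simp
      ultimately have "cnt (\<lambda>s t. s = cls V \<and> clsB w (R t)) V \<noteq> 0" by (intro cnt_nonzero[OF V full_sub[OF V]]) simp
      then show ?thesis by (simp add: B_count_def cnt_cls[OF V])
    qed
    show "lvl (\<lambda>M. card {X \<in> subs M. clsA w (quot M X) \<and> cls (sub_rep M X) = cls V}) = 0"
    proof (rule lvl_split[where w = "B_count w V" and P = "\<lambda>M X. clsA w (quot M X)" and h = "\<lambda>M X. cls (sub_rep M X)",
        OF _ lvl_B_count[OF less.prems] BV])
      fix y assume y: "y \<noteq> cls V" and w: "B_count w V y \<noteq> 0"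
      show "lvl (\<lambda>M. card {X \<in> subs M. clsA w (quot M X) \<and> cls (sub_rep M X) = y}) = 0"
      proof (rule lvl_instance)
        fix c' Y assume c': "c' \<in> S" and Y: "Y \<in> subs (R c')" and "clsA w (quot (R c') Y) \<and> cls (sub_rep (R c') Y) = y"
        then have yY: "y = cls (sub_rep (R c') Y)" by simp
        note M' = S_rep[OF c']
        note RY = rep_sub_rep[OF M' Y]
        have u: "rep (R y)" "cls (R y) = y" "dv (R y) = dv (sub_rep (R c') Y)" using rep_cls[OF RY] cls_cls[OF RY] dv_cls[OF RY] yY by auto
        obtain W where W: "W \<in> subs (R y)" "cls (sub_rep (R y) W) = cls V" "clsB w (R (cls (quot (R y) W)))"
          using cnt_pos[OF u(1) w[unfolded B_count_def]] by blast
        have dvW: "dv (sub_rep (R y) W) = dv V" by (rule cls_dv[OF rep_sub_rep[OF u(1) W(1)] V W(2)])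
        have nn: "wt w (quot (R y) W) \<ge> 0"
          by (rule clsB_nonneg[OF quot(1)[OF u(1) W(1)]]) (use W(3) clsB_cls[OF quot(1)[OF u(1) W(1)]] in blast)
        then have ge: "wt w V \<le> wt w (R y)" using wt_quot[OF u(1) W(1), of w] wt_cong[OF dvW, of w] by simp
        have dvy: "dv (R y) \<noteq> D"
        proof
          assume "dv (R y) = D"
          then have "wt w (R y) = wt w (R c)" using S_dv[OF c] by (intro wt_cong) simp
          then show False using neg ge by simp
        qed
        have "W \<noteq> full_sub (R y)"
        proof
          assume e: "W = full_sub (R y)"
          have "cls (sub_rep (R y) (full_sub (R y))) = cls (R y)"
            using cls_eq_iff[OF rep_sub_rep[OF u(1) full_sub[OF u(1)]] u(1)] sub_full_iso[OF u(1)] by simp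
          then show False using W(2) e u(2) y by simp
        qed
        then have "size (quot (R y) W) \<noteq> 0" using quot_zero_rep[OF u(1) W(1)] size_zero_iff by blast
        then have s1: "size V < size (R y)" using size_quot[OF u(1) W(1)] size_cong[OF dvW] by simp
        have "size (R y) \<le> (\<Sum>v\<in>I. D v)"
          unfolding size_def u(3) using sub_dv_le[OF M' Y] S_dv[OF c'] by (intro sum_mono) metis
        then have lt: "(\<Sum>v\<in>I. D v) - size (R y) < (\<Sum>v\<in>I. D v) - size V" using s1 by simp
        show "lvl (\<lambda>M. card {X \<in> subs M. clsA w (quot M X) \<and> cls (sub_rep M X) = y}) = 0"
          using less.hyps[OF lt u(1) dvy] unfolding u(2) .
      qed
    qed
  qed
qed

text \<open>In the recursion for \<open>V\<close> every X' other than M contributes 0 by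
  \<open>stable_level_zero\<close>. For X' = M the quotient by a copy of \<open>V\<close> is torsion
  of dimension dim U, and by \<open>clsB_brick\<close> it can only be \<open>U\<close>.\<close>

lemma rigid_level_zero:
  fixes U V :: "('v, 'a, 'k, nat) quiver_rep"
  assumes U: "rep U" and V: "rep V" and nz: "dv U \<noteq> (\<lambda>v. 0)"
    and brick: "\<And>\<phi>. \<phi> \<in> Hom U U \<Longrightarrow> ker_sub U U \<phi> = full_sub U \<or> ker_sub U U \<phi> = zero_sub U" and rigid: "ext0 U U"
    and dim: "\<And>v. D v = dv V v + dv U v"
  shows "lvl (cnt (\<lambda>s t. s = cls V \<and> t = cls U)) = 0"
proof -
  define w where "w = (\<lambda>v. wl (dv U) v - wr (dv U) v)"
  have st: "clsB w U" by (rule brick_clsB[OF U _ rigid nz w_def]) (rule brick)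
  \<comment> \<open>Quotients of representations on natural numbers live on sets of natural numbers,
    whence the carrier type.\<close>
  have st': "U \<approx> N" if "rep N" "dv N = dv U" "clsB w N" for N :: "('v, 'a, 'k, nat set) quiver_rep"
    by (rule clsB_brick[OF U _ rigid nz w_def that]) (rule brick)
  have dvV: "dv V \<noteq> D"
  proof
    assume "dv V = D"
    then have "dv U = (\<lambda>v. 0)" using dim by (intro ext) (metis add_cancel_right_right)
    then show False using nz by simp
  qed
  \<comment> \<open>Members of the support have dimension D, so dropping the weight at this
    dimension isolates the term X' = M.\<close>
  let ?w = "\<lambda>y. if dv (R y) = D then 0 else B_count w V y"
  have z: "lvl (\<lambda>M. \<Sum>X\<in>{X \<in> subs M. clsA w (quot M X)}. ?w (cls (sub_rep M X))) = 0"
  proof (rule lvl_zero[where w = ?w and P = "\<lambda>M X. clsA w (quot M X)" and h = "\<lambda>M X. cls (sub_rep M X)"])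
    fix y assume y: "?w y \<noteq> 0"
    show "lvl (\<lambda>M. card {X \<in> subs M. clsA w (quot M X) \<and> cls (sub_rep M X) = y}) = 0"
    proof (rule lvl_instance)
      fix c Y assume c: "c \<in> S" and Y: "Y \<in> subs (R c)" and "clsA w (quot (R c) Y) \<and> cls (sub_rep (R c) Y) = y"
      then have yY: "y = cls (sub_rep (R c) Y)" by simp
      note RY = rep_sub_rep[OF S_rep[OF c] Y]
      have u: "rep (R y)" "cls (R y) = y" using rep_cls[OF RY] cls_cls[OF RY] yY by auto
      have "dv (R y) \<noteq> D" using y by (auto split: if_splits)
      then show "lvl (\<lambda>M. card {X \<in> subs M. clsA w (quot M X) \<and> cls (sub_rep M X) = y}) = 0"
        using stable_level_zero[OF u(1), of w] unfolding u(2) by blast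
    qed
  qed
  have "lvl (\<lambda>M. \<Sum>X\<in>{X \<in> subs M. clsA w (quot M X)}. B_count w V (cls (sub_rep M X))) =
      lvl (\<lambda>M. (\<Sum>X\<in>{X \<in> subs M. clsA w (quot M X)}. ?w (cls (sub_rep M X))) + cnt (\<lambda>s t. s = cls V \<and> t = cls U) M)"
  proof (rule lvl_cong)
    fix c assume c: "c \<in> S"
    note M = S_rep[OF c]
    note F = full_sub[OF M]
    let ?T = "{X \<in> subs (R c). clsA w (quot (R c) X)}"
    have fin: "finite ?T" using finite_subs[OF M] by simp
    have FT: "full_sub (R c) \<in> ?T"
      using clsA_zero_rep[OF quot(1)[OF M F]] quot_zero_rep[OF M F] F by simp
    have full: "dv (R (cls (sub_rep (R c) X))) = D \<longleftrightarrow> X = full_sub (R c)" if "X \<in> ?T" for X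
      using that dv_cls[OF rep_sub_rep[OF M]] sub_full_iff[OF M] S_dv[OF c] by simp
    have "(\<Sum>X\<in>?T. B_count w V (cls (sub_rep (R c) X))) =
       (\<Sum>X\<in>?T. ?w (cls (sub_rep (R c) X)) + (if X = full_sub (R c) then B_count w V (cls (sub_rep (R c) X)) else 0))"
      by (intro sum.cong refl) (simp add: full)
    also have "\<dots> = (\<Sum>X\<in>?T. ?w (cls (sub_rep (R c) X))) + B_count w V (cls (sub_rep (R c) (full_sub (R c))))"
      unfolding sum.distrib using FT fin by simp
    also have "cls (sub_rep (R c) (full_sub (R c))) = cls (R c)"
      using cls_eq_iff[OF rep_sub_rep[OF M F] M] sub_full_iso[OF M] by simp
    also have "B_count w V (cls (R c)) = cnt (\<lambda>s t. s = cls V \<and> t = cls U) (R c)"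
      unfolding B_count_def cnt_cls[OF M] unfolding cnt_def
    proof (rule arg_cong[of _ _ card], rule Collect_cong)
      fix X
      have "clsB w (R (cls (quot (R c) X))) \<longleftrightarrow> cls (quot (R c) X) = cls U" if X: "X \<in> subs (R c)" "cls (sub_rep (R c) X) = cls V"
      proof -
        note QX = quot(1)[OF M X(1)]
        have "dv (sub_rep (R c) X) = dv V" by (rule cls_dv[OF rep_sub_rep[OF M X(1)] V X(2)])
        then have d: "dv (quot (R c) X) = dv U" using dv_quot[OF M X(1)] dim S_dv[OF c] by (intro ext) simp
        have "clsB w (quot (R c) X) \<longleftrightarrow> U \<approx> quot (R c) X"
          using st'[OF QX d] cls_iso(2)[OF U QX, of w] st by blast
        then show ?thesis using clsB_cls[OF QX, of w] cls_eq_iff[OF U QX] by auto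
      qed
      then show "X \<in> subs (R c) \<and> cls (sub_rep (R c) X) = cls V \<and> clsB w (R (cls (quot (R c) X))) \<longleftrightarrow>
          X \<in> subs (R c) \<and> cls (sub_rep (R c) X) = cls V \<and> cls (quot (R c) X) = cls U" by blast
    qed
    finally show "(\<Sum>X\<in>?T. B_count w V (cls (sub_rep (R c) X))) = (\<Sum>X\<in>?T. ?w (cls (sub_rep (R c) X))) + cnt (\<lambda>s t. s = cls V \<and> t = cls U) (R c)" .
  qed
  then show ?thesis using lvl_B_count[OF V dvV, of w] z unfolding lvl_add by simp
qed

lemma level_zero:
  fixes U V :: "('v, 'a, 'k, nat) quiver_rep"
  assumes "rep U" "rep V" "dv U \<noteq> (\<lambda>v. 0)" "dv V \<noteq> (\<lambda>v. 0)"
  shows "lvl (cnt (\<lambda>s t. s = cls V \<and> t = cls U)) = 0"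
  using assms
proof (induction U arbitrary: V rule: wf_induct_rule[OF wf_measures[of "[size, \<lambda>U. card (HomE U U)]"]])
  case (1 U)
  note U = 1(2) and V = 1(3) and nzU = 1(4) and nzV = 1(5)
  have IH: "lvl (cnt (\<lambda>s t. s = cls V' \<and> t = cls U')) = 0"
    if "size U' < size U \<or> (size U' = size U \<and> card (HomE U' U') < card (HomE U U))"
      "rep U'" "rep V'" "dv U' \<noteq> (\<lambda>v. 0)" "dv V' \<noteq> (\<lambda>v. 0)" for U' V' :: "('v, 'a, 'k, nat) quiver_rep"
    by (rule 1(1)[OF _ that(2-5)]) (use that(1) in auto)
  have "lvl (\<lambda>M. card {X \<in> subs M. cls (sub_rep M X) = cls V \<and> cls (quot M X) = cls U}) = 0"
  proof (rule lvl_instance)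
    fix c X assume c: "c \<in> S" and X: "X \<in> subs (R c)" and cX: "cls (sub_rep (R c) X) = cls V \<and> cls (quot (R c) X) = cls U"
    note M = S_rep[OF c]
    note RX = rep_sub_rep[OF M X] and QX = quot(1)[OF M X]
    have dvX: "dv (sub_rep (R c) X) = dv V" "dv (quot (R c) X) = dv U" using cls_dv[OF RX V] cls_dv[OF QX U] cX by blast+
    have "clsB (wl \<delta>) (R c)" using S_RR[OF c] by (simp add: RR_def)
    then have "clsB (wl \<delta>) (quot (R c) X)" by (rule clsB_quot_of[OF M X])
    \<comment> \<open>\<open>U\<close> is a quotient of a regular representation, so its quotients
      have nonnegative defect. If indecomposable, it has defect 0, where the cuspidal condition
      applies, or positive defect, where it is a rigid brick.\<close>
    then have BU: "clsB (wl \<delta>) U" using cls_iso(2)[OF QX U cls_isoI[OF QX U]] cX by blast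
    have "lvl (cnt (\<lambda>s t. s = cls V \<and> t = cls U)) = 0"
    proof (cases "indecomposable Q K U")
      case True
      show ?thesis
      proof (cases "th U = 0")
        case True
        have thX: "th (sub_rep (R c) X) = 0"
          using wt_quot[OF M X, of "wl \<delta>"] wt_cong[OF dvX(2), of "wl \<delta>"] True S_RR[OF c] by (simp add: RR_def)
        have "RR V" using RR_iso[OF RX V cls_isoI[OF RX V]] cX RR_sub[OF M S_RR[OF c] X thX] by blast
        moreover have "RR U" using True BU by (simp add: RR_def)
        ultimately show ?thesis by (intro cusp U V nzU nzV)
      next
        case False
        have I: "clsI U" by (rule clsI_of_indecomposable[OF U True BU False])
        note br = indecomposable_brick[OF U True I]
        have rigid: "ext0 U U" by (rule brick_rigid[OF U _ q_pos[OF False]]) (rule br)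
        show ?thesis
        proof (rule rigid_level_zero[OF U V nzU _ rigid])
          show "D v = dv V v + dv U v" for v using dv_quot[OF M X, of v] dvX S_dv[OF c] by simp
        qed (rule br)
      qed
    next
      case False
      obtain Y Z where Y: "comp U Y Z" "dv (sub_rep U Y) \<noteq> (\<lambda>v. 0)" "dv (sub_rep U Z) \<noteq> (\<lambda>v. 0)"
        using decomposable[OF U False nzU] by auto
      define y where "y = cls (sub_rep U Y)"
      define z where "z = cls (sub_rep U Z)"
      have Ys: "Y \<in> subs U" and Zs: "Z \<in> subs U" using compD(1,2)[OF Y(1)] by auto
      note RY = rep_sub_rep[OF U Ys] and RZ = rep_sub_rep[OF U Zs]
      have sz: "size U = size (sub_rep U Y) + size (sub_rep U Z)" by (rule size_comp[OF U Y(1)])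
      have "size (sub_rep U Z) \<noteq> 0" using Y(3) size_zero_iff by blast
      then have szY: "size (sub_rep U Y) < size U" using sz by simp
      \<comment> \<open>Flags X \<le> X' in M with X a copy of \<open>V\<close>, X'/X of class
        \<open>z\<close> and M/X' of class \<open>y\<close>. Sorted by X', the sum vanishes by
        induction because \<open>Y\<close> is smaller than \<open>U\<close>; sorted by X, it is a
        combination of the coefficients wanted.\<close>
      let ?v = "\<lambda>x. cnt (\<lambda>s t. s = cls V \<and> t = z) (R x)" and ?w = "\<lambda>u. cnt (\<lambda>s t. s = z \<and> t = y) (R u)"
      have low: "lvl (\<lambda>M. \<Sum>X'\<in>{X' \<in> subs M. cls (quot M X') = y}. ?v (cls (sub_rep M X'))) = 0"
      proof (rule lvl_zero[where w = ?v and P = "\<lambda>M X'. cls (quot M X') = y" and h = "\<lambda>M X'. cls (sub_rep M X')"])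
        fix x assume x: "?v x \<noteq> 0"
        show "lvl (\<lambda>M. card {X \<in> subs M. cls (quot M X) = y \<and> cls (sub_rep M X) = x}) = 0"
        proof (rule lvl_instance)
          fix c' X' assume c': "c' \<in> S" and X': "X' \<in> subs (R c')" and "cls (quot (R c') X') = y \<and> cls (sub_rep (R c') X') = x"
          then have xX: "x = cls (sub_rep (R c') X')" by simp
          note RX' = rep_sub_rep[OF S_rep[OF c'] X']
          have u: "rep (R x)" "cls (R x) = x" using rep_cls[OF RX'] cls_cls[OF RX'] xX by auto
          obtain W where W: "W \<in> subs (R x)" "cls (sub_rep (R x) W) = cls V" using cnt_pos[OF u(1) x] by blast
          have dvW: "dv (sub_rep (R x) W) = dv V" by (rule cls_dv[OF rep_sub_rep[OF u(1) W(1)] V W(2)])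
          have "dv (R x) \<noteq> (\<lambda>v. 0)"
          proof
            assume "dv (R x) = (\<lambda>v. 0)"
            then have "dv V = (\<lambda>v. 0)" using sub_dv_le[OF u(1) W(1)] dvW by (intro ext) (metis le_zero_eq)
            then show False using nzV by simp
          qed
          then have "lvl (cnt (\<lambda>s t. s = cls (R x) \<and> t = cls (sub_rep U Y))) = 0"
            by (intro IH disjI1 szY RY u(1) Y(2))
          then show "lvl (\<lambda>M. card {X \<in> subs M. cls (quot M X) = y \<and> cls (sub_rep M X) = x}) = 0"
            unfolding cnt_def u(2) y_def[symmetric] by (simp add: conj_commute)
        qed
      qed
      have "lvl (\<lambda>M. \<Sum>X'\<in>{X' \<in> subs M. cls (quot M X') = y}. ?v (cls (sub_rep M X'))) =
          lvl (\<lambda>M. \<Sum>X\<in>{X \<in> subs M. cls (sub_rep M X) = cls V}. ?w (cls (quot M X)))"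
      proof (rule lvl_cong)
        fix c assume c: "c \<in> S"
        note M = S_rep[OF c]
        let ?A = "{X \<in> subs (R c). cls (sub_rep (R c) X) = cls V}" and ?B = "{X' \<in> subs (R c). cls (quot (R c) X') = y}"
        let ?r = "\<lambda>X X'. X \<le> X' \<and> cls (quot (sub_rep (R c) X') X) = z"
        have l: "?v (cls (sub_rep (R c) X')) = card {X \<in> ?A. ?r X X'}" if X': "X' \<in> ?B" for X'
        proof -
          have s: "X' \<in> subs (R c)" using X' by simp
          show ?thesis unfolding cnt_cls[OF rep_sub_rep[OF M s]] cnt_lower[OF M s]
            by (rule arg_cong[of _ _ card]) blast
        qed
        have u: "?w (cls (quot (R c) X)) = card {X' \<in> ?B. ?r X X'}" if X: "X \<in> ?A" for X
        proof -
          have s: "X \<in> subs (R c)" using X by simp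
          show ?thesis unfolding cnt_cls[OF quot(1)[OF M s]] cnt_upper[OF M s]
            by (rule arg_cong[of _ _ card]) blast
        qed
        have "(\<Sum>X'\<in>?B. ?v (cls (sub_rep (R c) X'))) = (\<Sum>X'\<in>?B. card {X \<in> ?A. ?r X X'})" by (rule sum.cong[OF refl l])
        also have "\<dots> = (\<Sum>X\<in>?A. card {X' \<in> ?B. ?r X X'})" by (rule sum_card_swap) (use finite_subs[OF M] in simp_all)
        also have "\<dots> = (\<Sum>X\<in>?A. ?w (cls (quot (R c) X)))" by (rule sum.cong[OF refl u[symmetric]])
        finally show "(\<Sum>X'\<in>?B. ?v (cls (sub_rep (R c) X'))) = (\<Sum>X\<in>?A. ?w (cls (quot (R c) X)))" .
      qed
      then have tot: "lvl (\<lambda>M. \<Sum>X\<in>{X \<in> subs M. cls (sub_rep M X) = cls V}. ?w (cls (quot M X))) = 0" using low by simp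
      have "cls (quot U Z) = y"
        using cls_eq_iff[OF RY quot(1)[OF U Zs]] comp_quot_iso[OF U comp_sym[OF U Y(1)]] by (simp add: y_def)
      then have "cnt (\<lambda>s t. s = z \<and> t = y) U \<noteq> 0" by (intro cnt_nonzero[OF U Zs]) (simp add: z_def)
      then have wU: "?w (cls U) \<noteq> 0" using cnt_cls[OF U] by simp
      \<comment> \<open>The classes other than that of \<open>U\<close> are extensions of the same
        two pieces; they have the size of \<open>U\<close> but fewer endomorphisms, so the second
        component of the induction removes them.\<close>
      have "lvl (\<lambda>M. card {X \<in> subs M. cls (sub_rep M X) = cls V \<and> cls (quot M X) = cls U}) = 0"
      proof (rule lvl_split[where w = ?w and P = "\<lambda>M X. cls (sub_rep M X) = cls V" and h = "\<lambda>M X. cls (quot M X)", OF _ tot wU])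
        fix u assume uU: "u \<noteq> cls U" and w: "?w u \<noteq> 0"
        show "lvl (\<lambda>M. card {X \<in> subs M. cls (sub_rep M X) = cls V \<and> cls (quot M X) = u}) = 0"
        proof (rule lvl_instance)
          fix c' X' assume c': "c' \<in> S" and X': "X' \<in> subs (R c')" and "cls (sub_rep (R c') X') = cls V \<and> cls (quot (R c') X') = u"
          then have uX: "u = cls (quot (R c') X')" by simp
          note QX' = quot(1)[OF S_rep[OF c'] X']
          have u: "rep (R u)" "cls (R u) = u" using rep_cls[OF QX'] cls_cls[OF QX'] uX by auto
          obtain W where W: "W \<in> subs (R u)" "cls (sub_rep (R u) W) = z" "cls (quot (R u) W) = y" using cnt_pos[OF u(1) w] by blast
          note RW = rep_sub_rep[OF u(1) W(1)] and QW = quot(1)[OF u(1) W(1)]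
          have iZ: "sub_rep (R u) W \<approx> sub_rep U Z" and iY: "quot (R u) W \<approx> sub_rep U Y"
            using cls_isoI[OF RW RZ] cls_isoI[OF QW RY] W(2,3) by (simp_all add: y_def z_def)
          have "\<not> R u \<approx> U" using cls_eq_iff[OF u(1) U] uU u(2) by simp
          then have e: "card (HomE (R u) (R u)) < card (HomE U U)" by (rule End_less[OF U u(1) Y(1) W(1) iZ iY])
          have s: "size (R u) = size U"
            using size_quot[OF u(1) W(1)] size_cong[OF dv_iso[OF RW RZ iZ]] size_cong[OF dv_iso[OF QW RY iY]] sz by simp
          have "size U \<noteq> 0" using nzU size_zero_iff by blast
          then have "dv (R u) \<noteq> (\<lambda>v. 0)" using s size_zero_iff by metis
          then have "lvl (cnt (\<lambda>s t. s = cls V \<and> t = cls (R u))) = 0" by (intro IH disjI2 conjI s e u(1) V nzV)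
          then show "lvl (\<lambda>M. card {X \<in> subs M. cls (sub_rep M X) = cls V \<and> cls (quot M X) = u}) = 0"
            unfolding cnt_def u(2) .
        qed
      qed
      then show ?thesis unfolding cnt_def .
    qed
    then show "lvl (\<lambda>M. card {X \<in> subs M. cls (sub_rep M X) = cls V \<and> cls (quot M X) = cls U}) = 0" unfolding cnt_def .
  qed
  then show ?case unfolding cnt_def .
qed

end

section \<open>Automorphism numbers\<close>

context affine
begin

lemma aut_number_pos: "c \<in> iso_classes Q K \<Longrightarrow> aut_number Q K c > 0"
  and aut_number_zero: "rep N \<Longrightarrow> aut_number Q K (zero_class Q K) = 1"
proof -
  have fin: "finite (automorphisms Q K M)" and ne: "automorphisms Q K M \<noteq> {}"
    if M: "rep M" for M :: "('v, 'a, 'k, nat) quiver_rep"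
  proof -
    have "finite (\<Pi>\<^sub>E v\<in>I. car M v \<rightarrow>\<^sub>E car M v)" by (intro finite_PiE finite_car[OF M] finite_I) auto
    then show "finite (automorphisms Q K M)" unfolding automorphisms_def by (rule finite_Int[OF disjI2])
    have h: "nrm M (\<lambda>v x. x) \<in> Hom M M" using nrm_HomE[OF M Hom_id] by (rule HomE_hom)
    have b: "bij_betw (nrm M (\<lambda>v x. x) v) (car M v) (car M v)" if v: "v \<in> I" for v
      using v by (intro bij_betw_byWitness[where f' = "\<lambda>x. x"]) auto
    have "nrm M (\<lambda>v x. x) \<in> (\<Pi>\<^sub>E v\<in>I. car M v \<rightarrow>\<^sub>E car M v)" by (auto simp: nrm_def)
    then show "automorphisms Q K M \<noteq> {}" unfolding automorphisms_def rep_iso_def using h b by blast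
  qed
  show "aut_number Q K c > 0" if "c \<in> iso_classes Q K"
    unfolding aut_number_def using fin ne representative(1)[OF that] by (simp add: card_gt_0_iff)
  assume N: "rep N"
  let ?Z = "sub_rep N (zero_sub N)"
  have Z: "rep ?Z" "dv ?Z = (\<lambda>v. 0)" using rep_sub_rep[OF N zero_sub[OF N]] dv_zero[OF N] by auto
  let ?M = "R (zero_class Q K)"
  have zc: "cls ?Z = zero_class Q K" by (rule cls_eq_zero_class[OF Z])
  have M: "rep ?M" "dv ?M = (\<lambda>v. 0)" using rep_cls(1)[OF Z(1)] dv_cls[OF Z(1)] Z(2) zc by simp_all
  have "card (car ?M v) = 1" if "v \<in> I" for v using card_car[OF M(1) that] M(2) by simp
  then have P1: "card (\<Pi>\<^sub>E v\<in>I. car ?M v \<rightarrow>\<^sub>E car ?M v) = 1" by (simp add: card_PiE card_funcsetE finite_car[OF M(1)])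
  have finP: "finite (\<Pi>\<^sub>E v\<in>I. car ?M v \<rightarrow>\<^sub>E car ?M v)" by (intro finite_PiE finite_car[OF M(1)] finite_I) auto
  have "card (automorphisms Q K ?M) \<le> card (\<Pi>\<^sub>E v\<in>I. car ?M v \<rightarrow>\<^sub>E car ?M v)"
    unfolding automorphisms_def by (rule card_mono[OF finP Int_lower2])
  then have "card (automorphisms Q K ?M) \<le> 1" unfolding P1 .
  moreover have "card (automorphisms Q K ?M) > 0" using fin[OF M(1)] ne[OF M(1)] by (simp add: card_gt_0_iff)
  ultimately show "aut_number Q K (zero_class Q K) = 1" unfolding aut_number_def by simp
qed

end

section \<open>Cuspidal functions\<close>

context affine
begin

abbreviation zc :: "('v, 'a, 'k) iso_class" where "zc \<equiv> zero_class Q K"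

text \<open>The coefficient of [u] \<otimes> [v] in \<Delta>(f), stripped of the power of \<nu> and
  of the automorphism numbers of u and v. The first index is the quotient, the second the
  subrepresentation.\<close>

definition gam :: "('v, 'a, 'k) class_fun \<Rightarrow> ('v, 'a, 'k) iso_class \<Rightarrow> ('v, 'a, 'k) iso_class \<Rightarrow> complex" where
  "gam f u v = (\<Sum>c | f c \<noteq> 0. f c / of_nat (aut_number Q K c) * of_nat (cnt (\<lambda>s t. s = v \<and> t = u) (R c)))"

text \<open>A zero representation is found inside \<open>N\<close>, so that its class is known to be
  nonempty.\<close>

lemma zero_class_props:
  fixes N :: "('v, 'a, 'k, nat) quiver_rep"
  assumes N: "rep N"
  shows "zc \<in> iso_classes Q K" "class_dim Q K zc = (\<lambda>v. 0)" "zc \<in> regular_classes Q K \<delta>"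
proof -
  let ?Z = "sub_rep N (zero_sub N)"
  have Z: "rep ?Z" "dv ?Z = (\<lambda>v. 0)" using rep_sub_rep[OF N zero_sub[OF N]] dv_zero[OF N] by auto
  have zc: "zc = cls ?Z" by (rule cls_eq_zero_class[OF Z, symmetric])
  show 1: "zc \<in> iso_classes Q K" unfolding zc by (rule cls_class[OF Z(1)])
  show "class_dim Q K zc = (\<lambda>v. 0)" unfolding zc class_dim_cls[OF Z(1)] by (rule Z(2))
  have r: "rep (R zc)" "dv (R zc) = (\<lambda>v. 0)" using rep_cls(1)[OF Z(1)] dv_cls[OF Z(1)] Z(2) unfolding zc by simp_all
  have "RR (R zc)" unfolding RR_def using wt_zero[OF r(2)] clsB_zero[OF r] by blast
  then show "zc \<in> regular_classes Q K \<delta>" using 1 regular_iff[OF r(1)] by (simp add: regular_classes_def)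
qed

lemma zc_iff: "c \<in> iso_classes Q K \<Longrightarrow> c = zc \<longleftrightarrow> dv (R c) = (\<lambda>v. 0)"
  using cls_zero_class_iff[OF representative(1)] representative(2) by metis

lemma cnt_zero_sub:
  assumes c: "c \<in> iso_classes Q K" shows "cnt (\<lambda>s t. s = zc \<and> t = u) (R c) = (if c = u then 1 else 0)"
proof -
  note M = representative(1)[OF c]
  have "cls (sub_rep (R c) X) = zc \<longleftrightarrow> X = zero_sub (R c)" if "X \<in> subs (R c)" for X
    using cls_zero_class_iff[OF rep_sub_rep[OF M that]] sub_zero_iff[OF M that] by simp
  moreover have "cls (quot (R c) (zero_sub (R c))) = c"
    using cls_eq_iff[OF quot(1)[OF M zero_sub[OF M]] M] quot_zero_iso[OF M] representative(2)[OF c] by simp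
  ultimately have "{X \<in> subs (R c). cls (sub_rep (R c) X) = zc \<and> cls (quot (R c) X) = u} = (if c = u then {zero_sub (R c)} else {})"
    using zero_sub[OF M] by auto
  then show ?thesis by (simp add: cnt_def)
qed

lemma cnt_zero_quot:
  assumes c: "c \<in> iso_classes Q K" shows "cnt (\<lambda>s t. s = v \<and> t = zc) (R c) = (if c = v then 1 else 0)"
proof -
  note M = representative(1)[OF c]
  have "cls (quot (R c) X) = zc \<longleftrightarrow> X = full_sub (R c)" if "X \<in> subs (R c)" for X
    using cls_zero_class_iff[OF quot(1)[OF M that]] quot_zero_rep[OF M that] by simp
  moreover have "cls (sub_rep (R c) (full_sub (R c))) = c"
    using cls_eq_iff[OF rep_sub_rep[OF M full_sub[OF M]] M] sub_full_iso[OF M] representative(2)[OF c] by simp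
  ultimately have "{X \<in> subs (R c). cls (sub_rep (R c) X) = v \<and> cls (quot (R c) X) = zc} = (if c = v then {full_sub (R c)} else {})"
    using full_sub[OF M] by auto
  then show ?thesis by (simp add: cnt_def)
qed

lemma comult_gam:
  assumes f: "f \<in> hall_algebra Q K" and u: "u \<in> iso_classes Q K" and v: "v \<in> iso_classes Q K"
  shows "comult Q K f (u, v) = complex_of_real (sqrt (real (card (carrier K)))) powi euler_dim Q (class_dim Q K u) (class_dim Q K v) *
    (of_nat (aut_number Q K u) * of_nat (aut_number Q K v)) * gam f u v"
proof -
  have h: "hall_number Q K r u v = cnt (\<lambda>s t. s = v \<and> t = u) (R r)" if "f r \<noteq> 0" for r
    using hall_number_alt[of r u v] f u v that by (auto simp: hall_algebra_def cnt_def)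
  show ?thesis
    unfolding comult_def comult_coeff_def gam_def sum_distrib_left prod.case using u v
    by (auto intro!: sum.cong simp: h field_simps)
qed

lemma gam_zero_class:
  assumes f: "f \<in> hall_algebra Q K" and u: "u \<in> iso_classes Q K"
  shows "gam f u zc = f u / of_nat (aut_number Q K u)" "gam f zc u = f u / of_nat (aut_number Q K u)"
proof -
  have fin: "finite {c. f c \<noteq> 0}" and iso: "\<And>c. f c \<noteq> 0 \<Longrightarrow> c \<in> iso_classes Q K" using f by (auto simp: hall_algebra_def)
  have e: "(\<Sum>c | f c \<noteq> 0. f c / of_nat (aut_number Q K c) * (if c = u then 1 else 0)) = f u / of_nat (aut_number Q K u)"
    using fin by (cases "f u = 0") (simp_all add: if_distrib sum.delta cong: if_cong)
  show "gam f u zc = f u / of_nat (aut_number Q K u)"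
    unfolding gam_def e[symmetric] by (intro sum.cong refl) (simp add: cnt_zero_sub iso)
  show "gam f zc u = f u / of_nat (aut_number Q K u)"
    unfolding gam_def e[symmetric] by (intro sum.cong refl) (simp add: cnt_zero_quot iso)
qed

text \<open>If u or v is the zero class, only X = M or X = 0 contributes and both sides agree.
  Nonzero \<open>d\<close> makes f vanish at the zero class, so the two tensors do not overlap
  there.\<close>

lemma comult_primitive_iff:
  assumes f: "f \<in> hall_degree Q K d" and d: "d \<noteq> (\<lambda>v. 0)" and u: "u \<in> iso_classes Q K" and v: "v \<in> iso_classes Q K"
  shows "comult Q K f (u, v) = tensor f (hall_unit Q K) (u, v) + tensor (hall_unit Q K) f (u, v) \<longleftrightarrow>
    (u \<noteq> zc \<longrightarrow> v \<noteq> zc \<longrightarrow> gam f u v = 0)"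
proof -
  have fa: "f \<in> hall_algebra Q K" and deg: "\<And>c. f c \<noteq> 0 \<Longrightarrow> class_dim Q K c = d" using f by (auto simp: hall_degree_def)
  note Z = zero_class_props[OF representative(1)[OF u]] and az = aut_number_zero[OF representative(1)[OF u]]
  have fz: "f zc = 0" using deg[of zc] Z(2) d by auto
  have a: "of_nat (aut_number Q K c) \<noteq> (0 :: complex)" if "c \<in> iso_classes Q K" for c using aut_number_pos[OF that] by simp
  have e: "euler_form Q x (\<lambda>v. 0) = 0" "euler_form Q (\<lambda>v. 0) x = 0" for x by (simp_all add: euler_form_def)
  have un: "hall_unit Q K c = (if c = zc then 1 else 0)" for c by (simp add: hall_unit_def)
  consider "v = zc" | "u = zc" | "u \<noteq> zc" "v \<noteq> zc" by blast
  then show ?thesis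
  proof cases
    case 1
    have "comult Q K f (u, v) = f u" unfolding comult_gam[OF fa u v] using a[OF u] by (simp add: 1 Z(2) e az gam_zero_class(1)[OF fa u])
    then show ?thesis using 1 by (simp add: tensor_def un fz)
  next
    case 2
    have "comult Q K f (u, v) = f v" unfolding comult_gam[OF fa u v] using a[OF v] by (simp add: 2 Z(2) e az gam_zero_class(2)[OF fa v])
    then show ?thesis using 2 by (simp add: tensor_def un fz)
  next
    case 3
    then show ?thesis unfolding comult_gam[OF fa u v] using q_ge_2 a[OF u] a[OF v] by (auto simp: tensor_def un q_def)
  qed
qed

text \<open>Disposes of the pairs outside the index set; \<open>A\<close> will be all classes for
  \<Delta> and the regular classes for the regular coproduct.\<close>

lemma tensor_unit_zero:
  assumes "f \<in> hall_algebra Q K" and "\<And>c. f c \<noteq> 0 \<Longrightarrow> c \<in> A \<and> zc \<in> A" and "\<not> (u \<in> A \<and> v \<in> A)"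
  shows "tensor f (hall_unit Q K) (u, v) + tensor (hall_unit Q K) f (u, v) = 0"
  using assms(2)[of u] assms(2)[of v] assms(3) by (auto simp: tensor_def hall_unit_def indicator_def)

lemma cuspidal_iff:
  assumes d: "d \<noteq> (\<lambda>v. 0)"
  shows "f \<in> cuspidal Q K d \<longleftrightarrow> f \<in> hall_degree Q K d \<and>
    (\<forall>u\<in>iso_classes Q K. \<forall>v\<in>iso_classes Q K. u \<noteq> zc \<longrightarrow> v \<noteq> zc \<longrightarrow> gam f u v = 0)"
proof (cases "f \<in> hall_degree Q K d")
  case f: True
  have fa: "f \<in> hall_algebra Q K" using f by (simp add: hall_degree_def)
  have A: "f c \<noteq> 0 \<Longrightarrow> c \<in> iso_classes Q K \<and> zc \<in> iso_classes Q K" for c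
    using fa zero_class_props(1)[OF representative(1), of c] by (auto simp: hall_algebra_def)
  have out: "comult Q K f (u, v) = tensor f (hall_unit Q K) (u, v) + tensor (hall_unit Q K) f (u, v)"
    if n: "\<not> (u \<in> iso_classes Q K \<and> v \<in> iso_classes Q K)" for u v
    using tensor_unit_zero[OF fa A n] n by (auto simp: comult_def)
  have "f \<in> cuspidal Q K d \<longleftrightarrow> (\<forall>u v. comult Q K f (u, v) = tensor f (hall_unit Q K) (u, v) + tensor (hall_unit Q K) f (u, v))"
    using f by (simp add: cuspidal_def fun_eq_iff)
  also have "\<dots> \<longleftrightarrow> (\<forall>u\<in>iso_classes Q K. \<forall>v\<in>iso_classes Q K.
      comult Q K f (u, v) = tensor f (hall_unit Q K) (u, v) + tensor (hall_unit Q K) f (u, v))"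
    using out by metis
  also have "\<dots> \<longleftrightarrow> (\<forall>u\<in>iso_classes Q K. \<forall>v\<in>iso_classes Q K. u \<noteq> zc \<longrightarrow> v \<noteq> zc \<longrightarrow> gam f u v = 0)"
    by (intro ball_cong refl comult_primitive_iff[OF f d])
  finally show ?thesis using f by simp
qed (simp add: cuspidal_def)

lemma regular_cuspidal_iff:
  assumes d: "d \<noteq> (\<lambda>v. 0)"
  shows "f \<in> regular_cuspidal Q K \<delta> d \<longleftrightarrow> f \<in> hall_regular Q K \<delta> \<inter> hall_degree Q K d \<and>
    (\<forall>u\<in>regular_classes Q K \<delta>. \<forall>v\<in>regular_classes Q K \<delta>. u \<noteq> zc \<longrightarrow> v \<noteq> zc \<longrightarrow> gam f u v = 0)"
proof (cases "f \<in> hall_regular Q K \<delta> \<inter> hall_degree Q K d")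
  case f: True
  have fa: "f \<in> hall_algebra Q K" and fd: "f \<in> hall_degree Q K d" using f by (auto simp: hall_degree_def)
  have reg: "c \<in> regular_classes Q K \<delta> \<Longrightarrow> c \<in> iso_classes Q K" for c by (simp add: regular_classes_def)
  have A: "f c \<noteq> 0 \<Longrightarrow> c \<in> regular_classes Q K \<delta> \<and> zc \<in> regular_classes Q K \<delta>" for c
    using f zero_class_props(3)[OF representative(1)[OF reg], of c] by (auto simp: hall_regular_def)
  have out: "regular_comult Q K \<delta> f (u, v) = tensor f (hall_unit Q K) (u, v) + tensor (hall_unit Q K) f (u, v)"
    if n: "\<not> (u \<in> regular_classes Q K \<delta> \<and> v \<in> regular_classes Q K \<delta>)" for u v
    using tensor_unit_zero[OF fa A n] n by (auto simp: regular_comult_def)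
  have inn: "regular_comult Q K \<delta> f (u, v) = comult Q K f (u, v)"
    if "u \<in> regular_classes Q K \<delta>" "v \<in> regular_classes Q K \<delta>" for u v
    using that by (simp add: regular_comult_def)
  have "f \<in> regular_cuspidal Q K \<delta> d \<longleftrightarrow>
      (\<forall>u v. regular_comult Q K \<delta> f (u, v) = tensor f (hall_unit Q K) (u, v) + tensor (hall_unit Q K) f (u, v))"
    using f by (simp add: regular_cuspidal_def fun_eq_iff)
  also have "\<dots> \<longleftrightarrow> (\<forall>u\<in>regular_classes Q K \<delta>. \<forall>v\<in>regular_classes Q K \<delta>.
      comult Q K f (u, v) = tensor f (hall_unit Q K) (u, v) + tensor (hall_unit Q K) f (u, v))"
    using out inn by metis
  also have "\<dots> \<longleftrightarrow> (\<forall>u\<in>regular_classes Q K \<delta>. \<forall>v\<in>regular_classes Q K \<delta>. u \<noteq> zc \<longrightarrow> v \<noteq> zc \<longrightarrow> gam f u v = 0)"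
    by (intro ball_cong refl comult_primitive_iff[OF fd d] reg)
  finally show ?thesis using f by simp
qed (auto simp: regular_cuspidal_def)

lemma weighted_classes_of:
  assumes "f \<in> hall_algebra Q K"
  shows "weighted_classes K Q \<delta> {c. f c \<noteq> 0}"
  using assms by unfold_locales (auto simp: hall_algebra_def)

lemma lvl_gam:
  assumes "f \<in> hall_algebra Q K"
  shows "weighted_classes.lvl {c. f c \<noteq> 0} (\<lambda>c. f c / of_nat (aut_number Q K c)) (cnt (\<lambda>s t. s = v \<and> t = u)) = gam f u v"
  unfolding weighted_classes.lvl_def[OF weighted_classes_of[OF assms]] gam_def ..

text \<open>On multiples of \<delta> the forms <\<delta>, -> and <-, \<delta>> agree, yet by
  \<open>wr_delta\<close> they are negatives of each other.\<close>

lemma th_multiple: "dv M = (\<lambda>v. r * \<delta> v) \<Longrightarrow> th M = 0"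
proof -
  assume d: "dv M = (\<lambda>v. r * \<delta> v)"
  have "wt (wr \<delta>) M = th M" unfolding wt_wl wt_wr d by (simp add: e0_def e1_def mult_ac)
  then show "th M = 0" using wr_delta[of M] by simp
qed

lemma hall_inner_regular_char:
  assumes "\<And>c. f c \<noteq> 0 \<Longrightarrow> c \<in> regular_classes Q K \<delta> \<and> class_dim Q K c = d"
  shows "hall_inner Q K f (regular_char Q K \<delta> d) = (\<Sum>c | f c \<noteq> 0. f c / of_nat (aut_number Q K c))"
  unfolding hall_inner_def by (intro sum.cong refl) (use assms in \<open>simp add: regular_char_def\<close>)

text \<open>With weights f(c)/a_c the linear form becomes the plain sum of the weights and
  \<open>gam\<close> a value of \<open>lvl\<close>, so the locale assumptions are regular
  cuspidality and vanishing of the form.\<close>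

lemma cuspidal_of_regular_cuspidal:
  assumes d: "d \<noteq> (\<lambda>v. 0)" and f: "f \<in> regular_cuspidal Q K \<delta> d" and L: "hall_inner Q K f (regular_char Q K \<delta> d) = 0"
  shows "f \<in> cuspidal Q K d"
proof -
  have fh: "f \<in> hall_regular Q K \<delta>" "f \<in> hall_degree Q K d" and fa: "f \<in> hall_algebra Q K"
    and cu: "\<And>u v. u \<in> regular_classes Q K \<delta> \<Longrightarrow> v \<in> regular_classes Q K \<delta> \<Longrightarrow> u \<noteq> zc \<Longrightarrow> v \<noteq> zc \<Longrightarrow> gam f u v = 0"
    using f unfolding regular_cuspidal_iff[OF d] by (auto simp: hall_degree_def)
  have S: "c \<in> regular_classes Q K \<delta> \<and> class_dim Q K c = d" if "f c \<noteq> 0" for c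
    using fh that by (auto simp: hall_regular_def hall_degree_def)
  have reg: "c \<in> regular_classes Q K \<delta> \<longleftrightarrow> c \<in> iso_classes Q K \<and> RR (R c)" for c
    using regular_iff[OF representative(1)] by (auto simp: regular_classes_def)
  interpret W: weighted_classes K Q \<delta> "{c. f c \<noteq> 0}" "\<lambda>c. f c / of_nat (aut_number Q K c)"
    by (rule weighted_classes_of[OF fa])
  interpret W: regular_cuspidal_data K Q \<delta> "{c. f c \<noteq> 0}" "\<lambda>c. f c / of_nat (aut_number Q K c)" d
  proof
    show "RR (R c)" if "c \<in> {c. f c \<noteq> 0}" for c using S that reg by simp
    show "dv (R c) = d" if "c \<in> {c. f c \<noteq> 0}" for c using S that by (simp add: class_dim_def)
    show "(\<Sum>c | f c \<noteq> 0. f c / of_nat (aut_number Q K c)) = 0" using L hall_inner_regular_char[OF S] by simp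
    fix A B :: "('v, 'a, 'k, nat) quiver_rep"
    assume AB: "rep A" "rep B" "RR A" "RR B" "dv A \<noteq> (\<lambda>v. 0)" "dv B \<noteq> (\<lambda>v. 0)"
    have "gam f (cls A) (cls B) = 0"
    proof (rule cu)
      show "cls A \<in> regular_classes Q K \<delta>" "cls B \<in> regular_classes Q K \<delta>"
        using reg cls_class AB RR_iso[OF _ rep_cls(1) rep_cls(2)] by blast+
      show "cls A \<noteq> zc" "cls B \<noteq> zc" using cls_zero_class_iff AB by blast+
    qed
    then show "W.lvl (cnt (\<lambda>s t. s = cls B \<and> t = cls A)) = 0" unfolding lvl_gam[OF fa] .
  qed
  have "gam f u v = 0" if uv: "u \<in> iso_classes Q K" "v \<in> iso_classes Q K" "u \<noteq> zc" "v \<noteq> zc" for u v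
  proof -
    have "W.lvl (cnt (\<lambda>s t. s = cls (R v) \<and> t = cls (R u))) = 0"
      using uv zc_iff by (intro W.level_zero representative(1)) auto
    then show ?thesis unfolding lvl_gam[OF fa] representative(2)[OF uv(1)] representative(2)[OF uv(2)] .
  qed
  then show ?thesis unfolding cuspidal_iff[OF d] using fh(2) by blast
qed

text \<open>Defect zero, which follows from dim M = r \<delta>, makes the torsion part X of a
  nonregular M a proper nonzero one: X = M would make M regular, and X = 0 would make its defect
  negative.\<close>

lemma cuspidal_regular:
  assumes d: "d = (\<lambda>v. r * \<delta> v)" "d \<noteq> (\<lambda>v. 0)" and f: "f \<in> cuspidal Q K d" and c: "f c \<noteq> 0"
  shows "c \<in> regular_classes Q K \<delta>"
proof (rule ccontr)
  assume n: "c \<notin> regular_classes Q K \<delta>"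
  have fh: "f \<in> hall_degree Q K d" and fa: "f \<in> hall_algebra Q K"
    and cu: "\<And>u v. u \<in> iso_classes Q K \<Longrightarrow> v \<in> iso_classes Q K \<Longrightarrow> u \<noteq> zc \<Longrightarrow> v \<noteq> zc \<Longrightarrow> gam f u v = 0"
    using f unfolding cuspidal_iff[OF d(2)] by (auto simp: hall_degree_def)
  have iso: "c \<in> iso_classes Q K" if "f c \<noteq> 0" for c using fa that by (auto simp: hall_algebra_def)
  have fin: "finite {c. f c \<noteq> 0}" using fa by (simp add: hall_algebra_def)
  note M = representative(1)[OF iso[OF c]]
  have dM: "dv (R c) = d" using fh c by (simp add: hall_degree_def class_dim_def)
  have th: "th (R c) = 0" using dM d(1) by (intro th_multiple) simp
  have nR: "\<not> RR (R c)" using n iso[OF c] regular_iff[OF M] by (simp add: regular_classes_def)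
  obtain X where X: "hn (wl \<delta>) (R c) X" using hn_exists[OF M] by blast
  have Xs: "X \<in> subs (R c)" using X by (simp add: hn_def)
  note RX = rep_sub_rep[OF M Xs] and QX = quot(1)[OF M Xs]
  have XF: "X \<noteq> full_sub (R c)"
  proof
    assume "X = full_sub (R c)"
    then have "clsB (wl \<delta>) (R c)" using X cls_iso(2)[OF RX M] sub_full_iso[OF M] by (simp add: hn_def)
    then show False using nR th by (simp add: RR_def)
  qed
  have X0: "X \<noteq> zero_sub (R c)"
  proof
    assume "X = zero_sub (R c)"
    then have "clsA (wl \<delta>) (R c)" using X cls_iso(1)[OF QX M] quot_zero_iso[OF M] by (simp add: hn_def)
    then have "dv (R c) = (\<lambda>v. 0)" by (rule clsA_zero[OF M]) (simp add: th)
    then show False using dM d(2) by simp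
  qed
  have only: "c' = c" if c': "f c' \<noteq> 0" and w: "cnt (\<lambda>s t. s = cls (sub_rep (R c) X) \<and> t = cls (quot (R c) X)) (R c') \<noteq> 0" for c'
  proof -
    note M' = representative(1)[OF iso[OF c']]
    obtain Y where Y0: "Y \<in> subs (R c')" "cls (sub_rep (R c') Y) = cls (sub_rep (R c) X) \<and> cls (quot (R c') Y) = cls (quot (R c) X)"
      by (rule cnt_pos[OF M' w])
    then have Y: "Y \<in> subs (R c')" "cls (sub_rep (R c') Y) = cls (sub_rep (R c) X)" "cls (quot (R c') Y) = cls (quot (R c) X)"
      by auto
    have "R c \<approx> R c'"
      by (rule ext0_unique[OF M M' Xs Y(1) hn_split[OF M X] cls_isoI[OF RX rep_sub_rep[OF M' Y(1)]] cls_isoI[OF QX quot(1)[OF M' Y(1)]]])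
        (use Y in simp_all)
    then show ?thesis using cls_eq_iff[OF M M'] representative(2)[OF iso[OF c]] representative(2)[OF iso[OF c']] by simp
  qed
  have "gam f (cls (quot (R c) X)) (cls (sub_rep (R c) X)) = 0"
    using cu cls_class[OF QX] cls_class[OF RX] cls_zero_class_iff[OF QX] cls_zero_class_iff[OF RX]
      quot_zero_rep[OF M Xs] sub_zero_iff[OF M Xs] XF X0 by blast
  moreover have "gam f (cls (quot (R c) X)) (cls (sub_rep (R c) X)) =
      (\<Sum>c'\<in>{c}. f c' / of_nat (aut_number Q K c') * of_nat (cnt (\<lambda>s t. s = cls (sub_rep (R c) X) \<and> t = cls (quot (R c) X)) (R c')))"
    unfolding gam_def by (rule sum.mono_neutral_right[OF fin]) (use only c in auto)
  moreover have "cnt (\<lambda>s t. s = cls (sub_rep (R c) X) \<and> t = cls (quot (R c) X)) (R c) \<noteq> 0"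
    by (rule cnt_nonzero[OF M Xs]) simp
  ultimately show False using c aut_number_pos[OF iso[OF c]] by simp
qed

text \<open>The converse of a finite acyclic relation is well-founded; a minimal vertex for it has
  no outgoing arrow.\<close>

lemma sink_exists: obtains i where "i \<in> I" "\<And>a. a \<in> arcs Q \<Longrightarrow> tail Q a \<noteq> i"
proof -
  obtain n where "n \<ge> 1" "card I = n + 1" using affine_connected[OF affine_Q] by blast
  then have "I \<noteq> {}" by auto
  then obtain i0 where i0: "i0 \<in> I" by blast
  have "finite (arcs_ends Q)" by (simp add: arcs_ends_def)
  then have "wf ((arcs_ends Q)\<inverse>)" using acyclic_Q by (intro finite_acyclic_wf_converse) (simp_all add: acyclic_quiver_def)
  then obtain i where i: "i \<in> I" "\<And>y. (y, i) \<in> (arcs_ends Q)\<inverse> \<Longrightarrow> y \<notin> I" using wfE_min[OF _ i0] by metis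
  have "tail Q a \<noteq> i" if a: "a \<in> arcs Q" for a
  proof
    assume "tail Q a = i"
    then have "(i, head Q a) \<in> arcs_ends Q" using a by (auto simp: arcs_ends_def arc_to_ends_def)
    then show False using i(2)[of "head Q a"] head_I[OF a] by simp
  qed
  then show ?thesis using that i(1) by blast
qed

text \<open>Each \<open>M\<close> has exactly one subrepresentation of dimension \<open>d\<^sub>i\<close> at a sink \<open>i\<close> and zero elsewhere.\<close>

lemma cuspidal_sum_zero:
  assumes d: "d = (\<lambda>v. r * \<delta> v)" "r \<ge> 1" and f: "f \<in> cuspidal Q K d"
  shows "(\<Sum>c | f c \<noteq> 0. f c / of_nat (aut_number Q K c)) = 0"
proof -
  obtain i where i: "i \<in> I" "\<And>a. a \<in> arcs Q \<Longrightarrow> tail Q a \<noteq> i" using sink_exists by blast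
  obtain n where "n \<ge> 1" "card I = n + 1" using affine_connected[OF affine_Q] by blast
  then have "I \<noteq> {i}" by auto
  \<comment> \<open>A second vertex makes the quotient by the subrepresentation at \<open>i\<close>
    nonzero, so that the cuspidal condition applies to the pair.\<close>
  then obtain j where j: "j \<in> I" "j \<noteq> i" using i(1) by blast
  have dpos: "d v > 0" if "v \<in> I" for v using delta_pos[OF that] d by simp
  have dz: "d \<noteq> (\<lambda>v. 0)" using dpos[OF i(1)] by auto
  have fh: "f \<in> hall_degree Q K d" and fa: "f \<in> hall_algebra Q K"
    and cu: "\<And>u v. u \<in> iso_classes Q K \<Longrightarrow> v \<in> iso_classes Q K \<Longrightarrow> u \<noteq> zc \<Longrightarrow> v \<noteq> zc \<Longrightarrow> gam f u v = 0"
    using f unfolding cuspidal_iff[OF dz] by (auto simp: hall_degree_def)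
  interpret W: weighted_classes K Q \<delta> "{c. f c \<noteq> 0}" "\<lambda>c. f c / of_nat (aut_number Q K c)"
    by (rule weighted_classes_of[OF fa])
  define d0 where "d0 v = (if v = i then d i else 0)" for v
  have dM: "dv (R c) = d" if "f c \<noteq> 0" for c using fh that by (simp add: hall_degree_def class_dim_def)
  have one: "{X \<in> subs (R c). dv (sub_rep (R c) X) = d0} = {\<lambda>v\<in>I. if v = i then car (R c) v else {zer (R c) v}}" if c: "f c \<noteq> 0" for c
  proof -
    note M = W.S_rep[of c]
    have M: "rep (R c)" using W.S_rep c by simp
    let ?X = "\<lambda>v\<in>I. if v = i then car (R c) v else {zer (R c) v}"
    \<comment> \<open>No arrow leaves the sink, so the full space there together with zero elsewhere
      is stable.\<close>
    have Xs: "?X \<in> subs (R c)"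
    proof (rule subsI)
      fix v assume v: "v \<in> I"
      show "subspace K (?X v) (space (R c) v)"
        using v subspace_zero[OF repD(2)[OF M v]] subspace_full[OF repD(2)[OF M v]] by (cases "v = i") simp_all
    next
      fix a x assume a: "a \<in> arcs Q" and x: "x \<in> ?X (tail Q a)"
      have "x = zer (R c) (tail Q a)" using x a i(2)[OF a] by simp
      then have "arrow_map (R c) a x = zer (R c) (head Q a)"
        using module_hom_zero[OF repD(2)[OF M tail_I[OF a]] repD(2)[OF M head_I[OF a]] repD(3)[OF M a]] by simp
      then show "arrow_map (R c) a x \<in> ?X (head Q a)" using a zer_closed[OF M head_I[OF a]]
i(1)
        by (cases "head Q a = i") simp_all
    qed simp
    have dvX: "dv (sub_rep (R c) ?X) = d0"
    proof
      fix v show "dv (sub_rep (R c) ?X) v = d0 v"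
      proof (cases "v \<in> I")
        case v: True
        have "card (?X v) = q ^ d0 v" using card_car[OF M v] dM[OF c] v by (cases "v = i") (simp_all add: d0_def)
        then have "q ^ dv (sub_rep (R c) ?X) v = q ^ d0 v" using card_sub[OF M Xs v] by simp
        then show ?thesis using q_ge_2 by (simp add: power_inject_exp)
      next
        case False then show ?thesis using i(1) by (auto simp: d0_def)
      qed
    qed
    have "Y = ?X" if Y: "Y \<in> subs (R c)" "dv (sub_rep (R c) Y) = d0" for Y
    proof -
      have "Y v \<subseteq> ?X v" if v: "v \<in> I" for v
      proof (cases "v = i")
        case True then show ?thesis using subsD(3)[OF Y(1) v] v by simp
      next
        case False
        then have "card (Y v) = 1" using card_sub[OF M Y(1) v] Y(2) by (simp add: d0_def)
        then obtain y where "Y v = {y}" by (auto simp: card_1_singleton_iff)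
        then have "Y v = {zer (R c) v}" using subsD(4)[OF Y(1) v] by simp
        then show ?thesis using v False by simp
      qed
      then have "Y \<le> ?X" using subs_le_iff[OF Y(1) Xs] by blast
      then show ?thesis using subs_eq_dv[OF M Y(1) Xs] Y(2) dvX by simp
    qed
    then show ?thesis using Xs dvX by blast
  qed
  \<comment> \<open>The count, equal to 1 on every M, is broken up by the classes of
    subrepresentation and quotient; each piece is a coproduct coefficient at two nonzero
    classes.\<close>
  have "W.lvl (\<lambda>M. \<Sum>X\<in>{X \<in> subs M. dv (sub_rep M X) = d0}. 1) = 0"
  proof (rule W.lvl_zero[where w = "\<lambda>_. 1" and P = "\<lambda>M X. dv (sub_rep M X) = d0" and h = "\<lambda>M X. (cls (sub_rep M X), cls (quot M X))"])
    fix y show "W.lvl (\<lambda>M. card {X \<in> subs M. dv (sub_rep M X) = d0 \<and> (cls (sub_rep M X), cls (quot M X)) = y}) = 0"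
    proof (rule W.lvl_instance)
      fix c X assume c: "c \<in> {c. f c \<noteq> 0}" and X: "X \<in> subs (R c)"
        and cX: "dv (sub_rep (R c) X) = d0 \<and> (cls (sub_rep (R c) X), cls (quot (R c) X)) = y"
      have M: "rep (R c)" using W.S_rep[OF c] .
      note RX = rep_sub_rep[OF M X] and QX = quot(1)[OF M X]
      have y: "y = (cls (sub_rep (R c) X), cls (quot (R c) X))" using cX by simp
      have "dv (sub_rep (R c) X) i \<noteq> 0" using cX dpos[OF i(1)] by (simp add: d0_def)
      then have v: "cls (sub_rep (R c) X) \<noteq> zc" using cls_zero_class_iff[OF RX] by auto
      have "dv (quot (R c) X) j = d j" using dv_quot[OF M X, of j] cX dM c j(2) by (simp add: d0_def)
      then have u: "cls (quot (R c) X) \<noteq> zc" using cls_zero_class_iff[OF QX] dpos[OF j(1)] by auto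
      have "W.lvl (\<lambda>M. card {Y \<in> subs M. dv (sub_rep M Y) = d0 \<and> (cls (sub_rep M Y), cls (quot M Y)) = y}) =
          W.lvl (cnt (\<lambda>s t. s = cls (sub_rep (R c) X) \<and> t = cls (quot (R c) X)))"
      proof (rule W.lvl_cong)
        fix c' assume c': "c' \<in> {c. f c \<noteq> 0}"
        have M': "rep (R c')" using W.S_rep[OF c'] .
        have "dv (sub_rep (R c') Y) = d0" if "Y \<in> subs (R c')" "cls (sub_rep (R c') Y) = cls (sub_rep (R c) X)" for Y
          using cls_dv[OF rep_sub_rep[OF M' that(1)] RX that(2)] cX by simp
        then show "card {Y \<in> subs (R c'). dv (sub_rep (R c') Y) = d0 \<and> (cls (sub_rep (R c') Y), cls (quot (R c') Y)) = y} =
            cnt (\<lambda>s t. s = cls (sub_rep (R c) X) \<and> t = cls (quot (R c) X)) (R c')"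
          unfolding cnt_def y by (intro arg_cong[of _ _ card]) blast
      qed
      also have "\<dots> = 0" unfolding lvl_gam[OF fa] by (rule cu[OF cls_class[OF QX] cls_class[OF RX] u v])
      finally show "W.lvl (\<lambda>M. card {X \<in> subs M. dv (sub_rep M X) = d0 \<and> (cls (sub_rep M X), cls (quot M X)) = y}) = 0" .
    qed
  qed
  moreover have "W.lvl (\<lambda>M. \<Sum>X\<in>{X \<in> subs M. dv (sub_rep M X) = d0}. 1) = W.lvl (\<lambda>M. 1)"
    by (rule W.lvl_cong) (simp only: one mem_Collect_eq sum.insert sum.empty finite.emptyI empty_iff not_False_eq_True add_0_right)
  ultimately show ?thesis by (simp add: W.lvl_def)
qed

end

theorem theorem1p1:
  fixes Q :: "('v, 'a) pre_digraph"
    and K :: "('k, 'e) ring_scheme"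
    and \<delta> :: "'v \<Rightarrow> nat"
    and r :: nat
  assumes "affine_quiver Q"
    and "acyclic_quiver Q"
    and "indivisible_imaginary_root Q \<delta>"
    and "field K"
    and "finite (carrier K)"
    and "r \<ge> 1"
  shows "{f \<in> regular_cuspidal Q K \<delta> (\<lambda>v. r * \<delta> v).
            hall_inner Q K f (regular_char Q K \<delta> (\<lambda>v. r * \<delta> v)) = 0} =
         cuspidal Q K (\<lambda>v. r * \<delta> v)"
proof -
  interpret affine K Q \<delta>
    using assms by (intro affine.intro quiver_reps.intro finite_field.intro quiver_reps_axioms.intro affine_axioms.intro)
      (simp_all add: affine_quiver_def)
  let ?d = "\<lambda>v. r * \<delta> v"
  obtain i where i: "i \<in> I" using sink_exists by blast
  have "?d i \<noteq> 0" using delta_pos[OF i] assms(6) by simp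
  then have d: "?d \<noteq> (\<lambda>v. 0)" by metis
  show ?thesis
  proof (intro subset_antisym subsetI)
    fix f assume "f \<in> {f \<in> regular_cuspidal Q K \<delta> ?d. hall_inner Q K f (regular_char Q K \<delta> ?d) = 0}"
    then show "f \<in> cuspidal Q K ?d" using cuspidal_of_regular_cuspidal[OF d] by blast
  next
    fix f assume f: "f \<in> cuspidal Q K ?d"
    have fd: "f \<in> hall_degree Q K ?d" and
      cu: "\<forall>u\<in>iso_classes Q K. \<forall>v\<in>iso_classes Q K. u \<noteq> zc \<longrightarrow> v \<noteq> zc \<longrightarrow> gam f u v = 0"
      using f unfolding cuspidal_iff[OF d] by blast+
    \<comment> \<open>A cuspidal function lives on regular classes; the regular coproduct condition
      is then a part of the full one.\<close>
    have S: "c \<in> regular_classes Q K \<delta> \<and> class_dim Q K c = ?d" if "f c \<noteq> 0" for c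
      using cuspidal_regular[OF refl d f that] fd that by (simp add: hall_degree_def)
    have "f \<in> hall_regular Q K \<delta>" using S fd by (auto simp: hall_regular_def hall_degree_def)
    then have "f \<in> regular_cuspidal Q K \<delta> ?d"
      unfolding regular_cuspidal_iff[OF d] using fd cu by (auto simp: regular_classes_def)
    moreover have "hall_inner Q K f (regular_char Q K \<delta> ?d) = 0"
      using hall_inner_regular_char[OF S] cuspidal_sum_zero[OF refl assms(6) f] by simp
    ultimately show "f \<in> {f \<in> regular_cuspidal Q K \<delta> ?d. hall_inner Q K f (regular_char Q K \<delta> ?d) = 0}" by simp
  qed
qed

end
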